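(* Let $X=\{X(t),\,t\in I\}$ be an $(N,d)$-Gaussian random field whose coordinates are independent copies of a real-valued centered Gaussian random field $X_0$ with continuous covariance function, and assume that $X_0$ satisfies Conditions (C1) and (C2) on $I=[0,1]^N$ with index $H=(H_1,\ldots,H_N)\in(0,1)^N$. Then: (i) $L(0,I,X)\in D_1$ if and only if $\sum_{j=1}^N\frac1{H_j}>d+2$. (ii) If $\sum_{j=1}^N\frac1{H_j}>d+2$, then $L(x,I,X)\in D_1$ for every $x\in\mathbb{R}^d\setminus\{0\}$.
   Context: $N,d\ge 1$ are integers and $I=[0,1]^N$. An $(N,d)$-Gaussian random field is $X(t)=(X_1(t),\ldots,X_d(t))$, where $X_1,\ldots,X_d$ are independent copies of $X_0$. Sample paths are taken to be continuous on $I$ (the probability space is the space of continuous $\mathbb{R}^d$-valued functions on $I$). Condition (C1) with index $H$: there is a constant $0<c_1<\infty$ such that $\mathbb{E}[(X_0(s)-X_0(t))^2]\le c_1\sum_{j=1}^N|s_j-t_j|^{2H_j}$ for all $s,t\in I$. Condition (C2) with index $H$: there is a constant $c_2>0$ such that $\mathrm{Var}(X_0(t)\mid X_0(s))\ge c_2\sum_{j=1}^N\min\{|s_j-t_j|^{2H_j},|t_j|^{2H_j}\}$ for all $s,t\in I$ (conditional variance of $X_0(t)$ given $X_0(s)$). Local time: for $\varepsilon>0$ let $p_\varepsilon(x)=(2\pi\varepsilon)^{-d/2}\exp(-\|x\|^2/(2\varepsilon))$ and $L_\varepsilon(x,I,X)=\int_I p_\varepsilon(X(s)-x)\,ds$.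 $L(x,I,X)$ denotes the limit of $L_\varepsilon(x,I,X)$ in $L^2(\Omega,\mathbb{P})$ as $\varepsilon\to0$; the assertion $L(x,I,X)\in D_1$ means that this limit exists and belongs to $D_1$. Chaos expansion and $D_1$: let $\mathcal{P}_n$ be the closure in $L^2(\Omega,\mathbb{P})$ of the set of all polynomials of degree at most $n$ in finitely many of the variables $X_i(t)$ ($t\in I$, $1\le i\le d$), and let $\mathcal{C}_n$ be the orthogonal complement of $\mathcal{P}_{n-1}$ in $\mathcal{P}_n$ (with $\mathcal{C}_0=\mathcal{P}_0$ the constants). Then every square-integrable functional $F$ of $X$ decomposes uniquely as $F=\sum_{n\ge0}F_n$ with $F_n\in\mathcal{C}_n$ (chaos expansion). Set $D_1=\{F\in L^2(\Omega,\mathbb{P}):\ \sum_{n\ge0}n\,\mathbb{E}(|F_n|^2)<\infty\}$ (the smooth functionals in the sense of Meyer–Watanabe). *)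

theory Defs
  imports "HOL-Probability.Probability"
begin

section \<open>Gaussian random fields on the unit cube\<close>

definition unit_cube :: "(real^'n) set" where
  "unit_cube = cbox 0 1"

text \<open>The degenerate law (standard deviation zero, a point mass) counts as Gaussian.\<close>

definition gaussian_law :: "real \<Rightarrow> real \<Rightarrow> real measure" where
  "gaussian_law m s = (if s = 0 then return borel m else density lborel (normal_density m s))"

definition gaussian_variable :: "'w measure \<Rightarrow> ('w \<Rightarrow> real) \<Rightarrow> bool" where
  "gaussian_variable M Z \<longleftrightarrow>
     Z \<in> borel_measurable M \<and> (\<exists>m s. 0 \<le> s \<and> distr M borel Z = gaussian_law m s)"

text \<open>Fields are functions of all of \<open>real^'n\<close>, but only their values at points of the
  unit cube are ever constrained or used.\<close>

definition gaussian_field :: "'w measure \<Rightarrow> (real^'n \<Rightarrow> 'w \<Rightarrow> real) \<Rightarrow> bool" where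
  "gaussian_field M Y \<longleftrightarrow>
     (\<forall>S a. finite S \<and> S \<subseteq> unit_cube \<longrightarrow> gaussian_variable M (\<lambda>w. \<Sum>t\<in>S. a t * Y t w))"

definition centered_field :: "'w measure \<Rightarrow> (real^'n \<Rightarrow> 'w \<Rightarrow> real) \<Rightarrow> bool" where
  "centered_field M Y \<longleftrightarrow> (\<forall>t\<in>unit_cube. (\<integral>w. Y t w \<partial>M) = 0)"

definition covariance :: "'w measure \<Rightarrow> ('w \<Rightarrow> real) \<Rightarrow> ('w \<Rightarrow> real) \<Rightarrow> real" where
  "covariance M Y Z = (\<integral>w. (Y w - (\<integral>v. Y v \<partial>M)) * (Z w - (\<integral>v. Z v \<partial>M)) \<partial>M)"

definition continuous_covariance :: "'w measure \<Rightarrow> (real^'n \<Rightarrow> 'w \<Rightarrow> real) \<Rightarrow> bool" where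
  "continuous_covariance M Y \<longleftrightarrow>
     continuous_on (unit_cube \<times> unit_cube) (\<lambda>(s, t). covariance M (Y s) (Y t))"

text \<open>The random vector field \<open>X\<close> has independent coordinates, each with the law of \<open>X0\<close>
  (as a process indexed by the unit cube, i.e.\ the same finite-dimensional distributions);
  \<open>X0\<close> may live on a different probability space.\<close>

definition coordinate_path ::
  "(real^'n \<Rightarrow> 'w \<Rightarrow> real^'d) \<Rightarrow> 'd \<Rightarrow> 'w \<Rightarrow> (real^'n \<Rightarrow> real)" where
  "coordinate_path X i w = (\<lambda>t\<in>unit_cube. X t w $ i)"

definition independent_copies ::
  "'u measure \<Rightarrow> (real^'n \<Rightarrow> 'u \<Rightarrow> real) \<Rightarrow> 'w measure \<Rightarrow> (real^'n \<Rightarrow> 'w \<Rightarrow> real^'d) \<Rightarrow> bool" where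
  "independent_copies M0 X0 M X \<longleftrightarrow>
     prob_space.indep_vars M (\<lambda>i. \<Pi>\<^sub>M t\<in>unit_cube. borel) (coordinate_path X) UNIV \<and>
     (\<forall>i. distr M (\<Pi>\<^sub>M t\<in>unit_cube. borel) (coordinate_path X i) =
          distr M0 (\<Pi>\<^sub>M t\<in>unit_cube. borel) (\<lambda>w. \<lambda>t\<in>unit_cube. X0 t w))"

definition continuous_paths :: "'w measure \<Rightarrow> (real^'n \<Rightarrow> 'w \<Rightarrow> real^'d) \<Rightarrow> bool" where
  "continuous_paths M X \<longleftrightarrow> (\<forall>w\<in>space M. continuous_on unit_cube (\<lambda>t. X t w))"

section \<open>Conditions (C1) and (C2)\<close>

definition condition_C1 ::
  "'w measure \<Rightarrow> (real^'n \<Rightarrow> 'w \<Rightarrow> real) \<Rightarrow> real^'n \<Rightarrow> bool" where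
  "condition_C1 M Y H \<longleftrightarrow>
     (\<exists>c1>0. \<forall>s\<in>unit_cube. \<forall>t\<in>unit_cube.
        (\<integral>w. (Y s w - Y t w)\<^sup>2 \<partial>M) \<le> c1 * (\<Sum>j\<in>UNIV. \<bar>s $ j - t $ j\<bar> powr (2 * H $ j)))"

text \<open>The conditional variance \<open>Var(Z | W)\<close>: a random variable, defined almost surely.\<close>

definition cond_variance :: "'w measure \<Rightarrow> ('w \<Rightarrow> real) \<Rightarrow> ('w \<Rightarrow> real) \<Rightarrow> ('w \<Rightarrow> real)" where
  "cond_variance M Z W =
     (let F = vimage_algebra (space M) W borel
      in real_cond_exp M F (\<lambda>w. (Z w - real_cond_exp M F Z w)\<^sup>2))"

definition condition_C2 ::
  "'w measure \<Rightarrow> (real^'n \<Rightarrow> 'w \<Rightarrow> real) \<Rightarrow> real^'n \<Rightarrow> bool" where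
  "condition_C2 M Y H \<longleftrightarrow>
     (\<exists>c2>0. \<forall>s\<in>unit_cube. \<forall>t\<in>unit_cube. AE w in M.
        cond_variance M (Y t) (Y s) w \<ge>
          c2 * (\<Sum>j\<in>UNIV. min (\<bar>s $ j - t $ j\<bar> powr (2 * H $ j)) (\<bar>t $ j\<bar> powr (2 * H $ j))))"

section \<open>Chaos expansion and smooth functionals\<close>

text \<open>Elements of \<open>L\<^sup>2\<close> are represented by square-integrable functions; all sets below are
  invariant under almost sure equality, except for the set of polynomials itself.\<close>

definition square_integrable :: "'w measure \<Rightarrow> ('w \<Rightarrow> real) \<Rightarrow> bool" where
  "square_integrable M F \<longleftrightarrow> F \<in> borel_measurable M \<and> integrable M (\<lambda>w. (F w)\<^sup>2)"

definition L2_dist_sq :: "'w measure \<Rightarrow> ('w \<Rightarrow> real) \<Rightarrow> ('w \<Rightarrow> real) \<Rightarrow> ennreal" where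
  "L2_dist_sq M F G = (\<integral>\<^sup>+w. ennreal ((F w - G w)\<^sup>2) \<partial>M)"

text \<open>A monomial is a multiset of pairs \<open>(i, t)\<close>, each standing for the variable
  \<open>X\<^sub>i(t)\<close>; its size is its degree.\<close>

definition field_polynomials ::
  "(real^'n \<Rightarrow> 'w \<Rightarrow> real^'d) \<Rightarrow> nat \<Rightarrow> ('w \<Rightarrow> real) set" where
  "field_polynomials X n =
     {(\<lambda>w. \<Sum>m\<in>A. c m * (\<Prod>(i, t)\<in>#m. X t w $ i)) | c A.
        finite A \<and> (\<forall>m\<in>A. size m \<le> n \<and> set_mset m \<subseteq> UNIV \<times> unit_cube)}"

definition closed_polynomials ::
  "'w measure \<Rightarrow> (real^'n \<Rightarrow> 'w \<Rightarrow> real^'d) \<Rightarrow> nat \<Rightarrow> ('w \<Rightarrow> real) set" where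
  "closed_polynomials M X n =
     {F. square_integrable M F \<and>
         (\<forall>e>0. \<exists>p\<in>field_polynomials X n. L2_dist_sq M F p < ennreal e)}"

definition chaos ::
  "'w measure \<Rightarrow> (real^'n \<Rightarrow> 'w \<Rightarrow> real^'d) \<Rightarrow> nat \<Rightarrow> ('w \<Rightarrow> real) set" where
  "chaos M X n =
     (if n = 0 then closed_polynomials M X 0
      else {F \<in> closed_polynomials M X n.
              \<forall>G\<in>closed_polynomials M X (n - 1). (\<integral>w. F w * G w \<partial>M) = 0})"

definition chaos_expansion ::
  "'w measure \<Rightarrow> (real^'n \<Rightarrow> 'w \<Rightarrow> real^'d) \<Rightarrow> ('w \<Rightarrow> real) \<Rightarrow> (nat \<Rightarrow> 'w \<Rightarrow> real) \<Rightarrow> bool" where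
  "chaos_expansion M X F Fs \<longleftrightarrow>
     square_integrable M F \<and> (\<forall>n. Fs n \<in> chaos M X n) \<and>
     (\<lambda>k. L2_dist_sq M (\<lambda>w. \<Sum>n<k. Fs n w) F) \<longlonglongrightarrow> 0"

text \<open>On a probability space carrying more randomness than \<open>X\<close>, the square-integrable
  variables with a chaos expansion are those almost surely equal to a functional of \<open>X\<close>; the
  expansion is then unique up to almost sure equality, so the existential is harmless.\<close>

definition D1 :: "'w measure \<Rightarrow> (real^'n \<Rightarrow> 'w \<Rightarrow> real^'d) \<Rightarrow> ('w \<Rightarrow> real) set" where
  "D1 M X =
     {F. \<exists>Fs. chaos_expansion M X F Fs \<and>
              summable (\<lambda>n. real n * (\<integral>w. (Fs n w)\<^sup>2 \<partial>M))}"

section \<open>Local times\<close>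

definition heat_kernel :: "real \<Rightarrow> real^'d \<Rightarrow> real" where
  "heat_kernel \<epsilon> x =
     (2 * pi * \<epsilon>) powr (- real CARD('d) / 2) * exp (- (norm x)\<^sup>2 / (2 * \<epsilon>))"

definition approx_local_time ::
  "(real^'n \<Rightarrow> 'w \<Rightarrow> real^'d) \<Rightarrow> real \<Rightarrow> real^'d \<Rightarrow> 'w \<Rightarrow> real" where
  "approx_local_time X \<epsilon> x w = (LINT s:unit_cube|lborel. heat_kernel \<epsilon> (X s w - x))"

definition is_local_time ::
  "'w measure \<Rightarrow> (real^'n \<Rightarrow> 'w \<Rightarrow> real^'d) \<Rightarrow> real^'d \<Rightarrow> ('w \<Rightarrow> real) \<Rightarrow> bool" where
  "is_local_time M X x L \<longleftrightarrow>
     square_integrable M L \<and>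
     ((\<lambda>\<epsilon>. L2_dist_sq M (approx_local_time X \<epsilon> x) L) \<longlongrightarrow> 0) (at_right 0)"

definition local_time_in_D1 ::
  "'w measure \<Rightarrow> (real^'n \<Rightarrow> 'w \<Rightarrow> real^'d) \<Rightarrow> real^'d \<Rightarrow> bool" where
  "local_time_in_D1 M X x \<longleftrightarrow> (\<exists>L. is_local_time M X x L \<and> L \<in> D1 M X)"

end

theory Submission
  imports Defs "HOL-Probability.Probability"
begin

text \<open>Consider the points \<open>k = (s, \<xi>)\<close> of \<open>[0,1]\<^sup>N \<times> \<real>\<^sup>d\<close> with Lebesgue measure and the Gaussian
  variables \<open>Y(k) = \<xi> \<bullet> X(s)\<close>, whose covariance is \<open>q(k,l) = r(s,t) (\<xi> \<bullet> \<eta>)\<close> for \<open>k = (s, \<xi>)\<close>, \<open>l = (t, \<eta>)\<close>, where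
  \<open>r\<close> is the covariance of \<open>X\<^sub>0\<close>.  The Fourier representation of the heat kernel
  (\<open>heat_kernel_fourier\<close>) turns \<open>L\<^sub>\<epsilon>(x)\<close> into the superposition \<open>\<integral> u\<^sub>\<epsilon>(k) cos(Y(k) - \<xi> \<bullet> x) dk\<close> of
  oscillations, with \<open>u\<^sub>\<epsilon>(s, \<xi>) = (2\<pi>)\<^bsup>-d\<^esup> exp(-\<epsilon>|\<xi>|\<^sup>2/2)\<close>.

  Let \<open>h\<^sub>n(y, v)\<close> be the Hermite polynomials with generating function \<open>exp(ay - a\<^sup>2v/2)\<close>.  Evaluated at
  \<open>a = \<i>\<close>, that function expands the cosine, so the \<open>n\<close>-th chaos component of the superposition is the
  integral of \<open>u\<^sub>\<epsilon>(k) c\<^sub>n(k) exp(-q(k,k)/2) h\<^sub>n(Y(k), q(k,k))\<close>, with \<open>c\<^sub>n(k) = Re(\<i>\<^sup>n exp(-\<i> \<xi> \<bullet> x))\<close>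
  (\<open>oscillation_expansion\<close>).  As Hermite polynomials of jointly Gaussian variables satisfy
  \<open>E[h\<^sub>n(Y(k)) h\<^sub>n(Y(l))] = q(k,l)\<^sup>n/n!\<close>, its second moment is
  \<open>\<integral>\<integral> u\<^sub>\<epsilon>(k) u\<^sub>\<epsilon>(l) c\<^sub>n(k) c\<^sub>n(l) exp(-(q(k,k) + q(l,l))/2) q(k,l)\<^sup>n/n! dk dl\<close>.
  Summing these with the weights \<open>n\<close> of \<open>D\<^sub>1\<close> and letting \<open>\<epsilon> \<rightarrow> 0\<close> leads to two criteria.
  For every \<open>x\<close>, it suffices that \<open>\<integral>\<integral> exp(-(q(k,k) + q(l,l))/2) (1 + |q(k,l)|) exp |q(k,l)|\<close> is finite
  over the pairs with \<open>s, t\<close> in the cube (\<open>limit_in_D1\<close>).  For \<open>x = 0\<close> the coefficients satisfy \<open>c\<^sub>n\<^sup>2 = 1\<close> for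
  even \<open>n\<close>, where all integrands are nonnegative, and the even components alone force
  \<open>\<integral>\<integral> exp(-(q(k,k) + q(l,l))/2) q(k,l) sinh q(k,l)\<close> to be finite (\<open>limit_in_D1_imp_finite\<close>).

  Both integrals are decided by \<open>Q = \<Sum>\<^sub>j 1/H\<^sub>j\<close>.  Completing the square in \<open>\<xi>\<close> bounds the first by a multiple of
  \<open>\<integral>\<integral> Var(X\<^sub>0(s))\<^bsup>-d/2\<^esup> v(s,t)\<^bsup>-(d+2)/2\<^esup> ds dt\<close>, where \<open>v\<close> is the lower bound of the conditional variance in
  (C2).  Distributing the singularity evenly over the coordinates leaves one-dimensional integrals of \<open>|x|\<^bsup>-p\<^esup>\<close>
  with \<open>p \<le> (d+2)/Q\<close>, which converge for \<open>Q > d + 2\<close> (\<open>energy_finite\<close>).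
  Conversely, by (C1) the integrand of the second is at least a multiple of \<open>|\<xi>|\<^sup>2\<close> whenever \<open>s\<close> is
  close to the centre of the cube, \<open>|t\<^sub>j - s\<^sub>j| \<le> |\<xi>|^(-1/H\<^sub>j)\<close> for all \<open>j\<close>, \<open>|\<eta> - \<xi>| \<le> 1\<close> and \<open>|\<xi>|\<close> is large.  The
  integration over \<open>t\<close> and \<open>\<eta>\<close> then contributes a multiple of \<open>|\<xi>|\<^bsup>-Q\<^esup>\<close>, and \<open>|\<xi>|\<^bsup>2-Q\<^esup>\<close> is not integrable at
  infinity when \<open>Q \<le> d + 2\<close> (\<open>energy_divergent\<close>).\<close>


section \<open>Square-integrable random variables\<close>

text \<open>The distance of chaos expansions takes extended nonnegative values; a real-valued seminorm
  allows subtraction and the triangle inequality.\<close>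

definition L2norm :: "'w measure \<Rightarrow> ('w \<Rightarrow> real) \<Rightarrow> real" where
  "L2norm M F = sqrt (\<integral>w. (F w)\<^sup>2 \<partial>M)"

lemma L2norm_nonneg [simp]: "0 \<le> L2norm M F"
  by (simp add: L2norm_def)

lemma L2norm_sq: "(L2norm M F)\<^sup>2 = (\<integral>w. (F w)\<^sup>2 \<partial>M)"
  by (simp add: L2norm_def)

lemma square_integrableD [measurable_dest]: "square_integrable M F \<Longrightarrow> F \<in> borel_measurable M"
  by (simp add: square_integrable_def)

lemma square_integrable_mult:
  assumes "square_integrable M F" "square_integrable M G"
  shows "integrable M (\<lambda>w. F w * G w)"
proof (rule Bochner_Integration.integrable_bound)
  show "integrable M (\<lambda>w. (F w)\<^sup>2 + (G w)\<^sup>2)"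
    using assms by (simp add: square_integrable_def)
  have "\<bar>x * y\<bar> \<le> x\<^sup>2 + y\<^sup>2" for x y :: real
  proof -
    have "2 * (\<bar>x\<bar> * \<bar>y\<bar>) \<le> x\<^sup>2 + y\<^sup>2"
      using sum_squares_bound[of "\<bar>x\<bar>" "\<bar>y\<bar>"] by simp
    moreover have "0 \<le> \<bar>x\<bar> * \<bar>y\<bar>" by simp
    ultimately show ?thesis unfolding abs_mult by linarith
  qed
  then show "AE w in M. norm (F w * G w) \<le> norm ((F w)\<^sup>2 + (G w)\<^sup>2)"
    by simp
qed (use assms in measurable)

lemma square_integrable_cmult [intro, simp]:
  "square_integrable M F \<Longrightarrow> square_integrable M (\<lambda>w. c * F w)"
  by (auto simp: square_integrable_def power_mult_distrib)

lemma square_integrable_zero [simp]: "square_integrable M (\<lambda>w. 0)"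
  by (simp add: square_integrable_def)

lemma square_integrable_add [intro, simp]:
  assumes "square_integrable M F" "square_integrable M G"
  shows "square_integrable M (\<lambda>w. F w + G w)"
  using assms square_integrable_mult[OF assms]
  by (auto simp: square_integrable_def power2_sum mult.assoc)

lemma square_integrable_diff [intro, simp]:
  assumes "square_integrable M F" "square_integrable M G"
  shows "square_integrable M (\<lambda>w. F w - G w)"
  using square_integrable_add[OF assms(1) square_integrable_cmult[OF assms(2), of "-1"]] by simp

lemma square_integrable_sum [intro]:
  assumes "\<And>i. i \<in> I \<Longrightarrow> square_integrable M (F i)"
  shows "square_integrable M (\<lambda>w. \<Sum>i\<in>I. F i w)"
  using assms by (induction I rule: infinite_finite_induct) auto

lemma integral_sq_diff_expand:
  assumes "square_integrable M F" "square_integrable M G"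
  shows "(\<integral>w. (F w - G w)\<^sup>2 \<partial>M) = (\<integral>w. (F w)\<^sup>2 \<partial>M) - 2 * (\<integral>w. F w * G w \<partial>M) + (\<integral>w. (G w)\<^sup>2 \<partial>M)"
proof -
  have "(\<integral>w. (F w - G w)\<^sup>2 \<partial>M) = (\<integral>w. (F w)\<^sup>2 - 2 * (F w * G w) + (G w)\<^sup>2 \<partial>M)"
    by (simp add: power2_diff algebra_simps)
  then show ?thesis
    using assms square_integrable_mult[OF assms]
    by (simp add: square_integrable_def)
qed

lemma L2_dist_sq_eq:
  assumes "square_integrable M F" "square_integrable M G"
  shows "L2_dist_sq M F G = ennreal (\<integral>w. (F w - G w)\<^sup>2 \<partial>M)"
  unfolding L2_dist_sq_def
  using square_integrable_diff[OF assms]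
  by (intro nn_integral_eq_integral) (auto simp: square_integrable_def)

lemma integral_mult_le_L2norm:
  assumes "square_integrable M F" "square_integrable M G"
  shows "(\<integral>w. F w * G w \<partial>M) \<le> L2norm M F * L2norm M G"
proof -
  let ?a = "\<integral>w. (F w)\<^sup>2 \<partial>M" and ?b = "\<integral>w. F w * G w \<partial>M" and ?c = "\<integral>w. (G w)\<^sup>2 \<partial>M"
  have q: "0 \<le> ?a - 2 * (t * ?b) + t\<^sup>2 * ?c" for t
  proof -
    have "0 \<le> (\<integral>w. (F w - t * G w)\<^sup>2 \<partial>M)" by simp
    also have "\<dots> = ?a - 2 * (t * ?b) + t\<^sup>2 * ?c"
      using integral_sq_diff_expand[OF assms(1) square_integrable_cmult[OF assms(2), of t]]
      by (simp add: power_mult_distrib mult.left_commute[of _ t])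
    finally show ?thesis .
  qed
  have "?b\<^sup>2 \<le> ?a * ?c"
  proof (cases "?c = 0")
    case True
    have "?b = 0"
    proof (rule ccontr)
      assume b: "?b \<noteq> 0"
      from q[of "(?a + 1) / (2 * ?b)"] b True show False
        by (simp add: field_simps)
    qed
    then show ?thesis using True by simp
  next
    case False
    then have c: "?c > 0" by (simp add: order_less_le)
    from q[of "?b / ?c"] have "0 \<le> ?a - ?b\<^sup>2 / ?c"
      using c by (simp add: power2_eq_square field_simps)
    then show ?thesis using c by (simp add: field_simps)
  qed
  then have "\<bar>?b\<bar> \<le> sqrt (?a * ?c)"
    using real_le_rsqrt by (metis abs_of_nonneg power2_abs real_le_rsqrt)
  then show ?thesis by (simp add: L2norm_def real_sqrt_mult)
qed

lemma abs_integral_mult_le_L2norm: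
  assumes "square_integrable M F" "square_integrable M G"
  shows "\<bar>\<integral>w. F w * G w \<partial>M\<bar> \<le> L2norm M F * L2norm M G"
proof -
  have "- (\<integral>w. F w * G w \<partial>M) \<le> L2norm M (\<lambda>w. -1 * F w) * L2norm M G"
    using integral_mult_le_L2norm[OF square_integrable_cmult[OF assms(1), of "-1"] assms(2)] by simp
  moreover have "L2norm M (\<lambda>w. -1 * F w) = L2norm M F" by (simp add: L2norm_def)
  ultimately show ?thesis using integral_mult_le_L2norm[OF assms] by (simp only: abs_le_iff)
qed

lemma L2norm_cmult: "L2norm M (\<lambda>w. c * F w) = \<bar>c\<bar> * L2norm M F"
  by (simp add: L2norm_def power_mult_distrib real_sqrt_mult)

lemma L2norm_triangle:
  assumes "square_integrable M F" "square_integrable M G"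
  shows "L2norm M (\<lambda>w. F w + G w) \<le> L2norm M F + L2norm M G"
proof (rule power2_le_imp_le)
  have "(\<integral>w. (F w + G w)\<^sup>2 \<partial>M) = (\<integral>w. (F w)\<^sup>2 \<partial>M) + 2 * (\<integral>w. F w * G w \<partial>M) + (\<integral>w. (G w)\<^sup>2 \<partial>M)"
    using integral_sq_diff_expand[OF assms(1) square_integrable_cmult[OF assms(2), of "-1"]] by simp
  also have "\<dots> \<le> (L2norm M F + L2norm M G)\<^sup>2"
    using integral_mult_le_L2norm[OF assms]
    by (simp add: power2_sum L2norm_sq)
  finally show "(L2norm M (\<lambda>w. F w + G w))\<^sup>2 \<le> (L2norm M F + L2norm M G)\<^sup>2"
    by (simp add: L2norm_sq)
qed simp

lemma L2norm_triangle_diff: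
  assumes "square_integrable M F" "square_integrable M G" "square_integrable M K"
  shows "L2norm M (\<lambda>w. F w - K w) \<le> L2norm M (\<lambda>w. F w - G w) + L2norm M (\<lambda>w. G w - K w)"
  using L2norm_triangle[OF square_integrable_diff[OF assms(1,2)] square_integrable_diff[OF assms(2,3)]]
  by simp

lemma L2norm_commute: "L2norm M (\<lambda>w. F w - G w) = L2norm M (\<lambda>w. G w - F w)"
  by (simp add: L2norm_def power2_commute)

lemma L2norm_diff_ge:
  assumes "square_integrable M F" "square_integrable M G"
  shows "\<bar>L2norm M F - L2norm M G\<bar> \<le> L2norm M (\<lambda>w. F w - G w)"
  using L2norm_triangle[OF square_integrable_diff[OF assms] assms(2)]
    L2norm_triangle[OF square_integrable_diff[OF assms(2,1)] assms(1)]
  by (simp add: L2norm_commute[of M G F] abs_le_iff)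

lemma L2norm_tendsto:
  assumes "\<And>j. square_integrable M (F j)" "square_integrable M G"
    and "(\<lambda>j. L2norm M (\<lambda>w. F j w - G w)) \<longlonglongrightarrow> 0"
  shows "(\<lambda>j. L2norm M (F j)) \<longlonglongrightarrow> L2norm M G"
proof (rule LIM_zero_cancel, rule Lim_null_comparison[OF _ assms(3)])
  show "\<forall>\<^sub>F j in sequentially. norm (L2norm M (F j) - L2norm M G) \<le> L2norm M (\<lambda>w. F j w - G w)"
    using L2norm_diff_ge[OF assms(1,2)] by simp
qed

lemma (in finite_measure) square_integrable_imp_integrable:
  assumes "square_integrable M F"
  shows "integrable M F"
proof -
  have "square_integrable M (\<lambda>w. 1)" by (simp add: square_integrable_def)
  from square_integrable_mult[OF assms this] show ?thesis by simp
qed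

lemma (in prob_space) integral_abs_le_L2norm:
  assumes "square_integrable M F"
  shows "(\<integral>w. \<bar>F w\<bar> \<partial>M) \<le> L2norm M F"
proof -
  have 1: "square_integrable M (\<lambda>w. 1)" by (simp add: square_integrable_def)
  have 2: "square_integrable M (\<lambda>w. \<bar>F w\<bar>)" using assms by (auto simp: square_integrable_def)
  from integral_mult_le_L2norm[OF 2 1] show ?thesis by (simp add: L2norm_def prob_space)
qed

text \<open>Riesz--Fischer: a subsequence with summable increments converges almost surely, and
  Fatou's lemma turns the Cauchy condition into convergence in mean square.\<close>

lemma (in prob_space) L2_complete:
  assumes sq: "\<And>j. square_integrable M (f j)"
    and cauchy: "\<And>e. e > 0 \<Longrightarrow> \<exists>N. \<forall>m\<ge>N. \<forall>n\<ge>N. L2norm M (\<lambda>w. f m w - f n w) < e"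
  obtains g where "square_integrable M g" "(\<lambda>j. L2norm M (\<lambda>w. f j w - g w)) \<longlonglongrightarrow> 0"
proof -
  have [measurable]: "f j \<in> borel_measurable M" for j using sq by measurable
  obtain N where N: "\<And>k m n. m \<ge> N k \<Longrightarrow> n \<ge> N k \<Longrightarrow> L2norm M (\<lambda>w. f m w - f n w) < (1/2)^k"
    using cauchy[of "(1/2)^k" for k] by (metis zero_less_divide_1_iff zero_less_numeral zero_less_power)
  define r where "r k = (\<Sum>i\<le>k. N i)" for k
  have rN: "r k \<ge> N i" if "i \<le> k" for i k
    unfolding r_def using that by (intro member_le_sum) auto
  define d where "d k w = f (r (Suc k)) w - f (r k) w" for k w
  have d2: "square_integrable M (d k)" for k unfolding d_def using sq by auto
  have [measurable]: "d k \<in> borel_measurable M" for k using d2 by measurable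
  have d1: "(\<integral>w. \<bar>d k w\<bar> \<partial>M) \<le> (1/2)^k" for k
    using integral_abs_le_L2norm[OF d2, of k] N[of k "r (Suc k)" "r k"] rN[of k]
    unfolding d_def by fastforce
  have "(\<integral>\<^sup>+w. (\<Sum>k. ennreal \<bar>d k w\<bar>) \<partial>M) = (\<Sum>k. \<integral>\<^sup>+w. ennreal \<bar>d k w\<bar> \<partial>M)"
    by (rule nn_integral_suminf) measurable
  also have "\<dots> \<le> (\<Sum>k. ennreal ((1/2)^k))"
  proof (rule suminf_le)
    show "(\<integral>\<^sup>+w. ennreal \<bar>d k w\<bar> \<partial>M) \<le> ennreal ((1/2)^k)" for k
      using d1[of k] square_integrable_imp_integrable[OF d2, of k]
      by (subst nn_integral_eq_integral) (auto intro: ennreal_leI)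
  qed auto
  also have "\<dots> < \<infinity>"
    by (subst suminf_ennreal2) (auto simp: summable_geometric)
  finally have "(\<integral>\<^sup>+w. (\<Sum>k. ennreal \<bar>d k w\<bar>) \<partial>M) \<noteq> \<infinity>" by simp
  then have "AE w in M. (\<Sum>k. ennreal \<bar>d k w\<bar>) \<noteq> \<infinity>"
    by (intro nn_integral_PInf_AE) auto
  then have conv: "AE w in M. convergent (\<lambda>k. f (r k) w)"
  proof eventually_elim
    case (elim w)
    then have "summable (\<lambda>k. \<bar>d k w\<bar>)" by (intro summable_suminf_not_top) auto
    then have "summable (\<lambda>k. f (r (Suc k)) w - f (r k) w)"
      unfolding d_def by (rule summable_rabs_cancel)
    then have "convergent (\<lambda>n. \<Sum>k<n. f (r (Suc k)) w - f (r k) w)"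
      by (simp add: summable_iff_convergent)
    then have "convergent (\<lambda>n. f (r n) w - f (r 0) w)"
      by (subst (asm) sum_lessThan_telescope)
    then have "convergent (\<lambda>n. (f (r n) w - f (r 0) w) + f (r 0) w)"
      by (intro convergent_add) (auto simp: convergent_const)
    then show ?case by simp
  qed
  define g where "g w = lim (\<lambda>k. f (r k) w)" for w
  have [measurable]: "g \<in> borel_measurable M" unfolding g_def by measurable
  have key: "(\<integral>\<^sup>+w. ennreal ((f j w - g w)\<^sup>2) \<partial>M) \<le> ennreal (((1/2)^k)\<^sup>2)" if j: "j \<ge> N k" for j k
  proof -
    have "(\<integral>\<^sup>+w. ennreal ((f j w - g w)\<^sup>2) \<partial>M)
        = (\<integral>\<^sup>+w. liminf (\<lambda>i. ennreal ((f j w - f (r i) w)\<^sup>2)) \<partial>M)"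
    proof (rule nn_integral_cong_AE, use conv in eventually_elim)
      case (elim w)
      then have "(\<lambda>i. f (r i) w) \<longlonglongrightarrow> g w" by (simp add: convergent_LIMSEQ_iff g_def)
      then have "(\<lambda>i. ennreal ((f j w - f (r i) w)\<^sup>2)) \<longlonglongrightarrow> ennreal ((f j w - g w)\<^sup>2)"
        by (intro tendsto_intros)
      then show ?case by (rule lim_imp_Liminf[OF sequentially_bot, symmetric])
    qed
    also have "\<dots> \<le> liminf (\<lambda>i. \<integral>\<^sup>+w. ennreal ((f j w - f (r i) w)\<^sup>2) \<partial>M)"
      by (rule nn_integral_liminf) measurable
    also have "\<dots> \<le> liminf (\<lambda>i. ennreal (((1/2)^k)\<^sup>2))"
    proof (intro Liminf_mono eventually_sequentiallyI[of k])
      fix i assume "k \<le> i"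
      have "(\<integral>\<^sup>+w. ennreal ((f j w - f (r i) w)\<^sup>2) \<partial>M) = ennreal ((L2norm M (\<lambda>w. f j w - f (r i) w))\<^sup>2)"
        unfolding L2norm_sq using square_integrable_diff[OF sq sq]
        by (intro nn_integral_eq_integral) (auto simp: square_integrable_def)
      also have "\<dots> \<le> ennreal (((1/2)^k)\<^sup>2)"
        using N[OF j, of "r i"] rN[OF \<open>k \<le> i\<close>] by (intro ennreal_leI power_mono) auto
      finally show "(\<integral>\<^sup>+w. ennreal ((f j w - f (r i) w)\<^sup>2) \<partial>M) \<le> ennreal (((1/2)^k)\<^sup>2)" .
    qed
    also have "\<dots> = ennreal (((1/2)^k)\<^sup>2)" by (simp add: Liminf_const)
    finally show ?thesis .
  qed
  have sqd: "square_integrable M (\<lambda>w. f j w - g w)" if "j \<ge> N k" for j k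
    unfolding square_integrable_def
    using order.strict_trans1[OF key[OF that]]
    by (auto intro!: integrableI_bounded)
  have g2: "square_integrable M g"
    using square_integrable_diff[OF sq[of "N 0"] sqd[of 0 "N 0"]] by simp
  have "(\<lambda>j. L2norm M (\<lambda>w. f j w - g w)) \<longlonglongrightarrow> 0"
  proof (rule LIMSEQ_I)
    fix e :: real assume "e > 0"
    then obtain k where k: "(1/2)^k < e" using real_arch_pow_inv[of e "1/2"] by auto
    have "L2norm M (\<lambda>w. f j w - g w) \<le> (1/2)^k" if "j \<ge> N k" for j
    proof (rule power2_le_imp_le)
      have "ennreal ((L2norm M (\<lambda>w. f j w - g w))\<^sup>2) \<le> ennreal (((1/2)^k)\<^sup>2)"
        using key[OF that] sqd[OF that] unfolding L2norm_sq
        by (subst nn_integral_eq_integral[symmetric]) (auto simp: square_integrable_def)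
      then show "(L2norm M (\<lambda>w. f j w - g w))\<^sup>2 \<le> ((1/2)^k)\<^sup>2" by (simp add: ennreal_le_iff)
    qed simp
    then show "\<exists>no. \<forall>n\<ge>no. norm (L2norm M (\<lambda>w. f n w - g w) - 0) < e"
      using k by (intro exI[of _ "N k"]) force
  qed
  with g2 that show ?thesis by blast
qed

section \<open>Hermite polynomials with a variance parameter\<close>

text \<open>The Taylor coefficients of \<open>a \<mapsto> exp(-a\<^sup>2 v/2)\<close>.\<close>

definition gauss_coeff :: "real \<Rightarrow> nat \<Rightarrow> real" where
  "gauss_coeff v j = (if even j then (- v / 2) ^ (j div 2) / fact (j div 2) else 0)"

text \<open>The coefficient of \<open>a\<^sup>n\<close> in \<open>exp(ay - a\<^sup>2 v/2)\<close>, for \<open>v > 0\<close> the probabilists' Hermite polynomial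
  \<open>He\<^sub>n(y/sqrt v) (sqrt v)\<^sup>n / n!\<close>.  Keeping the variance \<open>v\<close> as a parameter makes \<open>v = 0\<close> and \<open>v < 0\<close>
  meaningful: the first gives the monomials, the second majorants of the absolute values.\<close>

definition hermite :: "nat \<Rightarrow> real \<Rightarrow> real \<Rightarrow> real" where
  "hermite n y v = (\<Sum>i\<le>n. y ^ i / fact i * gauss_coeff v (n - i))"

lemma gauss_coeff_sums_norm:
  fixes a :: "'a :: {real_normed_field, banach}"
  shows "summable (\<lambda>j. norm (of_real (gauss_coeff v j) * a ^ j))"
    and "(\<lambda>j. of_real (gauss_coeff v j) * a ^ j) sums exp (- (a\<^sup>2 * of_real (v / 2)))"
proof -
  let ?f = "\<lambda>j. of_real (gauss_coeff v j) * a ^ j"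
  have sm: "strict_mono (\<lambda>n::nat. 2 * n)" by (simp add: strict_mono_def)
  have nr: "?f j = 0" if "j \<notin> range (\<lambda>n. 2 * n)" for j
    using that by (auto simp: gauss_coeff_def elim!: evenE)
  have ev: "?f (2 * n) = (- (a\<^sup>2 * of_real (v / 2))) ^ n /\<^sub>R fact n" for n
    by (simp add: gauss_coeff_def scaleR_conv_of_real power_mult power_mult_distrib
        power_minus[of "_ / _"] power_minus[of "_ * _"] power_divide field_simps
        flip: power_mult)
  show "?f sums exp (- (a\<^sup>2 * of_real (v / 2)))"
    using exp_converges[of "- (a\<^sup>2 * of_real (v / 2))"] sums_mono_reindex[OF sm nr, of "\<lambda>x. x"]
    unfolding ev[symmetric] by (simp add: sums_mono_reindex[OF sm nr])
  have "summable (\<lambda>n. norm (?f (2 * n)))"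
    unfolding ev by (rule summable_norm_exp)
  then show "summable (\<lambda>j. norm (?f j))"
    using summable_mono_reindex[OF sm, of "\<lambda>j. norm (?f j)"] nr by simp
qed

lemma hermite_sums:
  fixes a :: "'a :: {real_normed_field, banach}"
  shows "(\<lambda>n. of_real (hermite n y v) * a ^ n) sums exp (a * of_real y - a\<^sup>2 * of_real (v / 2))"
proof -
  let ?e = "\<lambda>i. (a * of_real y) ^ i /\<^sub>R fact i"
  let ?g = "\<lambda>j. of_real (gauss_coeff v j) * a ^ j"
  have "(\<lambda>n. \<Sum>i\<le>n. ?e i * ?g (n - i)) sums ((\<Sum>i. ?e i) * (\<Sum>j. ?g j))"
    by (rule Cauchy_product_sums[OF summable_norm_exp gauss_coeff_sums_norm(1)])
  also have "(\<Sum>i. ?e i) * (\<Sum>j. ?g j) = exp (a * of_real y - a\<^sup>2 * of_real (v / 2))"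
    unfolding diff_conv_add_uminus exp_add
    by (rule arg_cong2[where f="(*)", OF sums_unique[OF exp_converges, symmetric]
          sums_unique[OF gauss_coeff_sums_norm(2), symmetric]])
  also have "(\<lambda>n. \<Sum>i\<le>n. ?e i * ?g (n - i)) = (\<lambda>n. of_real (hermite n y v) * a ^ n)"
  proof
    fix n
    have "?e i * ?g (n - i) = of_real (y ^ i / fact i * gauss_coeff v (n - i)) * a ^ n" if "i \<le> n" for i
    proof -
      have "a ^ n = a ^ i * a ^ (n - i)" using that by (simp flip: power_add)
      then show ?thesis by (simp add: scaleR_conv_of_real power_mult_distrib field_simps)
    qed
    then show "(\<Sum>i\<le>n. ?e i * ?g (n - i)) = of_real (hermite n y v) * a ^ n"
      unfolding hermite_def of_real_sum sum_distrib_right by (intro sum.cong) auto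
  qed
  finally show ?thesis .
qed

lemma abs_gauss_coeff: "\<bar>gauss_coeff v j\<bar> = gauss_coeff (- \<bar>v\<bar>) j"
  by (simp add: gauss_coeff_def power_abs)

lemma abs_hermite_le: "\<bar>hermite n y v\<bar> \<le> hermite n \<bar>y\<bar> (- \<bar>v\<bar>)"
  unfolding hermite_def
  by (rule order.trans[OF sum_abs]) (simp add: abs_mult abs_gauss_coeff power_abs)

text \<open>Replacing \<open>y\<close> by \<open>|y|\<close> and \<open>v\<close> by \<open>-|v|\<close> makes all coefficients of the generating function
  nonnegative without decreasing their absolute values, so its partial sums are below the full sum.\<close>

lemma hermite_partial_bound:
  "(\<Sum>n<k. \<bar>hermite n y v\<bar> * \<bar>a\<bar> ^ n) \<le> exp (\<bar>a\<bar> * \<bar>y\<bar> + a\<^sup>2 * (\<bar>v\<bar> / 2))"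
proof -
  have s: "(\<lambda>n. hermite n \<bar>y\<bar> (- \<bar>v\<bar>) * \<bar>a\<bar> ^ n) sums exp (\<bar>a\<bar> * \<bar>y\<bar> + a\<^sup>2 * (\<bar>v\<bar> / 2))"
    using hermite_sums[of "\<bar>y\<bar>" "- \<bar>v\<bar>" "\<bar>a\<bar>"] by simp
  have nn: "0 \<le> hermite n \<bar>y\<bar> (- \<bar>v\<bar>)" for n
    using abs_hermite_le[of n y v] by linarith
  have "(\<Sum>n<k. \<bar>hermite n y v\<bar> * \<bar>a\<bar> ^ n) \<le> (\<Sum>n<k. hermite n \<bar>y\<bar> (- \<bar>v\<bar>) * \<bar>a\<bar> ^ n)"
    by (intro sum_mono mult_right_mono abs_hermite_le) auto
  also have "\<dots> \<le> exp (\<bar>a\<bar> * \<bar>y\<bar> + a\<^sup>2 * (\<bar>v\<bar> / 2))"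
    unfolding sums_unique[OF s]
    by (rule sum_le_suminf) (use s nn in \<open>auto simp: sums_iff\<close>)
  finally show ?thesis .
qed

lemma abs_hermite_le_exp: "\<bar>hermite n y v\<bar> \<le> exp (\<bar>y\<bar> + \<bar>v\<bar> / 2)"
proof -
  have "\<bar>hermite n y v\<bar> \<le> (\<Sum>i<Suc n. \<bar>hermite i y v\<bar> * \<bar>1\<bar> ^ i)"
    by (simp add: sum_nonneg)
  also have "\<dots> \<le> exp (\<bar>y\<bar> + \<bar>v\<bar> / 2)" using hermite_partial_bound[where k="Suc n" and a=1] by simp
  finally show ?thesis .
qed

lemma hermite_0_var: "hermite n y 0 = y ^ n / fact n"
proof -
  have "hermite n y 0 = (\<Sum>i\<in>{n}. y ^ i / fact i * gauss_coeff 0 (n - i))"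
    unfolding hermite_def
  proof (rule sum.mono_neutral_right)
    have "gauss_coeff 0 (n - i) = 0" if "i < n" for i
    proof (cases "even (n - i)")
      case True
      with that have "(n - i) div 2 > 0" by presburger
      then show ?thesis by (simp add: gauss_coeff_def)
    qed (simp add: gauss_coeff_def)
    then show "\<forall>i\<in>{..n} - {n}. y ^ i / fact i * gauss_coeff 0 (n - i) = 0"
      by (auto simp: order_less_le)
  qed auto
  then show ?thesis by (simp add: gauss_coeff_def)
qed

lemma hermite_measurable [measurable]:
  assumes [measurable]: "f \<in> borel_measurable N" "g \<in> borel_measurable N"
  shows "(\<lambda>x. hermite n (f x) (g x)) \<in> borel_measurable N"
proof -
  have [measurable]: "(\<lambda>x. gauss_coeff (g x) j) \<in> borel_measurable N" for j
    unfolding gauss_coeff_def by (cases "even j") simp_all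
  show ?thesis unfolding hermite_def by measurable
qed

text \<open>The factor that arises when \<open>cos(y - b) = Re(exp(-\<i>b) exp(\<i>y))\<close> is expanded with the generating
  function of the Hermite polynomials at \<open>a = \<i>\<close>.\<close>

definition phase_coeff :: "nat \<Rightarrow> real \<Rightarrow> real" where
  "phase_coeff n b = Re (\<i> ^ n * exp (- (\<i> * complex_of_real b)))"

lemma abs_phase_coeff_le: "\<bar>phase_coeff n b\<bar> \<le> 1"
  unfolding phase_coeff_def
  by (rule order.trans[OF abs_Re_le_cmod]) (simp add: norm_mult norm_power norm_exp_eq_Re)

lemma phase_coeff_0_even: "even n \<Longrightarrow> (phase_coeff n 0)\<^sup>2 = 1"
  by (auto simp: phase_coeff_def power_mult elim!: evenE) (metis minus_one_power_iff one_complex.sel(1) power2_minus power_one uminus_complex.sel(1))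

lemma phase_coeff_measurable [measurable]:
  assumes [measurable]: "f \<in> borel_measurable N"
  shows "(\<lambda>x. phase_coeff n (f x)) \<in> borel_measurable N"
proof -
  have "phase_coeff n b = Re (\<i> ^ n) * cos b + Im (\<i> ^ n) * sin b" for b
    unfolding phase_coeff_def
    by (simp add: Re_exp Im_exp exp_of_real flip: exp_of_real)
  then show ?thesis by simp
qed

lemma Re_of_real_mult: "Re (complex_of_real r * z) = r * Re z"
  by simp

text \<open>At \<open>a = \<i>\<close> the generating function is \<open>exp(\<i>y + v/2)\<close>, whence the factor \<open>exp(-v/2)\<close>.\<close>

lemma cos_hermite_sums:
  "(\<lambda>n. phase_coeff n b * exp (- v / 2) * hermite n y v) sums cos (y - b)"
proof -
  have "(\<lambda>n. of_real (hermite n y v) * \<i> ^ n * (exp (- (\<i> * complex_of_real b)) * of_real (exp (- v / 2))))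
     sums (exp (\<i> * of_real y - \<i>\<^sup>2 * of_real (v / 2)) * (exp (- (\<i> * complex_of_real b)) * of_real (exp (- v / 2))))"
    by (intro sums_mult2 hermite_sums)
  also have "exp (\<i> * of_real y - \<i>\<^sup>2 * of_real (v / 2)) * (exp (- (\<i> * complex_of_real b)) * of_real (exp (- v / 2)))
      = exp (\<i> * of_real (y - b))"
    by (simp add: exp_of_real[symmetric] exp_add[symmetric] exp_diff exp_minus field_simps)
  finally have "(\<lambda>n. Re (of_real (hermite n y v) * \<i> ^ n * (exp (- (\<i> * complex_of_real b)) * of_real (exp (- v / 2)))))
     sums Re (exp (\<i> * of_real (y - b)))"
    by (rule sums_Re)
  moreover have "Re (of_real (hermite n y v) * \<i> ^ n * (exp (- (\<i> * complex_of_real b)) * of_real (exp (- v / 2))))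
     = phase_coeff n b * exp (- v / 2) * hermite n y v" for n
  proof -
    have "of_real (hermite n y v) * \<i> ^ n * (exp (- (\<i> * complex_of_real b)) * of_real (exp (- v / 2)))
      = of_real (hermite n y v * exp (- v / 2)) * (\<i> ^ n * exp (- (\<i> * complex_of_real b)))"
      by simp
    then have "Re (of_real (hermite n y v) * \<i> ^ n * (exp (- (\<i> * complex_of_real b)) * of_real (exp (- v / 2))))
      = Re (of_real (hermite n y v * exp (- v / 2)) * (\<i> ^ n * exp (- (\<i> * complex_of_real b))))"
      by (simp only:)
    also have "\<dots> = hermite n y v * exp (- v / 2) * phase_coeff n b"
      unfolding phase_coeff_def by (rule Re_of_real_mult)
    finally show ?thesis by (simp only: mult_ac)
  qed
  moreover have "Re (exp (\<i> * of_real (y - b))) = cos (y - b)"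
    by (simp add: Re_exp)
  ultimately show ?thesis by simp
qed

lemma powser_coeff_unique:
  fixes c d :: "nat \<Rightarrow> real"
  assumes "\<And>a. (\<lambda>n. c n * a ^ n) sums f a" "\<And>a. (\<lambda>n. d n * a ^ n) sums f a"
  shows "c n = d n"
proof -
  define e where "e n = c n - d n" for n
  have e: "(\<lambda>n. e n * a ^ n) sums 0" for a
    using sums_diff[OF assms(1)[of a] assms(2)[of a]] by (simp add: e_def algebra_simps)
  have "e n = 0" for n
  proof (induction n rule: less_induct)
    case (less n)
    have "(\<lambda>i. e (i + n) * a ^ i) sums 0" if "a \<noteq> 0" for a
    proof -
      have "(\<lambda>i. e (i + n) * a ^ (i + n)) sums 0"
        using e[of a] less by (subst sums_zero_iff_shift) auto
      then have "(\<lambda>i. e (i + n) * a ^ (i + n) / a ^ n) sums (0 / a ^ n)"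
        by (rule sums_divide)
      then show ?thesis using that by (simp add: power_add)
    qed
    then have "((\<lambda>x. 0) \<longlongrightarrow> e (0 + n)) (at (0::real))"
      by (intro powser_limit_0_strong[of 1 "\<lambda>i. e (i + n)"]) auto
    then show ?case using LIM_unique[OF _ tendsto_const] by force
  qed
  then show ?thesis by (simp add: e_def)
qed

section \<open>Gaussian spaces\<close>

text \<open>A space of centred, jointly Gaussian variables.  Closure under linear combinations and the
  one-dimensional moment generating function determine all joint exponential moments, on which the
  chaos calculus rests.\<close>

locale gaussian_space = prob_space M for M :: "'w measure" +
  fixes G :: "('w \<Rightarrow> real) set"
  assumes lin: "\<And>Y W a b. Y \<in> G \<Longrightarrow> W \<in> G \<Longrightarrow> (\<lambda>w. a * Y w + b * W w) \<in> G"
    and sq: "\<And>W. W \<in> G \<Longrightarrow> square_integrable M W"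
    and mgf: "\<And>W. W \<in> G \<Longrightarrow>
        (\<integral>\<^sup>+w. ennreal (exp (W w)) \<partial>M) = ennreal (exp ((\<integral>w. (W w)\<^sup>2 \<partial>M) / 2))"
begin

lemma G_measurable [measurable_dest]: "W \<in> G \<Longrightarrow> W \<in> borel_measurable M"
  using sq by (auto simp: square_integrable_def)

lemma exp_pair:
  assumes "Y \<in> G" "W \<in> G"
  shows "integrable M (\<lambda>w. exp (a * Y w + b * W w))"
    and "(\<integral>w. exp (a * Y w + b * W w) \<partial>M) = exp ((a\<^sup>2 * (\<integral>w. (Y w)\<^sup>2 \<partial>M)
        + 2 * a * b * (\<integral>w. Y w * W w \<partial>M) + b\<^sup>2 * (\<integral>w. (W w)\<^sup>2 \<partial>M)) / 2)"
proof -
  have [measurable]: "Y \<in> borel_measurable M" "W \<in> borel_measurable M" using assms by measurable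
  have "(\<integral>w. (a * Y w + b * W w)\<^sup>2 \<partial>M)
      = (\<integral>w. a\<^sup>2 * (Y w)\<^sup>2 + (2 * a * b) * (Y w * W w) + b\<^sup>2 * (W w)\<^sup>2 \<partial>M)"
    by (rule Bochner_Integration.integral_cong) (auto simp: power2_eq_square algebra_simps)
  also have "\<dots> = a\<^sup>2 * (\<integral>w. (Y w)\<^sup>2 \<partial>M)
        + 2 * a * b * (\<integral>w. Y w * W w \<partial>M) + b\<^sup>2 * (\<integral>w. (W w)\<^sup>2 \<partial>M)"
    using sq[OF assms(1)] sq[OF assms(2)] square_integrable_mult[OF sq sq, OF assms]
    by (simp add: square_integrable_def)
  finally have v: "(\<integral>w. (a * Y w + b * W w)\<^sup>2 \<partial>M) = \<dots>" .
  note m = mgf[OF lin[OF assms, of a b], unfolded v]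
  show i: "integrable M (\<lambda>w. exp (a * Y w + b * W w))"
    by (rule integrableI_bounded) (auto simp: m)
  show "(\<integral>w. exp (a * Y w + b * W w) \<partial>M) = exp ((a\<^sup>2 * (\<integral>w. (Y w)\<^sup>2 \<partial>M)
        + 2 * a * b * (\<integral>w. Y w * W w \<partial>M) + b\<^sup>2 * (\<integral>w. (W w)\<^sup>2 \<partial>M)) / 2)"
    by (subst integral_eq_nn_integral) (auto simp: m)
qed

lemma exp_abs_pair_integrable:
  assumes "Y \<in> G" "W \<in> G"
  shows "integrable M (\<lambda>w. exp (a * \<bar>Y w\<bar> + b * \<bar>W w\<bar>))"
proof (rule Bochner_Integration.integrable_bound)
  have [measurable]: "Y \<in> borel_measurable M" "W \<in> borel_measurable M" using assms by measurable
  show "integrable M (\<lambda>w. exp (a * Y w + b * W w) + exp ((-a) * Y w + b * W w)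
       + exp (a * Y w + (-b) * W w) + exp ((-a) * Y w + (-b) * W w))"
    by (intro Bochner_Integration.integrable_add exp_pair assms)
  have "exp (a * \<bar>x\<bar> + b * \<bar>y\<bar>) \<le> exp (a * x + b * y)
       + exp ((-a) * x + b * y) + exp (a * x + (-b) * y) + exp ((-a) * x + (-b) * y)" for x y
    using exp_gt_zero[of "a * x + b * y"] exp_gt_zero[of "(-a) * x + b * y"]
      exp_gt_zero[of "a * x + (-b) * y"] exp_gt_zero[of "(-a) * x + (-b) * y"]
    by (cases "x < 0"; cases "y < 0"; simp only: abs_if if_True if_False mult_minus_left mult_minus_right; linarith)
  then show "AE w in M. norm (exp (a * \<bar>Y w\<bar> + b * \<bar>W w\<bar>)) \<le> norm (exp (a * Y w + b * W w)
       + exp ((-a) * Y w + b * W w) + exp (a * Y w + (-b) * W w) + exp ((-a) * Y w + (-b) * W w))"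
    by (intro AE_I2) (simp add: add_nonneg_nonneg del: mult_minus_left mult_minus_right)
qed (use assms in measurable)

lemma exp_abs_integrable:
  assumes "Y \<in> G"
  shows "integrable M (\<lambda>w. exp (a * \<bar>Y w\<bar>))"
  using exp_abs_pair_integrable[OF assms assms, of a 0] by simp

text \<open>Expectations of Hermite polynomials are read off as Taylor coefficients of the transform
  \<open>a \<mapsto> E[\<phi> exp(aY - a\<^sup>2v/2)]\<close>, which is explicit in the cases of interest; the exponential moments justify
  exchanging the series with the expectation.\<close>

lemma hermite_coeff_integral:
  assumes Y: "Y \<in> G" and [measurable]: "\<phi> \<in> borel_measurable M"
    and int: "\<And>b. integrable M (\<lambda>w. \<bar>\<phi> w\<bar> * exp (b * \<bar>Y w\<bar>))"
    and d: "\<And>a. (\<lambda>n. d n * a ^ n) sums (\<integral>w. \<phi> w * exp (a * Y w - a\<^sup>2 * (v / 2)) \<partial>M)"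
  shows "(\<integral>w. \<phi> w * hermite n (Y w) v \<partial>M) = d n"
proof (rule powser_coeff_unique[OF _ d])
  fix a :: real
  have [measurable]: "Y \<in> borel_measurable M" using Y by measurable
  have i: "integrable M (\<lambda>w. \<phi> w * hermite n (Y w) v)" for n
  proof (rule Bochner_Integration.integrable_bound[OF integrable_mult_right[OF int[of 1], of "exp (\<bar>v\<bar> / 2)"]])
    have "\<bar>\<phi> w * hermite n (Y w) v\<bar> \<le> exp (\<bar>v\<bar> / 2) * (\<bar>\<phi> w\<bar> * exp (\<bar>Y w\<bar>))" for w
      using mult_left_mono[OF abs_hermite_le_exp[of n "Y w" v], of "\<bar>\<phi> w\<bar>"]
      by (simp add: abs_mult exp_add mult_ac)
    then show "AE w in M. norm (\<phi> w * hermite n (Y w) v) \<le> norm (exp (\<bar>v\<bar> / 2) * (\<bar>\<phi> w\<bar> * exp (1 * \<bar>Y w\<bar>)))"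
      by (simp add: abs_mult)
  qed measurable
  have "(\<lambda>k. \<integral>w. (\<Sum>n<k. \<phi> w * hermite n (Y w) v * a ^ n) \<partial>M)
     \<longlonglongrightarrow> (\<integral>w. \<phi> w * exp (a * Y w - a\<^sup>2 * (v / 2)) \<partial>M)"
  proof (rule integral_dominated_convergence)
    show "integrable M (\<lambda>w. exp (a\<^sup>2 * (\<bar>v\<bar> / 2)) * (\<bar>\<phi> w\<bar> * exp (\<bar>a\<bar> * \<bar>Y w\<bar>)))"
      by (intro integrable_mult_right int)
    show "AE w in M. (\<lambda>k. \<Sum>n<k. \<phi> w * hermite n (Y w) v * a ^ n) \<longlonglongrightarrow> \<phi> w * exp (a * Y w - a\<^sup>2 * (v / 2))"
      using hermite_sums[of "Y w" v a for w, THEN sums_mult, of "\<phi> w" for w]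
      by (intro AE_I2) (simp add: sums_def mult.assoc)
    show "AE w in M. norm (\<Sum>n<k. \<phi> w * hermite n (Y w) v * a ^ n)
        \<le> exp (a\<^sup>2 * (\<bar>v\<bar> / 2)) * (\<bar>\<phi> w\<bar> * exp (\<bar>a\<bar> * \<bar>Y w\<bar>))" for k
    proof (rule AE_I2)
      fix w
      have "norm (\<Sum>n<k. \<phi> w * hermite n (Y w) v * a ^ n) \<le> (\<Sum>n<k. \<bar>\<phi> w\<bar> * (\<bar>hermite n (Y w) v\<bar> * \<bar>a\<bar> ^ n))"
        by (rule sum_norm_le) (simp add: abs_mult power_abs)
      also have "\<dots> \<le> \<bar>\<phi> w\<bar> * exp (\<bar>a\<bar> * \<bar>Y w\<bar> + a\<^sup>2 * (\<bar>v\<bar> / 2))"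
        unfolding sum_distrib_left[symmetric] by (intro mult_left_mono hermite_partial_bound) auto
      finally show "norm (\<Sum>n<k. \<phi> w * hermite n (Y w) v * a ^ n)
        \<le> exp (a\<^sup>2 * (\<bar>v\<bar> / 2)) * (\<bar>\<phi> w\<bar> * exp (\<bar>a\<bar> * \<bar>Y w\<bar>))"
        by (simp add: exp_add mult_ac)
    qed
  qed measurable
  moreover have "(\<integral>w. (\<Sum>n<k. \<phi> w * hermite n (Y w) v * a ^ n) \<partial>M)
      = (\<Sum>n<k. (\<integral>w. \<phi> w * hermite n (Y w) v \<partial>M) * a ^ n)" for k
    using i by simp
  ultimately show "(\<lambda>n. (\<integral>w. \<phi> w * hermite n (Y w) v \<partial>M) * a ^ n)
     sums (\<integral>w. \<phi> w * exp (a * Y w - a\<^sup>2 * (v / 2)) \<partial>M)"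
    by (simp add: sums_def)
qed

text \<open>For Gaussian \<open>Y\<close>, \<open>W\<close> with covariance \<open>r\<close> the transform is \<open>E[exp(bW)] exp(abr)\<close>; the right-hand
  side is its coefficient of \<open>a\<^sup>n\<close>.\<close>

lemma hermite_exp_integral:
  assumes Y: "Y \<in> G" and W: "W \<in> G"
  shows "(\<integral>w. exp (b * W w) * hermite n (Y w) (\<integral>w. (Y w)\<^sup>2 \<partial>M) \<partial>M)
     = exp (b\<^sup>2 * ((\<integral>w. (W w)\<^sup>2 \<partial>M) / 2)) * ((b * (\<integral>w. Y w * W w \<partial>M)) ^ n / fact n)"
proof (rule hermite_coeff_integral[OF Y])
  have [measurable]: "Y \<in> borel_measurable M" "W \<in> borel_measurable M" using assms by measurable
  let ?v = "\<integral>w. (Y w)\<^sup>2 \<partial>M" and ?r = "\<integral>w. Y w * W w \<partial>M" and ?u = "\<integral>w. (W w)\<^sup>2 \<partial>M"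
  show "(\<lambda>w. exp (b * W w)) \<in> borel_measurable M" by measurable
  fix a :: real
  have "exp (a * \<bar>Y w\<bar> + \<bar>b\<bar> * \<bar>W w\<bar>) \<ge> exp (a * \<bar>Y w\<bar> + b * W w)" for w
    by (simp add: abs_mult[symmetric])
  then show "integrable M (\<lambda>w. \<bar>exp (b * W w)\<bar> * exp (a * \<bar>Y w\<bar>))"
    by (intro Bochner_Integration.integrable_bound[OF exp_abs_pair_integrable[OF Y W, of a "\<bar>b\<bar>"]])
      (auto simp: exp_add[symmetric] add.commute)
  have "(\<integral>w. exp (b * W w) * exp (a * Y w - a\<^sup>2 * (?v / 2)) \<partial>M)
      = (\<integral>w. exp (a * Y w + b * W w) * exp (- a\<^sup>2 * (?v / 2)) \<partial>M)"
    by (simp add: exp_add[symmetric] algebra_simps)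
  also have "\<dots> = exp ((a\<^sup>2 * ?v + 2 * a * b * ?r + b\<^sup>2 * ?u) / 2) * exp (- a\<^sup>2 * (?v / 2))"
    using exp_pair[OF Y W, of a b] by simp
  also have "\<dots> = exp (b\<^sup>2 * (?u / 2)) * exp (b * ?r * a)"
    by (simp add: exp_add[symmetric] field_simps)
  finally have e: "(\<integral>w. exp (b * W w) * exp (a * Y w - a\<^sup>2 * (?v / 2)) \<partial>M) = \<dots>" .
  have "(\<lambda>n. exp (b\<^sup>2 * (?u / 2)) * ((b * ?r * a) ^ n /\<^sub>R fact n)) sums (exp (b\<^sup>2 * (?u / 2)) * exp (b * ?r * a))"
    by (intro sums_mult exp_converges)
  then show "(\<lambda>n. exp (b\<^sup>2 * (?u / 2)) * ((b * ?r) ^ n / fact n) * a ^ n) sums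
      (\<integral>w. exp (b * W w) * exp (a * Y w - a\<^sup>2 * (?v / 2)) \<partial>M)"
    unfolding e by (simp add: power_mult_distrib field_simps)
qed

lemma hermite_times_exp_integrable:
  assumes Y: "Y \<in> G" and W: "W \<in> G"
  shows "integrable M (\<lambda>w. \<bar>hermite n (Y w) v\<bar> * exp (b * \<bar>W w\<bar>))"
proof (rule Bochner_Integration.integrable_bound[OF integrable_mult_right[OF exp_abs_pair_integrable[OF Y W, of 1 b], of "exp (\<bar>v\<bar> / 2)"]])
  have [measurable]: "Y \<in> borel_measurable M" "W \<in> borel_measurable M" using assms by measurable
  show "(\<lambda>w. \<bar>hermite n (Y w) v\<bar> * exp (b * \<bar>W w\<bar>)) \<in> borel_measurable M" by measurable
  have "\<bar>hermite n (Y w) v\<bar> * exp (b * \<bar>W w\<bar>) \<le> exp (\<bar>v\<bar> / 2) * exp (1 * \<bar>Y w\<bar> + b * \<bar>W w\<bar>)" for w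
    using mult_right_mono[OF abs_hermite_le_exp[of n "Y w" v], of "exp (b * \<bar>W w\<bar>)"]
    by (simp add: exp_add mult_ac)
  then show "AE w in M. norm (\<bar>hermite n (Y w) v\<bar> * exp (b * \<bar>W w\<bar>)) \<le> norm (exp (\<bar>v\<bar> / 2) * exp (1 * \<bar>Y w\<bar> + b * \<bar>W w\<bar>))"
    by simp
qed

text \<open>A second coefficient comparison, in the parameter of \<open>W\<close>: the transform is the single monomial
  \<open>(ar)\<^sup>n/n!\<close>.\<close>

lemma hermite_orthogonal:
  assumes Y: "Y \<in> G" and W: "W \<in> G"
  shows "(\<integral>w. hermite n (Y w) (\<integral>w. (Y w)\<^sup>2 \<partial>M) * hermite m (W w) (\<integral>w. (W w)\<^sup>2 \<partial>M) \<partial>M)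
     = (if m = n then (\<integral>w. Y w * W w \<partial>M) ^ n / fact n else 0)"
proof (rule hermite_coeff_integral[OF W _ hermite_times_exp_integrable[OF Y W]])
  have [measurable]: "Y \<in> borel_measurable M" "W \<in> borel_measurable M" using assms by measurable
  let ?v = "\<integral>w. (Y w)\<^sup>2 \<partial>M" and ?r = "\<integral>w. Y w * W w \<partial>M" and ?u = "\<integral>w. (W w)\<^sup>2 \<partial>M"
  show "(\<lambda>w. hermite n (Y w) ?v) \<in> borel_measurable M" by measurable
  fix a :: real
  have "(\<integral>w. hermite n (Y w) ?v * exp (a * W w - a\<^sup>2 * (?u / 2)) \<partial>M)
     = (\<integral>w. exp (- (a\<^sup>2 * (?u / 2))) * (exp (a * W w) * hermite n (Y w) ?v) \<partial>M)"
    unfolding diff_conv_add_uminus exp_add by (simp only: mult_ac)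
  also have "\<dots> = (a * ?r) ^ n / fact n"
    using hermite_exp_integral[OF Y W, of a n] by (simp add: exp_minus field_simps)
  finally have e: "(\<integral>w. hermite n (Y w) ?v * exp (a * W w - a\<^sup>2 * (?u / 2)) \<partial>M) = (a * ?r) ^ n / fact n" .
  have "(\<lambda>m. if m = n then (a * ?r) ^ m / fact m else 0) sums ((a * ?r) ^ n / fact n)"
    by (rule sums_single)
  also have "(\<lambda>m. if m = n then (a * ?r) ^ m / fact m else 0)
      = (\<lambda>m. (if m = n then ?r ^ n / fact n else 0) * a ^ m)"
    by (auto simp: power_mult_distrib)
  finally show "(\<lambda>m. (if m = n then ?r ^ n / fact n else 0) * a ^ m)
      sums (\<integral>w. hermite n (Y w) ?v * exp (a * W w - a\<^sup>2 * (?u / 2)) \<partial>M)"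
    unfolding e .
qed

text \<open>The powers \<open>W\<^sup>m/m!\<close> are the Hermite polynomials of variance \<open>0\<close>, and the transform
  \<open>E[h\<^sub>n(Y) exp(aW)]\<close> is divisible by \<open>a\<^sup>n\<close>.\<close>

lemma hermite_power_orthogonal:
  assumes Y: "Y \<in> G" and W: "W \<in> G" and "m < n"
  shows "(\<integral>w. hermite n (Y w) (\<integral>w. (Y w)\<^sup>2 \<partial>M) * W w ^ m \<partial>M) = 0"
proof -
  have [measurable]: "Y \<in> borel_measurable M" "W \<in> borel_measurable M" using assms by measurable
  let ?v = "\<integral>w. (Y w)\<^sup>2 \<partial>M" and ?r = "\<integral>w. Y w * W w \<partial>M" and ?u = "\<integral>w. (W w)\<^sup>2 \<partial>M"
  define d where "d k = (if k < n then 0 else gauss_coeff (- ?u) (k - n) * (?r ^ n / fact n))" for k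
  have "(\<integral>w. hermite n (Y w) ?v * hermite m (W w) 0 \<partial>M) = d m"
  proof (rule hermite_coeff_integral[OF W _ hermite_times_exp_integrable[OF Y W]])
    show "(\<lambda>w. hermite n (Y w) ?v) \<in> borel_measurable M" by measurable
    fix a :: real
    have e: "(\<integral>w. hermite n (Y w) ?v * exp (a * W w - a\<^sup>2 * (0 / 2)) \<partial>M)
       = exp (a\<^sup>2 * (?u / 2)) * ((a * ?r) ^ n / fact n)"
      using hermite_exp_integral[OF Y W, of a n] by (simp add: mult.commute)
    have "(\<lambda>j. gauss_coeff (- ?u) j * a ^ j * ((a * ?r) ^ n / fact n)) sums (exp (a\<^sup>2 * (?u / 2)) * ((a * ?r) ^ n / fact n))"
      using gauss_coeff_sums_norm(2)[of "- ?u" a] by (intro sums_mult2) simp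
    then have "(\<lambda>j. d (j + n) * a ^ (j + n)) sums (exp (a\<^sup>2 * (?u / 2)) * ((a * ?r) ^ n / fact n))"
      by (simp add: d_def power_mult_distrib power_add mult_ac)
    then show "(\<lambda>k. d k * a ^ k) sums (\<integral>w. hermite n (Y w) ?v * exp (a * W w - a\<^sup>2 * (0 / 2)) \<partial>M)"
      unfolding e by (subst (asm) sums_zero_iff_shift) (auto simp: d_def)
  qed
  then have "(\<integral>w. hermite n (Y w) ?v * W w ^ m / fact m \<partial>M) = 0"
    using assms(3) by (simp add: hermite_0_var d_def)
  then show ?thesis by simp
qed

end

section \<open>Polynomials of the field\<close>

context
  fixes X :: "real^'n \<Rightarrow> 'w \<Rightarrow> real^'d"
begin

definition linear_forms :: "('w \<Rightarrow> real) set" where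
  "linear_forms = {(\<lambda>w. \<Sum>t\<in>S. A t \<bullet> X t w) | S A. finite S \<and> S \<subseteq> unit_cube}"

lemma linear_forms_single: "t \<in> unit_cube \<Longrightarrow> (\<lambda>w. a \<bullet> X t w) \<in> linear_forms"
  unfolding linear_forms_def
  by (rule CollectI, rule exI[of _ "{t}"], rule exI[of _ "\<lambda>_. a"]) auto

lemma linear_forms_lin:
  assumes "Y \<in> linear_forms" "W \<in> linear_forms"
  shows "(\<lambda>w. a * Y w + b * W w) \<in> linear_forms"
proof -
  obtain S A where Y: "Y = (\<lambda>w. \<Sum>t\<in>S. A t \<bullet> X t w)" and S: "finite S" "S \<subseteq> unit_cube"
    using assms(1) by (auto simp: linear_forms_def)
  obtain T B where W: "W = (\<lambda>w. \<Sum>t\<in>T. B t \<bullet> X t w)" and T: "finite T" "T \<subseteq> unit_cube"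
    using assms(2) by (auto simp: linear_forms_def)
  let ?C = "\<lambda>t. a *\<^sub>R (if t \<in> S then A t else 0) + b *\<^sub>R (if t \<in> T then B t else 0)"
  have "(\<Sum>t\<in>S. A t \<bullet> X t w) = (\<Sum>t\<in>S\<union>T. (if t \<in> S then A t else 0) \<bullet> X t w)" for w
    using S T by (intro sum.mono_neutral_cong_left) auto
  moreover have "(\<Sum>t\<in>T. B t \<bullet> X t w) = (\<Sum>t\<in>S\<union>T. (if t \<in> T then B t else 0) \<bullet> X t w)" for w
    using S T by (intro sum.mono_neutral_cong_left) auto
  ultimately have "(\<lambda>w. a * Y w + b * W w) = (\<lambda>w. \<Sum>t\<in>S\<union>T. ?C t \<bullet> X t w)"
    unfolding Y W by (simp add: inner_add_left sum.distrib sum_distrib_left)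
  then show ?thesis unfolding linear_forms_def using S T
    by (intro CollectI exI[of _ "S \<union> T"] exI[of _ ?C]) auto
qed

lemma field_polynomials_add:
  assumes "p \<in> field_polynomials X n" "q \<in> field_polynomials X n"
  shows "(\<lambda>w. p w + q w) \<in> field_polynomials X n"
proof -
  obtain c A where p: "p = (\<lambda>w. \<Sum>m\<in>A. c m * (\<Prod>(i, t)\<in>#m. X t w $ i))"
    and A: "finite A" "\<forall>m\<in>A. size m \<le> n \<and> set_mset m \<subseteq> UNIV \<times> unit_cube"
    using assms(1) by (auto simp: field_polynomials_def)
  obtain d B where q: "q = (\<lambda>w. \<Sum>m\<in>B. d m * (\<Prod>(i, t)\<in>#m. X t w $ i))"
    and B: "finite B" "\<forall>m\<in>B. size m \<le> n \<and> set_mset m \<subseteq> UNIV \<times> unit_cube"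
    using assms(2) by (auto simp: field_polynomials_def)
  let ?e = "\<lambda>m. (if m \<in> A then c m else 0) + (if m \<in> B then d m else 0)"
  have "(\<Sum>m\<in>A. c m * (\<Prod>(i, t)\<in>#m. X t w $ i))
      = (\<Sum>m\<in>A\<union>B. (if m \<in> A then c m else 0) * (\<Prod>(i, t)\<in>#m. X t w $ i))" for w
    using A B by (intro sum.mono_neutral_cong_left) auto
  moreover have "(\<Sum>m\<in>B. d m * (\<Prod>(i, t)\<in>#m. X t w $ i))
      = (\<Sum>m\<in>A\<union>B. (if m \<in> B then d m else 0) * (\<Prod>(i, t)\<in>#m. X t w $ i))" for w
    using A B by (intro sum.mono_neutral_cong_left) auto
  ultimately have "(\<lambda>w. p w + q w) = (\<lambda>w. \<Sum>m\<in>A\<union>B. ?e m * (\<Prod>(i, t)\<in>#m. X t w $ i))"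
    unfolding p q by (simp add: distrib_right sum.distrib)
  then show ?thesis unfolding field_polynomials_def using A B
    by (intro CollectI exI[of _ ?e] exI[of _ "A \<union> B"]) auto
qed

lemma field_polynomials_cmult:
  assumes "p \<in> field_polynomials X n"
  shows "(\<lambda>w. a * p w) \<in> field_polynomials X n"
proof -
  obtain c A where p: "p = (\<lambda>w. \<Sum>m\<in>A. c m * (\<Prod>(i, t)\<in>#m. X t w $ i))"
    and A: "finite A" "\<forall>m\<in>A. size m \<le> n \<and> set_mset m \<subseteq> UNIV \<times> unit_cube"
    using assms by (auto simp: field_polynomials_def)
  show ?thesis unfolding field_polynomials_def using A
    by (intro CollectI exI[of _ "\<lambda>m. a * c m"] exI[of _ A])
      (auto simp: p sum_distrib_left mult.assoc)
qed

lemma field_polynomials_monomial: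
  assumes "size m \<le> n" "set_mset m \<subseteq> UNIV \<times> unit_cube"
  shows "(\<lambda>w. \<Prod>(i, t)\<in>#m. X t w $ i) \<in> field_polynomials X n"
  unfolding field_polynomials_def using assms
  by (intro CollectI exI[of _ "\<lambda>_. 1"] exI[of _ "{m}"]) auto

lemma field_polynomials_const: "(\<lambda>w. a) \<in> field_polynomials X n"
  using field_polynomials_cmult[OF field_polynomials_monomial[of "{#}" n], of a] by simp

lemma field_polynomials_sum:
  assumes "\<And>i. i \<in> I \<Longrightarrow> p i \<in> field_polynomials X n"
  shows "(\<lambda>w. \<Sum>i\<in>I. p i w) \<in> field_polynomials X n"
  using assms
  by (induction I rule: infinite_finite_induct)
    (auto intro: field_polynomials_add field_polynomials_const)

lemma field_polynomials_mono: "m \<le> n \<Longrightarrow> field_polynomials X m \<subseteq> field_polynomials X n"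
  unfolding field_polynomials_def by fastforce

lemma field_polynomials_mult:
  assumes "p \<in> field_polynomials X k" "q \<in> field_polynomials X l"
  shows "(\<lambda>w. p w * q w) \<in> field_polynomials X (k + l)"
proof -
  obtain c A where p: "p = (\<lambda>w. \<Sum>m\<in>A. c m * (\<Prod>(i, t)\<in>#m. X t w $ i))"
    and A: "finite A" "\<forall>m\<in>A. size m \<le> k \<and> set_mset m \<subseteq> UNIV \<times> unit_cube"
    using assms(1) by (auto simp: field_polynomials_def)
  obtain d B where q: "q = (\<lambda>w. \<Sum>m\<in>B. d m * (\<Prod>(i, t)\<in>#m. X t w $ i))"
    and B: "finite B" "\<forall>m\<in>B. size m \<le> l \<and> set_mset m \<subseteq> UNIV \<times> unit_cube"
    using assms(2) by (auto simp: field_polynomials_def)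
  have "(\<lambda>w. \<Sum>m\<in>A. \<Sum>m'\<in>B. (c m * d m') * (\<Prod>(i, t)\<in>#m + m'. X t w $ i)) \<in> field_polynomials X (k + l)"
    using A B by (intro field_polynomials_sum field_polynomials_cmult field_polynomials_monomial)
      (auto intro: add_mono)
  also have "(\<lambda>w. \<Sum>m\<in>A. \<Sum>m'\<in>B. (c m * d m') * (\<Prod>(i, t)\<in>#m + m'. X t w $ i)) = (\<lambda>w. p w * q w)"
    unfolding p q by (simp add: sum_product mult_ac)
  finally show ?thesis .
qed

lemma field_polynomials_power:
  assumes "p \<in> field_polynomials X 1"
  shows "(\<lambda>w. p w ^ k) \<in> field_polynomials X k"
proof (induction k)
  case 0
  then show ?case using field_polynomials_const[of 1 0] by simp
next
  case (Suc k)
  then show ?case using field_polynomials_mult[OF assms Suc] by simp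
qed

lemma linear_forms_polynomial: "W \<in> linear_forms \<Longrightarrow> W \<in> field_polynomials X 1"
proof -
  have "(\<lambda>w. X t w $ i) \<in> field_polynomials X 1" if "t \<in> unit_cube" for i t
    using field_polynomials_monomial[of "{#(i, t)#}" 1] that by simp
  then show "W \<in> linear_forms \<Longrightarrow> W \<in> field_polynomials X 1"
    by (auto simp: linear_forms_def inner_vec_def intro!: field_polynomials_sum field_polynomials_cmult)
qed

lemma hermite_polynomial:
  assumes "W \<in> linear_forms"
  shows "(\<lambda>w. hermite n (W w) v) \<in> field_polynomials X n"
proof -
  have "(\<lambda>w. \<Sum>i\<le>n. (1 / fact i * gauss_coeff v (n - i)) * W w ^ i) \<in> field_polynomials X n"
    using field_polynomials_power[OF linear_forms_polynomial[OF assms]] field_polynomials_mono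
    by (intro field_polynomials_sum field_polynomials_cmult) blast
  then show ?thesis by (simp add: hermite_def mult_ac)
qed

end

section \<open>Random variables with all moments\<close>

text \<open>Unlike square integrability, this property is stable under products, so it covers all polynomials
  in Gaussian variables at once.\<close>

definition all_moments :: "'w measure \<Rightarrow> ('w \<Rightarrow> real) \<Rightarrow> bool" where
  "all_moments M f \<longleftrightarrow> f \<in> borel_measurable M \<and> (\<forall>n. integrable M (\<lambda>w. \<bar>f w\<bar> ^ n))"

lemma all_moments_integrable: "all_moments M f \<Longrightarrow> integrable M f"
  unfolding all_moments_def by (auto dest!: spec[of _ 1] simp: integrable_abs_iff)

lemma all_moments_square_integrable: "all_moments M f \<Longrightarrow> square_integrable M f"
  unfolding all_moments_def square_integrable_def by (auto dest!: spec[of _ 2])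

lemma all_moments_mult:
  assumes "all_moments M f" "all_moments M g"
  shows "all_moments M (\<lambda>w. f w * g w)"
proof -
  have [measurable]: "f \<in> borel_measurable M" "g \<in> borel_measurable M"
    using assms by (auto simp: all_moments_def)
  have "square_integrable M (\<lambda>w. \<bar>h w\<bar> ^ n)" if h: "all_moments M h" for h n
  proof -
    have [measurable]: "h \<in> borel_measurable M" using h by (simp add: all_moments_def)
    have "integrable M (\<lambda>w. \<bar>h w\<bar> ^ (n * 2))" using h unfolding all_moments_def by blast
    then show ?thesis unfolding square_integrable_def power_mult by simp
  qed
  from square_integrable_mult[OF this[OF assms(1)] this[OF assms(2)]] show ?thesis
    by (simp add: all_moments_def abs_mult power_mult_distrib)
qed

lemma all_moments_add:
  assumes "all_moments M f" "all_moments M g"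
  shows "all_moments M (\<lambda>w. f w + g w)"
  unfolding all_moments_def
proof (intro conjI allI)
  have [measurable]: "f \<in> borel_measurable M" "g \<in> borel_measurable M"
    using assms by (auto simp: all_moments_def)
  show "(\<lambda>w. f w + g w) \<in> borel_measurable M" by measurable
  fix n
  have b: "\<bar>x + y\<bar> ^ n \<le> 2 ^ n * (\<bar>x\<bar> ^ n + \<bar>y\<bar> ^ n)" for x y :: real
  proof -
    have "\<bar>x + y\<bar> ^ n \<le> (2 * max \<bar>x\<bar> \<bar>y\<bar>) ^ n" by (intro power_mono) auto
    also have "\<dots> \<le> 2 ^ n * (\<bar>x\<bar> ^ n + \<bar>y\<bar> ^ n)"
      unfolding power_mult_distrib by (intro mult_left_mono) (auto simp: max_def)
    finally show ?thesis .
  qed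
  show "integrable M (\<lambda>w. \<bar>f w + g w\<bar> ^ n)"
  proof (rule Bochner_Integration.integrable_bound)
    show "integrable M (\<lambda>w. 2 ^ n * (\<bar>f w\<bar> ^ n + \<bar>g w\<bar> ^ n))"
      using assms unfolding all_moments_def by (intro integrable_mult_right Bochner_Integration.integrable_add) auto
    show "AE w in M. norm (\<bar>f w + g w\<bar> ^ n) \<le> norm (2 ^ n * (\<bar>f w\<bar> ^ n + \<bar>g w\<bar> ^ n))"
      using b by (intro AE_I2) (simp add: abs_mult)
  qed measurable
qed

lemma (in finite_measure) all_moments_const: "all_moments M (\<lambda>w. c)"
  by (simp add: all_moments_def)

lemma (in finite_measure) all_moments_sum:
  "(\<And>i. i \<in> I \<Longrightarrow> all_moments M (f i)) \<Longrightarrow> all_moments M (\<lambda>w. \<Sum>i\<in>I. f i w)"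
  by (induction I rule: infinite_finite_induct) (auto intro: all_moments_add all_moments_const)

lemma (in finite_measure) all_moments_power:
  "all_moments M f \<Longrightarrow> all_moments M (\<lambda>w. f w ^ k)"
  by (induction k) (auto intro: all_moments_mult all_moments_const)

lemma (in finite_measure) all_moments_prod_list:
  "(\<And>z. z \<in> set zs \<Longrightarrow> all_moments M z) \<Longrightarrow> all_moments M (\<lambda>w. \<Prod>z\<leftarrow>zs. z w)"
  by (induction zs) (auto intro: all_moments_mult all_moments_const)

lemma (in gaussian_space) all_moments_G:
  assumes "W \<in> G"
  shows "all_moments M W"
  unfolding all_moments_def
proof (intro conjI allI)
  show [measurable]: "W \<in> borel_measurable M" using assms by measurable
  fix n
  have "\<bar>y\<bar> ^ n \<le> fact n * exp \<bar>y\<bar>" for y :: real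
    using abs_hermite_le_exp[of n y 0] by (simp add: hermite_0_var power_abs field_simps)
  then show "integrable M (\<lambda>w. \<bar>W w\<bar> ^ n)"
    by (intro Bochner_Integration.integrable_bound[OF integrable_mult_right[OF exp_abs_integrable[OF assms, of 1], of "fact n"]])
      auto
qed

lemma (in gaussian_space) all_moments_hermite:
  assumes "Y \<in> G"
  shows "all_moments M (\<lambda>w. hermite n (Y w) v)"
  unfolding hermite_def
  using all_moments_mult[OF all_moments_power[OF all_moments_G[OF assms]] all_moments_const, of _ "gauss_coeff v (n - i) / fact i" for i]
  by (intro all_moments_sum) simp

text \<open>Orthogonality to powers of single Gaussian variables already gives orthogonality to
  mixed monomials: the coefficient of \<open>\<lambda>\<close> in \<open>E[\<phi> (\<lambda>Z + W)\<^sup>m\<^sup>+\<^sup>1 \<dots>]\<close> trades one power of \<open>W\<close> for a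
  factor \<open>Z\<close>.\<close>

lemma (in gaussian_space) orthogonal_powers_imp_products:
  assumes \<phi>: "all_moments M \<phi>"
    and orth: "\<And>W m. W \<in> G \<Longrightarrow> m < n \<Longrightarrow> (\<integral>w. \<phi> w * W w ^ m \<partial>M) = 0"
  shows "W \<in> G \<Longrightarrow> set zs \<subseteq> G \<Longrightarrow> m + length zs < n \<Longrightarrow>
    (\<integral>w. \<phi> w * W w ^ m * (\<Prod>z\<leftarrow>zs. z w) \<partial>M) = 0"
proof (induction zs arbitrary: m W)
  case Nil
  then show ?case using orth by simp
next
  case (Cons z zs)
  have zG: "z \<in> G" and zs: "set zs \<subseteq> G" using Cons.prems by auto
  define c where "c k = of_nat (Suc m choose k) *
      (\<integral>w. \<phi> w * (z w ^ k * W w ^ (Suc m - k)) * (\<Prod>z\<leftarrow>zs. z w) \<partial>M)" for k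
  have int: "integrable M (\<lambda>w. \<phi> w * (z w ^ k * W w ^ l) * (\<Prod>z\<leftarrow>zs. z w))" for k l
    using zs zG Cons.prems(1)
    by (intro all_moments_integrable all_moments_mult all_moments_power all_moments_prod_list \<phi> all_moments_G) auto
  have "(\<Sum>k\<le>Suc m. c k * l ^ k) = 0" for l
  proof -
    have lG: "(\<lambda>w. l * z w + 1 * W w) \<in> G" by (intro lin zG Cons.prems)
    have "0 = (\<integral>w. \<phi> w * (l * z w + 1 * W w) ^ Suc m * (\<Prod>z\<leftarrow>zs. z w) \<partial>M)"
      using Cons.IH[OF lG zs, of "Suc m"] Cons.prems(3) by simp
    also have "\<dots> = (\<integral>w. (\<Sum>k\<le>Suc m. (of_nat (Suc m choose k) * l ^ k) *
        (\<phi> w * (z w ^ k * W w ^ (Suc m - k)) * (\<Prod>z\<leftarrow>zs. z w))) \<partial>M)"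
      unfolding binomial_ring
      by (intro Bochner_Integration.integral_cong refl)
        (simp only: sum_distrib_left sum_distrib_right power_mult_distrib mult_1 mult_ac)
    also have "\<dots> = (\<Sum>k\<le>Suc m. c k * l ^ k)"
    proof (subst Bochner_Integration.integral_sum)
      show "(\<Sum>k\<le>Suc m. \<integral>w. (of_nat (Suc m choose k) * l ^ k) *
          (\<phi> w * (z w ^ k * W w ^ (Suc m - k)) * (\<Prod>z\<leftarrow>zs. z w)) \<partial>M) = (\<Sum>k\<le>Suc m. c k * l ^ k)"
        unfolding integral_mult_right_zero c_def by (intro sum.cong refl) (simp only: mult_ac)
    qed (rule integrable_mult_right[OF int])
    finally show ?thesis by simp
  qed
  then have "\<forall>l. (\<Sum>k\<le>Suc m. c k * l ^ k) = 0" by blast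
  then have "c 1 = 0" unfolding polyfun_eq_0 by simp
  then have "(\<integral>w. \<phi> w * (z w * W w ^ m) * (\<Prod>z\<leftarrow>zs. z w) \<partial>M) = 0"
    by (simp add: c_def)
  then show ?case by (simp add: mult_ac)
qed

section \<open>The chaos spaces\<close>

locale field_chaos = gaussian_space M "linear_forms X"
  for M :: "'w measure" and X :: "real^'n \<Rightarrow> 'w \<Rightarrow> real^'d"
begin

lemma coordinate_linear: "t \<in> unit_cube \<Longrightarrow> (\<lambda>w. X t w $ i) \<in> linear_forms X"
  using linear_forms_single[where t=t and X=X and a="axis i 1"] by (simp add: inner_axis' inner_real_def)

lemma monomial_as_list:
  assumes "set_mset m \<subseteq> UNIV \<times> unit_cube"
  obtains zs where "length zs = size m" "set zs \<subseteq> linear_forms X"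
    "\<And>w. (\<Prod>(i, t)\<in>#m. X t w $ i) = (\<Prod>z\<leftarrow>zs. z w)"
proof -
  obtain l where l: "mset l = m" using ex_mset by blast
  show ?thesis
  proof (rule that[of "map (\<lambda>(i, t) w. X t w $ i) l"])
    show "length (map (\<lambda>(i, t) w. X t w $ i) l) = size m" using l by auto
    show "set (map (\<lambda>(i, t) w. X t w $ i) l) \<subseteq> linear_forms X"
      using assms l coordinate_linear by fastforce
    show "(\<Prod>(i, t)\<in>#m. X t w $ i) = (\<Prod>z\<leftarrow>map (\<lambda>(i, t) w. X t w $ i) l. z w)" for w
      unfolding l[symmetric] by (simp flip: mset_map prod_mset_prod_list add: o_def case_prod_unfold)
  qed
qed

lemma polynomial_all_moments:
  assumes "p \<in> field_polynomials X n"
  shows "all_moments M p"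
proof -
  obtain c A where p: "p = (\<lambda>w. \<Sum>m\<in>A. c m * (\<Prod>(i, t)\<in>#m. X t w $ i))"
    and A: "finite A" "\<forall>m\<in>A. size m \<le> n \<and> set_mset m \<subseteq> UNIV \<times> unit_cube"
    using assms by (auto simp: field_polynomials_def)
  have "all_moments M (\<lambda>w. \<Prod>(i, t)\<in>#m. X t w $ i)" if "m \<in> A" for m
  proof -
    obtain zs where zs: "set zs \<subseteq> linear_forms X" "\<And>w. (\<Prod>(i, t)\<in>#m. X t w $ i) = (\<Prod>z\<leftarrow>zs. z w)"
      using monomial_as_list[of m] A(2) \<open>m \<in> A\<close> by metis
    show ?thesis unfolding zs(2) using zs(1) by (intro all_moments_prod_list all_moments_G) auto
  qed
  then show ?thesis unfolding p
    by (intro all_moments_sum all_moments_mult all_moments_const)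
qed

lemma polynomial_square_integrable: "p \<in> field_polynomials X n \<Longrightarrow> square_integrable M p"
  using polynomial_all_moments all_moments_square_integrable by blast

lemma hermite_orthogonal_polynomials:
  assumes Y: "Y \<in> linear_forms X" and p: "p \<in> field_polynomials X k" and "k < n"
  shows "(\<integral>w. hermite n (Y w) (\<integral>w. (Y w)\<^sup>2 \<partial>M) * p w \<partial>M) = 0"
proof -
  let ?\<phi> = "\<lambda>w. hermite n (Y w) (\<integral>w. (Y w)\<^sup>2 \<partial>M)"
  obtain c A where p: "p = (\<lambda>w. \<Sum>m\<in>A. c m * (\<Prod>(i, t)\<in>#m. X t w $ i))"
    and A: "finite A" "\<forall>m\<in>A. size m \<le> k \<and> set_mset m \<subseteq> UNIV \<times> unit_cube"
    using p by (auto simp: field_polynomials_def)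
  have mono: "(\<integral>w. ?\<phi> w * (\<Prod>(i, t)\<in>#m. X t w $ i) \<partial>M) = 0 \<and> integrable M (\<lambda>w. ?\<phi> w * (\<Prod>(i, t)\<in>#m. X t w $ i))"
    if m: "m \<in> A" for m
  proof -
    obtain zs where zs: "length zs = size m" "set zs \<subseteq> linear_forms X" "\<And>w. (\<Prod>(i, t)\<in>#m. X t w $ i) = (\<Prod>z\<leftarrow>zs. z w)"
      using monomial_as_list[of m] A(2) m by metis
    have "(\<integral>w. ?\<phi> w * Y w ^ 0 * (\<Prod>z\<leftarrow>zs. z w) \<partial>M) = 0"
      using A(2) m zs(1) \<open>k < n\<close> hermite_power_orthogonal[OF Y]
      by (intro orthogonal_powers_imp_products[OF all_moments_hermite[OF Y] _ Y zs(2), of n]) auto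
    moreover have "integrable M (\<lambda>w. ?\<phi> w * (\<Prod>z\<leftarrow>zs. z w))"
      using zs(2) by (intro all_moments_integrable all_moments_mult all_moments_hermite Y all_moments_prod_list all_moments_G) auto
    ultimately show ?thesis unfolding zs(3) by simp
  qed
  have "(\<integral>w. ?\<phi> w * p w \<partial>M) = (\<integral>w. (\<Sum>m\<in>A. c m * (?\<phi> w * (\<Prod>(i, t)\<in>#m. X t w $ i))) \<partial>M)"
    unfolding p by (simp add: sum_distrib_left mult_ac)
  also have "\<dots> = 0"
    using mono by (subst Bochner_Integration.integral_sum) auto
  finally show ?thesis .
qed

lemma closed_polynomials_iff:
  "F \<in> closed_polynomials M X n \<longleftrightarrow>
     square_integrable M F \<and> (\<forall>e>0. \<exists>p\<in>field_polynomials X n. L2norm M (\<lambda>w. F w - p w) < e)"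
proof -
  have eq: "L2_dist_sq M F p < ennreal e \<longleftrightarrow> L2norm M (\<lambda>w. F w - p w) < sqrt e"
    if "square_integrable M F" "p \<in> field_polynomials X n" "e > 0" for p e
    using L2_dist_sq_eq[OF that(1) polynomial_square_integrable[OF that(2)]] that(3)
    by (simp add: L2norm_def ennreal_less_iff)
  show ?thesis
  proof (cases "square_integrable M F")
    case True
    show ?thesis unfolding closed_polynomials_def mem_Collect_eq
    proof (intro conj_cong refl iffI allI impI)
      fix e :: real assume h: "\<forall>e>0. \<exists>p\<in>field_polynomials X n. L2_dist_sq M F p < ennreal e" and "e > 0"
      then show "\<exists>p\<in>field_polynomials X n. L2norm M (\<lambda>w. F w - p w) < e"
        using h[rule_format, of "e\<^sup>2"] eq[OF True, of _ "e\<^sup>2"] by auto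
    next
      fix e :: real assume h: "\<forall>e>0. \<exists>p\<in>field_polynomials X n. L2norm M (\<lambda>w. F w - p w) < e" and "e > 0"
      then show "\<exists>p\<in>field_polynomials X n. L2_dist_sq M F p < ennreal e"
        using h[rule_format, of "sqrt e"] eq[OF True, of _ e] by auto
    qed
  qed (simp add: closed_polynomials_def)
qed

lemma closed_polynomials_square_integrable: "F \<in> closed_polynomials M X n \<Longrightarrow> square_integrable M F"
  by (simp add: closed_polynomials_iff)

lemma polynomial_in_closed: "p \<in> field_polynomials X n \<Longrightarrow> p \<in> closed_polynomials M X n"
  unfolding closed_polynomials_iff
  by (auto intro: polynomial_square_integrable intro!: bexI[of _ p] simp: L2norm_def)

lemma closed_polynomials_mono: "m \<le> n \<Longrightarrow> closed_polynomials M X m \<subseteq> closed_polynomials M X n"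
  using field_polynomials_mono[of m n X] unfolding closed_polynomials_def by blast

lemma closed_polynomials_add:
  assumes "F \<in> closed_polynomials M X n" "F' \<in> closed_polynomials M X n"
  shows "(\<lambda>w. F w + F' w) \<in> closed_polynomials M X n"
  unfolding closed_polynomials_iff
proof (intro conjI allI impI)
  have sF: "square_integrable M F" "square_integrable M F'"
    using assms by (auto simp: closed_polynomials_iff)
  then show "square_integrable M (\<lambda>w. F w + F' w)" by auto
  fix e :: real assume "e > 0"
  then obtain p p' where p: "p \<in> field_polynomials X n" "L2norm M (\<lambda>w. F w - p w) < e/2"
    "p' \<in> field_polynomials X n" "L2norm M (\<lambda>w. F' w - p' w) < e/2"
    using assms[unfolded closed_polynomials_iff, THEN conjunct2, rule_format, of "e / 2"] half_gt_zero by metis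
  have "L2norm M (\<lambda>w. (F w - p w) + (F' w - p' w)) \<le> L2norm M (\<lambda>w. F w - p w) + L2norm M (\<lambda>w. F' w - p' w)"
    using p sF polynomial_square_integrable by (intro L2norm_triangle) auto
  also have "\<dots> < e" using p by simp
  finally show "\<exists>q\<in>field_polynomials X n. L2norm M (\<lambda>w. F w + F' w - q w) < e"
    using field_polynomials_add[OF p(1,3)]
    by (intro bexI[of _ "\<lambda>w. p w + p' w"]) (auto simp: algebra_simps)
qed

lemma closed_polynomials_cmult:
  assumes "F \<in> closed_polynomials M X n"
  shows "(\<lambda>w. a * F w) \<in> closed_polynomials M X n"
  unfolding closed_polynomials_iff
proof (intro conjI allI impI)
  show "square_integrable M (\<lambda>w. a * F w)" using assms by (auto simp: closed_polynomials_iff)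
  fix e :: real assume "e > 0"
  then have "e / (\<bar>a\<bar> + 1) > 0" by simp
  then obtain p where p: "p \<in> field_polynomials X n" "L2norm M (\<lambda>w. F w - p w) < e / (\<bar>a\<bar> + 1)"
    using assms[unfolded closed_polynomials_iff, THEN conjunct2, rule_format, of "e / (\<bar>a\<bar> + 1)"] by blast
  have "L2norm M (\<lambda>w. a * F w - a * p w) = \<bar>a\<bar> * L2norm M (\<lambda>w. F w - p w)"
    using L2norm_cmult[of M a "\<lambda>w. F w - p w"] by (simp add: algebra_simps)
  also have "\<dots> \<le> (\<bar>a\<bar> + 1) * L2norm M (\<lambda>w. F w - p w)" by (intro mult_right_mono) auto
  also have "\<dots> < e" using p(2) by (simp add: field_simps)
  finally show "\<exists>q\<in>field_polynomials X n. L2norm M (\<lambda>w. a * F w - q w) < e"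
    using field_polynomials_cmult[OF p(1), of a] by (intro bexI[of _ "\<lambda>w. a * p w"]) auto
qed

lemma closed_polynomials_limit:
  assumes "\<And>j. F j \<in> closed_polynomials M X n" "square_integrable M L"
    and lim: "(\<lambda>j. L2norm M (\<lambda>w. F j w - L w)) \<longlonglongrightarrow> 0"
  shows "L \<in> closed_polynomials M X n"
  unfolding closed_polynomials_iff
proof (intro conjI allI impI assms)
  fix e :: real assume "e > 0"
  then obtain j where j: "L2norm M (\<lambda>w. F j w - L w) < e/2"
    using order_tendstoD(2)[OF lim, of "e/2"] by (auto simp: eventually_sequentially)
  obtain p where p: "p \<in> field_polynomials X n" "L2norm M (\<lambda>w. F j w - p w) < e/2"
    using assms(1)[of j, unfolded closed_polynomials_iff, THEN conjunct2, rule_format, of "e / 2"] \<open>e > 0\<close> half_gt_zero by metis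
  have "L2norm M (\<lambda>w. L w - p w) \<le> L2norm M (\<lambda>w. L w - F j w) + L2norm M (\<lambda>w. F j w - p w)"
    using assms(1,2) polynomial_square_integrable[OF p(1)]
    by (intro L2norm_triangle_diff) (auto simp: closed_polynomials_iff)
  also have "\<dots> < e" using j p(2) L2norm_commute[of M L "F j"] by simp
  finally show "\<exists>p\<in>field_polynomials X n. L2norm M (\<lambda>w. L w - p w) < e" using p(1) by blast
qed

lemma chaos_closed: "F \<in> chaos M X n \<Longrightarrow> F \<in> closed_polynomials M X n"
  by (auto simp: chaos_def split: if_splits)

lemma chaos_square_integrable: "F \<in> chaos M X n \<Longrightarrow> square_integrable M F"
  using chaos_closed closed_polynomials_square_integrable by blast

lemma chaos_add:
  assumes "F \<in> chaos M X n" "F' \<in> chaos M X n"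
  shows "(\<lambda>w. F w + F' w) \<in> chaos M X n"
  using assms square_integrable_mult[OF chaos_square_integrable closed_polynomials_square_integrable]
  by (auto simp: chaos_def distrib_right intro: closed_polynomials_add split: if_splits)

lemma chaos_cmult:
  assumes "F \<in> chaos M X n"
  shows "(\<lambda>w. a * F w) \<in> chaos M X n"
  using assms by (auto simp: chaos_def mult.assoc intro: closed_polynomials_cmult split: if_splits)

lemma chaos_diff:
  assumes "F \<in> chaos M X n" "F' \<in> chaos M X n"
  shows "(\<lambda>w. F w - F' w) \<in> chaos M X n"
  using chaos_add[OF assms(1) chaos_cmult[OF assms(2), of "-1"]] by simp

lemma chaos_zero: "(\<lambda>w. 0) \<in> chaos M X n"
  using polynomial_in_closed[OF field_polynomials_const[of 0 X]] by (auto simp: chaos_def)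

lemma chaos_sum:
  assumes "\<And>i. i \<in> I \<Longrightarrow> F i \<in> chaos M X n"
  shows "(\<lambda>w. \<Sum>i\<in>I. F i w) \<in> chaos M X n"
  using assms by (induction I rule: infinite_finite_induct) (auto intro: chaos_add chaos_zero)

lemma chaos_limit:
  assumes F: "\<And>j. F j \<in> chaos M X n" and L: "square_integrable M L"
    and lim: "(\<lambda>j. L2norm M (\<lambda>w. F j w - L w)) \<longlonglongrightarrow> 0"
  shows "L \<in> chaos M X n"
proof -
  have cl: "L \<in> closed_polynomials M X n"
    using closed_polynomials_limit[OF chaos_closed[OF F] L lim] .
  have "(\<integral>w. L w * K w \<partial>M) = 0" if K: "K \<in> closed_polynomials M X (n - 1)" and n: "n \<noteq> 0" for K
  proof -
    have sK: "square_integrable M K" using K by (simp add: closed_polynomials_iff)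
    have "\<bar>\<integral>w. L w * K w \<partial>M\<bar> \<le> L2norm M (\<lambda>w. F j w - L w) * L2norm M K" for j
    proof -
      have sF: "square_integrable M (F j)" using F chaos_square_integrable by blast
      have "(\<integral>w. (F j w - L w) * K w \<partial>M) = (\<integral>w. F j w * K w \<partial>M) - (\<integral>w. L w * K w \<partial>M)"
        using square_integrable_mult[OF sF sK] square_integrable_mult[OF L sK]
        by (simp add: left_diff_distrib)
      moreover have "(\<integral>w. F j w * K w \<partial>M) = 0" using F[of j] K n by (auto simp: chaos_def)
      ultimately show ?thesis
        using abs_integral_mult_le_L2norm[OF square_integrable_diff[OF sF L] sK] by simp
    qed
    moreover have "(\<lambda>j. L2norm M (\<lambda>w. F j w - L w) * L2norm M K) \<longlonglongrightarrow> 0 * L2norm M K"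
      by (intro tendsto_intros lim)
    ultimately have "\<bar>\<integral>w. L w * K w \<partial>M\<bar> \<le> 0 * L2norm M K"
      by (intro LIMSEQ_le_const) auto
    then show ?thesis by simp
  qed
  with cl show ?thesis by (auto simp: chaos_def)
qed

text \<open>The chaos of smaller order consists of limits of polynomials to which the other one is orthogonal
  by definition.\<close>

lemma chaos_orthogonal:
  assumes "F \<in> chaos M X m" "K \<in> chaos M X n" "m \<noteq> n"
  shows "(\<integral>w. F w * K w \<partial>M) = 0"
proof -
  have *: "(\<integral>w. F w * K w \<partial>M) = 0" if "F \<in> chaos M X m" "K \<in> chaos M X n" "m < n" for F K m n
  proof -
    have "F \<in> closed_polynomials M X (n - 1)"
      using chaos_closed[OF that(1)] closed_polynomials_mono[of m "n - 1"] that(3)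
      by (metis One_nat_def Suc_pred less_Suc_eq_le less_nat_zero_code not_gr_zero subsetD)
    then have "(\<integral>w. K w * F w \<partial>M) = 0" using that by (auto simp: chaos_def)
    then show ?thesis by (simp add: mult.commute)
  qed
  show ?thesis using *[of F m K n] *[of K n F m] assms by (cases "m < n") (auto simp: mult.commute)
qed

text \<open>Orthogonality to the polynomials of smaller degree passes to their mean-square closure by the
  Cauchy--Schwarz inequality.\<close>

lemma hermite_in_chaos:
  assumes Y: "Y \<in> linear_forms X"
  shows "(\<lambda>w. hermite n (Y w) (\<integral>w. (Y w)\<^sup>2 \<partial>M)) \<in> chaos M X n"
proof -
  let ?\<phi> = "\<lambda>w. hermite n (Y w) (\<integral>w. (Y w)\<^sup>2 \<partial>M)"
  have cl: "?\<phi> \<in> closed_polynomials M X n"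
    by (intro polynomial_in_closed hermite_polynomial Y)
  have s\<phi>: "square_integrable M ?\<phi>" using cl closed_polynomials_square_integrable by blast
  have "(\<integral>w. ?\<phi> w * K w \<partial>M) = 0" if K: "K \<in> closed_polynomials M X (n - 1)" and n: "n \<noteq> 0" for K
  proof -
    have sK: "square_integrable M K" using K by (simp add: closed_polynomials_iff)
    have "\<bar>\<integral>w. ?\<phi> w * K w \<partial>M\<bar> \<le> L2norm M ?\<phi> * e" if e: "e > 0" for e
    proof -
      obtain p where p: "p \<in> field_polynomials X (n - 1)" "L2norm M (\<lambda>w. K w - p w) < e"
        using K[unfolded closed_polynomials_iff, THEN conjunct2, rule_format, OF e] by blast
      note sp = polynomial_square_integrable[OF p(1)]
      have "(\<integral>w. ?\<phi> w * K w \<partial>M) = (\<integral>w. ?\<phi> w * (K w - p w) \<partial>M) + (\<integral>w. ?\<phi> w * p w \<partial>M)"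
        using square_integrable_mult[OF s\<phi> sK] square_integrable_mult[OF s\<phi> sp]
        by (simp add: right_diff_distrib)
      also have "\<dots> = (\<integral>w. ?\<phi> w * (K w - p w) \<partial>M)"
        using hermite_orthogonal_polynomials[OF Y p(1), of n] n by simp
      finally have "\<bar>\<integral>w. ?\<phi> w * K w \<partial>M\<bar> \<le> L2norm M ?\<phi> * L2norm M (\<lambda>w. K w - p w)"
        using abs_integral_mult_le_L2norm[OF s\<phi> square_integrable_diff[OF sK sp]] by simp
      also have "\<dots> \<le> L2norm M ?\<phi> * e" using p(2) by (intro mult_left_mono) auto
      finally show ?thesis .
    qed
    note b = this
    have "(\<lambda>e. L2norm M ?\<phi> * e) \<midarrow>0\<rightarrow> L2norm M ?\<phi> * 0" by (intro tendsto_intros)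
    then have "((\<lambda>e. L2norm M ?\<phi> * e) \<longlongrightarrow> L2norm M ?\<phi> * 0) (at_right 0)"
      by (rule filterlim_mono) (auto simp: at_le)
    then have "\<bar>\<integral>w. ?\<phi> w * K w \<partial>M\<bar> \<le> L2norm M ?\<phi> * 0"
      by (rule tendsto_lowerbound) (use b in \<open>auto simp: eventually_at_filter\<close>)
    then show ?thesis by simp
  qed
  with cl show ?thesis by (auto simp: chaos_def)
qed

end

section \<open>Chaos expansions and mean-square limits\<close>

lemma L2norm_sum_le:
  assumes "\<And>i. i \<in> I \<Longrightarrow> square_integrable M (F i)"
  shows "L2norm M (\<lambda>w. \<Sum>i\<in>I. F i w) \<le> (\<Sum>i\<in>I. L2norm M (F i))"
  using assms
proof (induction I rule: infinite_finite_induct)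
  case (insert i I)
  have "L2norm M (\<lambda>w. F i w + (\<Sum>i\<in>I. F i w)) \<le> L2norm M (F i) + L2norm M (\<lambda>w. \<Sum>i\<in>I. F i w)"
    using insert.prems by (intro L2norm_triangle square_integrable_sum) auto
  with insert show ?case by simp
qed (auto simp: L2norm_def)

lemma LIMSEQ_zero_less:
  fixes f :: "nat \<Rightarrow> real"
  assumes "f \<longlonglongrightarrow> 0" "e > 0"
  obtains N where "\<And>j. j \<ge> N \<Longrightarrow> f j < e"
  using order_tendstoD(2)[OF assms] unfolding eventually_sequentially by blast

context field_chaos
begin

lemma chaos_expansion_iff:
  "chaos_expansion M X F Fs \<longleftrightarrow> square_integrable M F \<and> (\<forall>n. Fs n \<in> chaos M X n) \<and>
     (\<lambda>k. L2norm M (\<lambda>w. (\<Sum>n<k. Fs n w) - F w)) \<longlonglongrightarrow> 0"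
proof (cases "square_integrable M F \<and> (\<forall>n. Fs n \<in> chaos M X n)")
  case True
  have sq: "square_integrable M (\<lambda>w. \<Sum>n<k. Fs n w)" for k
    using True chaos_square_integrable by (intro square_integrable_sum) auto
  have eq: "L2_dist_sq M (\<lambda>w. \<Sum>n<k. Fs n w) F = ennreal ((L2norm M (\<lambda>w. (\<Sum>n<k. Fs n w) - F w))\<^sup>2)" for k
    using True by (subst L2_dist_sq_eq[OF sq]) (auto simp: L2norm_sq)
  have "(\<lambda>k. L2_dist_sq M (\<lambda>w. \<Sum>n<k. Fs n w) F) \<longlonglongrightarrow> 0 \<longleftrightarrow>
      (\<lambda>k. (L2norm M (\<lambda>w. (\<Sum>n<k. Fs n w) - F w))\<^sup>2) \<longlonglongrightarrow> 0"
    unfolding eq by (subst ennreal_0[symmetric], subst tendsto_ennreal_iff) auto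
  also have "\<dots> \<longleftrightarrow> (\<lambda>k. L2norm M (\<lambda>w. (\<Sum>n<k. Fs n w) - F w)) \<longlonglongrightarrow> 0"
  proof
    assume "(\<lambda>k. (L2norm M (\<lambda>w. (\<Sum>n<k. Fs n w) - F w))\<^sup>2) \<longlonglongrightarrow> 0"
    then have "(\<lambda>k. sqrt ((L2norm M (\<lambda>w. (\<Sum>n<k. Fs n w) - F w))\<^sup>2)) \<longlonglongrightarrow> sqrt 0"
      by (intro tendsto_intros)
    then show "(\<lambda>k. L2norm M (\<lambda>w. (\<Sum>n<k. Fs n w) - F w)) \<longlonglongrightarrow> 0" by simp
  next
    assume "(\<lambda>k. L2norm M (\<lambda>w. (\<Sum>n<k. Fs n w) - F w)) \<longlonglongrightarrow> 0"
    then have "(\<lambda>k. (L2norm M (\<lambda>w. (\<Sum>n<k. Fs n w) - F w))\<^sup>2) \<longlonglongrightarrow> 0\<^sup>2"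
      by (intro tendsto_intros)
    then show "(\<lambda>k. (L2norm M (\<lambda>w. (\<Sum>n<k. Fs n w) - F w))\<^sup>2) \<longlonglongrightarrow> 0" by simp
  qed
  finally show ?thesis using True by (simp add: chaos_expansion_def)
qed (auto simp: chaos_expansion_def)

lemma chaos_sum_square:
  assumes Fs: "\<And>n. Fs n \<in> chaos M X n" and "finite I"
  shows "(\<integral>w. (\<Sum>n\<in>I. Fs n w)\<^sup>2 \<partial>M) = (\<Sum>n\<in>I. \<integral>w. (Fs n w)\<^sup>2 \<partial>M)"
proof -
  have int: "integrable M (\<lambda>w. Fs m w * Fs n w)" for m n
    using Fs chaos_square_integrable square_integrable_mult by blast
  have "(\<integral>w. (\<Sum>n\<in>I. Fs n w)\<^sup>2 \<partial>M) = (\<integral>w. (\<Sum>m\<in>I. \<Sum>n\<in>I. Fs m w * Fs n w) \<partial>M)"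
    by (simp add: power2_eq_square sum_product)
  also have "\<dots> = (\<Sum>m\<in>I. \<Sum>n\<in>I. \<integral>w. Fs m w * Fs n w \<partial>M)"
    using int by simp
  also have "\<dots> = (\<Sum>m\<in>I. \<Sum>n\<in>I. if n = m then \<integral>w. (Fs m w)\<^sup>2 \<partial>M else 0)"
    using chaos_orthogonal[OF Fs Fs] by (intro sum.cong refl) (auto simp: power2_eq_square)
  finally show ?thesis using \<open>finite I\<close> by (simp add: sum.delta)
qed

lemma chaos_parseval:
  assumes "chaos_expansion M X F Fs"
  shows "(\<lambda>n. \<integral>w. (Fs n w)\<^sup>2 \<partial>M) sums (\<integral>w. (F w)\<^sup>2 \<partial>M)"
proof -
  have Fs: "\<And>n. Fs n \<in> chaos M X n" and F: "square_integrable M F"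
    and lim: "(\<lambda>k. L2norm M (\<lambda>w. (\<Sum>n<k. Fs n w) - F w)) \<longlonglongrightarrow> 0"
    using assms by (auto simp: chaos_expansion_iff)
  have "(\<lambda>k. L2norm M (\<lambda>w. \<Sum>n<k. Fs n w)) \<longlonglongrightarrow> L2norm M F"
    by (intro L2norm_tendsto[OF _ F lim] square_integrable_sum chaos_square_integrable[OF Fs])
  then have "(\<lambda>k. (L2norm M (\<lambda>w. \<Sum>n<k. Fs n w))\<^sup>2) \<longlonglongrightarrow> (L2norm M F)\<^sup>2"
    by (intro tendsto_intros)
  then show ?thesis
    unfolding L2norm_sq by (simp add: chaos_sum_square[OF Fs] sums_def)
qed

lemma chaos_expansion_diff:
  assumes "chaos_expansion M X F Fs" "chaos_expansion M X K Ks"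
  shows "chaos_expansion M X (\<lambda>w. F w - K w) (\<lambda>n w. Fs n w - Ks n w)"
  unfolding chaos_expansion_iff
proof (intro conjI allI)
  have F: "square_integrable M F" "square_integrable M K"
    "\<And>n. Fs n \<in> chaos M X n" "\<And>n. Ks n \<in> chaos M X n"
    "(\<lambda>k. L2norm M (\<lambda>w. (\<Sum>n<k. Fs n w) - F w)) \<longlonglongrightarrow> 0"
    "(\<lambda>k. L2norm M (\<lambda>w. (\<Sum>n<k. Ks n w) - K w)) \<longlonglongrightarrow> 0"
    using assms by (auto simp: chaos_expansion_iff)
  show "square_integrable M (\<lambda>w. F w - K w)" using F by auto
  show "(\<lambda>w. Fs n w - Ks n w) \<in> chaos M X n" for n using F by (intro chaos_diff)
  show "(\<lambda>k. L2norm M (\<lambda>w. (\<Sum>n<k. Fs n w - Ks n w) - (F w - K w))) \<longlonglongrightarrow> 0"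
  proof (rule Lim_null_comparison)
    show "(\<lambda>k. L2norm M (\<lambda>w. (\<Sum>n<k. Fs n w) - F w) + L2norm M (\<lambda>w. (\<Sum>n<k. Ks n w) - K w)) \<longlonglongrightarrow> 0"
      using tendsto_add[OF F(5,6)] by simp
    show "\<forall>\<^sub>F k in sequentially. norm (L2norm M (\<lambda>w. (\<Sum>n<k. Fs n w - Ks n w) - (F w - K w)))
      \<le> L2norm M (\<lambda>w. (\<Sum>n<k. Fs n w) - F w) + L2norm M (\<lambda>w. (\<Sum>n<k. Ks n w) - K w)"
    proof (intro always_eventually allI)
      fix k
      have s: "square_integrable M (\<lambda>w. (\<Sum>n<k. Fs n w) - F w)" "square_integrable M (\<lambda>w. (\<Sum>n<k. Ks n w) - K w)"
        using F chaos_square_integrable by (auto intro!: square_integrable_diff square_integrable_sum)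
      have "L2norm M (\<lambda>w. ((\<Sum>n<k. Fs n w) - F w) + -1 * ((\<Sum>n<k. Ks n w) - K w))
        \<le> L2norm M (\<lambda>w. (\<Sum>n<k. Fs n w) - F w) + L2norm M (\<lambda>w. -1 * ((\<Sum>n<k. Ks n w) - K w))"
        by (intro L2norm_triangle square_integrable_cmult s)
      then show "norm (L2norm M (\<lambda>w. (\<Sum>n<k. Fs n w - Ks n w) - (F w - K w)))
        \<le> L2norm M (\<lambda>w. (\<Sum>n<k. Fs n w) - F w) + L2norm M (\<lambda>w. (\<Sum>n<k. Ks n w) - K w)"
        by (subst (asm) L2norm_cmult) (simp add: sum_subtractf algebra_simps)
    qed
  qed
qed

lemma chaos_expansion_partial_le:
  assumes "chaos_expansion M X F Fs"
  shows "L2norm M (\<lambda>w. \<Sum>n<k. Fs n w) \<le> L2norm M F"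
proof -
  have "(\<Sum>n<k. \<integral>w. (Fs n w)\<^sup>2 \<partial>M) \<le> (\<integral>w. (F w)\<^sup>2 \<partial>M)"
    unfolding sums_unique[OF chaos_parseval[OF assms]]
    by (intro sum_le_suminf) (use chaos_parseval[OF assms] in \<open>auto simp: sums_iff\<close>)
  then show ?thesis using assms unfolding L2norm_def
    by (subst chaos_sum_square) (auto simp: chaos_expansion_iff)
qed

text \<open>Passing to a component of the expansion is a contraction, being an orthogonal projection.
  This gives at once uniqueness of expansions and continuity of the components.\<close>

lemma chaos_component_le:
  assumes "chaos_expansion M X F Fs" "chaos_expansion M X K Ks"
  shows "L2norm M (\<lambda>w. Fs n w - Ks n w) \<le> L2norm M (\<lambda>w. F w - K w)"
proof -
  note p = chaos_parseval[OF chaos_expansion_diff[OF assms]]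
  have "(\<Sum>i\<in>{n}. \<integral>w. (Fs i w - Ks i w)\<^sup>2 \<partial>M) \<le> (\<integral>w. (F w - K w)\<^sup>2 \<partial>M)"
    unfolding sums_unique[OF p] by (intro sum_le_suminf) (use p in \<open>auto simp: sums_iff\<close>)
  then show ?thesis by (simp add: L2norm_def)
qed

lemma chaos_component_tendsto:
  assumes "\<And>j. chaos_expansion M X (f j) (Fs j)" "chaos_expansion M X L Ls"
    and "(\<lambda>j. L2norm M (\<lambda>w. f j w - L w)) \<longlonglongrightarrow> 0"
  shows "(\<lambda>j. \<integral>w. (Fs j n w)\<^sup>2 \<partial>M) \<longlonglongrightarrow> (\<integral>w. (Ls n w)\<^sup>2 \<partial>M)"
proof -
  have "(\<lambda>j. L2norm M (\<lambda>w. Fs j n w - Ls n w)) \<longlonglongrightarrow> 0"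
    by (rule Lim_null_comparison[OF _ assms(3)]) (use chaos_component_le[OF assms(1,2)] in auto)
  then have "(\<lambda>j. L2norm M (Fs j n)) \<longlonglongrightarrow> L2norm M (Ls n)"
    using assms(1,2)
    by (intro L2norm_tendsto) (auto simp: chaos_expansion_iff intro: chaos_square_integrable[of _ n])
  then have "(\<lambda>j. (L2norm M (Fs j n))\<^sup>2) \<longlonglongrightarrow> (L2norm M (Ls n))\<^sup>2" by (intro tendsto_intros)
  then show ?thesis by (simp add: L2norm_sq)
qed

text \<open>Contractivity makes the components of each order a Cauchy sequence.  Their limits expand \<open>L\<close>,
  because the partial sums of an expansion are bounded by its total norm, so that a late member of the sequence
  approximates all partial sums simultaneously.\<close>

lemma chaos_expansion_limit:
  assumes exp: "\<And>j. chaos_expansion M X (f j) (Fs j)" and L: "square_integrable M L"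
    and lim: "(\<lambda>j. L2norm M (\<lambda>w. f j w - L w)) \<longlonglongrightarrow> 0"
  obtains Ls where "chaos_expansion M X L Ls"
proof -
  have sf: "square_integrable M (f j)" and Fs: "Fs j n \<in> chaos M X n" for j n
    using exp by (auto simp: chaos_expansion_iff)
  have sFs: "square_integrable M (Fs j n)" for j n using Fs chaos_square_integrable by blast
  have cauchy: "\<exists>N. \<forall>m\<ge>N. \<forall>k\<ge>N. L2norm M (\<lambda>w. f m w - f k w) < e" if e: "e > 0" for e
  proof -
    obtain N where N: "\<And>j. j \<ge> N \<Longrightarrow> L2norm M (\<lambda>w. f j w - L w) < e/2"
      using LIMSEQ_zero_less[OF lim half_gt_zero[OF e]] by blast
    have "L2norm M (\<lambda>w. f m w - f k w) < e" if "m \<ge> N" "k \<ge> N" for m k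
      using L2norm_triangle_diff[OF sf L sf, of m k] N[OF that(1)] N[OF that(2)]
        L2norm_commute[of M L "f k"] by linarith
    then show ?thesis by blast
  qed
  have "\<exists>g. square_integrable M g \<and> (\<lambda>j. L2norm M (\<lambda>w. Fs j n w - g w)) \<longlonglongrightarrow> 0" for n
  proof -
    have "L2norm M (\<lambda>w. Fs m n w - Fs k n w) \<le> L2norm M (\<lambda>w. f m w - f k w)" for m k
      by (rule chaos_component_le[OF exp exp])
    from order.strict_trans1[OF this]
    have "\<exists>N. \<forall>m\<ge>N. \<forall>k\<ge>N. L2norm M (\<lambda>w. Fs m n w - Fs k n w) < e" if "e > 0" for e
      using cauchy[OF that] by blast
    from L2_complete[OF sFs this] show ?thesis by blast
  qed
  then have "\<forall>n. \<exists>g. square_integrable M g \<and> (\<lambda>j. L2norm M (\<lambda>w. Fs j n w - g w)) \<longlonglongrightarrow> 0"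
    by blast
  from choice[OF this] obtain Ls where Ls: "\<And>n. square_integrable M (Ls n)"
    "\<And>n. (\<lambda>j. L2norm M (\<lambda>w. Fs j n w - Ls n w)) \<longlonglongrightarrow> 0" by blast
  have ch: "Ls n \<in> chaos M X n" for n
    using chaos_limit[OF Fs Ls(1) Ls(2)] .
  have sS: "square_integrable M (\<lambda>w. \<Sum>n<k. Ls n w)" "square_integrable M (\<lambda>w. \<Sum>n<k. Fs j n w)" for j k
    using Ls(1) sFs by auto
  have conv: "(\<lambda>i. L2norm M (\<lambda>w. (\<Sum>n<k. Fs i n w) - (\<Sum>n<k. Ls n w))) \<longlonglongrightarrow> 0" for k
  proof (rule Lim_null_comparison)
    show "(\<lambda>i. \<Sum>n<k. L2norm M (\<lambda>w. Fs i n w - Ls n w)) \<longlonglongrightarrow> 0"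
      using tendsto_sum[of "{..<k}", OF Ls(2)] by simp
    show "\<forall>\<^sub>F i in sequentially. norm (L2norm M (\<lambda>w. (\<Sum>n<k. Fs i n w) - (\<Sum>n<k. Ls n w)))
       \<le> (\<Sum>n<k. L2norm M (\<lambda>w. Fs i n w - Ls n w))"
      unfolding sum_subtractf[symmetric] using L2norm_sum_le[of "{..<k}" M] Ls(1) sFs by auto
  qed
  have "(\<lambda>k. L2norm M (\<lambda>w. (\<Sum>n<k. Ls n w) - L w)) \<longlonglongrightarrow> 0"
  proof (rule LIMSEQ_I)
    fix e :: real assume "e > 0"
    then have e4: "e / 4 > 0" by simp
    obtain N where N: "\<And>m k. m \<ge> N \<Longrightarrow> k \<ge> N \<Longrightarrow> L2norm M (\<lambda>w. f m w - f k w) < e/4"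
      using cauchy[OF e4] by blast
    obtain N' where N': "\<And>j. j \<ge> N' \<Longrightarrow> L2norm M (\<lambda>w. f j w - L w) < e/4"
      using LIMSEQ_zero_less[OF lim e4] by blast
    define j where "j = max N N'"
    have "(\<lambda>k. L2norm M (\<lambda>w. (\<Sum>n<k. Fs j n w) - f j w)) \<longlonglongrightarrow> 0"
      using exp by (auto simp: chaos_expansion_iff)
    then obtain K where K: "\<And>k. k \<ge> K \<Longrightarrow> L2norm M (\<lambda>w. (\<Sum>n<k. Fs j n w) - f j w) < e/4"
      using LIMSEQ_zero_less[OF _ e4] by blast
    have part: "L2norm M (\<lambda>w. (\<Sum>n<k. Ls n w) - (\<Sum>n<k. Fs j n w)) \<le> e/4" for k
    proof -
      have "L2norm M (\<lambda>w. (\<Sum>n<k. Ls n w) - (\<Sum>n<k. Fs j n w)) - e/4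
         \<le> L2norm M (\<lambda>w. (\<Sum>n<k. Fs i n w) - (\<Sum>n<k. Ls n w))" if "i \<ge> N" for i
      proof -
        have "L2norm M (\<lambda>w. (\<Sum>n<k. Fs i n w) - (\<Sum>n<k. Fs j n w)) \<le> L2norm M (\<lambda>w. f i w - f j w)"
          using chaos_expansion_partial_le[OF chaos_expansion_diff[OF exp exp], of i j k]
          by (simp add: sum_subtractf)
        also have "\<dots> \<le> e/4" using N[OF that, of j] by (simp add: j_def less_imp_le)
        finally show ?thesis
          using L2norm_triangle_diff[OF sS(1) sS(2) sS(2), of k j k i k] L2norm_commute[of M "\<lambda>w. (\<Sum>n<k. Fs i n w)" "\<lambda>w. (\<Sum>n<k. Ls n w)"]
          by linarith
      qed
      then have "L2norm M (\<lambda>w. (\<Sum>n<k. Ls n w) - (\<Sum>n<k. Fs j n w)) - e/4 \<le> 0"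
        using conv[of k] by (intro LIMSEQ_le_const) auto
      then show ?thesis by simp
    qed
    have "L2norm M (\<lambda>w. (\<Sum>n<k. Ls n w) - L w) < e" if "k \<ge> K" for k
    proof -
      have "L2norm M (\<lambda>w. (\<Sum>n<k. Ls n w) - L w)
         \<le> L2norm M (\<lambda>w. (\<Sum>n<k. Ls n w) - (\<Sum>n<k. Fs j n w)) + L2norm M (\<lambda>w. (\<Sum>n<k. Fs j n w) - L w)"
        by (intro L2norm_triangle_diff sS L)
      moreover have "L2norm M (\<lambda>w. (\<Sum>n<k. Fs j n w) - L w)
         \<le> L2norm M (\<lambda>w. (\<Sum>n<k. Fs j n w) - f j w) + L2norm M (\<lambda>w. f j w - L w)"
        by (intro L2norm_triangle_diff sS L sf)
      ultimately show ?thesis using part[of k] K[OF that] N'[of j] \<open>e > 0\<close> by (simp add: j_def)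
    qed
    then show "\<exists>no. \<forall>k\<ge>no. norm (L2norm M (\<lambda>w. (\<Sum>n<k. Ls n w) - L w) - 0) < e"
      by (intro exI[of _ K]) simp
  qed
  with that ch L show ?thesis by (auto simp: chaos_expansion_iff)
qed

text \<open>The sum defining \<open>D\<^sub>1\<close> is lower semicontinuous: each finite part of it converges along the
  sequence.\<close>

lemma D1_limitI:
  assumes exp: "\<And>j. chaos_expansion M X (f j) (Fs j)" and L: "square_integrable M L"
    and lim: "(\<lambda>j. L2norm M (\<lambda>w. f j w - L w)) \<longlonglongrightarrow> 0"
    and bound: "\<And>N j. (\<Sum>n<N. real n * (\<integral>w. (Fs j n w)\<^sup>2 \<partial>M)) \<le> C"
  shows "L \<in> D1 M X"
proof -
  obtain Ls where Ls: "chaos_expansion M X L Ls" using chaos_expansion_limit[OF exp L lim] .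
  have "(\<Sum>n<N. real n * (\<integral>w. (Ls n w)\<^sup>2 \<partial>M)) \<le> C" for N
  proof (rule LIMSEQ_le_const2)
    show "(\<lambda>j. \<Sum>n<N. real n * (\<integral>w. (Fs j n w)\<^sup>2 \<partial>M)) \<longlonglongrightarrow> (\<Sum>n<N. real n * (\<integral>w. (Ls n w)\<^sup>2 \<partial>M))"
      by (intro tendsto_intros chaos_component_tendsto[OF exp Ls lim])
  qed (use bound in auto)
  then have "summable (\<lambda>n. real n * (\<integral>w. (Ls n w)\<^sup>2 \<partial>M))"
    by (intro summableI_nonneg_bounded) auto
  with Ls show ?thesis by (auto simp: D1_def)
qed

lemma D1_limitD:
  assumes exp: "\<And>j. chaos_expansion M X (f j) (Fs j)" and L: "L \<in> D1 M X"
    and lim: "(\<lambda>j. L2norm M (\<lambda>w. f j w - L w)) \<longlonglongrightarrow> 0"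
  obtains e where "\<And>n. (\<lambda>j. \<integral>w. (Fs j n w)\<^sup>2 \<partial>M) \<longlonglongrightarrow> e n" "summable (\<lambda>n. real n * e n)"
proof -
  obtain Ls where Ls: "chaos_expansion M X L Ls" "summable (\<lambda>n. real n * (\<integral>w. (Ls n w)\<^sup>2 \<partial>M))"
    using L unfolding D1_def by blast
  then show ?thesis using that[OF chaos_component_tendsto[OF exp Ls(1) lim]] by simp
qed

end

section \<open>Superpositions of square-integrable random variables\<close>

lemma (in pair_sigma_finite) product_integral:
  fixes f g :: "_ \<Rightarrow> real"
  assumes f: "integrable M1 f" and g: "integrable M2 g"
  shows "integrable (M1 \<Otimes>\<^sub>M M2) (\<lambda>(k, l). f k * g l)"
    and "(\<integral>x. (case x of (k, l) \<Rightarrow> f k * g l) \<partial>(M1 \<Otimes>\<^sub>M M2)) = (\<integral>k. f k \<partial>M1) * (\<integral>l. g l \<partial>M2)"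
proof -
  have [measurable]: "f \<in> borel_measurable M1" "g \<in> borel_measurable M2" using f g by auto
  show i: "integrable (M1 \<Otimes>\<^sub>M M2) (\<lambda>(k, l). f k * g l)"
    using f g by (intro Fubini_integrable) (auto simp: abs_mult)
  show "(\<integral>x. (case x of (k, l) \<Rightarrow> f k * g l) \<partial>(M1 \<Otimes>\<^sub>M M2)) = (\<integral>k. f k \<partial>M1) * (\<integral>l. g l \<partial>M2)"
    using integral_fst[OF i] by simp
qed

text \<open>Throughout, \<open>e k\<close> is a family of random variables with \<open>E[(e k)\<^sup>2] \<le> B k\<close>, superposed with an integrable
  density \<open>a\<close>.  The bound \<open>|E[e k e l]| \<le> (B k + B l)/2\<close> separates the two parameters, so that integrability of
  \<open>|a| B\<close> in a single parameter suffices for Fubini's theorem on pairs.\<close>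

context prob_space
begin

lemma superposition_pair_integrable:
  fixes e :: "'k::euclidean_space \<Rightarrow> 'a \<Rightarrow> real"
  assumes e [measurable]: "(\<lambda>(w, k). e k w) \<in> borel_measurable (M \<Otimes>\<^sub>M lborel)"
    and a: "integrable lborel a" and aB: "integrable lborel (\<lambda>k. \<bar>a k\<bar> * B k)"
    and sq: "\<And>k. square_integrable M (e k)" and B: "\<And>k. (\<integral>w. (e k w)\<^sup>2 \<partial>M) \<le> B k"
  shows "integrable (M \<Otimes>\<^sub>M (lborel \<Otimes>\<^sub>M lborel)) (\<lambda>(w, k, l). (a k * e k w) * (a l * e l w))"
proof (rule integrableI_bounded)
  have [measurable]: "a \<in> borel_measurable lborel" using a by measurable
  have B0: "0 \<le> B k" for k using B[of k] by (rule order.trans[rotated]) simp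
  interpret P: pair_sigma_finite M "(lborel :: 'k measure) \<Otimes>\<^sub>M (lborel :: 'k measure)" ..
  show meas [measurable]: "(\<lambda>(w, k, l). (a k * e k w) * (a l * e l w)) \<in> borel_measurable (M \<Otimes>\<^sub>M (lborel \<Otimes>\<^sub>M lborel))"
    by measurable
  have [measurable]: "e k \<in> borel_measurable M" for k using sq by measurable
  have ee: "(\<integral>\<^sup>+w. ennreal \<bar>e k w * e l w\<bar> \<partial>M) \<le> ennreal (B k + B l)" for k l
  proof -
    have "\<bar>x * y\<bar> \<le> x\<^sup>2 + y\<^sup>2" for x y :: real
    proof -
      have "2 * (\<bar>x\<bar> * \<bar>y\<bar>) \<le> x\<^sup>2 + y\<^sup>2"
        using sum_squares_bound[of "\<bar>x\<bar>" "\<bar>y\<bar>"] by simp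
      moreover have "0 \<le> \<bar>x\<bar> * \<bar>y\<bar>" by simp
      ultimately show ?thesis unfolding abs_mult by linarith
    qed
    then have "(\<integral>\<^sup>+w. ennreal \<bar>e k w * e l w\<bar> \<partial>M) \<le> (\<integral>\<^sup>+w. ennreal ((e k w)\<^sup>2 + (e l w)\<^sup>2) \<partial>M)"
      by (intro nn_integral_mono ennreal_leI)
    also have "\<dots> = ennreal (\<integral>w. (e k w)\<^sup>2 + (e l w)\<^sup>2 \<partial>M)"
      using sq by (intro nn_integral_eq_integral) (auto simp: square_integrable_def)
    also have "\<dots> \<le> ennreal (B k + B l)"
      using sq B[of k] B[of l] by (intro ennreal_leI) (auto simp: square_integrable_def)
    finally show ?thesis .
  qed
  have "(\<integral>\<^sup>+x. ennreal (norm (case x of (w, k, l) \<Rightarrow> (a k * e k w) * (a l * e l w))) \<partial>(M \<Otimes>\<^sub>M (lborel \<Otimes>\<^sub>M lborel)))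
     = (\<integral>\<^sup>+kl. \<integral>\<^sup>+w. ennreal (norm (case (w, kl) of (w, k, l) \<Rightarrow> (a k * e k w) * (a l * e l w))) \<partial>M \<partial>(lborel \<Otimes>\<^sub>M lborel))"
    by (rule P.nn_integral_snd[symmetric]) measurable
  also have "\<dots> = (\<integral>\<^sup>+k. \<integral>\<^sup>+l. \<integral>\<^sup>+w. ennreal \<bar>(a k * e k w) * (a l * e l w)\<bar> \<partial>M \<partial>lborel \<partial>lborel)"
    by (subst lborel.nn_integral_fst[symmetric]) simp_all
  also have "\<dots> = (\<integral>\<^sup>+k. \<integral>\<^sup>+l. ennreal (\<bar>a k\<bar> * \<bar>a l\<bar>) * \<integral>\<^sup>+w. ennreal \<bar>e k w * e l w\<bar> \<partial>M \<partial>lborel \<partial>lborel)"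
    by (subst nn_integral_cmult[symmetric])
      (auto simp: abs_mult ennreal_mult[symmetric] mult_ac intro!: nn_integral_cong)
  also have "\<dots> \<le> (\<integral>\<^sup>+k. \<integral>\<^sup>+l. ennreal (\<bar>a k\<bar> * \<bar>a l\<bar>) * ennreal (B k + B l) \<partial>lborel \<partial>lborel)"
    by (intro nn_integral_mono mult_left_mono ee) auto
  also have "\<dots> = (\<integral>\<^sup>+k. \<integral>\<^sup>+l. ennreal \<bar>a k * B k * a l\<bar> + ennreal \<bar>a k * (a l * B l)\<bar> \<partial>lborel \<partial>lborel)"
    using B0 by (intro nn_integral_cong)
      (simp add: abs_mult abs_of_nonneg flip: ennreal_mult ennreal_plus, simp add: algebra_simps)
  also have "\<dots> = (\<integral>\<^sup>+k. \<integral>\<^sup>+l. ennreal (norm (case (k, l) of (k, l) \<Rightarrow>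
      \<bar>(\<bar>a k\<bar> * B k) * a l\<bar> + \<bar>a k * (\<bar>a l\<bar> * B l)\<bar>)) \<partial>lborel \<partial>lborel)"
    by (simp add: abs_mult flip: ennreal_plus)
  also have "\<dots> = (\<integral>\<^sup>+x. ennreal (norm (case x of (k, l) \<Rightarrow>
      \<bar>(\<bar>a k\<bar> * B k) * a l\<bar> + \<bar>a k * (\<bar>a l\<bar> * B l)\<bar>)) \<partial>(lborel \<Otimes>\<^sub>M lborel))"
    by (rule lborel.nn_integral_fst) (use aB in measurable)
  also have "\<dots> < \<infinity>"
  proof -
    have "integrable (lborel \<Otimes>\<^sub>M lborel) (\<lambda>x. \<bar>case x of (k, l) \<Rightarrow> (\<bar>a k\<bar> * B k) * a l\<bar> + \<bar>case x of (k, l) \<Rightarrow> a k * (\<bar>a l\<bar> * B l)\<bar>)"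
      by (intro Bochner_Integration.integrable_add integrable_abs lborel_pair.product_integral a aB)
    then have "integrable (lborel \<Otimes>\<^sub>M lborel) (\<lambda>(k, l). \<bar>(\<bar>a k\<bar> * B k) * a l\<bar> + \<bar>a k * (\<bar>a l\<bar> * B l)\<bar>)"
      by (simp add: case_prod_unfold)
    then show ?thesis unfolding integrable_iff_bounded by blast
  qed
  finally show "(\<integral>\<^sup>+x. ennreal (norm (case x of (w, k, l) \<Rightarrow> (a k * e k w) * (a l * e l w))) \<partial>(M \<Otimes>\<^sub>M (lborel \<Otimes>\<^sub>M lborel))) < \<infinity>" .
qed

lemma
  fixes e :: "'k::euclidean_space \<Rightarrow> 'a \<Rightarrow> real"
  assumes e [measurable]: "(\<lambda>(w, k). e k w) \<in> borel_measurable (M \<Otimes>\<^sub>M lborel)"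
    and a: "integrable lborel a" and aB: "integrable lborel (\<lambda>k. \<bar>a k\<bar> * B k)"
    and sq: "\<And>k. square_integrable M (e k)" and B: "\<And>k. (\<integral>w. (e k w)\<^sup>2 \<partial>M) \<le> B k"
  shows superposition_AE_integrable: "AE w in M. integrable lborel (\<lambda>k. a k * e k w)"
    and superposition_square_integrable: "square_integrable M (\<lambda>w. \<integral>k. a k * e k w \<partial>lborel)"
    and superposition_second_moment_integrable:
      "integrable (lborel \<Otimes>\<^sub>M lborel) (\<lambda>(k, l). a k * a l * (\<integral>w. e k w * e l w \<partial>M))"
    and superposition_second_moment:
      "(\<integral>w. (\<integral>k. a k * e k w \<partial>lborel)\<^sup>2 \<partial>M)
        = (\<integral>(k, l). a k * a l * (\<integral>w. e k w * e l w \<partial>M) \<partial>(lborel \<Otimes>\<^sub>M lborel))"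
    and superposition_bound:
      "(\<integral>w. (\<integral>k. a k * e k w \<partial>lborel)\<^sup>2 \<partial>M) \<le> (\<integral>k. \<bar>a k\<bar> \<partial>lborel) * (\<integral>k. \<bar>a k\<bar> * B k \<partial>lborel)"
proof -
  have [measurable]: "a \<in> borel_measurable lborel" using a by measurable
  have [measurable]: "e k \<in> borel_measurable M" for k using sq by measurable
  interpret P: pair_sigma_finite M "(lborel :: 'k measure) \<Otimes>\<^sub>M (lborel :: 'k measure)" ..
  interpret P1: pair_sigma_finite M "lborel :: 'k measure" ..
  have B0: "0 \<le> B k" for k using B[of k] by (rule order.trans[rotated]) simp
  have eL: "\<bar>\<integral>w. e k w * e l w \<partial>M\<bar> \<le> (B k + B l) / 2" for k l
  proof -
    have "\<bar>\<integral>w. e k w * e l w \<partial>M\<bar> \<le> L2norm M (e k) * L2norm M (e l)"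
      by (rule abs_integral_mult_le_L2norm[OF sq sq])
    also have "\<dots> \<le> ((L2norm M (e k))\<^sup>2 + (L2norm M (e l))\<^sup>2) / 2"
      using sum_squares_bound[of "L2norm M (e k)" "L2norm M (e l)"] by simp
    also have "\<dots> \<le> (B k + B l) / 2" using B[of k] B[of l] by (simp add: L2norm_sq)
    finally show ?thesis .
  qed
  note pi = superposition_pair_integrable[OF assms]
  have "(\<integral>\<^sup>+x. ennreal (norm (case x of (w, k) \<Rightarrow> a k * e k w)) \<partial>(M \<Otimes>\<^sub>M lborel))
     = (\<integral>\<^sup>+k. \<integral>\<^sup>+w. ennreal \<bar>a k * e k w\<bar> \<partial>M \<partial>lborel)"
    by (subst P1.nn_integral_snd[symmetric]) simp_all
  also have "\<dots> = (\<integral>\<^sup>+k. ennreal \<bar>a k\<bar> * \<integral>\<^sup>+w. ennreal \<bar>e k w\<bar> \<partial>M \<partial>lborel)"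
    by (subst nn_integral_cmult[symmetric]) (auto simp: abs_mult ennreal_mult)
  also have "\<dots> \<le> (\<integral>\<^sup>+k. ennreal \<bar>a k\<bar> * ennreal (1 + B k) \<partial>lborel)"
  proof (intro nn_integral_mono mult_left_mono)
    fix k
    have "\<bar>x\<bar> \<le> 1 + x\<^sup>2" for x :: real
      using sum_squares_bound[of "\<bar>x\<bar>" 1] by simp
    then have "(\<integral>\<^sup>+w. ennreal \<bar>e k w\<bar> \<partial>M) \<le> (\<integral>\<^sup>+w. ennreal (1 + (e k w)\<^sup>2) \<partial>M)"
      by (intro nn_integral_mono ennreal_leI)
    also have "\<dots> = ennreal (\<integral>w. 1 + (e k w)\<^sup>2 \<partial>M)"
      using sq by (intro nn_integral_eq_integral) (auto simp: square_integrable_def)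
    also have "\<dots> \<le> ennreal (1 + B k)"
      using sq B[of k] by (intro ennreal_leI) (auto simp: square_integrable_def prob_space)
    finally show "(\<integral>\<^sup>+w. ennreal \<bar>e k w\<bar> \<partial>M) \<le> ennreal (1 + B k)" .
  qed auto
  also have "\<dots> = (\<integral>\<^sup>+k. ennreal (norm (\<bar>a k\<bar> + \<bar>a k\<bar> * B k)) \<partial>lborel)"
    using B0 by (intro nn_integral_cong) (simp add: algebra_simps flip: ennreal_mult)
  also have "\<dots> < \<infinity>"
    using Bochner_Integration.integrable_add[OF integrable_abs[OF a] aB] unfolding integrable_iff_bounded by blast
  finally have "integrable (M \<Otimes>\<^sub>M lborel) (\<lambda>(w, k). a k * e k w)"
    by (intro integrableI_bounded) measurable
  from P1.AE_integrable_fst[OF this]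
  show ae: "AE w in M. integrable lborel (\<lambda>k. a k * e k w)" .
  have ae2: "AE w in M. (\<integral>k. a k * e k w \<partial>lborel)\<^sup>2
      = (\<integral>kl. (case kl of (k, l) \<Rightarrow> (a k * e k w) * (a l * e l w)) \<partial>(lborel \<Otimes>\<^sub>M lborel))"
    using ae by eventually_elim (simp add: lborel_pair.product_integral power2_eq_square)
  have Zm [measurable]: "(\<lambda>w. \<integral>k. a k * e k w \<partial>lborel) \<in> borel_measurable M"
    by measurable
  have pi': "integrable (M \<Otimes>\<^sub>M (lborel \<Otimes>\<^sub>M lborel)) (case_prod (\<lambda>w kl. case kl of (k, l) \<Rightarrow> (a k * e k w) * (a l * e l w)))"
    using pi by (simp add: case_prod_unfold)
  have "integrable M (\<lambda>w. (\<integral>k. a k * e k w \<partial>lborel)\<^sup>2) \<longleftrightarrow>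
     integrable M (\<lambda>w. \<integral>kl. (case kl of (k, l) \<Rightarrow> (a k * e k w) * (a l * e l w)) \<partial>(lborel \<Otimes>\<^sub>M lborel))"
    by (rule integrable_cong_AE[OF _ _ ae2]) measurable
  then show "square_integrable M (\<lambda>w. \<integral>k. a k * e k w \<partial>lborel)"
    using P.integrable_fst[OF pi'] by (simp add: square_integrable_def)
  have in_w: "(\<integral>w. (case kl of (k, l) \<Rightarrow> (a k * e k w) * (a l * e l w)) \<partial>M)
      = (case kl of (k, l) \<Rightarrow> a k * a l * (\<integral>w. e k w * e l w \<partial>M))" for kl
  proof (cases kl)
    case (Pair k l)
    have "(\<integral>w. (a k * e k w) * (a l * e l w) \<partial>M) = (\<integral>w. (a k * a l) * (e k w * e l w) \<partial>M)"
      by (simp add: mult_ac)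
    then show ?thesis by (simp add: Pair)
  qed
  show int: "integrable (lborel \<Otimes>\<^sub>M lborel) (\<lambda>(k, l). a k * a l * (\<integral>w. e k w * e l w \<partial>M))"
    using P.integrable_snd[OF pi'] unfolding in_w .
  have "(\<integral>w. (\<integral>k. a k * e k w \<partial>lborel)\<^sup>2 \<partial>M)
     = (\<integral>w. \<integral>kl. (case kl of (k, l) \<Rightarrow> (a k * e k w) * (a l * e l w)) \<partial>(lborel \<Otimes>\<^sub>M lborel) \<partial>M)"
    by (rule integral_cong_AE[OF _ _ ae2]) measurable
  also have "\<dots> = (\<integral>kl. \<integral>w. (case kl of (k, l) \<Rightarrow> (a k * e k w) * (a l * e l w)) \<partial>M \<partial>(lborel \<Otimes>\<^sub>M lborel))"
    by (rule P.Fubini_integral[OF pi', symmetric])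
  finally show formula: "(\<integral>w. (\<integral>k. a k * e k w \<partial>lborel)\<^sup>2 \<partial>M)
        = (\<integral>(k, l). a k * a l * (\<integral>w. e k w * e l w \<partial>M) \<partial>(lborel \<Otimes>\<^sub>M lborel))"
    unfolding in_w .
  let ?g = "\<lambda>x. ((case x of (k, l) \<Rightarrow> (\<bar>a k\<bar> * B k) * \<bar>a l\<bar>) + (case x of (k, l) \<Rightarrow> \<bar>a k\<bar> * (\<bar>a l\<bar> * B l))) / 2"
  note pr = lborel_pair.product_integral[OF aB integrable_abs[OF a]] lborel_pair.product_integral[OF integrable_abs[OF a] aB]
  have "(\<integral>(k, l). a k * a l * (\<integral>w. e k w * e l w \<partial>M) \<partial>(lborel \<Otimes>\<^sub>M lborel)) \<le> integral\<^sup>L (lborel \<Otimes>\<^sub>M lborel) ?g"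
  proof (rule integral_mono[OF int])
    show "integrable (lborel \<Otimes>\<^sub>M lborel) ?g"
      by (intro Bochner_Integration.integrable_add integrable_divide pr)
    fix x :: "'k \<times> 'k"
    obtain k l where x: "x = (k, l)" by (cases x)
    have "a k * a l * (\<integral>w. e k w * e l w \<partial>M) \<le> \<bar>a k\<bar> * \<bar>a l\<bar> * \<bar>\<integral>w. e k w * e l w \<partial>M\<bar>"
      by (metis abs_ge_self abs_mult)
    also have "\<dots> \<le> \<bar>a k\<bar> * \<bar>a l\<bar> * ((B k + B l) / 2)"
      by (intro mult_left_mono eL) auto
    finally show "(case x of (k, l) \<Rightarrow> a k * a l * (\<integral>w. e k w * e l w \<partial>M)) \<le> ?g x"
      by (simp add: x algebra_simps add_divide_distrib)
  qed
  also have "\<dots> = (\<integral>k. \<bar>a k\<bar> \<partial>lborel) * (\<integral>k. \<bar>a k\<bar> * B k \<partial>lborel)"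
    using pr by simp
  finally show "(\<integral>w. (\<integral>k. a k * e k w \<partial>lborel)\<^sup>2 \<partial>M) \<le> (\<integral>k. \<bar>a k\<bar> \<partial>lborel) * (\<integral>k. \<bar>a k\<bar> * B k \<partial>lborel)"
    unfolding formula .
qed

end

lemma (in prob_space) superposition_tendsto:
  fixes D :: "nat \<Rightarrow> 'k::euclidean_space \<Rightarrow> 'a \<Rightarrow> real"
  assumes D [measurable]: "\<And>m. (\<lambda>(w, k). D m k w) \<in> borel_measurable (M \<Otimes>\<^sub>M lborel)"
    and a: "integrable lborel a" and aB: "integrable lborel (\<lambda>k. \<bar>a k\<bar> * B k)"
    and sq: "\<And>m k. square_integrable M (D m k)" and B: "\<And>m k. (\<integral>w. (D m k w)\<^sup>2 \<partial>M) \<le> B k"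
    and lim: "\<And>k. (\<lambda>m. \<integral>w. (D m k w)\<^sup>2 \<partial>M) \<longlonglongrightarrow> 0"
  shows "(\<lambda>m. L2norm M (\<lambda>w. \<integral>k. a k * D m k w \<partial>lborel)) \<longlonglongrightarrow> 0"
proof -
  have [measurable]: "a \<in> borel_measurable lborel" using a by measurable
  interpret P: pair_sigma_finite M "lborel :: 'k measure" ..
  have [measurable]: "(\<lambda>(k, w). (D m k w)\<^sup>2) \<in> borel_measurable (lborel \<Otimes>\<^sub>M M)" for m
    by (subst measurable_pair_swap_iff) measurable
  \<comment> \<open>The mean-square bound for superpositions, applied with the second moments themselves as bounds,
    leaves an integral to which dominated convergence applies.\<close>
  let ?b = "\<lambda>m k. \<integral>w. (D m k w)\<^sup>2 \<partial>M"
  have bm [measurable]: "?b m \<in> borel_measurable lborel" for m by measurable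
  have bi: "integrable lborel (\<lambda>k. \<bar>a k\<bar> * ?b m k)" for m
    by (rule Bochner_Integration.integrable_bound[OF aB])
      (use B in \<open>auto simp: abs_mult intro!: mult_left_mono order.trans[OF B abs_ge_self]\<close>)
  have "(\<lambda>m. \<integral>k. \<bar>a k\<bar> * ?b m k \<partial>lborel) \<longlonglongrightarrow> (\<integral>k. 0 \<partial>(lborel :: 'k measure))"
  proof (rule integral_dominated_convergence[OF _ _ aB])
    show "AE k in lborel. (\<lambda>m. \<bar>a k\<bar> * ?b m k) \<longlonglongrightarrow> 0"
      using tendsto_mult_right_zero[OF lim] by auto
    show "AE k in lborel. norm (\<bar>a k\<bar> * ?b m k) \<le> \<bar>a k\<bar> * B k" for m
      using B by (auto simp: abs_mult intro!: mult_left_mono)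
  qed (use bm in measurable)
  then have z: "(\<lambda>m. sqrt ((\<integral>k. \<bar>a k\<bar> \<partial>lborel) * (\<integral>k. \<bar>a k\<bar> * ?b m k \<partial>lborel))) \<longlonglongrightarrow> sqrt ((\<integral>k. \<bar>a k\<bar> \<partial>lborel) * 0)"
    by (intro tendsto_intros) simp
  show ?thesis
  proof (rule Lim_null_comparison)
    show "(\<lambda>m. sqrt ((\<integral>k. \<bar>a k\<bar> \<partial>lborel) * (\<integral>k. \<bar>a k\<bar> * ?b m k \<partial>lborel))) \<longlonglongrightarrow> 0" using z by simp
    show "\<forall>\<^sub>F m in sequentially. norm (L2norm M (\<lambda>w. \<integral>k. a k * D m k w \<partial>lborel))
       \<le> sqrt ((\<integral>k. \<bar>a k\<bar> \<partial>lborel) * (\<integral>k. \<bar>a k\<bar> * ?b m k \<partial>lborel))"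
      using superposition_bound[OF D a bi sq order.refl]
      by (auto simp: L2norm_def)
  qed
qed

lemma simple_approximation_identity:
  obtains F :: "nat \<Rightarrow> 'k::euclidean_space \<Rightarrow> 'k"
  where "\<And>i. simple_function lborel (F i)" "\<And>k. (\<lambda>i. F i k) \<longlonglongrightarrow> k" "\<And>i k. norm (F i k) \<le> 2 * norm k"
proof -
  have "(\<lambda>k::'k. k) \<in> borel_measurable lborel" by simp
  from borel_measurable_implies_sequence_metric[OF this, of 0] that show ?thesis
    by (auto simp: dist_norm)
qed

section \<open>Superpositions of oscillations along a Gaussian family\<close>

text \<open>The oscillations \<open>cos(Y k - b k)\<close> of a continuously parametrized family of linear forms.  The bound on
  the variances makes every moment of \<open>Y k\<close> grow at most polynomially in \<open>k\<close>.\<close>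

locale gaussian_family = field_chaos M X
  for M :: "'w measure" and X :: "real^'n \<Rightarrow> 'w \<Rightarrow> real^'d" +
  fixes Y :: "'k::euclidean_space \<Rightarrow> 'w \<Rightarrow> real" and b :: "'k \<Rightarrow> real" and R :: real
    and q :: "'k \<Rightarrow> 'k \<Rightarrow> real"
  assumes Y_linear: "\<And>k. Y k \<in> linear_forms X"
    and Y_cont: "\<And>w. w \<in> space M \<Longrightarrow> continuous_on UNIV (\<lambda>k. Y k w)"
    and q_eq: "\<And>k l. q k l = (\<integral>w. Y k w * Y l w \<partial>M)"
    and q_cont: "continuous_on UNIV (\<lambda>(k, l). q k l)"
    and q_bound: "\<And>k. q k k \<le> R * (norm k)\<^sup>2"
    and b_measurable [measurable]: "b \<in> borel_measurable borel"
begin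

lemma q_sq: "q k k = (\<integral>w. (Y k w)\<^sup>2 \<partial>M)"
  by (simp add: q_eq power2_eq_square)

lemma q_nonneg: "0 \<le> q k k"
  by (simp add: q_sq)

lemma Y_measurable [measurable]: "Y k \<in> borel_measurable M"
  using G_measurable[OF Y_linear] .

lemma q_measurable [measurable]:
  assumes [measurable]: "f \<in> borel_measurable N" "g \<in> borel_measurable N"
  shows "(\<lambda>x. q (f x) (g x)) \<in> borel_measurable N"
proof -
  have "(\<lambda>(k, l). q k l) \<in> borel_measurable borel"
    by (rule borel_measurable_continuous_onI[OF q_cont])
  from measurable_compose[OF _ this, of "\<lambda>x. (f x, g x)" N] show ?thesis by (simp add: borel_prod[symmetric])
qed

lemma Y_joint_measurable [measurable]: "(\<lambda>(w, k). Y k w) \<in> borel_measurable (M \<Otimes>\<^sub>M lborel)"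
proof -
  obtain F :: "nat \<Rightarrow> 'k \<Rightarrow> 'k" where F: "\<And>i. simple_function lborel (F i)" "\<And>k. (\<lambda>i. F i k) \<longlonglongrightarrow> k"
    "\<And>i k. norm (F i k) \<le> 2 * norm k"
    by (rule simple_approximation_identity) blast
  have fin: "finite (range (F i))" for i using simple_functionD(1)[OF F(1)] by simp
  have [measurable]: "F i \<in> borel_measurable lborel" for i by (rule borel_measurable_simple_function[OF F(1)])
  have "(\<lambda>x. Y (F i (snd x)) (fst x)) \<in> borel_measurable (M \<Otimes>\<^sub>M lborel)" for i
  proof -
    have "(\<lambda>x. \<Sum>p\<in>range (F i). indicator {p} (F i (snd x)) * Y p (fst x)) \<in> borel_measurable (M \<Otimes>\<^sub>M lborel)"
      by measurable
    moreover have "(\<Sum>p\<in>range (F i). indicator {p} (F i (snd x)) * Y p (fst x)) = Y (F i (snd x)) (fst x)" for x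
      by (subst sum.mono_neutral_right[OF fin, of "{F i (snd x)}"]) auto
    ultimately show ?thesis by simp
  qed
  then have "(\<lambda>x. Y (snd x) (fst x)) \<in> borel_measurable (M \<Otimes>\<^sub>M lborel)"
  proof (rule borel_measurable_LIMSEQ_real[rotated])
    fix x :: "'w \<times> 'k" assume "x \<in> space (M \<Otimes>\<^sub>M lborel)"
    then have "fst x \<in> space M" by (auto simp: space_pair_measure)
    from continuous_on_tendsto_compose[OF Y_cont[OF this] F(2)]
    show "(\<lambda>i. Y (F i (snd x)) (fst x)) \<longlonglongrightarrow> Y (snd x) (fst x)" by simp
  qed
  then show ?thesis by (simp add: case_prod_unfold)
qed

text \<open>Second moments of Hermite polynomials of order \<open>n\<close> grow like \<open>|k|\<close> to the power \<open>2n\<close>; to superpose all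
  orders, a weight must integrate every power.\<close>

definition fast_decay :: "('k \<Rightarrow> real) \<Rightarrow> bool" where
  "fast_decay u \<longleftrightarrow> u \<in> borel_measurable lborel \<and> (\<forall>m. integrable lborel (\<lambda>k. \<bar>u k\<bar> * (1 + norm k) ^ m))"

definition coeff :: "nat \<Rightarrow> ('k \<Rightarrow> real) \<Rightarrow> 'k \<Rightarrow> real" where
  "coeff n u k = u k * (phase_coeff n (b k) * exp (- q k k / 2))"

text \<open>The \<open>n\<close>-th term of the expansion of the cosine, integrated over the parameter; it is shown to be the
  projection of the superposition to the \<open>n\<close>-th chaos.\<close>

definition component :: "('k \<Rightarrow> real) \<Rightarrow> nat \<Rightarrow> 'w \<Rightarrow> real" where
  "component u n w = (\<integral>k. coeff n u k * hermite n (Y k w) (q k k) \<partial>lborel)"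

definition oscillation :: "('k \<Rightarrow> real) \<Rightarrow> 'w \<Rightarrow> real" where
  "oscillation u w = (\<integral>k. u k * cos (Y k w - b k) \<partial>lborel)"

lemma fast_decay_measurable: "fast_decay u \<Longrightarrow> u \<in> borel_measurable borel"
  by (simp add: fast_decay_def)

lemma coeff_measurable:
  assumes "fast_decay u"
  shows "coeff n u \<in> borel_measurable borel"
proof -
  have [measurable]: "u \<in> borel_measurable borel" using assms by (rule fast_decay_measurable)
  have "(\<lambda>k. u k * (phase_coeff n (b k) * exp (- q k k / 2))) \<in> borel_measurable borel" by measurable
  then show ?thesis by (simp add: coeff_def[abs_def])
qed

lemma abs_phase_exp_le: "\<bar>phase_coeff n (b k) * exp (- q k k / 2)\<bar> \<le> 1"
proof -
  have "\<bar>phase_coeff n (b k)\<bar> * exp (- q k k / 2) \<le> 1 * 1"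
    using abs_phase_coeff_le[of n "b k"] q_nonneg[of k] by (intro mult_mono) auto
  then show ?thesis by (simp add: abs_mult)
qed

lemma abs_coeff_le: "\<bar>coeff n u k\<bar> \<le> \<bar>u k\<bar>"
  unfolding coeff_def abs_mult[of "u k"] using mult_left_mono[OF abs_phase_exp_le, of "\<bar>u k\<bar>"] by simp

lemma fast_decay_integrable:
  assumes "fast_decay u" "f \<in> borel_measurable lborel" "\<And>k. \<bar>f k\<bar> \<le> \<bar>u k\<bar> * (C * (1 + norm k) ^ m)"
  shows "integrable lborel f"
proof (rule Bochner_Integration.integrable_bound)
  show "integrable lborel (\<lambda>k. C * (\<bar>u k\<bar> * (1 + norm k) ^ m))"
    using assms(1) by (auto simp: fast_decay_def)
  show "AE k in lborel. norm (f k) \<le> norm (C * (\<bar>u k\<bar> * (1 + norm k) ^ m))"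
    using assms(3) by (intro AE_I2) (metis abs_ge_self mult.left_commute order_trans real_norm_def)
qed (rule assms)

lemma fast_decay_imp_integrable: "fast_decay u \<Longrightarrow> integrable lborel u"
  by (rule fast_decay_integrable[where C=1 and m=0]) (auto dest: fast_decay_measurable)

lemma coeff_integrable: "fast_decay u \<Longrightarrow> integrable lborel (coeff n u)"
  by (rule fast_decay_integrable[where C=1 and m=0]) (use abs_coeff_le coeff_measurable in auto)

lemma hermite_second_moment:
  "(\<integral>w. hermite n (Y k w) (q k k) * hermite m (Y l w) (q l l) \<partial>M) = (if m = n then q k l ^ n / fact n else 0)"
  using hermite_orthogonal[OF Y_linear Y_linear, of n k m l] by (simp add: q_sq q_eq)

lemma hermite_Y_square_integrable: "square_integrable M (\<lambda>w. hermite n (Y k w) (q k k))"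
  by (rule all_moments_square_integrable[OF all_moments_hermite[OF Y_linear]])

text \<open>A majorant of the second moment \<open>q(k,k)\<^sup>n/n!\<close> of the Hermite polynomial that stays comparable when \<open>k\<close> is
  replaced by a point of at most twice its norm.\<close>

definition hbound :: "nat \<Rightarrow> 'k \<Rightarrow> real" where
  "hbound n k = \<bar>R\<bar> ^ n * (1 + norm k) ^ (2 * n)"

lemma q_power_le: "norm k' \<le> c * norm k \<Longrightarrow> c \<ge> 0 \<Longrightarrow> q k' k' ^ n / fact n \<le> c ^ (2 * n) * hbound n k"
proof -
  assume c: "norm k' \<le> c * norm k" "c \<ge> 0"
  have "norm k' \<le> c * (1 + norm k)" using c by (simp add: distrib_left)
  then have n2: "(norm k')\<^sup>2 \<le> (c * (1 + norm k))\<^sup>2" by (rule power_mono) simp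
  have "q k' k' \<le> \<bar>R\<bar> * (norm k')\<^sup>2"
    using order.trans[OF q_bound mult_right_mono[OF abs_ge_self]] by simp
  also have "\<dots> \<le> \<bar>R\<bar> * (c * (1 + norm k))\<^sup>2"
    by (intro mult_left_mono n2) auto
  finally have "q k' k' ^ n \<le> (\<bar>R\<bar> * (c * (1 + norm k))\<^sup>2) ^ n"
    by (intro power_mono q_nonneg)
  also have "\<dots> = c ^ (2 * n) * hbound n k"
    by (simp add: hbound_def power_mult_distrib mult_ac flip: power_mult)
  finally have "q k' k' ^ n \<le> c ^ (2 * n) * hbound n k" .
  moreover have "q k' k' ^ n / fact n \<le> q k' k' ^ n"
  proof -
    have "q k' k' ^ n / fact n \<le> q k' k' ^ n / 1"
      by (rule divide_left_mono) (auto simp: fact_ge_1 q_nonneg)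
    then show ?thesis by simp
  qed
  ultimately show ?thesis by linarith
qed

lemma coeff_hbound_integrable: "fast_decay u \<Longrightarrow> integrable lborel (\<lambda>k. \<bar>coeff n u k\<bar> * (c * hbound n k))"
proof (rule fast_decay_integrable[where C="\<bar>c\<bar> * \<bar>R\<bar> ^ n" and m="2 * n"])
  assume "fast_decay u"
  note [measurable] = coeff_measurable[OF this]
  show "(\<lambda>k. \<bar>coeff n u k\<bar> * (c * hbound n k)) \<in> borel_measurable lborel"
    unfolding hbound_def by measurable
  show "\<bar>\<bar>coeff n u k\<bar> * (c * hbound n k)\<bar> \<le> \<bar>u k\<bar> * (\<bar>c\<bar> * \<bar>R\<bar> ^ n * (1 + norm k) ^ (2 * n))" for k
    using mult_right_mono[OF abs_coeff_le[of n u k], of "\<bar>c\<bar> * hbound n k"]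
    by (simp add: abs_mult hbound_def mult_ac)
qed

lemma hermite_joint_measurable [measurable]:
  "(\<lambda>(w, k). hermite n (Y k w) (q k k)) \<in> borel_measurable (M \<Otimes>\<^sub>M lborel)"
  by measurable

lemma hermite_sq_le: "(\<integral>w. (hermite n (Y k w) (q k k))\<^sup>2 \<partial>M) \<le> 1 * hbound n k"
  using q_power_le[of k 1 k n] hermite_second_moment[of n k n k] by (simp add: power2_eq_square)

lemma component_AE_integrable:
  "fast_decay u \<Longrightarrow> AE w in M. integrable lborel (\<lambda>k. coeff n u k * hermite n (Y k w) (q k k))"
  by (rule superposition_AE_integrable[OF hermite_joint_measurable coeff_integrable coeff_hbound_integrable
        hermite_Y_square_integrable hermite_sq_le])

lemma component_square_integrable:
  "fast_decay u \<Longrightarrow> square_integrable M (component u n)"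
  unfolding component_def
  by (rule superposition_square_integrable[OF hermite_joint_measurable coeff_integrable coeff_hbound_integrable
        hermite_Y_square_integrable hermite_sq_le])

lemma component_second_moment:
  assumes "fast_decay u"
  shows "integrable (lborel \<Otimes>\<^sub>M lborel) (\<lambda>(k, l). coeff n u k * coeff n u l * (q k l ^ n / fact n))"
    and "(\<integral>w. (component u n w)\<^sup>2 \<partial>M)
      = (\<integral>(k, l). coeff n u k * coeff n u l * (q k l ^ n / fact n) \<partial>(lborel \<Otimes>\<^sub>M lborel))"
proof -
  note prems = hermite_joint_measurable coeff_integrable[OF assms] coeff_hbound_integrable[OF assms]
        hermite_Y_square_integrable hermite_sq_le
  show "integrable (lborel \<Otimes>\<^sub>M lborel) (\<lambda>(k, l). coeff n u k * coeff n u l * (q k l ^ n / fact n))"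
    using superposition_second_moment_integrable[OF prems, of n] by (simp add: hermite_second_moment)
  show "(\<integral>w. (component u n w)\<^sup>2 \<partial>M)
      = (\<integral>(k, l). coeff n u k * coeff n u l * (q k l ^ n / fact n) \<partial>(lborel \<Otimes>\<^sub>M lborel))"
    unfolding component_def using superposition_second_moment[OF prems, of n] by (simp add: hermite_second_moment)
qed

text \<open>Discretizing the parameter turns a component into a finite combination of Hermite
  polynomials of linear forms; continuity of the covariance makes the error vanish.\<close>

lemma component_in_chaos:
  assumes u: "fast_decay u"
  shows "component u n \<in> chaos M X n"
proof -
  obtain F :: "nat \<Rightarrow> 'k \<Rightarrow> 'k" where F: "\<And>i. simple_function lborel (F i)" "\<And>k. (\<lambda>i. F i k) \<longlonglongrightarrow> k"
    "\<And>i k. norm (F i k) \<le> 2 * norm k"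
    by (rule simple_approximation_identity) blast
  have fin: "finite (range (F i))" for i using simple_functionD(1)[OF F(1)] by simp
  have [measurable]: "F i \<in> borel_measurable lborel" for i by (rule borel_measurable_simple_function[OF F(1)])
  define e where "e k w = hermite n (Y k w) (q k k)" for k w
  let ?a = "coeff n u"
  have ai: "integrable lborel ?a" by (rule coeff_integrable[OF u])
  have [measurable]: "?a \<in> borel_measurable lborel" using coeff_measurable[OF u] by simp
  have se: "square_integrable M (e k)" for k unfolding e_def by (rule hermite_Y_square_integrable)
  have ee: "(\<integral>w. e k w * e l w \<partial>M) = q k l ^ n / fact n" for k l
    unfolding e_def using hermite_second_moment[of n k n l] by simp
  have ej [measurable]: "(\<lambda>(w, k). e k w) \<in> borel_measurable (M \<Otimes>\<^sub>M lborel)" unfolding e_def by measurable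
  have eF [measurable]: "(\<lambda>(w, k). e (F i k) w) \<in> borel_measurable (M \<Otimes>\<^sub>M lborel)" for i
  proof -
    have "(\<lambda>x. (fst x, F i (snd x))) \<in> (M \<Otimes>\<^sub>M lborel) \<rightarrow>\<^sub>M (M \<Otimes>\<^sub>M lborel)" by measurable
    from measurable_compose[OF this ej] show ?thesis by (simp add: case_prod_unfold)
  qed
  \<comment> \<open>\<open>F i\<close> has finite range, so \<open>Z i\<close> is a finite linear combination of the \<open>e p\<close>.\<close>
  define Z where "Z i w = (\<integral>k. ?a k * e (F i k) w \<partial>lborel)" for i w
  have Zchaos: "Z i \<in> chaos M X n" for i
  proof -
    define c where "c p = (\<integral>k. ?a k * indicator (F i -` {p}) k \<partial>lborel)" for p
    have int: "integrable lborel (\<lambda>k. ?a k * indicator (F i -` {p}) k)" for p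
    proof (rule integrable_real_mult_indicator[OF _ ai])
      show "F i -` {p} \<in> sets lborel" using simple_functionD(2)[OF F(1), of i "{p}"] by simp
    qed
    have "Z i w = (\<Sum>p\<in>range (F i). c p * e p w)" for w
    proof -
      have "?a k * e (F i k) w = (\<Sum>p\<in>range (F i). (?a k * indicator (F i -` {p}) k) * e p w)" for k
        by (subst sum.mono_neutral_right[OF fin, of "{F i k}"]) auto
      then have "Z i w = (\<integral>k. (\<Sum>p\<in>range (F i). (?a k * indicator (F i -` {p}) k) * e p w) \<partial>lborel)"
        unfolding Z_def by simp
      also have "\<dots> = (\<Sum>p\<in>range (F i). c p * e p w)"
        using int by (subst Bochner_Integration.integral_sum) (auto simp: c_def)
      finally show ?thesis .
    qed
    then have "Z i = (\<lambda>w. \<Sum>p\<in>range (F i). c p * e p w)" by blast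
    moreover have "e p \<in> chaos M X n" for p
      using hermite_in_chaos[OF Y_linear, of n p] by (simp add: e_def[abs_def] q_sq)
    ultimately show ?thesis using chaos_sum[OF chaos_cmult, of "range (F i)" e n c] by simp
  qed
  have D2: "(\<integral>w. (e (F i k) w - e k w)\<^sup>2 \<partial>M) = q (F i k) (F i k) ^ n / fact n - 2 * (q (F i k) k ^ n / fact n) + q k k ^ n / fact n" for i k
    using integral_sq_diff_expand[OF se[of "F i k"] se[of k]] by (simp add: power2_eq_square ee)
  have half_sum: "- 2 * x \<le> A + B" if "\<bar>x\<bar> \<le> (A + B) / 2" for x A B :: real
    using that by (simp add: abs_le_iff field_simps)
  have n2: "(L2norm M (e k))\<^sup>2 = q k k ^ n / fact n" for k
    by (subst L2norm_sq) (simp add: power2_eq_square ee)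
  have Db: "(\<integral>w. (e (F i k) w - e k w)\<^sup>2 \<partial>M) \<le> (2 * (2 ^ (2 * n)) + 2) * hbound n k" for i k
  proof -
    have "\<bar>\<integral>w. e (F i k) w * e k w \<partial>M\<bar> \<le> L2norm M (e (F i k)) * L2norm M (e k)"
      by (rule abs_integral_mult_le_L2norm[OF se se])
    also have "\<dots> \<le> ((L2norm M (e (F i k)))\<^sup>2 + (L2norm M (e k))\<^sup>2) / 2"
      using sum_squares_bound[of "L2norm M (e (F i k))" "L2norm M (e k)"] by simp
    finally have "- 2 * (q (F i k) k ^ n / fact n) \<le> q (F i k) (F i k) ^ n / fact n + q k k ^ n / fact n"
      unfolding n2 ee by (rule half_sum)
    then have "(\<integral>w. (e (F i k) w - e k w)\<^sup>2 \<partial>M) \<le> 2 * (q (F i k) (F i k) ^ n / fact n) + 2 * (q k k ^ n / fact n)"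
      unfolding D2 by linarith
    also have "\<dots> \<le> 2 * (2 ^ (2 * n) * hbound n k) + 2 * (1 ^ (2 * n) * hbound n k)"
      using F(3) by (intro add_mono mult_left_mono q_power_le) auto
    finally show ?thesis by (simp add: algebra_simps)
  qed
  have "(\<lambda>i. L2norm M (\<lambda>w. \<integral>k. ?a k * (e (F i k) w - e k w) \<partial>lborel)) \<longlonglongrightarrow> 0"
  proof (rule superposition_tendsto[OF _ ai coeff_hbound_integrable[OF u] _ Db])
    show "(\<lambda>(w, k). e (F i k) w - e k w) \<in> borel_measurable (M \<Otimes>\<^sub>M lborel)" for i
      using borel_measurable_diff[OF eF ej] by (simp add: case_prod_unfold)
    show "square_integrable M (\<lambda>w. e (F i k) w - e k w)" for i k using se by auto
    fix k
    have "(\<lambda>i. q (F i k) (F i k)) \<longlonglongrightarrow> q k k"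
      using continuous_on_tendsto_compose[OF q_cont, of "\<lambda>i. (F i k, F i k)" "(k, k)"]
        tendsto_Pair[OF F(2)[of k] F(2)[of k]] by simp
    moreover have "(\<lambda>i. q (F i k) k) \<longlonglongrightarrow> q k k"
      using continuous_on_tendsto_compose[OF q_cont, of "\<lambda>i. (F i k, k)" "(k, k)"]
        tendsto_Pair[OF F(2)[of k] tendsto_const[of k sequentially]] by simp
    ultimately have "(\<lambda>i. \<integral>w. (e (F i k) w - e k w)\<^sup>2 \<partial>M) \<longlonglongrightarrow> q k k ^ n / fact n - 2 * (q k k ^ n / fact n) + q k k ^ n / fact n"
      unfolding D2 by (intro tendsto_intros) auto
    then show "(\<lambda>i. \<integral>w. (e (F i k) w - e k w)\<^sup>2 \<partial>M) \<longlonglongrightarrow> 0" by simp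
  qed
  moreover have "L2norm M (\<lambda>w. \<integral>k. ?a k * (e (F i k) w - e k w) \<partial>lborel) = L2norm M (\<lambda>w. Z i w - component u n w)" for i
  proof -
    have sqF: "(\<integral>w. (e (F i k) w)\<^sup>2 \<partial>M) \<le> 2 ^ (2 * n) * hbound n k" for k
      using q_power_le[of "F i k" 2 k n] F(3) by (simp add: power2_eq_square ee)
    have "AE w in M. integrable lborel (\<lambda>k. ?a k * e (F i k) w)"
      by (rule superposition_AE_integrable[OF eF ai coeff_hbound_integrable[OF u] se sqF])
    moreover have "AE w in M. integrable lborel (\<lambda>k. ?a k * e k w)"
      using component_AE_integrable[OF u] by (simp add: e_def)
    ultimately have "AE w in M. (\<integral>k. ?a k * (e (F i k) w - e k w) \<partial>lborel)\<^sup>2 = (Z i w - component u n w)\<^sup>2"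
    proof eventually_elim
      case (elim w)
      then show ?case by (simp add: Z_def component_def e_def[symmetric] right_diff_distrib)
    qed
    moreover have "Z i \<in> borel_measurable M" "component u n \<in> borel_measurable M"
      using chaos_square_integrable[OF Zchaos] component_square_integrable[OF u] by (auto simp: square_integrable_def)
    moreover have "(\<lambda>w. \<integral>k. ?a k * (e (F i k) w - e k w) \<partial>lborel) \<in> borel_measurable M"
      by measurable
    ultimately show ?thesis unfolding L2norm_def by (intro arg_cong[of _ _ sqrt] integral_cong_AE) measurable
  qed
  ultimately show ?thesis
    by (intro chaos_limit[OF Zchaos component_square_integrable[OF u]]) simp
qed

text \<open>For fixed \<open>k\<close> the partial sums of the expansion of the cosine converge in mean square and have norm at most \<open>1\<close>,
  because \<open>exp(-q(k,k))\<close> times the sum of \<open>q(k,k)\<^sup>n/n!\<close> is \<open>1\<close>.  This uniform bound lets the convergence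
  survive the integration over \<open>k\<close>.\<close>

lemma oscillation_expansion:
  assumes u: "fast_decay u"
  shows "chaos_expansion M X (oscillation u) (component u)"
  unfolding chaos_expansion_iff
proof (intro conjI allI)
  have [measurable]: "u \<in> borel_measurable lborel" using fast_decay_measurable[OF u] by simp
  have ui: "integrable lborel u" by (rule fast_decay_imp_integrable[OF u])
  define c where "c n k = phase_coeff n (b k) * exp (- q k k / 2)" for n k
  have [measurable]: "c n \<in> borel_measurable lborel" for n unfolding c_def by measurable
  \<comment> \<open>The error after \<open>N\<close> terms; its norm is at most \<open>1 + 1\<close>, uniformly in \<open>k\<close> and \<open>N\<close>.\<close>
  define D where "D N k w = (\<Sum>n<N. c n k * hermite n (Y k w) (q k k)) - cos (Y k w - b k)" for N :: nat and k w
  have Dj: "(\<lambda>(w, k). D N k w) \<in> borel_measurable (M \<Otimes>\<^sub>M lborel)" for N unfolding D_def by measurable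
  have scos: "square_integrable M (\<lambda>w. cos (Y k w - b k))" for k
    unfolding square_integrable_def
    by (intro conjI integrable_const_bound[of _ 1]) (auto simp: abs_square_le_1)
  have cos1: "(\<integral>w. (cos (Y k w - b k))\<^sup>2 \<partial>M) \<le> 1" for k
  proof -
    have "(\<integral>w. (cos (Y k w - b k))\<^sup>2 \<partial>M) \<le> (\<integral>w. 1 \<partial>M)"
      using scos[of k] by (intro integral_mono) (auto simp: square_integrable_def abs_square_le_1)
    then show ?thesis by (simp add: prob_space)
  qed
  have sS: "square_integrable M (\<lambda>w. \<Sum>n<N. c n k * hermite n (Y k w) (q k k))" for N k
    by (intro square_integrable_sum square_integrable_cmult hermite_Y_square_integrable)
  have sD: "square_integrable M (D N k)" for N k unfolding D_def by (intro square_integrable_diff sS scos)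
  have S1: "(\<integral>w. (\<Sum>n<N. c n k * hermite n (Y k w) (q k k))\<^sup>2 \<partial>M) \<le> 1" for N k
  proof -
    have "(\<lambda>w. c n k * hermite n (Y k w) (q k k)) \<in> chaos M X n" for n
      unfolding q_sq[of k] by (intro chaos_cmult hermite_in_chaos Y_linear)
    from chaos_sum_square[of "\<lambda>n w. c n k * hermite n (Y k w) (q k k)", OF this, of "{..<N}"]
    have "(\<integral>w. (\<Sum>n<N. c n k * hermite n (Y k w) (q k k))\<^sup>2 \<partial>M) = (\<Sum>n<N. (c n k)\<^sup>2 * (q k k ^ n / fact n))"
      using hermite_second_moment[of _ k _ k] by (simp add: power_mult_distrib power2_eq_square[of "hermite _ _ _"])
    also have "\<dots> \<le> (\<Sum>n<N. exp (- q k k) * (q k k ^ n / fact n))"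
    proof (intro sum_mono mult_right_mono)
      fix n
      have "(phase_coeff n (b k))\<^sup>2 \<le> 1" using abs_phase_coeff_le[of n "b k"] by (simp add: abs_square_le_1)
      then show "(c n k)\<^sup>2 \<le> exp (- q k k)"
        unfolding c_def power_mult_distrib by (simp add: exp_double[symmetric])
    qed (simp add: q_nonneg)
    also have "\<dots> \<le> exp (- q k k) * exp (q k k)"
    proof -
      have "(\<Sum>n<N. q k k ^ n / fact n) \<le> (\<Sum>n. q k k ^ n / fact n)"
        using summable_exp_generic[of "q k k"] q_nonneg[of k]
        by (intro sum_le_suminf) (auto simp: field_simps)
      also have "\<dots> = exp (q k k)" by (simp add: exp_def field_simps)
      finally show ?thesis unfolding sum_distrib_left[symmetric] by (rule mult_left_mono) simp
    qed
    also have "\<dots> = 1" by (simp flip: exp_add)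
    finally show ?thesis .
  qed
  have D4: "(\<integral>w. (D N k w)\<^sup>2 \<partial>M) \<le> 4" for N k
  proof -
    have "L2norm M (D N k) \<le> L2norm M (\<lambda>w. \<Sum>n<N. c n k * hermite n (Y k w) (q k k)) + L2norm M (\<lambda>w. -1 * cos (Y k w - b k))"
      using L2norm_triangle[OF sS square_integrable_cmult[OF scos, of "-1"], of k N] by (simp add: D_def[abs_def])
    also have "\<dots> \<le> 1 + 1"
      unfolding L2norm_cmult using S1[of k N] cos1[of k] by (intro add_mono) (auto simp: L2norm_def)
    finally have "(L2norm M (D N k))\<^sup>2 \<le> 2\<^sup>2" by (intro power_mono) auto
    then show ?thesis by (simp add: L2norm_sq)
  qed
  have Dlim: "(\<lambda>N. \<integral>w. (D N k w)\<^sup>2 \<partial>M) \<longlonglongrightarrow> 0" for k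
  proof -
    have pt: "(\<lambda>N. D N k w) \<longlonglongrightarrow> 0" for w
      using cos_hermite_sums[of "b k" "q k k" "Y k w"] unfolding D_def c_def sums_def by (rule LIM_zero)
    have dom: "\<bar>D N k w\<bar> \<le> exp \<bar>Y k w\<bar> + 1" for N w
    proof -
      have "\<bar>\<Sum>n<N. c n k * hermite n (Y k w) (q k k)\<bar> \<le> (\<Sum>n<N. exp (- q k k / 2) * (\<bar>hermite n (Y k w) (q k k)\<bar> * \<bar>1\<bar> ^ n))"
      proof (rule order.trans[OF sum_abs sum_mono])
        fix n
        show "\<bar>c n k * hermite n (Y k w) (q k k)\<bar> \<le> exp (- q k k / 2) * (\<bar>hermite n (Y k w) (q k k)\<bar> * \<bar>1\<bar> ^ n)"
          using mult_right_mono[OF abs_phase_coeff_le[of n "b k"], of "exp (- q k k / 2) * \<bar>hermite n (Y k w) (q k k)\<bar>"]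
          by (simp add: c_def abs_mult mult_ac)
      qed
      also have "\<dots> \<le> exp (- q k k / 2) * exp (\<bar>1\<bar> * \<bar>Y k w\<bar> + 1\<^sup>2 * (\<bar>q k k\<bar> / 2))"
        unfolding sum_distrib_left[symmetric] by (intro mult_left_mono hermite_partial_bound) auto
      also have "\<dots> = exp \<bar>Y k w\<bar>" using q_nonneg[of k] by (simp flip: exp_add)
      finally show ?thesis unfolding D_def using abs_cos_le_one[of "Y k w - b k"] by linarith
    qed
    have "(\<lambda>N. \<integral>w. (D N k w)\<^sup>2 \<partial>M) \<longlonglongrightarrow> (\<integral>w. 0 \<partial>M)"
    proof (rule integral_dominated_convergence)
      show "integrable M (\<lambda>w. exp (2 * \<bar>Y k w\<bar>) + (2 * exp (1 * \<bar>Y k w\<bar>) + 1))"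
        by (intro Bochner_Integration.integrable_add integrable_mult_right exp_abs_integrable Y_linear) simp
      show "AE w in M. (\<lambda>N. (D N k w)\<^sup>2) \<longlonglongrightarrow> 0"
        using tendsto_power[OF pt, of _ 2] by simp
      show "AE w in M. norm ((D N k w)\<^sup>2) \<le> exp (2 * \<bar>Y k w\<bar>) + (2 * exp (1 * \<bar>Y k w\<bar>) + 1)" for N
      proof (rule AE_I2)
        fix w
        have "(D N k w)\<^sup>2 \<le> (exp \<bar>Y k w\<bar> + 1)\<^sup>2" using dom[of N w] by (metis abs_ge_zero power2_abs power_mono)
        then show "norm ((D N k w)\<^sup>2) \<le> exp (2 * \<bar>Y k w\<bar>) + (2 * exp (1 * \<bar>Y k w\<bar>) + 1)"
          by (simp add: power2_sum exp_double)
      qed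
      show "(\<lambda>w. (D N k w)\<^sup>2) \<in> borel_measurable M" for N unfolding D_def by measurable
    qed simp
    then show ?thesis by simp
  qed
  have u4: "integrable lborel (\<lambda>k. \<bar>u k\<bar> * 4)" using ui by simp
  have cosj: "(\<lambda>(w, k). cos (Y k w - b k)) \<in> borel_measurable (M \<Otimes>\<^sub>M lborel)" by measurable
  have u1: "integrable lborel (\<lambda>k. \<bar>u k\<bar> * 1)" using ui by simp
  show so: "square_integrable M (oscillation u)"
    unfolding oscillation_def by (rule superposition_square_integrable[OF cosj ui u1 scos cos1])
  show "component u n \<in> chaos M X n" for n by (rule component_in_chaos[OF u])
  have "(\<lambda>N. L2norm M (\<lambda>w. \<integral>k. u k * D N k w \<partial>lborel)) \<longlonglongrightarrow> 0"
    by (rule superposition_tendsto[OF Dj ui u4 sD D4 Dlim])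
  moreover have "L2norm M (\<lambda>w. \<integral>k. u k * D N k w \<partial>lborel) = L2norm M (\<lambda>w. (\<Sum>n<N. component u n w) - oscillation u w)" for N
  proof -
    have "AE w in M. integrable lborel (\<lambda>k. u k * cos (Y k w - b k))"
      by (rule superposition_AE_integrable[OF cosj ui u1 scos cos1])
    moreover have "AE w in M. \<forall>n. integrable lborel (\<lambda>k. coeff n u k * hermite n (Y k w) (q k k))"
      using component_AE_integrable[OF u] by (simp add: AE_all_countable)
    ultimately have "AE w in M. (\<integral>k. u k * D N k w \<partial>lborel)\<^sup>2 = ((\<Sum>n<N. component u n w) - oscillation u w)\<^sup>2"
    proof eventually_elim
      case (elim w)
      have "(\<integral>k. u k * D N k w \<partial>lborel) = (\<integral>k. (\<Sum>n<N. coeff n u k * hermite n (Y k w) (q k k)) - u k * cos (Y k w - b k) \<partial>lborel)"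
        by (intro Bochner_Integration.integral_cong refl)
          (simp add: D_def coeff_def c_def right_diff_distrib sum_distrib_left mult_ac)
      also have "\<dots> = (\<Sum>n<N. component u n w) - oscillation u w"
        using elim by (simp add: component_def oscillation_def)
      finally show ?case by simp
    qed
    moreover have "component u n \<in> borel_measurable M" "oscillation u \<in> borel_measurable M" for n
      using so component_square_integrable[OF u] by (auto simp: square_integrable_def)
    moreover have "(\<lambda>w. \<integral>k. u k * D N k w \<partial>lborel) \<in> borel_measurable M"
      using Dj by measurable
    ultimately show ?thesis unfolding L2norm_def by (intro arg_cong[of _ _ sqrt] integral_cong_AE
          borel_measurable_power borel_measurable_diff borel_measurable_sum)
  qed
  ultimately show "(\<lambda>N. L2norm M (\<lambda>w. (\<Sum>n<N. component u n w) - oscillation u w)) \<longlonglongrightarrow> 0" by simp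
qed

end

section \<open>Second moments as double integrals\<close>

lemma sums_n_power_over_fact: "(\<lambda>n. real n * (z ^ n / fact n)) sums (z * exp z)" for z :: real
proof -
  have "(\<lambda>n. z * (z ^ n /\<^sub>R fact n)) sums (z * exp z)"
    by (intro sums_mult exp_converges)
  moreover have "z * (z ^ n /\<^sub>R fact n) = real (Suc n) * (z ^ Suc n / fact (Suc n))" for n
    by (simp add: divide_simps)
  ultimately have "(\<lambda>n. real (Suc n) * (z ^ Suc n / fact (Suc n))) sums (z * exp z)" by simp
  then show ?thesis by (subst (asm) sums_Suc_iff) simp
qed

lemma sums_even_n_power_over_fact:
  "(\<lambda>n. if even n then real n * (z ^ n / fact n) else 0) sums (z * sinh z)" for z :: real
proof -
  have "(\<lambda>n. (real n * (z ^ n / fact n) + real n * ((- z) ^ n / fact n)) / 2) sums ((z * exp z + (- z) * exp (- z)) / 2)"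
    by (intro sums_divide sums_add sums_n_power_over_fact)
  moreover have "(real n * (z ^ n / fact n) + real n * ((- z) ^ n / fact n)) / 2
      = (if even n then real n * (z ^ n / fact n) else 0)" for n
    by auto
  moreover have "(z * exp z + (- z) * exp (- z)) / 2 = z * sinh z"
    by (simp add: sinh_field_def field_simps)
  ultimately show ?thesis by simp
qed

context gaussian_family
begin

definition gauss_weight :: "'k \<Rightarrow> 'k \<Rightarrow> real" where
  "gauss_weight k l = exp (- (q k k + q l l) / 2)"

lemma gauss_weight_pos: "0 < gauss_weight k l"
  by (simp add: gauss_weight_def)

lemma gauss_weight_measurable [measurable]:
  assumes [measurable]: "f \<in> borel_measurable N" "g \<in> borel_measurable N"
  shows "(\<lambda>x. gauss_weight (f x) (g x)) \<in> borel_measurable N"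
  unfolding gauss_weight_def by measurable

lemma component_sq_le:
  assumes u: "fast_decay u"
  shows "ennreal (\<integral>w. (component u n w)\<^sup>2 \<partial>M)
    \<le> (\<integral>\<^sup>+(k, l). ennreal (\<bar>u k\<bar> * \<bar>u l\<bar> * (gauss_weight k l * (\<bar>q k l\<bar> ^ n / fact n))) \<partial>(lborel \<Otimes>\<^sub>M lborel))"
proof -
  have "ennreal (\<integral>w. (component u n w)\<^sup>2 \<partial>M)
      \<le> ennreal (norm (\<integral>(k, l). coeff n u k * coeff n u l * (q k l ^ n / fact n) \<partial>(lborel \<Otimes>\<^sub>M lborel)))"
    unfolding component_second_moment(2)[OF u] by (intro ennreal_leI) simp
  also have "\<dots> \<le> (\<integral>\<^sup>+x. ennreal (norm (case x of (k, l) \<Rightarrow> coeff n u k * coeff n u l * (q k l ^ n / fact n))) \<partial>(lborel \<Otimes>\<^sub>M lborel))"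
    by (rule integral_norm_bound_ennreal[OF component_second_moment(1)[OF u]])
  also have "\<dots> \<le> (\<integral>\<^sup>+(k, l). ennreal (\<bar>u k\<bar> * \<bar>u l\<bar> * (gauss_weight k l * (\<bar>q k l\<bar> ^ n / fact n))) \<partial>(lborel \<Otimes>\<^sub>M lborel))"
  proof (intro nn_integral_mono, clarify)
    fix k l
    have c: "\<bar>coeff n u k\<bar> \<le> \<bar>u k\<bar> * exp (- q k k / 2)" for k
      using mult_left_mono[OF abs_phase_coeff_le[of n "b k"], of "\<bar>u k\<bar> * exp (- q k k / 2)"]
      by (simp add: coeff_def abs_mult mult_ac)
    have "\<bar>coeff n u k\<bar> * \<bar>coeff n u l\<bar> \<le> (\<bar>u k\<bar> * exp (- q k k / 2)) * (\<bar>u l\<bar> * exp (- q l l / 2))"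
      by (intro mult_mono c) auto
    also have "\<dots> = \<bar>u k\<bar> * \<bar>u l\<bar> * (exp (- q k k / 2) * exp (- q l l / 2))"
      by (simp only: mult_ac)
    also have "exp (- q k k / 2) * exp (- q l l / 2) = gauss_weight k l"
      by (simp add: gauss_weight_def flip: exp_add)
    finally have "\<bar>coeff n u k\<bar> * \<bar>coeff n u l\<bar> * (\<bar>q k l\<bar> ^ n / fact n) \<le> \<bar>u k\<bar> * \<bar>u l\<bar> * gauss_weight k l * (\<bar>q k l\<bar> ^ n / fact n)"
      by (rule mult_right_mono) simp
    then show "ennreal (norm (coeff n u k * coeff n u l * (q k l ^ n / fact n)))
        \<le> ennreal (\<bar>u k\<bar> * \<bar>u l\<bar> * (gauss_weight k l * (\<bar>q k l\<bar> ^ n / fact n)))"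
      by (intro ennreal_leI) (simp add: abs_mult power_abs mult_ac)
  qed
  finally show ?thesis .
qed

text \<open>With zero phases and even \<open>n\<close> the squared coefficients are \<open>1\<close> and \<open>q(k,l)\<^sup>n \<ge> 0\<close>, so there is no cancellation
  and the double integral may be taken with values in \<open>[0, \<infinity>]\<close>.\<close>

lemma component_sq_eq:
  assumes u: "fast_decay u" and b0: "\<And>k. b k = 0" and "even n" and u0: "\<And>k. 0 \<le> u k"
  shows "ennreal (\<integral>w. (component u n w)\<^sup>2 \<partial>M)
    = (\<integral>\<^sup>+(k, l). ennreal (u k * u l * (gauss_weight k l * (q k l ^ n / fact n))) \<partial>(lborel \<Otimes>\<^sub>M lborel))"
proof -
  have e: "coeff n u k * coeff n u l * (q k l ^ n / fact n) = u k * u l * (gauss_weight k l * (q k l ^ n / fact n))" for k l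
  proof -
    have "coeff n u k * coeff n u l = u k * u l * (phase_coeff n 0)\<^sup>2 * (exp (- q k k / 2) * exp (- q l l / 2))"
      by (simp add: coeff_def b0 power2_eq_square mult_ac)
    also have "exp (- q k k / 2) * exp (- q l l / 2) = gauss_weight k l"
      by (simp add: gauss_weight_def flip: exp_add)
    finally show ?thesis using phase_coeff_0_even[OF \<open>even n\<close>] by simp
  qed
  show ?thesis
    unfolding component_second_moment(2)[OF u] e
    by (subst nn_integral_eq_integral[symmetric])
      (use component_second_moment(1)[OF u, of n, unfolded e] u0 \<open>even n\<close> in
        \<open>auto simp: case_prod_unfold zero_le_even_power gauss_weight_pos less_imp_le intro!: mult_nonneg_nonneg divide_nonneg_nonneg\<close>)
qed

lemma oscillation_sq_le:
  assumes u: "fast_decay u"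
  shows "ennreal (\<integral>w. (oscillation u w)\<^sup>2 \<partial>M)
    \<le> (\<integral>\<^sup>+(k, l). ennreal (\<bar>u k\<bar> * \<bar>u l\<bar> * (gauss_weight k l * exp \<bar>q k l\<bar>)) \<partial>(lborel \<Otimes>\<^sub>M lborel))"
proof -
  have [measurable]: "u \<in> borel_measurable borel" using u by (rule fast_decay_measurable)
  note p = chaos_parseval[OF oscillation_expansion[OF u]]
  have "ennreal (\<integral>w. (oscillation u w)\<^sup>2 \<partial>M) = (\<Sum>n. ennreal (\<integral>w. (component u n w)\<^sup>2 \<partial>M))"
    unfolding sums_unique[OF p] using p by (intro suminf_ennreal2[symmetric]) (auto simp: sums_iff)
  also have "\<dots> \<le> (\<Sum>n. \<integral>\<^sup>+(k, l). ennreal (\<bar>u k\<bar> * \<bar>u l\<bar> * (gauss_weight k l * (\<bar>q k l\<bar> ^ n / fact n))) \<partial>(lborel \<Otimes>\<^sub>M lborel))"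
    by (intro suminf_le component_sq_le u) auto
  also have "\<dots> = (\<integral>\<^sup>+x. (\<Sum>n. case x of (k, l) \<Rightarrow> ennreal (\<bar>u k\<bar> * \<bar>u l\<bar> * (gauss_weight k l * (\<bar>q k l\<bar> ^ n / fact n)))) \<partial>(lborel \<Otimes>\<^sub>M lborel))"
    by (rule nn_integral_suminf[symmetric]) measurable
  also have "\<dots> = (\<integral>\<^sup>+(k, l). ennreal (\<bar>u k\<bar> * \<bar>u l\<bar> * (gauss_weight k l * exp \<bar>q k l\<bar>)) \<partial>(lborel \<Otimes>\<^sub>M lborel))"
  proof (intro nn_integral_cong, clarify)
    fix k l
    have "(\<lambda>n. \<bar>q k l\<bar> ^ n / fact n) sums exp \<bar>q k l\<bar>"
      using exp_converges[of "\<bar>q k l\<bar>"] by (simp add: divide_inverse mult.commute)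
    then have s: "(\<lambda>n. \<bar>u k\<bar> * \<bar>u l\<bar> * (gauss_weight k l * (\<bar>q k l\<bar> ^ n / fact n))) sums (\<bar>u k\<bar> * \<bar>u l\<bar> * (gauss_weight k l * exp \<bar>q k l\<bar>))"
      by (intro sums_mult)
    show "(\<Sum>n. ennreal (\<bar>u k\<bar> * \<bar>u l\<bar> * (gauss_weight k l * (\<bar>q k l\<bar> ^ n / fact n)))) = ennreal (\<bar>u k\<bar> * \<bar>u l\<bar> * (gauss_weight k l * exp \<bar>q k l\<bar>))"
      unfolding sums_unique[OF s] using s
      by (intro suminf_ennreal2) (auto simp: sums_iff gauss_weight_pos less_imp_le)
  qed
  finally show ?thesis .
qed

text \<open>Under the integral, \<open>\<Sum> n z\<^sup>n/n! = z exp z\<close>.\<close>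

lemma component_weighted_sum_le:
  assumes u: "fast_decay u"
  shows "ennreal (\<Sum>n<N. real n * (\<integral>w. (component u n w)\<^sup>2 \<partial>M))
    \<le> (\<integral>\<^sup>+(k, l). ennreal (\<bar>u k\<bar> * \<bar>u l\<bar> * (gauss_weight k l * (\<bar>q k l\<bar> * exp \<bar>q k l\<bar>))) \<partial>(lborel \<Otimes>\<^sub>M lborel))"
proof -
  have [measurable]: "u \<in> borel_measurable borel" using u by (rule fast_decay_measurable)
  let ?f = "\<lambda>n x. case x of (k, l) \<Rightarrow> ennreal (\<bar>u k\<bar> * \<bar>u l\<bar> * (gauss_weight k l * (\<bar>q k l\<bar> ^ n / fact n)))"
  have "ennreal (\<Sum>n<N. real n * (\<integral>w. (component u n w)\<^sup>2 \<partial>M)) = (\<Sum>n<N. ennreal (real n) * ennreal (\<integral>w. (component u n w)\<^sup>2 \<partial>M))"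
    by (subst sum_ennreal[symmetric]) (auto simp: ennreal_mult)
  also have "\<dots> \<le> (\<Sum>n<N. ennreal (real n) * (\<integral>\<^sup>+x. ?f n x \<partial>(lborel \<Otimes>\<^sub>M lborel)))"
    by (intro sum_mono mult_left_mono component_sq_le u) auto
  also have "\<dots> = (\<integral>\<^sup>+x. (\<Sum>n<N. ennreal (real n) * ?f n x) \<partial>(lborel \<Otimes>\<^sub>M lborel))"
    by (subst nn_integral_sum) (auto simp: nn_integral_cmult)
  also have "\<dots> \<le> (\<integral>\<^sup>+(k, l). ennreal (\<bar>u k\<bar> * \<bar>u l\<bar> * (gauss_weight k l * (\<bar>q k l\<bar> * exp \<bar>q k l\<bar>))) \<partial>(lborel \<Otimes>\<^sub>M lborel))"
  proof (intro nn_integral_mono, clarify)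
    fix k l
    let ?c = "\<bar>u k\<bar> * \<bar>u l\<bar> * gauss_weight k l"
    have c0: "0 \<le> ?c" by (simp add: gauss_weight_pos less_imp_le)
    note s = sums_n_power_over_fact[of "\<bar>q k l\<bar>"]
    have "(\<Sum>n<N. ennreal (real n) * ennreal (\<bar>u k\<bar> * \<bar>u l\<bar> * (gauss_weight k l * (\<bar>q k l\<bar> ^ n / fact n))))
        = (\<Sum>n<N. ennreal (?c * (real n * (\<bar>q k l\<bar> ^ n / fact n))))"
      by (intro sum.cong refl) (simp add: ennreal_mult[symmetric] gauss_weight_pos less_imp_le mult_ac)
    also have "\<dots> = ennreal (\<Sum>n<N. ?c * (real n * (\<bar>q k l\<bar> ^ n / fact n)))"
      using c0 by (intro sum_ennreal) auto
    also have "\<dots> \<le> ennreal (?c * (\<bar>q k l\<bar> * exp \<bar>q k l\<bar>))"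
      unfolding sum_distrib_left[symmetric] sums_unique[OF s]
      using s by (intro ennreal_leI mult_left_mono c0 sum_le_suminf) (auto simp: sums_iff)
    finally show "(\<Sum>n<N. ennreal (real n) * ennreal (\<bar>u k\<bar> * \<bar>u l\<bar> * (gauss_weight k l * (\<bar>q k l\<bar> ^ n / fact n))))
       \<le> ennreal (\<bar>u k\<bar> * \<bar>u l\<bar> * (gauss_weight k l * (\<bar>q k l\<bar> * exp \<bar>q k l\<bar>)))"
      by (simp add: mult.assoc)
  qed
  finally show ?thesis .
qed

lemma fast_decay_diff:
  assumes "fast_decay u" "fast_decay v"
  shows "fast_decay (\<lambda>k. u k - v k)"
  unfolding fast_decay_def
proof (intro conjI allI)
  have [measurable]: "u \<in> borel_measurable borel" "v \<in> borel_measurable borel"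
    using assms by (auto dest: fast_decay_measurable)
  show "(\<lambda>k. u k - v k) \<in> borel_measurable lborel" by simp
  fix m
  show "integrable lborel (\<lambda>k. \<bar>u k - v k\<bar> * (1 + norm k) ^ m)"
  proof (rule Bochner_Integration.integrable_bound)
    show "integrable lborel (\<lambda>k. \<bar>u k\<bar> * (1 + norm k) ^ m + \<bar>v k\<bar> * (1 + norm k) ^ m)"
      using assms by (auto simp: fast_decay_def)
    have "\<bar>u k - v k\<bar> * (1 + norm k) ^ m \<le> \<bar>u k\<bar> * (1 + norm k) ^ m + \<bar>v k\<bar> * (1 + norm k) ^ m" for k
      unfolding distrib_right[symmetric] by (intro mult_right_mono) auto
    then show "AE k in lborel. norm (\<bar>u k - v k\<bar> * (1 + norm k) ^ m) \<le> norm (\<bar>u k\<bar> * (1 + norm k) ^ m + \<bar>v k\<bar> * (1 + norm k) ^ m)"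
      by (simp add: abs_mult)
  qed simp
qed

lemma oscillation_diff:
  assumes u: "fast_decay u" and v: "fast_decay v" and w: "w \<in> space M"
  shows "oscillation (\<lambda>k. u k - v k) w = oscillation u w - oscillation v w"
proof -
  have [measurable]: "(\<lambda>k. Y k w) \<in> borel_measurable borel"
    using Y_cont[OF w] by (rule borel_measurable_continuous_onI)
  have "integrable lborel (\<lambda>k. u k * cos (Y k w - b k))" if u: "fast_decay u" for u
  proof (rule fast_decay_integrable[OF u, where C=1 and m=0])
    have [measurable]: "u \<in> borel_measurable borel" using u by (rule fast_decay_measurable)
    show "(\<lambda>k. u k * cos (Y k w - b k)) \<in> borel_measurable lborel" by simp
    show "\<bar>u k * cos (Y k w - b k)\<bar> \<le> \<bar>u k\<bar> * (1 * (1 + norm k) ^ 0)" for k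
      using mult_left_mono[OF abs_cos_le_one, of "\<bar>u k\<bar>"] by (simp add: abs_mult)
  qed
  from this[OF u] this[OF v] show ?thesis by (simp add: oscillation_def left_diff_distrib)
qed

end

section \<open>The chaos criterion for the limit of the oscillations\<close>

text \<open>Weights \<open>u \<epsilon>\<close> that increase to \<open>w0\<close> as \<open>\<epsilon>\<close> decreases to \<open>0\<close>.  The limit \<open>w0\<close> itself need not be integrable,
  so the limit of the superpositions exists only thanks to the Gaussian factors in their second moments.\<close>

locale regularized_weights = gaussian_family M X Y b R q
  for M :: "'w measure" and X :: "real^'n \<Rightarrow> 'w \<Rightarrow> real^'d"
    and Y :: "'k::euclidean_space \<Rightarrow> 'w \<Rightarrow> real" and b R q +
  fixes w0 :: "'k \<Rightarrow> real" and u :: "real \<Rightarrow> 'k \<Rightarrow> real"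
  assumes w0_measurable [measurable]: "w0 \<in> borel_measurable borel"
    and u_decay: "\<And>\<epsilon>. \<epsilon> > 0 \<Longrightarrow> fast_decay (u \<epsilon>)"
    and u_nonneg: "\<And>\<epsilon> k. \<epsilon> > 0 \<Longrightarrow> 0 \<le> u \<epsilon> k" and u_le: "\<And>\<epsilon> k. \<epsilon> > 0 \<Longrightarrow> u \<epsilon> k \<le> w0 k"
    and u_antimono: "\<And>\<epsilon> \<delta> k. 0 < \<epsilon> \<Longrightarrow> \<epsilon> \<le> \<delta> \<Longrightarrow> u \<delta> k \<le> u \<epsilon> k"
    and u_lim: "\<And>k. ((\<lambda>\<epsilon>. u \<epsilon> k) \<longlongrightarrow> w0 k) (at_right 0)"
begin

lemma w0_nonneg: "0 \<le> w0 k"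
  using u_nonneg[of 1 k] u_le[of 1 k] by simp

lemma u_measurable: "\<epsilon> > 0 \<Longrightarrow> u \<epsilon> \<in> borel_measurable borel"
  by (rule fast_decay_measurable[OF u_decay])

lemma inverse_Suc_at_right: "filterlim (\<lambda>j. 1 / real (Suc j)) (at_right 0) sequentially"
  unfolding filterlim_at using LIMSEQ_Suc[OF lim_1_over_n] by auto

lemma u_seq_lim: "(\<lambda>j. u (1 / real (Suc j)) k) \<longlonglongrightarrow> w0 k"
  by (rule filterlim_compose[OF u_lim inverse_Suc_at_right])

lemma oscillation_square_integrable: "\<epsilon> > 0 \<Longrightarrow> square_integrable M (oscillation (u \<epsilon>))"
  using oscillation_expansion[OF u_decay] by (simp add: chaos_expansion_iff)

text \<open>Bounds the mean-square distance of the superposition for \<open>u \<epsilon>\<close> from all those closer to the limit, and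
  tends to \<open>0\<close> by dominated convergence: this is the Cauchy condition.\<close>

definition defect :: "real \<Rightarrow> ennreal" where
  "defect \<epsilon> = (\<integral>\<^sup>+(k, l). ennreal ((w0 k - u \<epsilon> k) * w0 l * (gauss_weight k l * exp \<bar>q k l\<bar>)) \<partial>(lborel \<Otimes>\<^sub>M lborel))"

lemma defect_mono:
  assumes "0 < \<epsilon>" "\<epsilon> \<le> \<delta>"
  shows "defect \<epsilon> \<le> defect \<delta>"
  unfolding defect_def
  using u_antimono[OF assms] w0_nonneg gauss_weight_pos
  by (intro nn_integral_mono) (auto intro!: ennreal_leI mult_right_mono simp: less_imp_le)

lemma oscillation_diff_le_defect:
  assumes e: "0 < \<epsilon>" "\<epsilon> \<le> \<delta>"
  shows "ennreal (\<integral>w. (oscillation (u \<epsilon>) w - oscillation (u \<delta>) w)\<^sup>2 \<partial>M) \<le> defect \<delta>"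
proof -
  have d: "0 < \<delta>" using e by simp
  let ?v = "\<lambda>k. u \<epsilon> k - u \<delta> k"
  have v: "0 \<le> ?v k" "?v k \<le> w0 k - u \<delta> k" "?v k \<le> w0 k" for k
    using u_antimono[OF e, of k] u_le[OF e(1), of k] u_nonneg[OF d, of k] by auto
  have "(\<integral>w. (oscillation (u \<epsilon>) w - oscillation (u \<delta>) w)\<^sup>2 \<partial>M) = (\<integral>w. (oscillation ?v w)\<^sup>2 \<partial>M)"
    using oscillation_diff[OF u_decay[OF e(1)] u_decay[OF d]] by (intro Bochner_Integration.integral_cong) auto
  then have "ennreal (\<integral>w. (oscillation (u \<epsilon>) w - oscillation (u \<delta>) w)\<^sup>2 \<partial>M)
     \<le> (\<integral>\<^sup>+(k, l). ennreal (\<bar>?v k\<bar> * \<bar>?v l\<bar> * (gauss_weight k l * exp \<bar>q k l\<bar>)) \<partial>(lborel \<Otimes>\<^sub>M lborel))"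
    using oscillation_sq_le[OF fast_decay_diff[OF u_decay[OF e(1)] u_decay[OF d]]] by simp
  also have "\<dots> \<le> defect \<delta>"
    unfolding defect_def
  proof (intro nn_integral_mono, clarify)
    fix k l
    have "\<bar>?v k\<bar> * \<bar>?v l\<bar> \<le> (w0 k - u \<delta> k) * w0 l"
      using v[of k] v[of l] by (intro mult_mono) auto
    then show "ennreal (\<bar>?v k\<bar> * \<bar>?v l\<bar> * (gauss_weight k l * exp \<bar>q k l\<bar>))
      \<le> ennreal ((w0 k - u \<delta> k) * w0 l * (gauss_weight k l * exp \<bar>q k l\<bar>))"
      using gauss_weight_pos[of k l] by (intro ennreal_leI mult_right_mono) auto
  qed
  finally show ?thesis .
qed

lemma defect_tendsto_0:
  assumes fin: "(\<integral>\<^sup>+(k, l). ennreal (w0 k * w0 l * (gauss_weight k l * exp \<bar>q k l\<bar>)) \<partial>(lborel \<Otimes>\<^sub>M lborel)) < \<infinity>"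
  shows "(\<lambda>j. defect (1 / real (Suc j))) \<longlonglongrightarrow> 0"
proof -
  have [measurable]: "u (1 / real (Suc j)) \<in> borel_measurable borel" for j by (rule u_measurable) simp
  have "(\<lambda>j. \<integral>\<^sup>+x. (case x of (k, l) \<Rightarrow> ennreal ((w0 k - u (1 / real (Suc j)) k) * w0 l * (gauss_weight k l * exp \<bar>q k l\<bar>))) \<partial>(lborel \<Otimes>\<^sub>M lborel))
     \<longlonglongrightarrow> (\<integral>\<^sup>+x. 0 \<partial>((lborel :: 'k measure) \<Otimes>\<^sub>M (lborel :: 'k measure)))"
  proof (rule nn_integral_dominated_convergence[OF _ _ _ _ fin])
    show "AE x in lborel \<Otimes>\<^sub>M lborel. (case x of (k, l) \<Rightarrow> ennreal ((w0 k - u (1 / real (Suc j)) k) * w0 l * (gauss_weight k l * exp \<bar>q k l\<bar>)))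
       \<le> (case x of (k, l) \<Rightarrow> ennreal (w0 k * w0 l * (gauss_weight k l * exp \<bar>q k l\<bar>)))" for j
      using u_nonneg[of "1 / real (Suc j)"] w0_nonneg gauss_weight_pos
      by (intro AE_I2) (auto intro!: ennreal_leI mult_right_mono simp: less_imp_le)
    show "AE x in lborel \<Otimes>\<^sub>M lborel. (\<lambda>j. case x of (k, l) \<Rightarrow> ennreal ((w0 k - u (1 / real (Suc j)) k) * w0 l * (gauss_weight k l * exp \<bar>q k l\<bar>))) \<longlonglongrightarrow> 0"
    proof (intro AE_I2, clarify)
      fix k l :: 'k
      have "(\<lambda>j. ennreal ((w0 k - u (1 / real (Suc j)) k) * w0 l * (gauss_weight k l * exp \<bar>q k l\<bar>))) \<longlonglongrightarrow> ennreal ((w0 k - w0 k) * w0 l * (gauss_weight k l * exp \<bar>q k l\<bar>))"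
        by (intro tendsto_intros u_seq_lim)
      then show "(\<lambda>j. ennreal ((w0 k - u (1 / real (Suc j)) k) * w0 l * (gauss_weight k l * exp \<bar>q k l\<bar>))) \<longlonglongrightarrow> 0" by simp
    qed
  qed measurable
  then show ?thesis by (simp add: defect_def)
qed

text \<open>The sums of \<open>n E[F\<^sub>n\<^sup>2]\<close> for all regularizations are bounded by the integral of \<open>|q| exp |q|\<close>, and the
  part with \<open>exp |q|\<close> dominates the defect.\<close>

lemma limit_in_D1:
  assumes fin: "(\<integral>\<^sup>+(k, l). ennreal (w0 k * w0 l * (gauss_weight k l * ((1 + \<bar>q k l\<bar>) * exp \<bar>q k l\<bar>))) \<partial>(lborel \<Otimes>\<^sub>M lborel)) < \<infinity>"
  obtains L where "square_integrable M L" "L \<in> D1 M X"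
    "((\<lambda>\<epsilon>. L2_dist_sq M (oscillation (u \<epsilon>)) L) \<longlongrightarrow> 0) (at_right 0)"
proof -
  define \<e> where "\<e> j = 1 / real (Suc j)" for j
  have \<e>: "\<e> j > 0" for j by (simp add: \<e>_def)
  have fin1: "(\<integral>\<^sup>+(k, l). ennreal (w0 k * w0 l * (gauss_weight k l * exp \<bar>q k l\<bar>)) \<partial>(lborel \<Otimes>\<^sub>M lborel)) < \<infinity>"
    by (rule order.strict_trans1[OF nn_integral_mono fin])
      (auto intro!: ennreal_leI mult_left_mono mult_nonneg_nonneg simp: w0_nonneg gauss_weight_pos less_imp_le)
  let ?I = "\<integral>\<^sup>+(k, l). ennreal (w0 k * w0 l * (gauss_weight k l * (\<bar>q k l\<bar> * exp \<bar>q k l\<bar>))) \<partial>(lborel \<Otimes>\<^sub>M lborel)"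
  have fin2: "?I < \<infinity>"
    by (rule order.strict_trans1[OF nn_integral_mono fin])
      (auto intro!: ennreal_leI mult_left_mono mult_right_mono mult_nonneg_nonneg simp: w0_nonneg gauss_weight_pos less_imp_le)
  have dl: "(\<lambda>j. defect (\<e> j)) \<longlonglongrightarrow> 0" unfolding \<e>_def by (rule defect_tendsto_0[OF fin1])
  have sq: "square_integrable M (oscillation (u (\<e> j)))" for j by (rule oscillation_square_integrable[OF \<e>])
  have dle: "L2norm M (\<lambda>w. oscillation (u (\<e> m)) w - oscillation (u (\<e> k)) w) < e"
    if e: "e > 0" and N: "defect (\<e> N) < ennreal (e\<^sup>2)" and mk: "m \<ge> N" "k \<ge> N" for e N m k
  proof -
    have main: "ennreal (\<integral>w. (oscillation (u (\<e> m)) w - oscillation (u (\<e> k)) w)\<^sup>2 \<partial>M) \<le> defect (\<e> N)" if "k \<le> m" "k \<ge> N" for m k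
    proof -
      have "\<e> m \<le> \<e> k" "\<e> k \<le> \<e> N" using that by (auto simp: \<e>_def frac_le)
      then show ?thesis using oscillation_diff_le_defect[OF \<e>, of m "\<e> k"] defect_mono[OF \<e>, of k "\<e> N"] by (meson order.trans)
    qed
    have "ennreal (\<integral>w. (oscillation (u (\<e> m)) w - oscillation (u (\<e> k)) w)\<^sup>2 \<partial>M) \<le> defect (\<e> N)"
      using main[of k m] main[of m k] mk by (cases "k \<le> m") (auto simp: power2_commute)
    also have "\<dots> < ennreal (e\<^sup>2)" by (rule N)
    finally have "(L2norm M (\<lambda>w. oscillation (u (\<e> m)) w - oscillation (u (\<e> k)) w))\<^sup>2 < e\<^sup>2"
      using e by (simp add: L2norm_sq ennreal_less_iff)
    then show ?thesis using e by (simp add: power2_less_imp_less)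
  qed
  have "\<exists>N. \<forall>m\<ge>N. \<forall>k\<ge>N. L2norm M (\<lambda>w. oscillation (u (\<e> m)) w - oscillation (u (\<e> k)) w) < e" if e: "e > 0" for e
  proof -
    have "\<forall>\<^sub>F j in sequentially. defect (\<e> j) < ennreal (e\<^sup>2)"
      using order_tendstoD(2)[OF dl, of "ennreal (e\<^sup>2)"] e by simp
    then obtain N where "defect (\<e> N) < ennreal (e\<^sup>2)" by (auto simp: eventually_sequentially)
    then show ?thesis using dle[OF e] by blast
  qed
  from L2_complete[OF sq this] obtain L where L: "square_integrable M L"
    and lim: "(\<lambda>j. L2norm M (\<lambda>w. oscillation (u (\<e> j)) w - L w)) \<longlonglongrightarrow> 0" by blast
  have "L \<in> D1 M X"
  proof (rule D1_limitI[OF oscillation_expansion[OF u_decay[OF \<e>]] L lim, where C="enn2real ?I"])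
    fix N j
    have sum_le: "ennreal (\<Sum>n<N. real n * (\<integral>w. (component (u (\<e> j)) n w)\<^sup>2 \<partial>M)) \<le> ?I"
    proof (rule order.trans[OF component_weighted_sum_le[OF u_decay[OF \<e>]]], intro nn_integral_mono, clarify)
      fix k l
      have "\<bar>u (\<e> j) k\<bar> * \<bar>u (\<e> j) l\<bar> \<le> w0 k * w0 l"
        using u_le[OF \<e>] u_nonneg[OF \<e>] w0_nonneg by (intro mult_mono) auto
      then show "ennreal (\<bar>u (\<e> j) k\<bar> * \<bar>u (\<e> j) l\<bar> * (gauss_weight k l * (\<bar>q k l\<bar> * exp \<bar>q k l\<bar>)))
         \<le> ennreal (w0 k * w0 l * (gauss_weight k l * (\<bar>q k l\<bar> * exp \<bar>q k l\<bar>)))"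
        using gauss_weight_pos[of k l] by (intro ennreal_leI mult_right_mono) auto
    qed
    from enn2real_mono[OF sum_le fin2[unfolded infinity_ennreal_def]]
    show "(\<Sum>n<N. real n * (\<integral>w. (component (u (\<e> j)) n w)\<^sup>2 \<partial>M)) \<le> enn2real ?I"
      by (simp add: sum_nonneg)
  qed
  moreover have "((\<lambda>\<epsilon>. L2_dist_sq M (oscillation (u \<epsilon>)) L) \<longlongrightarrow> 0) (at_right 0)"
  proof (rule order_tendstoI)
    fix a :: ennreal assume "0 < a"
    define c where "c = min a 1"
    have c: "0 < c" "c \<le> a" "c < \<infinity>" using \<open>0 < a\<close> by (auto simp: c_def min_less_iff_disj)
    define e where "e = sqrt (enn2real c)"
    have e: "e > 0" "ennreal (e\<^sup>2) = c" using c by (auto simp: e_def enn2real_positive_iff)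
    have e2: "e / 2 > 0" using e by simp
    have "\<forall>\<^sub>F j in sequentially. defect (\<e> j) < ennreal ((e/2)\<^sup>2)"
      using order_tendstoD(2)[OF dl, of "ennreal ((e/2)\<^sup>2)"] e by simp
    then obtain N where N: "defect (\<e> N) < ennreal ((e/2)\<^sup>2)" by (auto simp: eventually_sequentially)
    obtain N2 where N2: "\<And>j. j \<ge> N2 \<Longrightarrow> L2norm M (\<lambda>w. oscillation (u (\<e> j)) w - L w) < e / 2"
      using LIMSEQ_zero_less[OF lim e2] by blast
    \<comment> \<open>Compare an arbitrary small \<open>\<epsilon>\<close> with a later member of the sequence along which \<open>L\<close> was constructed.\<close>
    have "L2_dist_sq M (oscillation (u \<epsilon>)) L < a" if \<epsilon>: "0 < \<epsilon>" "\<epsilon> < \<e> N" for \<epsilon>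
    proof -
      have "\<forall>\<^sub>F j in sequentially. \<e> j < \<epsilon>"
        using order_tendstoD(2)[OF LIMSEQ_Suc[OF lim_1_over_n] \<epsilon>(1)] by (simp add: \<e>_def)
      then obtain j where j: "j \<ge> N2" "\<e> j < \<epsilon>" unfolding eventually_sequentially by (meson max.cobounded1 max.cobounded2)
      have "ennreal (\<integral>w. (oscillation (u (\<e> j)) w - oscillation (u \<epsilon>) w)\<^sup>2 \<partial>M) \<le> defect (\<e> N)"
        using oscillation_diff_le_defect[OF \<e> less_imp_le[OF j(2)]] defect_mono[OF \<epsilon>(1) less_imp_le[OF \<epsilon>(2)]] by (rule order.trans)
      also note N
      finally have "(L2norm M (\<lambda>w. oscillation (u (\<e> j)) w - oscillation (u \<epsilon>) w))\<^sup>2 < (e/2)\<^sup>2"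
        using e by (simp add: L2norm_sq ennreal_less_iff)
      then have "L2norm M (\<lambda>w. oscillation (u \<epsilon>) w - oscillation (u (\<e> j)) w) < e/2"
        using e2 by (subst L2norm_commute) (rule power2_less_imp_less, auto)
      then have "L2norm M (\<lambda>w. oscillation (u \<epsilon>) w - L w) < e"
        using N2[OF j(1)] L2norm_triangle_diff[OF oscillation_square_integrable[OF \<epsilon>(1)] sq[of j] L] by linarith
      then have "(L2norm M (\<lambda>w. oscillation (u \<epsilon>) w - L w))\<^sup>2 < e\<^sup>2"
        by (intro power_strict_mono) auto
      then have "L2_dist_sq M (oscillation (u \<epsilon>)) L < ennreal (e\<^sup>2)"
        by (subst L2_dist_sq_eq[OF oscillation_square_integrable[OF \<epsilon>(1)] L]) (simp add: L2norm_sq ennreal_less_iff)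
      then show ?thesis using e(2) c(2) by simp
    qed
    then show "\<forall>\<^sub>F \<epsilon> in at_right 0. L2_dist_sq M (oscillation (u \<epsilon>)) L < a"
      unfolding eventually_at_right_field using \<e>[of N] by blast
  qed simp
  ultimately show ?thesis using that L by blast
qed

text \<open>Membership of the limit in \<open>D\<^sub>1\<close> bounds the limits of the components.  For even orders Fatou's lemma transfers
  this to the integrals with \<open>w0\<close>, and the sum of \<open>n z\<^sup>n/n!\<close> over even \<open>n\<close> is \<open>z sinh z\<close>.\<close>

lemma limit_in_D1_imp_finite:
  assumes b0: "\<And>k. b k = 0" and L: "square_integrable M L" "L \<in> D1 M X"
    and lim: "((\<lambda>\<epsilon>. L2_dist_sq M (oscillation (u \<epsilon>)) L) \<longlongrightarrow> 0) (at_right 0)"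
  shows "(\<integral>\<^sup>+(k, l). ennreal (w0 k * w0 l * (gauss_weight k l * (q k l * sinh (q k l)))) \<partial>(lborel \<Otimes>\<^sub>M lborel)) < \<infinity>"
proof -
  define \<e> where "\<e> j = 1 / real (Suc j)" for j
  have \<e>: "\<e> j > 0" for j by (simp add: \<e>_def)
  have [measurable]: "u (\<e> j) \<in> borel_measurable borel" for j by (rule u_measurable[OF \<e>])
  have "(\<lambda>j. L2_dist_sq M (oscillation (u (\<e> j))) L) \<longlonglongrightarrow> 0"
    unfolding \<e>_def by (rule filterlim_compose[OF lim inverse_Suc_at_right])
  then have "(\<lambda>j. ennreal ((L2norm M (\<lambda>w. oscillation (u (\<e> j)) w - L w))\<^sup>2)) \<longlonglongrightarrow> ennreal 0"
    by (simp add: L2_dist_sq_eq[OF oscillation_square_integrable[OF \<e>] L(1)] L2norm_sq)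
  then have "(\<lambda>j. (L2norm M (\<lambda>w. oscillation (u (\<e> j)) w - L w))\<^sup>2) \<longlonglongrightarrow> 0"
    by (subst (asm) tendsto_ennreal_iff) auto
  from tendsto_real_sqrt[OF this]
  have "(\<lambda>j. L2norm M (\<lambda>w. oscillation (u (\<e> j)) w - L w)) \<longlonglongrightarrow> 0" by simp
  from D1_limitD[OF oscillation_expansion[OF u_decay[OF \<e>]] L(2) this]
  obtain e where e: "\<And>n. (\<lambda>j. \<integral>w. (component (u (\<e> j)) n w)\<^sup>2 \<partial>M) \<longlonglongrightarrow> e n"
    "summable (\<lambda>n. real n * e n)" by blast
  have e0: "0 \<le> e n" for n by (rule LIMSEQ_le_const[OF e(1)]) auto
  let ?f = "\<lambda>n x. case x of (k, l) \<Rightarrow> ennreal (w0 k * w0 l * (gauss_weight k l * (q k l ^ n / fact n)))"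
  have fatou: "(\<integral>\<^sup>+x. ?f n x \<partial>(lborel \<Otimes>\<^sub>M lborel)) \<le> ennreal (e n)" if n: "even n" for n
  proof -
    let ?g = "\<lambda>j x. case x of (k, l) \<Rightarrow> ennreal (u (\<e> j) k * u (\<e> j) l * (gauss_weight k l * (q k l ^ n / fact n)))"
    have "?f n x = liminf (\<lambda>j. ?g j x)" for x
    proof (cases x)
      case (Pair k l)
      have "(\<lambda>j. ennreal (u (\<e> j) k * u (\<e> j) l * (gauss_weight k l * (q k l ^ n / fact n)))) \<longlonglongrightarrow> ennreal (w0 k * w0 l * (gauss_weight k l * (q k l ^ n / fact n)))"
        unfolding \<e>_def by (intro tendsto_intros u_seq_lim)
      from lim_imp_Liminf[OF sequentially_bot this] show ?thesis by (simp add: Pair)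
    qed
    then have "(\<integral>\<^sup>+x. ?f n x \<partial>(lborel \<Otimes>\<^sub>M lborel)) = (\<integral>\<^sup>+x. liminf (\<lambda>j. ?g j x) \<partial>(lborel \<Otimes>\<^sub>M lborel))"
      by (intro nn_integral_cong)
    also have "\<dots> \<le> liminf (\<lambda>j. \<integral>\<^sup>+x. ?g j x \<partial>(lborel \<Otimes>\<^sub>M lborel))"
      by (rule nn_integral_liminf) measurable
    also have "\<dots> = liminf (\<lambda>j. ennreal (\<integral>w. (component (u (\<e> j)) n w)\<^sup>2 \<partial>M))"
      by (simp add: component_sq_eq[OF u_decay[OF \<e>] b0 n u_nonneg[OF \<e>]])
    also have "\<dots> = ennreal (e n)"
      by (intro lim_imp_Liminf sequentially_bot tendsto_ennrealI e(1))
    finally show ?thesis .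
  qed
  have "(\<integral>\<^sup>+(k, l). ennreal (w0 k * w0 l * (gauss_weight k l * (q k l * sinh (q k l)))) \<partial>(lborel \<Otimes>\<^sub>M lborel))
     = (\<integral>\<^sup>+x. (\<Sum>n. if even n then ennreal (real n) * ?f n x else 0) \<partial>(lborel \<Otimes>\<^sub>M lborel))"
  proof (rule nn_integral_cong)
    fix x :: "'k \<times> 'k"
    obtain k l where x: "x = (k, l)" by (cases x)
    let ?c = "w0 k * w0 l * gauss_weight k l"
    have c0: "0 \<le> ?c" by (simp add: gauss_weight_pos less_imp_le w0_nonneg)
    have s: "(\<lambda>n. ?c * (if even n then real n * (q k l ^ n / fact n) else 0)) sums (?c * (q k l * sinh (q k l)))"
      by (intro sums_mult sums_even_n_power_over_fact)
    have "(\<Sum>n. if even n then ennreal (real n) * ennreal (w0 k * w0 l * (gauss_weight k l * (q k l ^ n / fact n))) else 0)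
        = (\<Sum>n. ennreal (?c * (if even n then real n * (q k l ^ n / fact n) else 0)))"
      using c0 by (intro suminf_cong) (auto simp: ennreal_mult'[symmetric] mult_ac)
    also have "\<dots> = ennreal (?c * (q k l * sinh (q k l)))"
      unfolding sums_unique[OF s] using s c0
      by (intro suminf_ennreal2) (auto simp: sums_iff zero_le_even_power intro!: mult_nonneg_nonneg divide_nonneg_nonneg)
    finally show "(case x of (k, l) \<Rightarrow> ennreal (w0 k * w0 l * (gauss_weight k l * (q k l * sinh (q k l)))))
      = (\<Sum>n. if even n then ennreal (real n) * ?f n x else 0)"
      unfolding x prod.case by (simp only: mult.assoc)
  qed
  also have "\<dots> = (\<Sum>n. \<integral>\<^sup>+x. (if even n then ennreal (real n) * ?f n x else 0) \<partial>(lborel \<Otimes>\<^sub>M lborel))"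
    by (rule nn_integral_suminf) measurable
  also have "\<dots> \<le> (\<Sum>n. ennreal (real n * e n))"
  proof (rule suminf_le)
    fix n
    show "(\<integral>\<^sup>+x. (if even n then ennreal (real n) * ?f n x else 0) \<partial>(lborel \<Otimes>\<^sub>M lborel)) \<le> ennreal (real n * e n)"
      using fatou[of n] e0[of n] by (cases "even n") (auto simp: nn_integral_cmult ennreal_mult intro!: mult_left_mono)
  qed auto
  also have "\<dots> = ennreal (\<Sum>n. real n * e n)"
    using e0 e(2) by (intro suminf_ennreal2) auto
  also have "\<dots> < \<infinity>" by simp
  finally show ?thesis .
qed

end

section \<open>Gaussian integrals and integrable singularities\<close>

lemma nn_integral_affine:
  fixes f :: "'a::euclidean_space \<Rightarrow> ennreal"
  assumes [measurable]: "f \<in> borel_measurable borel" and c: "c \<noteq> 0"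
  shows "(\<integral>\<^sup>+x. f (t + c *\<^sub>R x) \<partial>lborel) = ennreal (inverse (\<bar>c\<bar> ^ DIM('a))) * (\<integral>\<^sup>+x. f x \<partial>lborel)"
proof -
  have p: "\<bar>c\<bar> ^ DIM('a) > 0" using c by simp
  have "(\<integral>\<^sup>+x. f x \<partial>lborel) = (\<integral>\<^sup>+x. f x \<partial>density (distr lborel borel (\<lambda>x. t + c *\<^sub>R x)) (\<lambda>_. \<bar>c\<bar> ^ DIM('a)))"
    by (subst lborel_affine[OF c, of t]) simp
  also have "\<dots> = ennreal (\<bar>c\<bar> ^ DIM('a)) * (\<integral>\<^sup>+x. f (t + c *\<^sub>R x) \<partial>lborel)"
    by (subst nn_integral_density) (auto simp: nn_integral_distr nn_integral_cmult)
  finally have "ennreal (inverse (\<bar>c\<bar> ^ DIM('a))) * (\<integral>\<^sup>+x. f x \<partial>lborel)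
     = (ennreal (inverse (\<bar>c\<bar> ^ DIM('a))) * ennreal (\<bar>c\<bar> ^ DIM('a))) * (\<integral>\<^sup>+x. f (t + c *\<^sub>R x) \<partial>lborel)"
    by (simp add: mult.assoc)
  also have "ennreal (inverse (\<bar>c\<bar> ^ DIM('a))) * ennreal (\<bar>c\<bar> ^ DIM('a)) = 1"
    using p by (simp flip: ennreal_mult)
  finally show ?thesis by simp
qed

lemma nn_integral_gauss_finite_real:
  assumes "a > 0"
  shows "(\<integral>\<^sup>+x. ennreal (exp (- a * x\<^sup>2)) \<partial>lborel) < \<infinity>"
proof -
  define s where "s = sqrt (1 / (2 * a))"
  have s: "s > 0" "s\<^sup>2 = 1 / (2 * a)" using assms by (auto simp: s_def)
  have "exp (- a * x\<^sup>2) = sqrt (2 * pi * s\<^sup>2) * normal_density 0 s x" for x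
    using s assms by (simp add: normal_density_def)
  then have "(\<integral>\<^sup>+x. ennreal (exp (- a * x\<^sup>2)) \<partial>lborel) = (\<integral>\<^sup>+x. ennreal (norm (sqrt (2 * pi * s\<^sup>2) * normal_density 0 s x)) \<partial>lborel)"
    by (simp add: abs_mult)
  also have "\<dots> < \<infinity>"
    using integrable_mult_right[OF integrable_normal_density[OF s(1), of 0], of "sqrt (2 * pi * s\<^sup>2)"]
    unfolding integrable_iff_bounded by blast
  finally show ?thesis .
qed

lemma nn_integral_gauss_finite:
  assumes "a > 0"
  shows "(\<integral>\<^sup>+x. ennreal (exp (- a * (norm x)\<^sup>2)) \<partial>(lborel :: 'a::euclidean_space measure)) < \<infinity>"
proof -
  have "exp (- a * (norm x)\<^sup>2) = (\<Prod>b\<in>Basis. exp (- a * (x \<bullet> b)\<^sup>2))" for x :: 'a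
  proof -
    have "(norm x)\<^sup>2 = (\<Sum>b\<in>Basis. (x \<bullet> b)\<^sup>2)"
      unfolding power2_norm_eq_inner euclidean_inner[of x x] by (simp add: power2_eq_square)
    then show ?thesis by (simp add: exp_sum[symmetric] sum_distrib_left)
  qed
  then have "(\<integral>\<^sup>+x. ennreal (exp (- a * (norm x)\<^sup>2)) \<partial>(lborel :: 'a measure))
     = (\<integral>\<^sup>+x. (\<Prod>b\<in>Basis. ennreal (exp (- a * (x \<bullet> b)\<^sup>2))) \<partial>(lborel :: 'a measure))"
    by (simp add: prod_ennreal)
  also have "\<dots> = (\<Prod>b\<in>(Basis :: 'a set). \<integral>\<^sup>+x. ennreal (exp (- a * x\<^sup>2)) \<partial>lborel)"
    by (rule nn_integral_lborel_prod) auto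
  also have "\<dots> < \<infinity>"
    using nn_integral_gauss_finite_real[OF assms] by (simp add: power_less_top_ennreal)
  finally show ?thesis .
qed

definition gauss_moment :: "'a::euclidean_space itself \<Rightarrow> real" where
  "gauss_moment _ = enn2real (\<integral>\<^sup>+x. ennreal ((1 + (norm x)\<^sup>2) * exp (- (norm x)\<^sup>2 / 2)) \<partial>(lborel :: 'a measure))"

lemma gauss_moment:
  "(\<integral>\<^sup>+x. ennreal ((1 + (norm x)\<^sup>2) * exp (- (norm x)\<^sup>2 / 2)) \<partial>(lborel :: 'a::euclidean_space measure))
    = ennreal (gauss_moment TYPE('a))"
proof -
  have "(1 + y) * exp (- y / 2) \<le> 4 * exp (- (1/4) * y)" if "y \<ge> 0" for y :: real
  proof -
    have "1 + y \<le> 4 * exp (y / 4)" using exp_ge_add_one_self[of "y / 4"] that by linarith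
    then have "(1 + y) * exp (- y / 2) \<le> 4 * exp (y / 4) * exp (- y / 2)" by (rule mult_right_mono) simp
    also have "\<dots> = 4 * exp (- (1/4) * y)" by (simp add: mult.assoc flip: exp_add)
    finally show ?thesis .
  qed
  then have "(\<integral>\<^sup>+x. ennreal ((1 + (norm x)\<^sup>2) * exp (- (norm x)\<^sup>2 / 2)) \<partial>(lborel :: 'a measure))
     \<le> (\<integral>\<^sup>+x. 4 * ennreal (exp (- (1/4) * (norm x)\<^sup>2)) \<partial>(lborel :: 'a measure))"
    by (intro nn_integral_mono) (auto simp: ennreal_mult'[symmetric] ennreal_numeral[symmetric] simp del: ennreal_numeral intro!: ennreal_leI)
  also have "\<dots> < \<infinity>"
    using nn_integral_gauss_finite[of "1/4", where ?'a='a] by (simp add: nn_integral_cmult ennreal_mult_less_top)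
  finally show ?thesis by (simp add: gauss_moment_def)
qed

lemma gauss_moment_nonneg: "0 \<le> gauss_moment TYPE('a::euclidean_space)"
  by (simp add: gauss_moment_def)

lemma nn_integral_shifted_gauss:
  assumes "c > 0"
  shows "(\<integral>\<^sup>+x. ennreal ((1 + (norm (c *\<^sub>R x - y))\<^sup>2) * exp (- (norm (c *\<^sub>R x - y))\<^sup>2 / 2)) \<partial>(lborel :: 'a::euclidean_space measure))
    = ennreal (inverse (c ^ DIM('a)) * gauss_moment TYPE('a))"
proof -
  have "(\<integral>\<^sup>+x. ennreal ((1 + (norm (c *\<^sub>R x - y))\<^sup>2) * exp (- (norm (c *\<^sub>R x - y))\<^sup>2 / 2)) \<partial>(lborel :: 'a measure))
    = (\<integral>\<^sup>+x. ennreal ((1 + (norm (- y + c *\<^sub>R x))\<^sup>2) * exp (- (norm (- y + c *\<^sub>R x))\<^sup>2 / 2)) \<partial>(lborel :: 'a measure))"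
    by (simp add: algebra_simps)
  also have "\<dots> = ennreal (inverse (\<bar>c\<bar> ^ DIM('a))) * ennreal (gauss_moment TYPE('a))"
    unfolding gauss_moment[symmetric] using assms
    by (intro nn_integral_affine[where f="\<lambda>x. ennreal ((1 + (norm x)\<^sup>2) * exp (- (norm x)\<^sup>2 / 2))"]) auto
  also have "\<dots> = ennreal (inverse (c ^ DIM('a)) * gauss_moment TYPE('a))"
    using assms gauss_moment_nonneg[where ?'a='a] by (simp add: ennreal_mult)
  finally show ?thesis .
qed

lemma powr_neg_half_add: assumes v: "0 < (v::real)" shows "v powr (- (d + 2) / 2) = inverse (v powr (d / 2)) * inverse v"
proof -
  have "v powr (- (d + 2) / 2) = v powr (- (d / 2) + - 1)"
    by (rule arg_cong[of _ _ "\<lambda>x. v powr x"]) (simp add: field_simps)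
  also have "\<dots> = v powr (- (d / 2)) * v powr (- 1)" by (rule powr_add)
  also have "\<dots> = inverse (v powr (d / 2)) * inverse v"
    using v powr_minus[of v "d / 2"] powr_minus[of v 1] by simp
  finally show ?thesis .
qed
lemma sqrt_power_eq_powr: assumes v: "0 < (v::real)" shows "sqrt v ^ d = v powr (real d / 2)"
proof -
  have "sqrt v ^ d = sqrt v powr real d" using v by (subst powr_realpow) auto
  then show ?thesis using v powr_powr[of v "1/2" "real d"] by (simp add: powr_half_sqrt)
qed

text \<open>The scaling \<open>x \<mapsto> x / sqrt v\<close> yields the power \<open>-d/2\<close> of \<open>v\<close>; the polynomial factor costs a further
  power \<open>v\<^bsup>-1\<^esup>\<close>.  This is the source of the \<open>2\<close> in \<open>d + 2\<close>.\<close>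

lemma nn_integral_scaled_gauss_le:
  assumes v: "0 < v" "v \<le> A"
  shows "(\<integral>\<^sup>+x. ennreal ((1 + (norm x)\<^sup>2) * exp (- v * (norm x)\<^sup>2 / 2)) \<partial>(lborel :: 'a::euclidean_space measure))
    \<le> ennreal ((1 + A) * gauss_moment TYPE('a) * v powr (- (real DIM('a) + 2) / 2))"
proof -
  have p: "(1 + (norm x)\<^sup>2) * exp (- v * (norm x)\<^sup>2 / 2)
     \<le> (1 + A) / v * ((1 + (norm (sqrt v *\<^sub>R x - 0))\<^sup>2) * exp (- (norm (sqrt v *\<^sub>R x - 0))\<^sup>2 / 2))" for x :: 'a
  proof -
    have "1 + (norm x)\<^sup>2 \<le> (1 + A) / v * (1 + v * (norm x)\<^sup>2)"
    proof -
      have "v * (1 + (norm x)\<^sup>2) \<le> (1 + A) * (1 + v * (norm x)\<^sup>2)"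
        using v by (auto simp: algebra_simps intro!: add_increasing add_increasing2 mult_nonneg_nonneg)
      then show ?thesis using v by (simp add: field_simps)
    qed
    then have "(1 + (norm x)\<^sup>2) * exp (- v * (norm x)\<^sup>2 / 2) \<le> (1 + A) / v * (1 + v * (norm x)\<^sup>2) * exp (- v * (norm x)\<^sup>2 / 2)"
      by (rule mult_right_mono) simp
    then show ?thesis using v by (simp add: power_mult_distrib mult.assoc)
  qed
  have "(\<integral>\<^sup>+x. ennreal ((1 + (norm x)\<^sup>2) * exp (- v * (norm x)\<^sup>2 / 2)) \<partial>(lborel :: 'a measure))
    \<le> (\<integral>\<^sup>+x. ennreal ((1 + A) / v) * ennreal ((1 + (norm (sqrt v *\<^sub>R x - 0))\<^sup>2) * exp (- (norm (sqrt v *\<^sub>R x - 0))\<^sup>2 / 2)) \<partial>(lborel :: 'a measure))"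
  proof (intro nn_integral_mono)
    fix x :: 'a
    show "ennreal ((1 + (norm x)\<^sup>2) * exp (- v * (norm x)\<^sup>2 / 2))
      \<le> ennreal ((1 + A) / v) * ennreal ((1 + (norm (sqrt v *\<^sub>R x - 0))\<^sup>2) * exp (- (norm (sqrt v *\<^sub>R x - 0))\<^sup>2 / 2))"
      using v by (subst ennreal_mult[symmetric]) (auto simp only: intro!: ennreal_leI p divide_nonneg_nonneg mult_nonneg_nonneg add_nonneg_nonneg
            zero_le_power2 exp_ge_zero)
  qed
  also have "\<dots> = ennreal ((1 + A) / v)
      * (\<integral>\<^sup>+x. ennreal ((1 + (norm (sqrt v *\<^sub>R x - 0))\<^sup>2) * exp (- (norm (sqrt v *\<^sub>R x - 0))\<^sup>2 / 2)) \<partial>(lborel :: 'a measure))"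
    by (rule nn_integral_cmult) simp
  also have "\<dots> = ennreal ((1 + A) / v) * ennreal (inverse (sqrt v ^ DIM('a)) * gauss_moment TYPE('a))"
    by (subst nn_integral_shifted_gauss) (use v in auto)
  also have "\<dots> = ennreal ((1 + A) / v * (inverse (sqrt v ^ DIM('a)) * gauss_moment TYPE('a)))"
    using v gauss_moment_nonneg[where ?'a='a] by (intro ennreal_mult[symmetric]) auto
  also have "(1 + A) / v * (inverse (sqrt v ^ DIM('a)) * gauss_moment TYPE('a))
     = (1 + A) * gauss_moment TYPE('a) * v powr (- (real DIM('a) + 2) / 2)"
  proof -
    show ?thesis
      unfolding sqrt_power_eq_powr[OF v(1)] powr_neg_half_add[OF v(1)] by (simp only: divide_inverse mult_ac)
  qed
  finally show ?thesis .
qed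

lemma ennreal_le_add:
  assumes "x \<le> y + z" "0 \<le> y" "0 \<le> z"
  shows "ennreal x \<le> ennreal y + ennreal z"
  unfolding ennreal_plus[OF assms(2,3), symmetric] by (rule ennreal_leI[OF assms(1)])

lemma ennreal_double:
  assumes "0 \<le> B" "0 \<le> h" "0 \<le> K"
  shows "ennreal (2 * B * h) * ennreal K + ennreal (2 * B * h) * ennreal K = ennreal (4 * B * K) * ennreal h"
proof -
  have "ennreal (2 * B * h) * ennreal K = ennreal (2 * B * h * K)"
    using assms by (intro ennreal_mult[symmetric]) auto
  moreover have "ennreal (2 * B * h * K) + ennreal (2 * B * h * K) = ennreal (2 * B * h * K + 2 * B * h * K)"
    using assms by (intro ennreal_plus[symmetric]) auto
  moreover have "2 * B * h * K + 2 * B * h * K = 4 * B * K * h" by simp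
  moreover have "ennreal (4 * B * K) * ennreal h = ennreal (4 * B * K * h)"
    using assms by (intro ennreal_mult[symmetric]) auto
  ultimately show ?thesis by metis
qed

text \<open>Completing the square in \<open>\<xi>\<close> leaves the conditional variance as the quadratic form in \<open>\<eta>\<close>.
  Here \<open>a\<close>, \<open>c\<close> are the variances at two points, \<open>b\<close> their covariance and \<open>v\<close> a lower bound of the
  conditional variance.\<close>

lemma gaussian_pair_integral_bound:
  fixes a b c v A :: real
  assumes a: "0 < a" and v: "0 < v" "v \<le> c - b\<^sup>2 / a" and A: "c \<le> A"
  shows "(\<integral>\<^sup>+\<eta>. \<integral>\<^sup>+\<xi>. ennreal (exp (- (a * (norm \<xi>)\<^sup>2 + c * (norm \<eta>)\<^sup>2) / 2)
        * ((1 + \<bar>b * (\<xi> \<bullet> \<eta>)\<bar>) * exp \<bar>b * (\<xi> \<bullet> \<eta>)\<bar>)) \<partial>(lborel :: 'a::euclidean_space measure) \<partial>(lborel :: 'a measure))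
    \<le> ennreal (4 * (1 + A)\<^sup>2 * (gauss_moment TYPE('a))\<^sup>2 * a powr (- real DIM('a) / 2) * v powr (- (real DIM('a) + 2) / 2))"
proof -
  define s where "s = sqrt a"
  have s: "s > 0" "s\<^sup>2 = a" using a by (auto simp: s_def)
  have b2: "b\<^sup>2 / a \<ge> 0" using a by simp
  have "v \<le> c \<and> v \<le> A \<and> 0 < A \<and> \<beta> \<le> A" if "0 < v" "v \<le> c - \<beta>" "c \<le> A" "0 \<le> \<beta>" for \<beta>
    using that by auto
  from this[OF v A b2] have c: "v \<le> c" "v \<le> A" "0 < A" "b\<^sup>2 / a \<le> A" by blast+
  let ?g = "\<lambda>x :: 'a. (1 + (norm x)\<^sup>2) * exp (- (norm x)\<^sup>2 / 2)"
  let ?h = "\<lambda>\<eta> :: 'a. (1 + (norm \<eta>)\<^sup>2) * exp (- v * (norm \<eta>)\<^sup>2 / 2)"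
  have sq: "(norm (s *\<^sub>R \<xi> - (\<tau> * (b / s)) *\<^sub>R \<eta>))\<^sup>2 = a * (norm \<xi>)\<^sup>2 - 2 * (\<tau> * (b * (\<xi> \<bullet> \<eta>))) + b\<^sup>2 / a * (norm \<eta>)\<^sup>2"
    if "\<tau> = 1 \<or> \<tau> = -1" for \<tau> and \<xi> \<eta> :: 'a
  proof -
    have gen: "(norm (s *\<^sub>R \<xi> - k *\<^sub>R \<eta>))\<^sup>2 = s\<^sup>2 * (norm \<xi>)\<^sup>2 - 2 * ((s * k) * (\<xi> \<bullet> \<eta>)) + k\<^sup>2 * (norm \<eta>)\<^sup>2" for k
      unfolding power2_norm_eq_inner
      by (simp add: inner_diff_left inner_diff_right inner_commute[of \<eta> \<xi>] power2_eq_square algebra_simps)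
    have e: "s * (\<tau> * (b / s)) = \<tau> * b" "(\<tau> * (b / s))\<^sup>2 = b\<^sup>2 / a"
      using s that by (auto simp: power_mult_distrib power_divide)
    show ?thesis unfolding gen e by (simp only: s(2) mult.assoc)
  qed
  have shift: "- (A1 + c * y) / 2 + T \<le> - (A1 - 2 * T + \<beta> * y) / 2 + - v * y / 2"
    if "v * y \<le> (c - \<beta>) * y" for A1 y T \<beta> :: real
    using that by (simp add: left_diff_distrib add_divide_distrib diff_divide_distrib)
  \<comment> \<open>The sign \<open>\<tau>\<close> disposes of the absolute value: \<open>exp |z| \<le> exp z + exp (-z)\<close>, and each of the two terms
    is a Gaussian in \<open>\<xi>\<close> centred at a multiple of \<open>\<eta>\<close>.\<close>
  have expo: "exp (- (a * (norm \<xi>)\<^sup>2 + c * (norm \<eta>)\<^sup>2) / 2) * exp (\<tau> * (b * (\<xi> \<bullet> \<eta>)))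
      \<le> exp (- (norm (s *\<^sub>R \<xi> - (\<tau> * (b / s)) *\<^sub>R \<eta>))\<^sup>2 / 2) * exp (- v * (norm \<eta>)\<^sup>2 / 2)"
    if \<tau>: "\<tau> = 1 \<or> \<tau> = -1" for \<tau> and \<xi> \<eta> :: 'a
  proof -
    have "v * (norm \<eta>)\<^sup>2 \<le> (c - b\<^sup>2 / a) * (norm \<eta>)\<^sup>2" using v by (intro mult_right_mono) auto
    from shift[OF this] show ?thesis
      unfolding sq[OF \<tau>] exp_add[symmetric] exp_le_cancel_iff .
  qed
  have poly: "1 + \<bar>b * (\<xi> \<bullet> \<eta>)\<bar> \<le> 2 * (1 + A) * ((1 + (norm (s *\<^sub>R \<xi> - (\<tau> * (b / s)) *\<^sub>R \<eta>))\<^sup>2) * (1 + (norm \<eta>)\<^sup>2))"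
    if \<tau>: "\<tau> = 1 \<or> \<tau> = -1" for \<tau> and \<xi> \<eta> :: 'a
  proof -
    let ?\<zeta> = "s *\<^sub>R \<xi> - (\<tau> * (b / s)) *\<^sub>R \<eta>"
    have e: "b * (\<xi> \<bullet> \<eta>) = (b / s) * (?\<zeta> \<bullet> \<eta>) + \<tau> * (b\<^sup>2 / a) * (norm \<eta>)\<^sup>2"
    proof -
      have z: "?\<zeta> \<bullet> \<eta> = s * (\<xi> \<bullet> \<eta>) - (\<tau> * (b / s)) * (norm \<eta>)\<^sup>2"
        by (simp add: inner_diff_left power2_norm_eq_inner)
      have "k * (s * x - (\<tau> * k) * y) + \<tau> * (k * k) * y = (k * s) * x" for k x y
        by (simp add: algebra_simps)
      from this[of "b / s"] show ?thesis
        unfolding z using s by (simp add: power2_eq_square)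
    qed
    have "\<bar>b / s\<bar> \<le> 1 + A"
    proof (rule power2_le_imp_le)
      have "\<bar>b / s\<bar>\<^sup>2 = b\<^sup>2 / a" using s by (simp add: power_divide)
      also have "\<dots> \<le> A" by (rule c)
      also have "A \<le> (1 + A)\<^sup>2" using c(3) by (simp add: power2_eq_square algebra_simps)
      finally show "\<bar>b / s\<bar>\<^sup>2 \<le> (1 + A)\<^sup>2" .
    qed (use c in auto)
    moreover have "\<bar>?\<zeta> \<bullet> \<eta>\<bar> \<le> ((norm ?\<zeta>)\<^sup>2 + (norm \<eta>)\<^sup>2) / 2"
    proof (rule order.trans[OF Cauchy_Schwarz_ineq2])
      show "norm ?\<zeta> * norm \<eta> \<le> ((norm ?\<zeta>)\<^sup>2 + (norm \<eta>)\<^sup>2) / 2"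
        using sum_squares_bound[of "norm ?\<zeta>" "norm \<eta>"] by simp
    qed
    ultimately have 1: "\<bar>(b / s) * (?\<zeta> \<bullet> \<eta>)\<bar> \<le> (1 + A) * (((norm ?\<zeta>)\<^sup>2 + (norm \<eta>)\<^sup>2) / 2)"
      unfolding abs_mult using c by (intro mult_mono) auto
    have 2: "\<bar>\<tau> * (b\<^sup>2 / a) * (norm \<eta>)\<^sup>2\<bar> \<le> (1 + A) * (norm \<eta>)\<^sup>2"
    proof -
      have "\<bar>\<tau> * (b\<^sup>2 / a) * (norm \<eta>)\<^sup>2\<bar> = (b\<^sup>2 / a) * (norm \<eta>)\<^sup>2"
        using \<tau> a by (elim disjE) (simp_all add: abs_mult)
      also have "\<dots> \<le> (1 + A) * (norm \<eta>)\<^sup>2"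
        using c(4) by (intro mult_right_mono) auto
      finally show ?thesis .
    qed
    have "1 + \<bar>b * (\<xi> \<bullet> \<eta>)\<bar> \<le> 1 + ((1 + A) * (((norm ?\<zeta>)\<^sup>2 + (norm \<eta>)\<^sup>2) / 2) + (1 + A) * (norm \<eta>)\<^sup>2)"
      using add_left_mono[OF order.trans[OF abs_triangle_ineq add_mono[OF 1 2]], of 1]
      by (simp only: e[symmetric])
    also have "\<dots> \<le> 2 * (1 + A) * (1 + (norm ?\<zeta>)\<^sup>2 + (norm \<eta>)\<^sup>2)"
    proof -
      have aux: "1 + (B * ((x + y) / 2) + B * y) \<le> 2 * B * (1 + x + y)"
        if "1 \<le> B" "0 \<le> x" "0 \<le> y" for B x y :: real
      proof -
        have "0 \<le> B * x" "0 \<le> B * y" using that by auto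
        then have "1 + (B * x / 2 + B * y / 2 + B * y) \<le> 2 * B + 2 * (B * x) + 2 * (B * y)"
          using that by linarith
        then show ?thesis by (simp add: distrib_left add_divide_distrib)
      qed
      show ?thesis by (rule aux) (use c in auto)
    qed
    also have "\<dots> \<le> 2 * (1 + A) * ((1 + (norm ?\<zeta>)\<^sup>2) * (1 + (norm \<eta>)\<^sup>2))"
    proof (intro mult_left_mono)
      have "0 \<le> (norm ?\<zeta>)\<^sup>2 * (norm \<eta>)\<^sup>2" by simp
      then show "1 + (norm ?\<zeta>)\<^sup>2 + (norm \<eta>)\<^sup>2 \<le> (1 + (norm ?\<zeta>)\<^sup>2) * (1 + (norm \<eta>)\<^sup>2)"
        by (simp only: distrib_left distrib_right mult_1 mult_1_right)
    qed (use c in auto)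
    finally show ?thesis .
  qed
  have bound: "exp (- (a * (norm \<xi>)\<^sup>2 + c * (norm \<eta>)\<^sup>2) / 2) * ((1 + \<bar>b * (\<xi> \<bullet> \<eta>)\<bar>) * exp \<bar>b * (\<xi> \<bullet> \<eta>)\<bar>)
     \<le> 2 * (1 + A) * ?h \<eta> * ?g (s *\<^sub>R \<xi> - (b / s) *\<^sub>R \<eta>) + 2 * (1 + A) * ?h \<eta> * ?g (s *\<^sub>R \<xi> - (- (b / s)) *\<^sub>R \<eta>)"
    for \<xi> \<eta> :: 'a
  proof -
    let ?z = "b * (\<xi> \<bullet> \<eta>)"
    have part: "exp (- (a * (norm \<xi>)\<^sup>2 + c * (norm \<eta>)\<^sup>2) / 2) * ((1 + \<bar>?z\<bar>) * exp (\<tau> * ?z))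
       \<le> 2 * (1 + A) * ?h \<eta> * ?g (s *\<^sub>R \<xi> - (\<tau> * (b / s)) *\<^sub>R \<eta>)" if \<tau>: "\<tau> = 1 \<or> \<tau> = -1" for \<tau>
    proof -
      have "(1 + \<bar>?z\<bar>) * (exp (- (a * (norm \<xi>)\<^sup>2 + c * (norm \<eta>)\<^sup>2) / 2) * exp (\<tau> * ?z))
         \<le> (2 * (1 + A) * ((1 + (norm (s *\<^sub>R \<xi> - (\<tau> * (b / s)) *\<^sub>R \<eta>))\<^sup>2) * (1 + (norm \<eta>)\<^sup>2)))
           * (exp (- (norm (s *\<^sub>R \<xi> - (\<tau> * (b / s)) *\<^sub>R \<eta>))\<^sup>2 / 2) * exp (- v * (norm \<eta>)\<^sup>2 / 2))"
        using c by (intro mult_mono poly[OF \<tau>] expo[OF \<tau>]) auto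
      then show ?thesis by (simp only: mult_ac)
    qed
    have "exp \<bar>?z\<bar> \<le> exp (1 * ?z) + exp (-1 * ?z)" by (auto simp: abs_if)
    then have "exp (- (a * (norm \<xi>)\<^sup>2 + c * (norm \<eta>)\<^sup>2) / 2) * ((1 + \<bar>?z\<bar>) * exp \<bar>?z\<bar>)
       \<le> exp (- (a * (norm \<xi>)\<^sup>2 + c * (norm \<eta>)\<^sup>2) / 2) * ((1 + \<bar>?z\<bar>) * (exp (1 * ?z) + exp (-1 * ?z)))"
      by (intro mult_left_mono) auto
    also have "\<dots> = exp (- (a * (norm \<xi>)\<^sup>2 + c * (norm \<eta>)\<^sup>2) / 2) * ((1 + \<bar>?z\<bar>) * exp (1 * ?z))
        + exp (- (a * (norm \<xi>)\<^sup>2 + c * (norm \<eta>)\<^sup>2) / 2) * ((1 + \<bar>?z\<bar>) * exp (-1 * ?z))"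
      by (simp only: distrib_left)
    also have "\<dots> \<le> 2 * (1 + A) * ?h \<eta> * ?g (s *\<^sub>R \<xi> - (1 * (b / s)) *\<^sub>R \<eta>) + 2 * (1 + A) * ?h \<eta> * ?g (s *\<^sub>R \<xi> - (-1 * (b / s)) *\<^sub>R \<eta>)"
      by (intro add_mono part) auto
    finally show ?thesis by simp
  qed
  let ?G = "gauss_moment TYPE('a)"
  have h0: "0 \<le> 2 * (1 + A) * ?h \<eta>" for \<eta> using c by (intro mult_nonneg_nonneg) auto
  have inner: "(\<integral>\<^sup>+\<xi>. ennreal (exp (- (a * (norm \<xi>)\<^sup>2 + c * (norm \<eta>)\<^sup>2) / 2) * ((1 + \<bar>b * (\<xi> \<bullet> \<eta>)\<bar>) * exp \<bar>b * (\<xi> \<bullet> \<eta>)\<bar>)) \<partial>lborel)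
     \<le> ennreal (4 * (1 + A) * (inverse (s ^ DIM('a)) * ?G)) * ennreal (?h \<eta>)" for \<eta> :: 'a
  proof -
    have "(\<integral>\<^sup>+\<xi>. ennreal (exp (- (a * (norm \<xi>)\<^sup>2 + c * (norm \<eta>)\<^sup>2) / 2) * ((1 + \<bar>b * (\<xi> \<bullet> \<eta>)\<bar>) * exp \<bar>b * (\<xi> \<bullet> \<eta>)\<bar>)) \<partial>lborel)
       \<le> (\<integral>\<^sup>+\<xi>. (ennreal (2 * (1 + A) * ?h \<eta>) * ennreal (?g (s *\<^sub>R \<xi> - (b / s) *\<^sub>R \<eta>))
          + ennreal (2 * (1 + A) * ?h \<eta>) * ennreal (?g (s *\<^sub>R \<xi> - (- (b / s)) *\<^sub>R \<eta>))) \<partial>lborel)"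
    proof (intro nn_integral_mono)
      fix \<xi> :: 'a
      have g0: "0 \<le> ?g x" for x :: 'a by simp
      show "ennreal (exp (- (a * (norm \<xi>)\<^sup>2 + c * (norm \<eta>)\<^sup>2) / 2) * ((1 + \<bar>b * (\<xi> \<bullet> \<eta>)\<bar>) * exp \<bar>b * (\<xi> \<bullet> \<eta>)\<bar>))
         \<le> ennreal (2 * (1 + A) * ?h \<eta>) * ennreal (?g (s *\<^sub>R \<xi> - (b / s) *\<^sub>R \<eta>))
          + ennreal (2 * (1 + A) * ?h \<eta>) * ennreal (?g (s *\<^sub>R \<xi> - (- (b / s)) *\<^sub>R \<eta>))"
        unfolding ennreal_mult[OF h0 g0, symmetric]
        by (rule ennreal_le_add[OF bound]) (intro mult_nonneg_nonneg h0 g0)+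
    qed
    also have "\<dots> = (\<integral>\<^sup>+\<xi>. ennreal (2 * (1 + A) * ?h \<eta>) * ennreal (?g (s *\<^sub>R \<xi> - (b / s) *\<^sub>R \<eta>)) \<partial>lborel)
        + (\<integral>\<^sup>+\<xi>. ennreal (2 * (1 + A) * ?h \<eta>) * ennreal (?g (s *\<^sub>R \<xi> - (- (b / s)) *\<^sub>R \<eta>)) \<partial>lborel)"
      by (rule nn_integral_add) measurable
    also have "\<dots> = ennreal (2 * (1 + A) * ?h \<eta>) * (\<integral>\<^sup>+\<xi>. ennreal (?g (s *\<^sub>R \<xi> - (b / s) *\<^sub>R \<eta>)) \<partial>lborel)
        + ennreal (2 * (1 + A) * ?h \<eta>) * (\<integral>\<^sup>+\<xi>. ennreal (?g (s *\<^sub>R \<xi> - (- (b / s)) *\<^sub>R \<eta>)) \<partial>lborel)"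
      by (intro arg_cong2[of _ _ _ _ "(+)"] nn_integral_cmult) measurable
    also have "\<dots> = ennreal (2 * (1 + A) * ?h \<eta>) * ennreal (inverse (s ^ DIM('a)) * ?G) + ennreal (2 * (1 + A) * ?h \<eta>) * ennreal (inverse (s ^ DIM('a)) * ?G)"
      unfolding nn_integral_shifted_gauss[OF s(1)] by (rule refl)
    also have "\<dots> = ennreal (4 * (1 + A) * (inverse (s ^ DIM('a)) * ?G)) * ennreal (?h \<eta>)"
      by (rule ennreal_double) (use c s(1) gauss_moment_nonneg[where ?'a='a] in auto)
    finally show ?thesis .
  qed
  have "(\<integral>\<^sup>+\<eta>. \<integral>\<^sup>+\<xi>. ennreal (exp (- (a * (norm \<xi>)\<^sup>2 + c * (norm \<eta>)\<^sup>2) / 2)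
        * ((1 + \<bar>b * (\<xi> \<bullet> \<eta>)\<bar>) * exp \<bar>b * (\<xi> \<bullet> \<eta>)\<bar>)) \<partial>(lborel :: 'a measure) \<partial>(lborel :: 'a measure))
     \<le> (\<integral>\<^sup>+\<eta>. ennreal (4 * (1 + A) * (inverse (s ^ DIM('a)) * ?G)) * ennreal (?h \<eta>) \<partial>lborel)"
    by (intro nn_integral_mono inner)
  also have "\<dots> = ennreal (4 * (1 + A) * (inverse (s ^ DIM('a)) * ?G)) * (\<integral>\<^sup>+\<eta>. ennreal (?h \<eta>) \<partial>lborel)"
    by (rule nn_integral_cmult) auto
  also have "\<dots> \<le> ennreal (4 * (1 + A) * (inverse (s ^ DIM('a)) * ?G)) * ennreal ((1 + A) * ?G * v powr (- (real DIM('a) + 2) / 2))"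
    by (intro mult_left_mono nn_integral_scaled_gauss_le v(1) c) auto
  also have "\<dots> = ennreal (4 * (1 + A)\<^sup>2 * ?G\<^sup>2 * a powr (- real DIM('a) / 2) * v powr (- (real DIM('a) + 2) / 2))"
  proof -
    have "inverse (s ^ DIM('a)) = a powr (- real DIM('a) / 2)"
      using powr_minus[of a "real DIM('a) / 2"] by (simp add: s_def sqrt_power_eq_powr[OF a])
    then have e: "4 * (1 + A)\<^sup>2 * ?G\<^sup>2 * a powr (- real DIM('a) / 2) * v powr (- (real DIM('a) + 2) / 2)
      = (4 * (1 + A) * (inverse (s ^ DIM('a)) * ?G)) * ((1 + A) * ?G * v powr (- (real DIM('a) + 2) / 2))"
      by (simp only: power2_eq_square mult_ac)
    show ?thesis unfolding e
      using c s(1) gauss_moment_nonneg[where ?'a='a] by (intro ennreal_mult[symmetric]) auto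
  qed
  finally show ?thesis .
qed

lemma nn_integral_vec_prod:
  fixes f :: "'n::finite \<Rightarrow> real \<Rightarrow> ennreal"
  assumes [measurable]: "\<And>j. f j \<in> borel_measurable borel"
  shows "(\<integral>\<^sup>+x. (\<Prod>j\<in>UNIV. f j (x $ j)) \<partial>(lborel :: (real^'n) measure)) = (\<Prod>j\<in>UNIV. \<integral>\<^sup>+x. f j x \<partial>lborel)"
proof -
  define i where "i b = (THE j. b = axis j (1::real))" for b :: "real^'n"
  have i: "i (axis j 1) = j" for j
    unfolding i_def by (rule the_equality) (auto simp: axis_eq_axis)
  have B: "(Basis :: (real^'n) set) = range (\<lambda>j. axis j 1)"
    by (auto simp: Basis_vec_def)
  have inj: "inj (\<lambda>j. axis j (1::real) :: real^'n)" by (auto simp: inj_on_def axis_eq_axis)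
  have "(\<Prod>b\<in>(Basis :: (real^'n) set). g b) = (\<Prod>j\<in>UNIV. g (axis j 1))" for g :: "real^'n \<Rightarrow> ennreal"
    unfolding B by (subst prod.reindex[OF inj]) simp
  note P = this
  have "(\<integral>\<^sup>+x. (\<Prod>b\<in>Basis. f (i b) (x \<bullet> b)) \<partial>(lborel :: (real^'n) measure)) = (\<Prod>b\<in>(Basis :: (real^'n) set). \<integral>\<^sup>+x. f (i b) x \<partial>lborel)"
    by (rule nn_integral_lborel_prod) auto
  then show ?thesis unfolding P by (simp add: i inner_axis)
qed

lemma AE_component_neq: "AE t in (lborel :: (real^'n) measure). t $ j \<noteq> c"
proof -
  have "negligible {t :: real^'n. t \<bullet> axis j 1 = c}"
    by (rule negligible_standard_hyperplane) (auto simp: Basis_vec_def)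
  then have "{t :: real^'n. t $ j = c} \<in> null_sets (completion lborel)"
    by (simp add: inner_axis negligible_iff_null_sets)
  from AE_not_in[OF this] show ?thesis by (simp add: AE_completion_iff)
qed

definition singular_mass :: "real \<Rightarrow> ennreal" where
  "singular_mass p = (\<integral>\<^sup>+x. ennreal (\<bar>x\<bar> powr - p) * indicator {-1..1} x \<partial>lborel)"

lemma singular_mass_finite:
  assumes "p < 1"
  shows "singular_mass p < \<infinity>"
proof -
  let ?g = "\<lambda>x :: real. ennreal (x powr - p) * indicator {0..1} x"
  have g: "(\<integral>\<^sup>+x. ?g x \<partial>lborel) = ennreal (1 powr (- p + 1) / (- p + 1))"
    by (rule nn_integral_has_integral_lebesgue'[OF _ has_integral_powr_from_0]) (use assms in auto)
  have g': "(\<integral>\<^sup>+x. ?g (0 + (-1) * x) \<partial>lborel) = (\<integral>\<^sup>+x. ?g x \<partial>lborel)"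
    using nn_integral_real_affine[of ?g "-1" 0] by simp
  have "singular_mass p \<le> (\<integral>\<^sup>+x. ?g x + ?g (0 + (-1) * x) \<partial>lborel)"
    unfolding singular_mass_def by (intro nn_integral_mono) (auto simp: indicator_def)
  also have "\<dots> = (\<integral>\<^sup>+x. ?g x \<partial>lborel) + (\<integral>\<^sup>+x. ?g (0 + (-1) * x) \<partial>lborel)"
    by (rule nn_integral_add) auto
  also have "\<dots> < \<infinity>" unfolding g' g by simp
  finally show ?thesis .
qed

lemma singular_integral_le:
  assumes "c \<in> {0..1}"
  shows "(\<integral>\<^sup>+t. ennreal (\<bar>c - t\<bar> powr - p) * indicator {0..1} t \<partial>lborel) \<le> singular_mass p"
proof -
  have "(\<integral>\<^sup>+t. ennreal (\<bar>c - t\<bar> powr - p) * indicator {0..1} t \<partial>lborel)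
      = (\<integral>\<^sup>+u. ennreal (\<bar>c - (c + 1 * u)\<bar> powr - p) * indicator {0..1} (c + 1 * u) \<partial>lborel)"
    using nn_integral_real_affine[of "\<lambda>t. ennreal (\<bar>c - t\<bar> powr - p) * indicator {0..1} t" 1 c] by simp
  also have "\<dots> \<le> singular_mass p"
    unfolding singular_mass_def using assms by (intro nn_integral_mono) (auto simp: indicator_def)
  finally show ?thesis .
qed

text \<open>Each summand bounds the sum from below, and the exponents \<open>\<kappa>/(2 H\<^sub>j Q)\<close> add up to \<open>\<kappa>/2\<close>;
  this distributes the singularity evenly over the coordinates.\<close>

lemma anisotropic_sum_powr_le:
  fixes y H :: "'n::finite \<Rightarrow> real"
  assumes y: "\<And>j. 0 < y j" and H: "\<And>j. 0 < H j" and \<kappa>: "0 \<le> \<kappa>"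
  defines "Q \<equiv> \<Sum>j\<in>UNIV. 1 / H j"
  shows "(\<Sum>j\<in>UNIV. y j powr (2 * H j)) powr (- \<kappa> / 2) \<le> (\<Prod>j\<in>UNIV. y j powr (- (\<kappa> / Q)))"
proof -
  let ?m = "\<Sum>j\<in>UNIV. y j powr (2 * H j)"
  have Q: "Q > 0" unfolding Q_def using H by (intro sum_pos) auto
  have m: "?m > 0" using y by (intro sum_pos) (auto simp: less_le)
  have "(\<Sum>j\<in>UNIV. - (\<kappa> / (2 * H j * Q))) = (\<Sum>j\<in>UNIV. - (\<kappa> / (2 * Q)) * (1 / H j))"
    by (intro sum.cong refl) simp
  also have "\<dots> = - (\<kappa> / (2 * Q)) * Q"
    by (simp only: Q_def sum_distrib_left)
  also have "\<dots> = - \<kappa> / 2" using Q by simp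
  finally have "?m powr (- \<kappa> / 2) = (\<Prod>j\<in>UNIV. ?m powr (- (\<kappa> / (2 * H j * Q))))"
    using m by (simp add: powr_sum[symmetric] less_imp_neq)
  also have "\<dots> \<le> (\<Prod>j\<in>UNIV. y j powr (- (\<kappa> / Q)))"
  proof (intro prod_mono conjI)
    fix j :: 'n
    have Hj: "H j > 0" by (rule H)
    have "y j powr (2 * H j) \<le> ?m" by (rule member_le_sum) auto
    then have "?m powr (- (\<kappa> / (2 * H j * Q))) \<le> (y j powr (2 * H j)) powr (- (\<kappa> / (2 * H j * Q)))"
      using y[of j] Hj Q \<kappa> by (intro powr_mono2') (auto simp: less_le)
    also have "\<dots> = y j powr (- (\<kappa> / Q))" using Hj Q by (simp add: powr_powr)
    finally show "?m powr (- (\<kappa> / (2 * H j * Q))) \<le> y j powr (- (\<kappa> / Q))" .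
  qed simp
  finally show ?thesis .
qed

lemma indicator_unit_cube: "indicator unit_cube (t :: real^'n) = (\<Prod>j\<in>UNIV. indicator {0..1} (t $ j) :: ennreal)"
proof (cases "t \<in> unit_cube")
  case True
  then show ?thesis by (auto simp: unit_cube_def mem_box_cart indicator_def intro!: prod.neutral[symmetric])
next
  case False
  then obtain j where "t $ j \<notin> {0..1}" by (auto simp: unit_cube_def mem_box_cart)
  then have "(\<Prod>j\<in>UNIV. indicator {0..1} (t $ j) :: ennreal) = 0"
    by (intro prod_zero) (auto simp: indicator_def intro!: exI[of _ j])
  then show ?thesis using False by simp
qed

lemma unit_cube_measurable [measurable]: "unit_cube \<in> sets borel"
  by (simp add: unit_cube_def)

lemma variance_singularity_integrable:
  fixes H :: "real^'n"
  assumes H: "\<And>j. 0 < H $ j" and \<kappa>: "0 \<le> \<kappa>" "\<kappa> < (\<Sum>j\<in>UNIV. 1 / H $ j)"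
  shows "(\<integral>\<^sup>+s. ennreal ((\<Sum>j\<in>UNIV. \<bar>s $ j\<bar> powr (2 * H $ j)) powr (- \<kappa> / 2)) * indicator unit_cube s \<partial>lborel) < \<infinity>"
proof -
  define p where "p = \<kappa> / (\<Sum>j\<in>UNIV. 1 / H $ j)"
  have p1: "p < 1" using \<kappa> by (simp add: p_def field_simps)
  have "AE s in (lborel :: (real^'n) measure). \<forall>j\<in>UNIV. s $ j \<noteq> 0"
    by (rule AE_finite_allI) (auto intro: AE_component_neq)
  then have "AE s in (lborel :: (real^'n) measure).
      ennreal ((\<Sum>j\<in>UNIV. \<bar>s $ j\<bar> powr (2 * H $ j)) powr (- \<kappa> / 2)) * indicator unit_cube s
      \<le> (\<Prod>j\<in>UNIV. ennreal (\<bar>0 - s $ j\<bar> powr - p) * indicator {0..1} (s $ j))"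
  proof eventually_elim
    case (elim s)
    have "(\<Sum>j\<in>UNIV. \<bar>s $ j\<bar> powr (2 * H $ j)) powr (- \<kappa> / 2) \<le> (\<Prod>j\<in>UNIV. \<bar>s $ j\<bar> powr - p)"
      using anisotropic_sum_powr_le[of "\<lambda>j. \<bar>s $ j\<bar>" "\<lambda>j. H $ j" \<kappa>] elim H \<kappa> by (simp add: p_def)
    then show ?case
      unfolding indicator_unit_cube prod.distrib
      by (intro mult_right_mono) (auto simp: prod_ennreal intro: ennreal_leI)
  qed
  then have "(\<integral>\<^sup>+s. ennreal ((\<Sum>j\<in>UNIV. \<bar>s $ j\<bar> powr (2 * H $ j)) powr (- \<kappa> / 2)) * indicator unit_cube s \<partial>lborel)
     \<le> (\<integral>\<^sup>+s. (\<Prod>j\<in>UNIV. ennreal (\<bar>0 - s $ j\<bar> powr - p) * indicator {0..1} (s $ j)) \<partial>(lborel :: (real^'n) measure))"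
    by (rule nn_integral_mono_AE)
  also have "\<dots> = (\<Prod>j\<in>(UNIV :: 'n set). \<integral>\<^sup>+x. ennreal (\<bar>0 - x\<bar> powr - p) * indicator {0..1} x \<partial>lborel)"
    by (rule nn_integral_vec_prod[where f="\<lambda>_ x. ennreal (\<bar>0 - x\<bar> powr - p) * indicator {0..1} x"]) auto
  also have "\<dots> < \<infinity>"
    using order.strict_trans1[OF singular_integral_le singular_mass_finite[OF p1], of 0]
    by (simp add: power_less_top_ennreal)
  finally show ?thesis .
qed

text \<open>The singularity at \<open>t\<^sub>j = 0\<close> and the one at \<open>t\<^sub>j = s\<^sub>j\<close> are separated by
  \<open>min(x, y)\<^bsup>-p\<^esup> \<le> x\<^bsup>-p\<^esup> + y\<^bsup>-p\<^esup>\<close>; the bound is uniform in \<open>s\<close> since \<open>|s\<^sub>j - t\<^sub>j| \<le> 1\<close>.\<close>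

lemma conditional_singularity_bound:
  fixes H :: "real^'n"
  assumes H: "\<And>j. 0 < H $ j" and \<kappa>: "0 \<le> \<kappa>" "\<kappa> < (\<Sum>j\<in>UNIV. 1 / H $ j)"
  obtains C where "C < \<infinity>" "\<And>s. s \<in> unit_cube \<Longrightarrow>
    (\<integral>\<^sup>+t. ennreal ((\<Sum>j\<in>UNIV. min (\<bar>s $ j - t $ j\<bar> powr (2 * H $ j)) (\<bar>t $ j\<bar> powr (2 * H $ j))) powr (- \<kappa> / 2))
        * indicator unit_cube t \<partial>(lborel :: (real^'n) measure)) \<le> C"
proof -
  define p where "p = \<kappa> / (\<Sum>j\<in>UNIV. 1 / H $ j)"
  have p1: "p < 1" using \<kappa> by (simp add: p_def field_simps)
  define C where "C = (\<Prod>j\<in>(UNIV :: 'n set). singular_mass p + singular_mass p)"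
  show ?thesis
  proof (rule that)
    show "C < \<infinity>" using singular_mass_finite[OF p1] by (simp add: C_def power_less_top_ennreal)
    fix s :: "real^'n" assume s: "s \<in> unit_cube"
    let ?f = "\<lambda>j x. ennreal (\<bar>s $ j - x\<bar> powr - p) * indicator {0..1} x + ennreal (\<bar>0 - x\<bar> powr - p) * indicator {0..1} x"
    have "AE t in (lborel :: (real^'n) measure). \<forall>j\<in>UNIV. t $ j \<noteq> 0 \<and> t $ j \<noteq> s $ j"
      by (rule AE_finite_allI) (auto intro: AE_component_neq)
    then have "AE t in (lborel :: (real^'n) measure).
      ennreal ((\<Sum>j\<in>UNIV. min (\<bar>s $ j - t $ j\<bar> powr (2 * H $ j)) (\<bar>t $ j\<bar> powr (2 * H $ j))) powr (- \<kappa> / 2)) * indicator unit_cube t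
      \<le> (\<Prod>j\<in>UNIV. ?f j (t $ j))"
    proof eventually_elim
      case (elim t)
      define y where "y j = min \<bar>s $ j - t $ j\<bar> \<bar>t $ j\<bar>" for j
      have y: "y j > 0" for j
      proof -
        have "t $ j \<noteq> 0" "t $ j \<noteq> s $ j" using elim by auto
        then show ?thesis by (auto simp: y_def)
      qed
      have e: "min (\<bar>s $ j - t $ j\<bar> powr (2 * H $ j)) (\<bar>t $ j\<bar> powr (2 * H $ j)) = y j powr (2 * H $ j)" for j
        unfolding y_def using powr_mono2[of "2 * H $ j" "\<bar>s $ j - t $ j\<bar>" "\<bar>t $ j\<bar>"]
          powr_mono2[of "2 * H $ j" "\<bar>t $ j\<bar>" "\<bar>s $ j - t $ j\<bar>"] H[of j] by (auto simp: min_def)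
      have "(\<Sum>j\<in>UNIV. y j powr (2 * H $ j)) powr (- \<kappa> / 2) \<le> (\<Prod>j\<in>UNIV. y j powr - p)"
        using anisotropic_sum_powr_le[of y "\<lambda>j. H $ j" \<kappa>] y H \<kappa> by (simp add: p_def)
      also have "\<dots> \<le> (\<Prod>j\<in>UNIV. \<bar>s $ j - t $ j\<bar> powr - p + \<bar>0 - t $ j\<bar> powr - p)"
        by (intro prod_mono) (auto simp: y_def min_def)
      finally have *: "ennreal ((\<Sum>j\<in>UNIV. y j powr (2 * H $ j)) powr (- \<kappa> / 2)) \<le> (\<Prod>j\<in>UNIV. ennreal (\<bar>s $ j - t $ j\<bar> powr - p) + ennreal (\<bar>0 - t $ j\<bar> powr - p))"
        by (auto simp: prod_ennreal simp flip: ennreal_plus intro: ennreal_leI)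
      show ?case
        unfolding e indicator_unit_cube distrib_right[symmetric] prod.distrib
        by (intro mult_right_mono *) auto
    qed
    then have "(\<integral>\<^sup>+t. ennreal ((\<Sum>j\<in>UNIV. min (\<bar>s $ j - t $ j\<bar> powr (2 * H $ j)) (\<bar>t $ j\<bar> powr (2 * H $ j))) powr (- \<kappa> / 2))
        * indicator unit_cube t \<partial>(lborel :: (real^'n) measure)) \<le> (\<integral>\<^sup>+t. (\<Prod>j\<in>UNIV. ?f j (t $ j)) \<partial>(lborel :: (real^'n) measure))"
      by (rule nn_integral_mono_AE)
    also have "\<dots> = (\<Prod>j\<in>UNIV. \<integral>\<^sup>+x. ?f j x \<partial>lborel)"
      by (rule nn_integral_vec_prod) auto
    also have "\<dots> \<le> C"
      unfolding C_def
    proof (rule prod_mono_ennreal)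
      fix j :: 'n
      have "s $ j \<in> {0..1}" using s by (auto simp: unit_cube_def mem_box_cart)
      then show "(\<integral>\<^sup>+x. ?f j x \<partial>lborel) \<le> singular_mass p + singular_mass p"
        by (subst nn_integral_add) (auto intro!: add_mono singular_integral_le simp del: diff_0 diff_0_right)
    qed
    finally show "(\<integral>\<^sup>+t. ennreal ((\<Sum>j\<in>UNIV. min (\<bar>s $ j - t $ j\<bar> powr (2 * H $ j)) (\<bar>t $ j\<bar> powr (2 * H $ j))) powr (- \<kappa> / 2))
        * indicator unit_cube t \<partial>(lborel :: (real^'n) measure)) \<le> C" .
  qed
qed

text \<open>The integral over \<open>{norm x \<ge> C}\<close> is invariant under dilation by \<open>2\<close>, so it cannot be finite:
  the shell in between has positive mass.\<close>

lemma nn_integral_norm_powr_outside_ball: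
  assumes C: "C > 0"
  shows "(\<integral>\<^sup>+x. ennreal (norm x powr - real DIM('a)) * indicator {x. C \<le> norm x} x \<partial>(lborel :: 'a::euclidean_space measure)) = \<infinity>"
proof (rule ccontr)
  let ?d = "DIM('a)"
  let ?f = "\<lambda>c x. ennreal (norm (x::'a) powr - real ?d) * indicator {x. c \<le> norm x} x"
  assume "(\<integral>\<^sup>+x. ?f C x \<partial>lborel) \<noteq> \<infinity>"
  then have fin: "(\<integral>\<^sup>+x. ?f C x \<partial>lborel) < \<infinity>" by (simp add: top.not_eq_extremum)
  have [measurable]: "ball 0 c \<in> sets (borel :: 'a measure)" for c by auto
  have fC [measurable]: "?f c \<in> borel_measurable borel" for c by measurable
  have "(\<integral>\<^sup>+x. ?f (2 * C) (0 + 2 *\<^sub>R x) \<partial>lborel) = ennreal (inverse (\<bar>2\<bar> ^ ?d)) * (\<integral>\<^sup>+x. ?f (2 * C) x \<partial>lborel)"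
    by (rule nn_integral_affine) auto
  moreover have "?f (2 * C) (0 + 2 *\<^sub>R x) = ennreal (inverse (\<bar>2\<bar> ^ ?d)) * ?f C x" for x :: 'a
    by (auto simp: indicator_def powr_mult powr_minus powr_realpow ennreal_mult)
  ultimately have "ennreal (inverse (\<bar>2\<bar> ^ ?d)) * (\<integral>\<^sup>+x. ?f C x \<partial>lborel) = ennreal (inverse (\<bar>2\<bar> ^ ?d)) * (\<integral>\<^sup>+x. ?f (2 * C) x \<partial>lborel)"
    by (simp add: nn_integral_cmult)
  then have eq: "(\<integral>\<^sup>+x. ?f C x \<partial>lborel) = (\<integral>\<^sup>+x. ?f (2 * C) x \<partial>lborel)"
    by (subst (asm) ennreal_mult_cancel_left) auto
  have "(\<integral>\<^sup>+x. ?f C x \<partial>lborel) = (\<integral>\<^sup>+x. ?f (2 * C) x + ennreal (norm x powr - real ?d) * indicator (ball 0 (2 * C) - ball 0 C) x \<partial>lborel)"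
    using C by (intro nn_integral_cong) (auto simp: indicator_def)
  also have "\<dots> = (\<integral>\<^sup>+x. ?f (2 * C) x \<partial>lborel) + (\<integral>\<^sup>+x. ennreal (norm x powr - real ?d) * indicator (ball 0 (2 * C) - ball 0 C) x \<partial>(lborel :: 'a measure))"
    by (rule nn_integral_add) measurable
  finally have "(\<integral>\<^sup>+x. ?f (2 * C) x \<partial>lborel) + (\<integral>\<^sup>+x. ennreal (norm x powr - real ?d) * indicator (ball 0 (2 * C) - ball 0 C) x \<partial>(lborel :: 'a measure))
     = (\<integral>\<^sup>+x. ?f (2 * C) x \<partial>lborel) + 0"
    unfolding eq by (simp only: add.right_neutral)
  moreover have "(\<integral>\<^sup>+x. ?f (2 * C) x \<partial>lborel) \<noteq> \<infinity>" using fin unfolding eq by simp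
  ultimately have z: "(\<integral>\<^sup>+x. ennreal (norm x powr - real ?d) * indicator (ball 0 (2 * C) - ball 0 C) x \<partial>(lborel :: 'a measure)) = 0"
    unfolding ennreal_add_left_cancel by blast
  have "(\<integral>\<^sup>+x. ennreal ((2 * C) powr - real ?d) * indicator (ball 0 (2 * C) - ball 0 C) x \<partial>(lborel :: 'a measure))
     \<le> (\<integral>\<^sup>+x. ennreal (norm x powr - real ?d) * indicator (ball 0 (2 * C) - ball 0 C) x \<partial>(lborel :: 'a measure))"
    using C by (intro nn_integral_mono) (auto simp: indicator_def intro!: ennreal_leI powr_mono2')
  then have "ennreal ((2 * C) powr - real ?d) * emeasure lborel (ball 0 (2 * C) - ball 0 C :: 'a set) = 0"
    unfolding z by (subst (asm) nn_integral_cmult_indicator) auto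
  then have "emeasure lborel (ball 0 (2 * C) - ball 0 C :: 'a set) = 0"
    using C by simp
  moreover have "emeasure lborel (ball 0 (2 * C) - ball 0 C :: 'a set)
      = ennreal (unit_ball_vol (real ?d) * (2 * C) ^ ?d) - ennreal (unit_ball_vol (real ?d) * C ^ ?d)"
    using C by (subst emeasure_Diff) (auto simp: emeasure_ball)
  ultimately have "ennreal (unit_ball_vol (real ?d) * (2 * C) ^ ?d) \<le> ennreal (unit_ball_vol (real ?d) * C ^ ?d)"
    by (metis diff_eq_0_iff_ennreal)
  then have "(2 * C) ^ ?d \<le> C ^ ?d" using C by (simp add: ennreal_le_iff)
  then have "2 * C \<le> C" using C by (subst (asm) power_mono_iff) auto
  then show False using C by simp
qed

lemma nn_integral_lborel_pair:
  fixes g :: "'a::euclidean_space \<times> 'b::euclidean_space \<Rightarrow> ennreal"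
  assumes [measurable]: "g \<in> borel_measurable borel"
  shows "(\<integral>\<^sup>+x. g x \<partial>lborel) = (\<integral>\<^sup>+t. \<integral>\<^sup>+\<eta>. g (t, \<eta>) \<partial>lborel \<partial>lborel)"
  unfolding lborel_prod[symmetric]
  by (rule lborel.nn_integral_fst[symmetric]) (simp add: lborel_prod)

section \<open>The energy integral of a covariance\<close>

text \<open>The properties of the covariance of \<open>X\<^sub>0\<close> on which the energy integrals depend.  Condition (C2) appears in its
  quadratic form: \<open>r(t,t) - 2a r(s,t) + a\<^sup>2 r(s,s)\<close> is the second moment of \<open>X\<^sub>0(t) - a X\<^sub>0(s)\<close>.\<close>

locale covariance_kernel =
  fixes r :: "real^'n \<Rightarrow> real^'n \<Rightarrow> real" and H :: "real^'n" and c1 c2 A :: real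
  assumes r_cont: "continuous_on UNIV (\<lambda>(s, t). r s t)"
    and H01: "\<And>j. 0 < H $ j" "\<And>j. H $ j < 1"
    and c1: "0 < c1" and c2: "0 < c2"
    and psd: "\<And>s t x y. s \<in> unit_cube \<Longrightarrow> t \<in> unit_cube \<Longrightarrow>
        0 \<le> x\<^sup>2 * r s s + 2 * (x * y) * r s t + y\<^sup>2 * r t t"
    and C1: "\<And>s t. s \<in> unit_cube \<Longrightarrow> t \<in> unit_cube \<Longrightarrow>
        r s s - 2 * r s t + r t t \<le> c1 * (\<Sum>j\<in>UNIV. \<bar>s $ j - t $ j\<bar> powr (2 * H $ j))"
    and C2: "\<And>s t a. s \<in> unit_cube \<Longrightarrow> t \<in> unit_cube \<Longrightarrow>
        c2 * (\<Sum>j\<in>UNIV. min (\<bar>s $ j - t $ j\<bar> powr (2 * H $ j)) (\<bar>t $ j\<bar> powr (2 * H $ j)))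
          \<le> r t t - 2 * a * r s t + a\<^sup>2 * r s s"
    and bounded: "\<And>t. t \<in> unit_cube \<Longrightarrow> r t t \<le> A"
begin

definition q :: "(real^'n) \<times> (real^'d) \<Rightarrow> (real^'n) \<times> (real^'d) \<Rightarrow> real" where
  "q k l = r (fst k) (fst l) * (snd k \<bullet> snd l)"

lemma q_cont: "continuous_on UNIV (\<lambda>(k, l). q k l)"
proof -
  have "continuous_on UNIV (\<lambda>x :: ((real^'n) \<times> (real^'d)) \<times> ((real^'n) \<times> (real^'d)). (fst (fst x), fst (snd x)))"
    by (intro continuous_intros)
  from continuous_on_compose2[OF r_cont this]
  have "continuous_on UNIV (\<lambda>x :: ((real^'n) \<times> (real^'d)) \<times> ((real^'n) \<times> (real^'d)). r (fst (fst x)) (fst (snd x)))"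
    by simp
  then show ?thesis unfolding q_def case_prod_unfold by (intro continuous_intros)
qed

lemma r_measurable [measurable]:
  assumes [measurable]: "f \<in> borel_measurable N" "g \<in> borel_measurable N"
  shows "(\<lambda>x. r (f x) (g x)) \<in> borel_measurable N"
proof -
  have "(\<lambda>(k, l). r k l) \<in> borel_measurable borel"
    by (rule borel_measurable_continuous_onI[OF r_cont])
  from measurable_compose[OF _ this, of "\<lambda>x. (f x, g x)" N] show ?thesis by (simp add: borel_prod[symmetric])
qed

definition Q :: real where "Q = (\<Sum>j\<in>UNIV. 1 / H $ j)"

text \<open>Condition (C2) with the origin as conditioning point and \<open>a = 0\<close>.\<close>

lemma variance_lower: "s \<in> unit_cube \<Longrightarrow> c2 * (\<Sum>j\<in>UNIV. \<bar>s $ j\<bar> powr (2 * H $ j)) \<le> r s s"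
  using C2[of 0 s 0] by (simp add: unit_cube_def mem_box_cart)

definition energy_density :: "real^'n \<Rightarrow> real^'d \<Rightarrow> real^'n \<Rightarrow> real^'d \<Rightarrow> real" where
  "energy_density s \<xi> t \<eta> = exp (- (r s s * (norm \<xi>)\<^sup>2 + r t t * (norm \<eta>)\<^sup>2) / 2)
      * ((1 + \<bar>r s t * (\<xi> \<bullet> \<eta>)\<bar>) * exp \<bar>r s t * (\<xi> \<bullet> \<eta>)\<bar>)"

lemma energy_density_measurable [measurable]:
  assumes [measurable]: "f \<in> borel_measurable N" "g \<in> borel_measurable N" "f' \<in> borel_measurable N" "g' \<in> borel_measurable N"
  shows "(\<lambda>x. energy_density (f x) (g x) (f' x) (g' x)) \<in> borel_measurable N"
  unfolding energy_density_def by measurable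

text \<open>The Gaussian integral over \<open>\<xi>\<close> and \<open>\<eta>\<close> leaves singularities of orders \<open>d\<close> in the variance at \<open>s\<close> and \<open>d + 2\<close> in
  the conditional variance of \<open>X\<^sub>0(t)\<close> given \<open>X\<^sub>0(s)\<close>; both orders are below \<open>Q\<close>.\<close>

lemma energy_finite:
  assumes Q: "real CARD('d) + 2 < Q"
  shows "(\<integral>\<^sup>+s. \<integral>\<^sup>+t. indicator unit_cube s * indicator unit_cube t
     * (\<integral>\<^sup>+\<eta>. \<integral>\<^sup>+\<xi>. ennreal (energy_density s \<xi> t \<eta>) \<partial>(lborel :: (real^'d) measure) \<partial>(lborel :: (real^'d) measure)) \<partial>lborel \<partial>lborel) < \<infinity>"
proof -
  let ?d = "real CARD('d)"
  let ?S = "\<lambda>s. \<Sum>j\<in>UNIV. \<bar>s $ j\<bar> powr (2 * H $ j)"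
  let ?m = "\<lambda>s t. \<Sum>j\<in>UNIV. min (\<bar>s $ j - t $ j\<bar> powr (2 * H $ j)) (\<bar>t $ j\<bar> powr (2 * H $ j))"
  let ?G = "gauss_moment TYPE(real^'d)"
  define K where "K = 4 * (1 + A)\<^sup>2 * ?G\<^sup>2 * c2 powr (- ?d / 2) * c2 powr (- (?d + 2) / 2)"
  have K: "K \<ge> 0" by (simp add: K_def)
  have \<kappa>: "0 \<le> ?d" "?d < (\<Sum>j\<in>UNIV. 1 / H $ j)" "0 \<le> ?d + 2" "?d + 2 < (\<Sum>j\<in>UNIV. 1 / H $ j)"
    using Q by (auto simp: Q_def)
  obtain C where C: "C < \<infinity>" "\<And>s. s \<in> unit_cube \<Longrightarrow>
    (\<integral>\<^sup>+t. ennreal (?m s t powr (- (?d + 2) / 2)) * indicator unit_cube t \<partial>(lborel :: (real^'n) measure)) \<le> C"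
    using conditional_singularity_bound[of H "?d + 2", OF H01(1) \<kappa>(3,4)] by blast
  have pt: "(\<integral>\<^sup>+\<eta>. \<integral>\<^sup>+\<xi>. ennreal (energy_density s \<xi> t \<eta>) \<partial>(lborel :: (real^'d) measure) \<partial>(lborel :: (real^'d) measure))
     \<le> ennreal K * ennreal (?S s powr (- ?d / 2)) * ennreal (?m s t powr (- (?d + 2) / 2))"
    if s: "s \<in> unit_cube" and t: "t \<in> unit_cube" and S: "?S s > 0" and m: "?m s t > 0" for s t
  proof -
    have a: "0 < r s s" using variance_lower[OF s] S c2 by (meson mult_pos_pos order_less_le_trans)
    have v: "0 < c2 * ?m s t" using m c2 by simp
    \<comment> \<open>The choice of \<open>a\<close> that minimizes the quadratic form in (C2): the best linear approximation.\<close>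
    have "c2 * ?m s t \<le> r t t - 2 * (r s t / r s s) * r s t + (r s t / r s s)\<^sup>2 * r s s"
      by (rule C2[OF s t])
    also have "\<dots> = r t t - (r s t)\<^sup>2 / r s s" using a by (simp add: power2_eq_square field_simps)
    finally have v': "c2 * ?m s t \<le> r t t - (r s t)\<^sup>2 / r s s" .
    have "(\<integral>\<^sup>+\<eta>. \<integral>\<^sup>+\<xi>. ennreal (energy_density s \<xi> t \<eta>) \<partial>(lborel :: (real^'d) measure) \<partial>(lborel :: (real^'d) measure))
      \<le> ennreal (4 * (1 + A)\<^sup>2 * ?G\<^sup>2 * r s s powr (- ?d / 2) * (c2 * ?m s t) powr (- (?d + 2) / 2))"
      unfolding energy_density_def
      using gaussian_pair_integral_bound[OF a v v' bounded[OF t], where ?'a="real^'d"] by simp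
    also have "\<dots> \<le> ennreal (K * ?S s powr (- ?d / 2) * ?m s t powr (- (?d + 2) / 2))"
    proof (rule ennreal_leI)
      have "r s s powr (- ?d / 2) \<le> (c2 * ?S s) powr (- ?d / 2)"
        using variance_lower[OF s] S c2 by (intro powr_mono2') auto
      also have "\<dots> = c2 powr (- ?d / 2) * ?S s powr (- ?d / 2)"
        by (rule powr_mult)
      finally have 1: "r s s powr (- ?d / 2) \<le> c2 powr (- ?d / 2) * ?S s powr (- ?d / 2)" .
      have 2: "(c2 * ?m s t) powr (- (?d + 2) / 2) = c2 powr (- (?d + 2) / 2) * ?m s t powr (- (?d + 2) / 2)"
        by (rule powr_mult)
      have "4 * (1 + A)\<^sup>2 * ?G\<^sup>2 * r s s powr (- ?d / 2) * (c2 * ?m s t) powr (- (?d + 2) / 2)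
        \<le> 4 * (1 + A)\<^sup>2 * ?G\<^sup>2 * (c2 powr (- ?d / 2) * ?S s powr (- ?d / 2)) * (c2 powr (- (?d + 2) / 2) * ?m s t powr (- (?d + 2) / 2))"
        unfolding 2 by (intro mult_right_mono mult_left_mono 1) auto
      also have "\<dots> = K * ?S s powr (- ?d / 2) * ?m s t powr (- (?d + 2) / 2)"
        unfolding K_def by (simp only: mult_ac)
      finally show "4 * (1 + A)\<^sup>2 * ?G\<^sup>2 * r s s powr (- ?d / 2) * (c2 * ?m s t) powr (- (?d + 2) / 2)
        \<le> K * ?S s powr (- ?d / 2) * ?m s t powr (- (?d + 2) / 2)" .
    qed
    also have "\<dots> = ennreal K * ennreal (?S s powr (- ?d / 2)) * ennreal (?m s t powr (- (?d + 2) / 2))"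
      using K by (simp add: ennreal_mult)
    finally show ?thesis .
  qed
  have inner: "(\<integral>\<^sup>+t. indicator unit_cube s * indicator unit_cube t
     * (\<integral>\<^sup>+\<eta>. \<integral>\<^sup>+\<xi>. ennreal (energy_density s \<xi> t \<eta>) \<partial>(lborel :: (real^'d) measure) \<partial>(lborel :: (real^'d) measure)) \<partial>lborel)
     \<le> ennreal K * C * (ennreal (?S s powr (- ?d / 2)) * indicator unit_cube s)" if S: "\<forall>j\<in>UNIV. s $ j \<noteq> 0" for s
  proof (cases "s \<in> unit_cube")
    case True
    have Sp: "?S s > 0" using S by (intro sum_pos) auto
    have "AE t in (lborel :: (real^'n) measure). \<forall>j\<in>UNIV. t $ j \<noteq> 0 \<and> t $ j \<noteq> s $ j"
      by (rule AE_finite_allI) (auto intro: AE_component_neq)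
    then have "AE t in lborel. indicator unit_cube s * indicator unit_cube t
     * (\<integral>\<^sup>+\<eta>. \<integral>\<^sup>+\<xi>. ennreal (energy_density s \<xi> t \<eta>) \<partial>(lborel :: (real^'d) measure) \<partial>(lborel :: (real^'d) measure))
       \<le> ennreal K * ennreal (?S s powr (- ?d / 2)) * (ennreal (?m s t powr (- (?d + 2) / 2)) * indicator unit_cube t)"
    proof eventually_elim
      case (elim t)
      have "?m s t > 0"
      proof (intro sum_pos)
        fix j
        have "t $ j \<noteq> 0" "t $ j \<noteq> s $ j" using elim by auto
        then show "min (\<bar>s $ j - t $ j\<bar> powr (2 * H $ j)) (\<bar>t $ j\<bar> powr (2 * H $ j)) > 0" by simp
      qed auto
      then show ?case using pt[OF True _ Sp, of t] True by (cases "t \<in> unit_cube") auto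
    qed
    then have "(\<integral>\<^sup>+t. indicator unit_cube s * indicator unit_cube t
     * (\<integral>\<^sup>+\<eta>. \<integral>\<^sup>+\<xi>. ennreal (energy_density s \<xi> t \<eta>) \<partial>(lborel :: (real^'d) measure) \<partial>(lborel :: (real^'d) measure)) \<partial>lborel)
       \<le> (\<integral>\<^sup>+t. ennreal K * ennreal (?S s powr (- ?d / 2)) * (ennreal (?m s t powr (- (?d + 2) / 2)) * indicator unit_cube t) \<partial>lborel)"
      by (rule nn_integral_mono_AE)
    also have "\<dots> = ennreal K * ennreal (?S s powr (- ?d / 2)) * (\<integral>\<^sup>+t. ennreal (?m s t powr (- (?d + 2) / 2)) * indicator unit_cube t \<partial>lborel)"
      by (rule nn_integral_cmult) measurable
    also have "\<dots> \<le> ennreal K * ennreal (?S s powr (- ?d / 2)) * C"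
      by (intro mult_left_mono C(2) True) auto
    finally show ?thesis using True by (simp add: mult_ac)
  qed simp
  have ae: "AE s in (lborel :: (real^'n) measure). \<forall>j\<in>UNIV. s $ j \<noteq> 0"
    by (rule AE_finite_allI) (auto intro: AE_component_neq)
  have "(\<integral>\<^sup>+s. \<integral>\<^sup>+t. indicator unit_cube s * indicator unit_cube t
     * (\<integral>\<^sup>+\<eta>. \<integral>\<^sup>+\<xi>. ennreal (energy_density s \<xi> t \<eta>) \<partial>(lborel :: (real^'d) measure) \<partial>(lborel :: (real^'d) measure)) \<partial>lborel \<partial>lborel)
     \<le> (\<integral>\<^sup>+s. ennreal K * C * (ennreal (?S s powr (- ?d / 2)) * indicator unit_cube s) \<partial>lborel)"
    by (rule nn_integral_mono_AE[OF eventually_mono[OF ae inner]])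
  also have "\<dots> = ennreal K * C * (\<integral>\<^sup>+s. ennreal (?S s powr (- ?d / 2)) * indicator unit_cube s \<partial>lborel)"
    by (rule nn_integral_cmult) measurable
  also have "\<dots> < \<infinity>"
    using variance_singularity_integrable[of H ?d, OF H01(1) \<kappa>(1,2)] C(1) by (simp add: ennreal_mult_less_top)
  finally show ?thesis .
qed

lemma energy_reorder:
  "(\<integral>\<^sup>+(k, l). indicator unit_cube (fst k) * indicator unit_cube (fst l)
       * ennreal (energy_density (fst k) (snd k) (fst l) (snd l))
       \<partial>((lborel :: ((real^'n) \<times> (real^'d)) measure) \<Otimes>\<^sub>M (lborel :: ((real^'n) \<times> (real^'d)) measure)))
    = (\<integral>\<^sup>+s. \<integral>\<^sup>+t. indicator unit_cube s * indicator unit_cube t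
     * (\<integral>\<^sup>+\<eta>. \<integral>\<^sup>+\<xi>. ennreal (energy_density s \<xi> t \<eta>) \<partial>(lborel :: (real^'d) measure) \<partial>(lborel :: (real^'d) measure)) \<partial>lborel \<partial>lborel)"
  (is "?L = _")
proof -
  let ?f = "\<lambda>s (\<xi> :: real^'d) t (\<eta> :: real^'d). indicator unit_cube s * indicator unit_cube t * ennreal (energy_density s \<xi> t \<eta>)"
  have [measurable]: "(fst :: (real^'n) \<times> (real^'d) \<Rightarrow> real^'n) \<in> borel_measurable borel"
    "(snd :: (real^'n) \<times> (real^'d) \<Rightarrow> real^'d) \<in> borel_measurable borel"
    by (auto intro!: borel_measurable_continuous_onI continuous_intros)
  have m: "(\<lambda>p. ?f (fst (fst p)) (snd (fst p)) (fst (snd p)) (snd (snd p)))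
      \<in> borel_measurable ((lborel :: ((real^'n) \<times> (real^'d)) measure) \<Otimes>\<^sub>M (lborel :: ((real^'n) \<times> (real^'d)) measure))"
    by measurable
  have "?L = (\<integral>\<^sup>+k. \<integral>\<^sup>+l. ?f (fst k) (snd k) (fst l) (snd l) \<partial>(lborel :: ((real^'n) \<times> (real^'d)) measure) \<partial>(lborel :: ((real^'n) \<times> (real^'d)) measure))"
    using lborel.nn_integral_fst[OF m] by (simp add: case_prod_unfold)
  also have "\<dots> = (\<integral>\<^sup>+k. \<integral>\<^sup>+t. \<integral>\<^sup>+\<eta>. ?f (fst k) (snd k) t \<eta> \<partial>lborel \<partial>lborel \<partial>(lborel :: ((real^'n) \<times> (real^'d)) measure))"
    by (simp add: nn_integral_lborel_pair)
  also have "\<dots> = (\<integral>\<^sup>+s. \<integral>\<^sup>+\<xi>. \<integral>\<^sup>+t. \<integral>\<^sup>+\<eta>. ?f s \<xi> t \<eta> \<partial>lborel \<partial>lborel \<partial>lborel \<partial>lborel)"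
    by (subst nn_integral_lborel_pair) simp_all
  also have "\<dots> = (\<integral>\<^sup>+s. \<integral>\<^sup>+t. \<integral>\<^sup>+\<xi>. \<integral>\<^sup>+\<eta>. ?f s \<xi> t \<eta> \<partial>lborel \<partial>lborel \<partial>lborel \<partial>lborel)"
    by (intro nn_integral_cong lborel_pair.Fubini') measurable
  also have "\<dots> = (\<integral>\<^sup>+s. \<integral>\<^sup>+t. \<integral>\<^sup>+\<eta>. \<integral>\<^sup>+\<xi>. ?f s \<xi> t \<eta> \<partial>lborel \<partial>lborel \<partial>lborel \<partial>lborel)"
    by (intro nn_integral_cong lborel_pair.Fubini') measurable
  also have "\<dots> = (\<integral>\<^sup>+s. \<integral>\<^sup>+t. indicator unit_cube s * indicator unit_cube t
     * (\<integral>\<^sup>+\<eta>. \<integral>\<^sup>+\<xi>. ennreal (energy_density s \<xi> t \<eta>) \<partial>(lborel :: (real^'d) measure) \<partial>(lborel :: (real^'d) measure)) \<partial>lborel \<partial>lborel)"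
    by (simp add: nn_integral_cmult)
  finally show ?thesis .
qed

lemma psd_vector:
  fixes x y :: "real^'d"
  assumes "s \<in> unit_cube" "t \<in> unit_cube"
  shows "0 \<le> r s s * (x \<bullet> x) + 2 * r s t * (x \<bullet> y) + r t t * (y \<bullet> y)"
proof -
  have "0 \<le> (\<Sum>i\<in>UNIV. (x $ i)\<^sup>2 * r s s + 2 * (x $ i * y $ i) * r s t + (y $ i)\<^sup>2 * r t t)"
    by (intro sum_nonneg psd assms)
  also have "\<dots> = r s s * (x \<bullet> x) + 2 * r s t * (x \<bullet> y) + r t t * (y \<bullet> y)"
    by (simp add: inner_vec_def sum.distrib sum_distrib_left power2_eq_square mult_ac)
  finally show ?thesis .
qed

lemma sinh_lower:
  fixes z :: real
  assumes "1 \<le> z"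
  shows "exp z / 4 \<le> sinh z"
proof -
  have "2 \<le> exp z" using exp_ge_add_one_self[of z] assms by linarith
  moreover have "exp (- z) \<le> 1" using assms by simp
  ultimately have "exp (- z) * 2 \<le> exp z" by linarith
  then show ?thesis by (simp add: sinh_field_def)
qed

text \<open>By (C2) the variance at the centre of the cube is positive; the covariance stays positive nearby by
  continuity.\<close>

lemma positive_covariance_box:
  obtains \<delta> r0 where "0 < \<delta>" "\<delta> \<le> 1 / 4" "0 < r0"
    "\<And>s t. (\<And>j. \<bar>s $ j - 1 / 2\<bar> \<le> \<delta>) \<Longrightarrow> (\<And>j. \<bar>t $ j - 1 / 2\<bar> \<le> 2 * \<delta>) \<Longrightarrow> r0 \<le> r s t"
proof -
  define p :: "real^'n" where "p = (\<chi> j. 1 / 2)"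
  have p: "p \<in> unit_cube" by (auto simp: unit_cube_def mem_box_cart p_def)
  have "0 < (\<Sum>j\<in>UNIV. \<bar>p $ j\<bar> powr (2 * H $ j))" by (intro sum_pos) (auto simp: p_def)
  then have rp: "0 < r p p" using variance_lower[OF p] c2 by (meson mult_pos_pos order_less_le_trans)
  have "continuous (at (p, p)) (\<lambda>(s, t). r s t)"
    using r_cont by (simp add: continuous_on_eq_continuous_at)
  then obtain d where d: "d > 0" "\<And>x. dist x (p, p) < d \<Longrightarrow> dist ((\<lambda>(s, t). r s t) x) ((\<lambda>(s, t). r s t) (p, p)) < r p p / 2"
    using rp unfolding continuous_at_eps_delta by (meson half_gt_zero)
  let ?N = "real CARD('n)"
  define \<delta> where "\<delta> = min (1 / 4) (d / (4 * ?N))"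
  have N: "?N > 0" by simp
  have \<delta>: "0 < \<delta>" "\<delta> \<le> 1 / 4" "3 * ?N * \<delta> < d"
  proof -
    show "0 < \<delta>" "\<delta> \<le> 1 / 4" using d N by (auto simp: \<delta>_def)
    have "3 * ?N * \<delta> \<le> 3 * ?N * (d / (4 * ?N))" by (intro mult_left_mono) (auto simp: \<delta>_def)
    also have "\<dots> < d" using d N by simp
    finally show "3 * ?N * \<delta> < d" .
  qed
  have near: "dist s p \<le> ?N * e" if "\<And>j. \<bar>s $ j - 1 / 2\<bar> \<le> e" for s :: "real^'n" and e
  proof -
    have "dist s p \<le> (\<Sum>j\<in>UNIV. \<bar>(s - p) $ j\<bar>)" unfolding dist_norm by (rule norm_le_l1_cart)
    also have "\<dots> \<le> (\<Sum>j\<in>(UNIV :: 'n set). e)" using that by (intro sum_mono) (simp add: p_def)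
    finally show ?thesis by simp
  qed
  show ?thesis
  proof (rule that[of \<delta> "r p p / 2"])
    fix s t :: "real^'n" assume s: "\<And>j. \<bar>s $ j - 1 / 2\<bar> \<le> \<delta>" and t: "\<And>j. \<bar>t $ j - 1 / 2\<bar> \<le> 2 * \<delta>"
    have "dist (s, t) (p, p) \<le> dist s p + dist t p" unfolding dist_Pair_Pair by (rule sqrt_sum_squares_le_sum) auto
    also have "\<dots> \<le> ?N * \<delta> + ?N * (2 * \<delta>)" by (intro add_mono near s t)
    also have "\<dots> = 3 * ?N * \<delta>" by simp
    also have "\<dots> < d" by (rule \<delta>)
    finally have "dist (r s t) (r p p) < r p p / 2" using d(2)[of "(s, t)"] by simp
    then have "\<bar>r s t - r p p\<bar> < r p p / 2" by (simp only: dist_real_def)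
    then show "r p p / 2 \<le> r s t" by (simp only: abs_less_iff) linarith
  qed (use \<delta> rp in auto)
qed

text \<open>Near the diagonal, at the scale on which \<open>|\<xi>| (X(s) - X(t))\<close> stays bounded, the density is at least a
  multiple of \<open>|\<xi>|\<^sup>2\<close>.\<close>

lemma density_lower_bound:
  obtains \<delta> C c where "0 < \<delta>" "1 \<le> C" "0 < c"
    "\<And>s t (\<xi> :: real^'d) \<eta>. (\<And>j. \<bar>s $ j - 1 / 2\<bar> \<le> \<delta>) \<Longrightarrow> C \<le> norm \<xi> \<Longrightarrow>
       (\<And>j. \<bar>t $ j - s $ j\<bar> \<le> norm \<xi> powr (- (1 / H $ j))) \<Longrightarrow> norm (\<eta> - \<xi>) \<le> 1 \<Longrightarrow>
       s \<in> unit_cube \<and> t \<in> unit_cube \<and>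
       c * (norm \<xi>)\<^sup>2 \<le> exp (- (r s s * (norm \<xi>)\<^sup>2 + r t t * (norm \<eta>)\<^sup>2) / 2)
          * (r s t * (\<xi> \<bullet> \<eta>) * sinh (r s t * (\<xi> \<bullet> \<eta>)))"
proof -
  obtain \<delta> r0 where \<delta>: "0 < \<delta>" "\<delta> \<le> 1 / 4" and r0: "0 < r0"
    "\<And>s t. (\<And>j. \<bar>s $ j - 1 / 2\<bar> \<le> \<delta>) \<Longrightarrow> (\<And>j. \<bar>t $ j - 1 / 2\<bar> \<le> 2 * \<delta>) \<Longrightarrow> r0 \<le> r s t"
    by (rule positive_covariance_box) blast
  let ?N = "real CARD('n)"
  \<comment> \<open>\<open>|\<xi>| \<ge> 1/\<delta>\<close> keeps \<open>t\<close> in the box of positive covariance, and the other two bounds give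
    \<open>r(s,t) (\<xi> \<bullet> \<eta>) \<ge> r0 |\<xi>|\<^sup>2/2 \<ge> 1\<close>.\<close>
  define C where "C = max 2 (max (1 / \<delta>) (2 / r0))"
  define C1' where "C1' = c1 * ?N + A"
  define c where "c = exp (- C1') * r0 / 8"
  show ?thesis
  proof (rule that[of \<delta> C c])
    show "0 < \<delta>" "1 \<le> C" "0 < c" using \<delta> r0 by (auto simp: C_def c_def)
    fix s t :: "real^'n" and \<xi> \<eta> :: "real^'d"
    assume s: "\<And>j. \<bar>s $ j - 1 / 2\<bar> \<le> \<delta>" and \<xi>: "C \<le> norm \<xi>"
      and t: "\<And>j. \<bar>t $ j - s $ j\<bar> \<le> norm \<xi> powr (- (1 / H $ j))" and \<eta>: "norm (\<eta> - \<xi>) \<le> 1"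
    define \<rho> where "\<rho> = norm \<xi>"
    define \<zeta> where "\<zeta> = \<eta> - \<xi>"
    have \<rho>: "2 \<le> \<rho>" "1 / \<delta> \<le> \<rho>" "2 / r0 \<le> \<rho>" using \<xi> by (auto simp: C_def \<rho>_def)
    have w: "\<rho> powr (- (1 / H $ j)) \<le> \<delta>" for j
    proof -
      have "1 \<le> 1 / H $ j" using H01(1)[of j] H01(2)[of j] by simp
      then have "\<rho> powr (- (1 / H $ j)) \<le> \<rho> powr (- 1)" using \<rho> by (intro powr_mono) auto
      also have "\<dots> = 1 / \<rho>" using \<rho> by (simp add: powr_minus_divide)
      also have "\<dots> \<le> \<delta>" using \<rho> \<delta> by (simp add: field_simps)
      finally show ?thesis .
    qed
    have t2: "\<bar>t $ j - 1 / 2\<bar> \<le> 2 * \<delta>" for j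
      using t[of j] w[of j] s[of j] unfolding \<rho>_def by linarith
    have s1: "s \<in> unit_cube"
    proof -
      have "0 \<le> s $ j \<and> s $ j \<le> 1" for j using s[of j] \<delta> by (simp only: abs_le_iff) linarith
      then show ?thesis by (simp add: unit_cube_def mem_box_cart)
    qed
    have t1: "t \<in> unit_cube"
    proof -
      have "0 \<le> t $ j \<and> t $ j \<le> 1" for j using t2[of j] \<delta> by (simp only: abs_le_iff) linarith
      then show ?thesis by (simp add: unit_cube_def mem_box_cart)
    qed
    have rst: "r0 \<le> r s t" by (rule r0(2)[OF s t2])
    let ?D = "r s s - 2 * r s t + r t t"
    have "(\<Sum>j\<in>UNIV. \<bar>s $ j - t $ j\<bar> powr (2 * H $ j)) \<le> (\<Sum>j\<in>(UNIV :: 'n set). \<rho> powr (- 2))"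
    proof (rule sum_mono)
      fix j
      have Hj: "H $ j > 0" by (rule H01)
      have "\<bar>s $ j - t $ j\<bar> powr (2 * H $ j) \<le> (\<rho> powr (- (1 / H $ j))) powr (2 * H $ j)"
        using t[of j] Hj by (intro powr_mono2) (auto simp: \<rho>_def abs_minus_commute)
      also have "\<dots> = \<rho> powr (- 2)" using Hj by (simp add: powr_powr)
      finally show "\<bar>s $ j - t $ j\<bar> powr (2 * H $ j) \<le> \<rho> powr (- 2)" .
    qed
    then have "(\<Sum>j\<in>UNIV. \<bar>s $ j - t $ j\<bar> powr (2 * H $ j)) \<le> ?N * \<rho> powr (- 2)" by simp
    then have "?D \<le> c1 * (?N * \<rho> powr (- 2))"
      using C1[OF s1 t1] mult_left_mono[of _ _ c1] c1 by (meson less_imp_le order.trans)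
    then have "\<rho>\<^sup>2 * ?D \<le> \<rho>\<^sup>2 * (c1 * (?N * \<rho> powr (- 2)))" by (rule mult_left_mono) simp
    also have "\<dots> = c1 * ?N"
    proof -
      have "\<rho>\<^sup>2 * \<rho> powr (- 2) = 1" using \<rho> by (simp add: powr_minus powr_numeral)
      then show ?thesis by (metis mult.commute mult.left_commute mult_1)
    qed
    finally have D: "\<rho>\<^sup>2 * ?D \<le> c1 * ?N" .
    have \<rho>2: "\<xi> \<bullet> \<xi> = \<rho>\<^sup>2" by (simp add: \<rho>_def power2_norm_eq_inner)
    have eta: "\<eta> = \<xi> + \<zeta>" by (simp add: \<zeta>_def)
    have \<zeta>: "\<zeta> \<bullet> \<zeta> \<le> 1" using \<eta> by (simp add: \<zeta>_def power2_norm_eq_inner[symmetric] power_le_one)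
    have "r t t * (\<zeta> \<bullet> \<zeta>) \<le> A"
    proof -
      have "0 \<le> r t t" using psd[OF t1 t1, of 0 1] by simp
      then have "r t t * (\<zeta> \<bullet> \<zeta>) \<le> r t t * 1" by (intro mult_left_mono \<zeta>)
      then show ?thesis using bounded[OF t1] by simp
    qed
    \<comment> \<open>With \<open>\<eta> = \<xi> + \<zeta>\<close> the left-hand side is the second moment of the difference of \<open>\<xi> \<bullet> (X(s) - X(t))\<close> and
      \<open>\<zeta> \<bullet> X(t)\<close>, hence at most twice the sum of their second moments.\<close>
    have "r s s * (\<xi> \<bullet> \<xi>) - 2 * (r s t * (\<xi> \<bullet> \<eta>)) + r t t * (\<eta> \<bullet> \<eta>) \<le> 2 * (\<rho>\<^sup>2 * ?D) + 2 * (r t t * (\<zeta> \<bullet> \<zeta>))"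
      using psd_vector[OF s1 t1, of \<xi> "\<zeta> - \<xi>"] unfolding eta \<rho>2[symmetric]
      by (simp add: inner_add_left inner_add_right inner_diff_left inner_diff_right inner_commute[of \<zeta> \<xi>] algebra_simps)
    also have "\<dots> \<le> 2 * C1'" using D \<open>r t t * (\<zeta> \<bullet> \<zeta>) \<le> A\<close> by (simp add: C1'_def)
    finally have F: "r s s * (\<xi> \<bullet> \<xi>) - 2 * (r s t * (\<xi> \<bullet> \<eta>)) + r t t * (\<eta> \<bullet> \<eta>) \<le> 2 * C1'" .
    have half_shift: "- d \<le> - (a + e) / 2 + b" if "a - 2 * b + e \<le> 2 * d" for a b d e :: real
      using that by (simp add: field_simps)
    define z where "z = r s t * (\<xi> \<bullet> \<eta>)"
    have z: "r0 * \<rho>\<^sup>2 / 2 \<le> z"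
    proof -
      have "\<bar>\<xi> \<bullet> \<zeta>\<bar> \<le> \<rho> * 1"
        using Cauchy_Schwarz_ineq2[of \<xi> \<zeta>] mult_left_mono[of "norm \<zeta>" 1 "norm \<xi>"] \<eta> unfolding \<rho>_def \<zeta>_def by simp
      then have "\<rho>\<^sup>2 - \<rho> \<le> \<xi> \<bullet> \<eta>" unfolding eta inner_add_right \<rho>2 by simp
      moreover have "2 * \<rho> \<le> \<rho>\<^sup>2" using \<rho> by (simp add: power2_eq_square)
      ultimately have "\<rho>\<^sup>2 / 2 \<le> \<xi> \<bullet> \<eta>" by linarith
      then have "r0 * (\<rho>\<^sup>2 / 2) \<le> z" unfolding z_def using rst r0 by (intro mult_mono) auto
      then show ?thesis by simp
    qed
    have z1: "1 \<le> z"
    proof -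
      have "2 / r0 * 1 \<le> \<rho> * \<rho>" using \<rho> r0 by (intro mult_mono) auto
      then have "1 \<le> r0 * \<rho>\<^sup>2 / 2" using r0 by (simp add: power2_eq_square field_simps)
      then show ?thesis using z by simp
    qed
    have "c * (norm \<xi>)\<^sup>2 = exp (- C1') * (r0 * \<rho>\<^sup>2 / 2 / 4)" by (simp add: c_def \<rho>_def)
    also have "\<dots> \<le> exp (- (r s s * (norm \<xi>)\<^sup>2 + r t t * (norm \<eta>)\<^sup>2) / 2 + z) * (z / 4)"
    proof (intro mult_mono)
      show "exp (- C1') \<le> exp (- (r s s * (norm \<xi>)\<^sup>2 + r t t * (norm \<eta>)\<^sup>2) / 2 + z)"
        using half_shift[OF F] unfolding power2_norm_eq_inner z_def exp_le_cancel_iff .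
      show "r0 * \<rho>\<^sup>2 / 2 / 4 \<le> z / 4" using z by simp
    qed (use r0 in auto)
    also have "\<dots> = exp (- (r s s * (norm \<xi>)\<^sup>2 + r t t * (norm \<eta>)\<^sup>2) / 2) * (z * (exp z / 4))"
      by (simp add: exp_add)
    also have "\<dots> \<le> exp (- (r s s * (norm \<xi>)\<^sup>2 + r t t * (norm \<eta>)\<^sup>2) / 2) * (z * sinh z)"
      using sinh_lower[OF z1] z1 by (intro mult_left_mono) auto
    finally show "s \<in> unit_cube \<and> t \<in> unit_cube \<and>
       c * (norm \<xi>)\<^sup>2 \<le> exp (- (r s s * (norm \<xi>)\<^sup>2 + r t t * (norm \<eta>)\<^sup>2) / 2)
          * (r s t * (\<xi> \<bullet> \<eta>) * sinh (r s t * (\<xi> \<bullet> \<eta>)))"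
      using s1 t1 by (simp add: z_def)
  qed
qed

text \<open>By the lower bound of the density, the integral over \<open>t\<close> and \<open>\<eta>\<close> is at least a multiple of \<open>|\<xi>|\<^bsup>2-Q\<^esup>\<close>, which
  dominates \<open>|\<xi>|\<^bsup>-d\<^esup>\<close> for large \<open>|\<xi>|\<close>.\<close>

lemma energy_divergent:
  assumes Q: "Q \<le> real CARD('d) + 2"
  shows "(\<integral>\<^sup>+(k, l). indicator unit_cube (fst k) * indicator unit_cube (fst l)
       * ennreal (exp (- (r (fst k) (fst k) * (norm (snd k))\<^sup>2 + r (fst l) (fst l) * (norm (snd l))\<^sup>2) / 2)
          * (r (fst k) (fst l) * (snd k \<bullet> snd l) * sinh (r (fst k) (fst l) * (snd k \<bullet> snd l))))
       \<partial>((lborel :: ((real^'n) \<times> (real^'d)) measure) \<Otimes>\<^sub>M (lborel :: ((real^'n) \<times> (real^'d)) measure))) = \<infinity>"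
    (is "?L = \<infinity>")
proof -
  define g where "g s \<xi> t \<eta> = exp (- (r s s * (norm \<xi>)\<^sup>2 + r t t * (norm \<eta>)\<^sup>2) / 2)
          * (r s t * (\<xi> \<bullet> \<eta>) * sinh (r s t * (\<xi> \<bullet> \<eta>)))" for s t and \<xi> \<eta> :: "real^'d"
  have g [measurable]: "(\<lambda>x. g (f x) (f1 x) (f2 x) (f3 x)) \<in> borel_measurable N"
    if [measurable]: "f \<in> borel_measurable N" "f1 \<in> borel_measurable N" "f2 \<in> borel_measurable N" "f3 \<in> borel_measurable N"
    for f f1 f2 f3 and N :: "(((real^'n) \<times> (real^'d)) \<times> ((real^'n) \<times> (real^'d))) measure"
    unfolding g_def sinh_field_def by measurable
  obtain \<delta> C c where dc: "0 < \<delta>" "1 \<le> C" "0 < c"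
    and low: "\<And>s t (\<xi> :: real^'d) \<eta>. (\<And>j. \<bar>s $ j - 1 / 2\<bar> \<le> \<delta>) \<Longrightarrow> C \<le> norm \<xi> \<Longrightarrow>
       (\<And>j. \<bar>t $ j - s $ j\<bar> \<le> norm \<xi> powr (- (1 / H $ j))) \<Longrightarrow> norm (\<eta> - \<xi>) \<le> 1 \<Longrightarrow>
       s \<in> unit_cube \<and> t \<in> unit_cube \<and> c * (norm \<xi>)\<^sup>2 \<le> g s \<xi> t \<eta>"
    unfolding g_def by (rule density_lower_bound[where ?'d='d]) blast
  let ?f = "\<lambda>s \<xi> t \<eta>. indicator unit_cube s * indicator unit_cube t * ennreal (g s \<xi> t \<eta>)"
  have [measurable]: "(fst :: (real^'n) \<times> (real^'d) \<Rightarrow> real^'n) \<in> borel_measurable borel"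
    "(snd :: (real^'n) \<times> (real^'d) \<Rightarrow> real^'d) \<in> borel_measurable borel"
    by (auto intro!: borel_measurable_continuous_onI continuous_intros)
  have [measurable]: "(\<lambda>k :: (real^'n) \<times> (real^'d). fst k $ j) \<in> borel_measurable borel" for j
    by (intro borel_measurable_continuous_onI continuous_intros)
  have [measurable]: "(\<lambda>x :: real^'n. x $ j) \<in> borel_measurable borel" for j
    by (intro borel_measurable_continuous_onI continuous_intros)
  have [measurable]: "(\<lambda>k :: (real^'n) \<times> (real^'d). indicator (cball \<xi> 1) (snd k) :: ennreal) \<in> borel_measurable borel" for \<xi>
  proof -
    have "cball \<xi> 1 \<in> sets (borel :: (real^'d) measure)" by auto
    then have "(indicator (cball \<xi> 1) :: real^'d \<Rightarrow> ennreal) \<in> borel_measurable borel"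
      by (rule borel_measurable_indicator)
    from measurable_compose[of "snd :: (real^'n) \<times> (real^'d) \<Rightarrow> real^'d" borel borel, OF _ this]
    show ?thesis by measurable
  qed
  have m: "(\<lambda>p. ?f (fst (fst p)) (snd (fst p)) (fst (snd p)) (snd (snd p)))
      \<in> borel_measurable ((lborel :: ((real^'n) \<times> (real^'d)) measure) \<Otimes>\<^sub>M (lborel :: ((real^'n) \<times> (real^'d)) measure))"
    by measurable
  let ?V = "unit_ball_vol (real CARD('d))"
  define K where "K = c * 2 ^ CARD('n) * ?V"
  have K: "K > 0" using dc by (simp add: K_def)
  let ?S = "\<lambda>s :: real^'n. (\<Prod>j\<in>UNIV. indicator {1/2 - \<delta>..1/2 + \<delta>} (s $ j) :: ennreal)"
  have inner: "?S s * (ennreal K * (ennreal (norm \<xi> powr - real CARD('d)) * indicator {x. C \<le> norm x} \<xi>))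
     \<le> (\<integral>\<^sup>+l. ?f s \<xi> (fst l) (snd l) \<partial>(lborel :: ((real^'n) \<times> (real^'d)) measure))" for s and \<xi> :: "real^'d"
  proof (cases "(\<forall>j. s $ j \<in> {1/2 - \<delta>..1/2 + \<delta>}) \<and> C \<le> norm \<xi>")
    case True
    then have sj: "\<bar>s $ j - 1 / 2\<bar> \<le> \<delta>" for j by (auto simp: abs_le_iff algebra_simps)
    define \<rho> where "\<rho> = norm \<xi>"
    have \<rho>: "C \<le> \<rho>" "1 \<le> \<rho>" using True dc by (auto simp: \<rho>_def)
    define w where "w j = \<rho> powr (- (1 / H $ j))" for j
    let ?T = "\<lambda>t :: real^'n. (\<Prod>j\<in>UNIV. indicator {s $ j - w j..s $ j + w j} (t $ j) :: ennreal)"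
    let ?h = "\<lambda>l :: (real^'n) \<times> (real^'d). ennreal (c * \<rho>\<^sup>2) * (?T (fst l) * indicator (cball \<xi> 1) (snd l))"
    have [measurable]: "cball \<xi> 1 \<in> sets borel" by auto
    have hle: "?h l \<le> ?f s \<xi> (fst l) (snd l)" for l
    proof (cases "(\<forall>j. fst l $ j \<in> {s $ j - w j..s $ j + w j}) \<and> snd l \<in> cball \<xi> 1")
      case True
      then have "\<bar>fst l $ j - s $ j\<bar> \<le> norm \<xi> powr (- (1 / H $ j))" for j
        by (auto simp: abs_le_iff algebra_simps w_def \<rho>_def)
      moreover have "norm (snd l - \<xi>) \<le> 1" using True by (simp add: dist_norm norm_minus_commute)
      ultimately have "s \<in> unit_cube \<and> fst l \<in> unit_cube \<and> c * (norm \<xi>)\<^sup>2 \<le> g s \<xi> (fst l) (snd l)"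
        using low[OF sj] \<rho>(1) unfolding \<rho>_def by blast
      then show ?thesis using True by (auto simp: \<rho>_def intro!: ennreal_leI)
    next
      case False
      then have "?T (fst l) * indicator (cball \<xi> 1) (snd l) = 0"
      proof (cases "snd l \<in> cball \<xi> 1")
        case True
        with False obtain j where "fst l $ j \<notin> {s $ j - w j..s $ j + w j}" by blast
        then have "?T (fst l) = 0" by (intro prod_zero) (auto simp: indicator_def intro!: exI[of _ j])
        then show ?thesis by simp
      qed simp
      then show ?thesis by (simp only: mult_zero_right zero_le)
    qed
    have hm: "?h \<in> borel_measurable borel" by measurable
    \<comment> \<open>The volume of the box \<open>|t\<^sub>j - s\<^sub>j| \<le> w j\<close>.\<close>
    have prodw: "(\<Prod>j\<in>UNIV. 2 * w j) = 2 ^ CARD('n) * \<rho> powr - Q"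
    proof -
      have "(\<Prod>j\<in>UNIV. w j) = \<rho> powr (\<Sum>j\<in>UNIV. - (1 / H $ j))"
        using \<rho> unfolding w_def by (intro powr_sum[symmetric]) auto
      then show ?thesis by (simp add: prod.distrib Q_def sum_negf)
    qed
    have "(\<integral>\<^sup>+l. ?h l \<partial>lborel) = (\<integral>\<^sup>+t. \<integral>\<^sup>+\<eta>. ennreal (c * \<rho>\<^sup>2) * (?T t * indicator (cball \<xi> 1) \<eta>) \<partial>lborel \<partial>lborel)"
      using nn_integral_lborel_pair[OF hm] by simp
    also have "\<dots> = (\<integral>\<^sup>+t. (ennreal (c * \<rho>\<^sup>2) * ennreal ?V) * ?T t \<partial>lborel)"
    proof (intro nn_integral_cong)
      fix t :: "real^'n"
      have "(\<integral>\<^sup>+\<eta>. ennreal (c * \<rho>\<^sup>2) * (?T t * indicator (cball \<xi> 1) \<eta>) \<partial>lborel)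
        = (\<integral>\<^sup>+\<eta>. (ennreal (c * \<rho>\<^sup>2) * ?T t) * indicator (cball \<xi> 1) \<eta> \<partial>lborel)" by (simp only: mult.assoc)
      also have "\<dots> = (ennreal (c * \<rho>\<^sup>2) * ?T t) * emeasure lborel (cball \<xi> 1)"
        by (rule nn_integral_cmult_indicator) simp
      also have "emeasure lborel (cball \<xi> 1) = ennreal ?V" by (simp add: emeasure_cball)
      finally show "(\<integral>\<^sup>+\<eta>. ennreal (c * \<rho>\<^sup>2) * (?T t * indicator (cball \<xi> 1) \<eta>) \<partial>lborel) = (ennreal (c * \<rho>\<^sup>2) * ennreal ?V) * ?T t"
        by (simp only: mult_ac)
    qed
    also have "\<dots> = (ennreal (c * \<rho>\<^sup>2) * ennreal ?V) * (\<integral>\<^sup>+t. ?T t \<partial>lborel)"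
      by (rule nn_integral_cmult) measurable
    also have "(\<integral>\<^sup>+t. ?T t \<partial>lborel) = (\<Prod>j\<in>UNIV. \<integral>\<^sup>+x. indicator {s $ j - w j..s $ j + w j} x \<partial>lborel)"
      by (rule nn_integral_vec_prod) auto
    also have "\<dots> = (\<Prod>j\<in>UNIV. ennreal (2 * w j))"
      by (intro prod.cong refl) (simp add: w_def)
    also have "\<dots> = ennreal (2 ^ CARD('n) * \<rho> powr - Q)"
      unfolding prodw[symmetric] by (rule prod_ennreal) (simp add: w_def)
    also have "ennreal (c * \<rho>\<^sup>2) * ennreal ?V * ennreal (2 ^ CARD('n) * \<rho> powr - Q) = ennreal (K * (\<rho>\<^sup>2 * \<rho> powr - Q))"
    proof -
      have "K * (\<rho>\<^sup>2 * \<rho> powr - Q) = (c * \<rho>\<^sup>2) * ?V * (2 ^ CARD('n) * \<rho> powr - Q)" by (simp add: K_def)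
      moreover have "ennreal (c * \<rho>\<^sup>2) * ennreal ?V = ennreal ((c * \<rho>\<^sup>2) * ?V)"
        using dc by (intro ennreal_mult[symmetric]) auto
      moreover have "ennreal ((c * \<rho>\<^sup>2) * ?V) * ennreal (2 ^ CARD('n) * \<rho> powr - Q)
          = ennreal ((c * \<rho>\<^sup>2) * ?V * (2 ^ CARD('n) * \<rho> powr - Q))"
        using dc by (intro ennreal_mult[symmetric]) auto
      ultimately show ?thesis by (simp only:)
    qed
    finally have hI: "(\<integral>\<^sup>+l. ?h l \<partial>lborel) = ennreal (K * (\<rho>\<^sup>2 * \<rho> powr - Q))" .
    have "\<rho> powr - real CARD('d) \<le> \<rho> powr (2 - Q)" using \<rho> Q by (intro powr_mono) auto
    also have "\<dots> = \<rho>\<^sup>2 * \<rho> powr - Q" using \<rho> by (simp add: powr_diff powr_minus powr_numeral divide_inverse)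
    finally have le: "K * \<rho> powr - real CARD('d) \<le> K * (\<rho>\<^sup>2 * \<rho> powr - Q)" using K by (intro mult_left_mono) auto
    have "?S s = 1" using True by (intro prod.neutral) auto
    then have "?S s * (ennreal K * (ennreal (norm \<xi> powr - real CARD('d)) * indicator {x. C \<le> norm x} \<xi>)) = ennreal (K * \<rho> powr - real CARD('d))"
      using True K by (simp add: \<rho>_def ennreal_mult)
    also have "\<dots> \<le> (\<integral>\<^sup>+l. ?h l \<partial>lborel)" unfolding hI by (rule ennreal_leI[OF le])
    also have "\<dots> \<le> (\<integral>\<^sup>+l. ?f s \<xi> (fst l) (snd l) \<partial>lborel)" by (intro nn_integral_mono hle)
    finally show ?thesis .
  next
    case False
    then have "?S s * (ennreal K * (ennreal (norm \<xi> powr - real CARD('d)) * indicator {x. C \<le> norm x} \<xi>)) = 0"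
    proof (cases "C \<le> norm \<xi>")
      case True
      with False obtain j where "s $ j \<notin> {1/2 - \<delta>..1/2 + \<delta>}" by blast
      then have "?S s = 0" by (intro prod_zero) (auto simp: indicator_def intro!: exI[of _ j])
      then show ?thesis by simp
    qed simp
    then show ?thesis by (simp only: zero_le)
  qed
  let ?k = "\<lambda>k :: (real^'n) \<times> (real^'d). ?S (fst k) * (ennreal K * (ennreal (norm (snd k) powr - real CARD('d)) * indicator {x. C \<le> norm x} (snd k)))"
  have km: "?k \<in> borel_measurable borel" by measurable
  have "(\<integral>\<^sup>+k. ?k k \<partial>lborel) = (\<integral>\<^sup>+s. \<integral>\<^sup>+\<xi>. ?S s * (ennreal K * (ennreal (norm \<xi> powr - real CARD('d)) * indicator {x. C \<le> norm x} \<xi>)) \<partial>(lborel :: (real^'d) measure) \<partial>lborel)"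
    using nn_integral_lborel_pair[OF km] by simp
  also have "\<dots> = (\<integral>\<^sup>+s. ?S s * (ennreal K * (\<integral>\<^sup>+\<xi>. ennreal (norm \<xi> powr - real CARD('d)) * indicator {x. C \<le> norm x} \<xi> \<partial>(lborel :: (real^'d) measure))) \<partial>lborel)"
    by (simp add: nn_integral_cmult)
  also have "\<dots> = (\<integral>\<^sup>+s. \<infinity> * ?S s \<partial>lborel)"
    using nn_integral_norm_powr_outside_ball[of C, where ?'a="real^'d"] dc K
    by (simp add: ennreal_mult_top mult.commute)
  also have "\<dots> = \<infinity> * (\<integral>\<^sup>+s. ?S s \<partial>lborel)"
    by (rule nn_integral_cmult) measurable
  also have "(\<integral>\<^sup>+s. ?S s \<partial>lborel) = (\<Prod>j\<in>(UNIV :: 'n set). \<integral>\<^sup>+x. indicator {1/2 - \<delta>..1/2 + \<delta>} x \<partial>lborel)"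
    by (rule nn_integral_vec_prod) auto
  also have "\<dots> = ennreal ((2 * \<delta>) ^ CARD('n))"
    using dc by (simp add: ennreal_power)
  also have "\<infinity> * ennreal ((2 * \<delta>) ^ CARD('n)) = \<infinity>"
    using dc by (simp add: ennreal_top_mult)
  finally have inf: "(\<integral>\<^sup>+k. ?k k \<partial>lborel) = \<infinity>" .
  have "?L = (\<integral>\<^sup>+k. \<integral>\<^sup>+l. ?f (fst k) (snd k) (fst l) (snd l) \<partial>(lborel :: ((real^'n) \<times> (real^'d)) measure) \<partial>(lborel :: ((real^'n) \<times> (real^'d)) measure))"
    using lborel.nn_integral_fst[OF m] by (simp add: case_prod_unfold g_def)
  also have "\<dots> \<ge> (\<integral>\<^sup>+k. ?k k \<partial>lborel)"
    by (intro nn_integral_mono inner)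
  finally show ?thesis unfolding inf by (simp add: top_unique)
qed

end

section \<open>Best approximation and conditional variance\<close>

lemma (in prob_space) square_integrable_cond_exp:
  assumes "subalgebra M F" "square_integrable M Z"
  shows "square_integrable M (real_cond_exp M F Z)"
proof -
  interpret finite_measure_subalgebra M F by standard (rule assms)
  have Z: "integrable M Z" by (rule square_integrable_imp_integrable[OF assms(2)])
  have c: "convex_on UNIV (\<lambda>x::real. x\<^sup>2)" by (rule convex_power2)
  have Z2: "integrable M (\<lambda>x. (Z x)\<^sup>2)" using assms(2) by (simp add: square_integrable_def)
  have J: "AE x in M. (real_cond_exp M F Z x)\<^sup>2 \<le> real_cond_exp M F (\<lambda>x. (Z x)\<^sup>2) x"
    by (rule real_cond_exp_jensens_inequality(2)[OF Z _ _ Z2 c]) auto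
  have "AE x in M. norm ((real_cond_exp M F Z x)\<^sup>2) \<le> norm (real_cond_exp M F (\<lambda>x. (Z x)\<^sup>2) x)"
    by (rule eventually_mono[OF J]) simp
  then have "integrable M (\<lambda>x. (real_cond_exp M F Z x)\<^sup>2)"
    by (rule Bochner_Integration.integrable_bound[OF real_cond_exp_int(1)[OF Z2], rotated]) measurable
  then show ?thesis by (simp add: square_integrable_def)
qed

text \<open>The conditional expectation is the best mean-square approximation of \<open>Z\<close> by a function of \<open>W\<close>, and the
  conditional variance integrates to its error; a multiple of \<open>W\<close> does no better.\<close>

lemma (in prob_space) cond_variance_le_approximation:
  assumes Z: "square_integrable M Z" and W: "square_integrable M W"
    and c: "AE w in M. cond_variance M Z W w \<ge> \<kappa>"
  shows "\<kappa> \<le> (\<integral>w. (Z w - a * W w)\<^sup>2 \<partial>M)"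
proof -
  have Wm [measurable]: "W \<in> borel_measurable M" using W by measurable
  define F where "F = vimage_algebra (space M) W borel"
  have sub: "subalgebra M F"
    unfolding subalgebra_def F_def
    using measurable_sets[OF Wm] by (auto simp: sets_vimage_algebra2)
  interpret finite_measure_subalgebra M F by standard (rule sub)
  have WF [measurable]: "W \<in> borel_measurable F" unfolding F_def by (rule measurable_vimage_algebra1) simp
  let ?E = "real_cond_exp M F Z"
  have sE: "square_integrable M ?E" by (rule square_integrable_cond_exp[OF sub Z])
  have sD: "square_integrable M (\<lambda>w. Z w - ?E w)" by (rule square_integrable_diff[OF Z sE])
  have sa: "square_integrable M (\<lambda>w. ?E w - a * W w)" using sE W by auto
  have "\<kappa> = (\<integral>w. \<kappa> \<partial>M)" by (simp add: prob_space)
  also have "\<dots> \<le> (\<integral>w. real_cond_exp M F (\<lambda>w. (Z w - ?E w)\<^sup>2) w \<partial>M)"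
    using c sD by (intro integral_mono_AE real_cond_exp_int(1)) (auto simp: cond_variance_def F_def Let_def square_integrable_def)
  also have "\<dots> = (\<integral>w. (Z w - ?E w)\<^sup>2 \<partial>M)"
    using sD by (intro real_cond_exp_int(2)) (simp add: square_integrable_def)
  also have "\<dots> \<le> (\<integral>w. (Z w - a * W w)\<^sup>2 \<partial>M)"
  proof -
    define E where "E = ?E"
    define S where "S w = E w - a * W w" for w
    have sE': "square_integrable M E" using sE by (simp only: E_def)
    have sS: "square_integrable M S"
      unfolding S_def[abs_def] by (rule square_integrable_diff[OF sE' square_integrable_cmult[OF W]])
    have SF: "S \<in> borel_measurable F"
      unfolding S_def[abs_def] E_def by measurable
    have sD: "square_integrable M (\<lambda>w. Z w - E w)" by (rule square_integrable_diff[OF Z sE'])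
    have iZ: "integrable M (\<lambda>w. S w * Z w)" by (rule square_integrable_mult[OF sS Z])
    have iE: "integrable M (\<lambda>w. S w * E w)" by (rule square_integrable_mult[OF sS sE'])
    have "(\<integral>w. S w * E w \<partial>M) = (\<integral>w. S w * Z w \<partial>M)"
      unfolding E_def by (rule real_cond_exp_intg(2)[OF iZ SF]) (use Z in measurable)
    then have cross: "(\<integral>w. S w * Z w - S w * E w \<partial>M) = 0"
      by (simp only: Bochner_Integration.integral_diff[OF iZ iE] diff_self)
    have "(\<lambda>w. (Z w - E w) * (-1 * S w)) = (\<lambda>w. -1 * (S w * Z w - S w * E w))"
      by (rule ext) (simp add: algebra_simps)
    then have cross': "(\<integral>w. (Z w - E w) * (-1 * S w) \<partial>M) = 0"
      using cross by (simp only: integral_mult_right_zero mult_zero_right)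
    have pt: "(Z w - E w) - -1 * S w = Z w - a * W w" for w by (simp add: S_def)
    have "(\<integral>w. (Z w - a * W w)\<^sup>2 \<partial>M) = (\<integral>w. ((Z w - E w) - -1 * S w)\<^sup>2 \<partial>M)" by (simp only: pt)
    also have "\<dots> = (\<integral>w. (Z w - E w)\<^sup>2 \<partial>M) - 2 * (\<integral>w. (Z w - E w) * (-1 * S w) \<partial>M) + (\<integral>w. (-1 * S w)\<^sup>2 \<partial>M)"
      by (rule integral_sq_diff_expand[OF sD square_integrable_cmult[OF sS]])
    also have "\<dots> = (\<integral>w. (Z w - ?E w)\<^sup>2 \<partial>M) + (\<integral>w. (-1 * S w)\<^sup>2 \<partial>M)"
      by (simp only: cross' E_def[symmetric] mult_zero_right diff_0_right)
    finally show ?thesis by simp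
  qed
  finally show ?thesis .
qed

section \<open>Gaussian laws\<close>

text \<open>Exponential tilting shifts the mean of a normal law.\<close>

lemma normal_density_times_exp:
  assumes "0 < s"
  shows "normal_density m s x * exp x = exp (m + s\<^sup>2 / 2) * normal_density (m + s\<^sup>2) s x"
proof -
  have "- (x - m)\<^sup>2 / (2 * s\<^sup>2) + x = (m + s\<^sup>2 / 2) + - (x - (m + s\<^sup>2))\<^sup>2 / (2 * s\<^sup>2)"
    using assms by (simp add: field_simps power2_eq_square)
  then have "exp (- (x - m)\<^sup>2 / (2 * s\<^sup>2)) * exp x = exp (m + s\<^sup>2 / 2) * exp (- (x - (m + s\<^sup>2))\<^sup>2 / (2 * s\<^sup>2))"
    by (simp only: flip: exp_add)
  then show ?thesis by (simp add: normal_density_def)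
qed

text \<open>The mean is constrained only in case \<open>W\<close> is integrable because integrability is a conclusion here; the
  degenerate law becomes the point mass at \<open>0\<close>.\<close>

lemma (in prob_space) gaussian_variable_centered:
  assumes g: "gaussian_variable M W" and mean: "integrable M W \<Longrightarrow> (\<integral>w. W w \<partial>M) = 0"
  shows "square_integrable M W"
    and "(\<integral>\<^sup>+w. ennreal (exp (W w)) \<partial>M) = ennreal (exp ((\<integral>w. (W w)\<^sup>2 \<partial>M) / 2))"
proof -
  have W [measurable]: "W \<in> borel_measurable M" using g by (simp add: gaussian_variable_def)
  obtain m s where s: "0 \<le> s" and d: "distr M borel W = gaussian_law m s"
    using g by (auto simp: gaussian_variable_def)
  have "square_integrable M W \<and> (\<integral>\<^sup>+w. ennreal (exp (W w)) \<partial>M) = ennreal (exp ((\<integral>w. (W w)\<^sup>2 \<partial>M) / 2))"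
  proof (cases "s = 0")
    case True
    then have d: "distr M borel W = return borel m" using d by (simp add: gaussian_law_def)
    have ae: "AE w in M. W w = m"
      by (rule AE_distrD[OF W]) (subst d, subst AE_return, auto)
    have i: "integrable M (\<lambda>w. f (W w)) \<and> (\<integral>w. f (W w) \<partial>M) = f m" if [measurable]: "f \<in> borel_measurable borel" for f :: "real \<Rightarrow> real"
    proof -
      have e: "AE w in M. f (W w) = f m" using ae by auto
      have "integrable M (\<lambda>w. f (W w)) \<longleftrightarrow> integrable M (\<lambda>w. f m)"
        by (rule integrable_cong_AE[OF _ _ e]) measurable
      moreover have "(\<integral>w. f (W w) \<partial>M) = (\<integral>w. f m \<partial>M)"
        by (rule integral_cong_AE[OF _ _ e]) measurable
      ultimately show ?thesis by (simp add: prob_space)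
    qed
    have "m = 0" using i[of "\<lambda>x. x"] mean by simp
    moreover have "(\<integral>\<^sup>+w. ennreal (exp (W w)) \<partial>M) = ennreal (exp m)"
      using nn_integral_distr[of W M borel "\<lambda>x. ennreal (exp x)"] unfolding d by (simp add: nn_integral_return)
    ultimately show ?thesis using i[of "\<lambda>x. x\<^sup>2"] by (simp add: square_integrable_def)
  next
    case False
    then have s: "0 < s" using s by simp
    have d: "distr M borel W = density lborel (normal_density m s)" using d False by (simp add: gaussian_law_def)
    then have D: "distributed M lborel W (normal_density m s)"
      unfolding distributed_def by (auto simp: normal_density_nonneg cong: distr_cong)
    have "(\<integral>w. W w \<partial>M) = m" by (rule normal_distributed_expectation[OF s D])
    have iW: "integrable M (\<lambda>w. (W w - m) ^ k)" for k
    proof -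
      have "integrable (density lborel (normal_density m s)) (\<lambda>x. (x - m) ^ k)"
        using integrable_normal_moment[OF s, of m k] by (subst integrable_density) (auto simp: normal_density_nonneg)
      then show ?thesis unfolding d[symmetric] by (simp add: integrable_distr_eq)
    qed
    have "integrable M (\<lambda>w. (W w - m) ^ 1 + m)" by (intro Bochner_Integration.integrable_add iW) simp
    then have "integrable M W" by simp
    then have m: "m = 0" using mean \<open>(\<integral>w. W w \<partial>M) = m\<close> by simp
    have sq: "square_integrable M W" using iW[of 2] m by (simp add: square_integrable_def)
    have v: "(\<integral>w. (W w)\<^sup>2 \<partial>M) = s\<^sup>2"
      using normal_distributed_variance[OF s D] m \<open>(\<integral>w. W w \<partial>M) = m\<close> by simp
    have "(\<integral>\<^sup>+w. ennreal (exp (W w)) \<partial>M) = (\<integral>\<^sup>+x. ennreal (exp x) \<partial>distr M borel W)"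
      by (simp add: nn_integral_distr)
    also have "\<dots> = (\<integral>\<^sup>+x. ennreal (normal_density 0 s x) * ennreal (exp x) \<partial>lborel)"
      unfolding d m by (subst nn_integral_density) auto
    also have "\<dots> = (\<integral>\<^sup>+x. ennreal (exp (s\<^sup>2 / 2)) * ennreal (normal_density (s\<^sup>2) s x) \<partial>lborel)"
      using normal_density_times_exp[OF s, of 0]
      by (intro nn_integral_cong) (simp add: ennreal_mult[symmetric] normal_density_nonneg)
    also have "\<dots> = ennreal (exp (s\<^sup>2 / 2))"
      using s by (subst nn_integral_cmult) (auto simp: nn_integral_eq_integral normal_density_nonneg)
    finally show ?thesis using sq v by simp
  qed
  then show "square_integrable M W"
    and "(\<integral>\<^sup>+w. ennreal (exp (W w)) \<partial>M) = ennreal (exp ((\<integral>w. (W w)\<^sup>2 \<partial>M) / 2))" by auto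
qed

section \<open>Fourier representation of the heat kernel\<close>

lemma gauss_fourier_real:
  assumes e: "0 < \<epsilon>"
  shows "integrable lborel (\<lambda>x. iexp (y * x) * complex_of_real (exp (- \<epsilon> * x\<^sup>2 / 2)))"
    and "(\<integral>x. iexp (y * x) * complex_of_real (exp (- \<epsilon> * x\<^sup>2 / 2)) \<partial>lborel) = complex_of_real (sqrt (2 * pi / \<epsilon>) * exp (- y\<^sup>2 / (2 * \<epsilon>)))"
proof -
  let ?f = "\<lambda>x. iexp (y * x) * complex_of_real (exp (- \<epsilon> * x\<^sup>2 / 2))"
  let ?s = "1 / sqrt \<epsilon>"
  have s: "?s > 0" using e by simp
  have nd: "exp (- \<epsilon> * x\<^sup>2 / 2) = sqrt (2 * pi / \<epsilon>) * normal_density 0 ?s x" for x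
    using e by (simp add: normal_density_def power_divide)
  show "integrable lborel ?f"
  proof (rule Bochner_Integration.integrable_bound)
    show "integrable lborel (\<lambda>x. sqrt (2 * pi / \<epsilon>) * normal_density 0 ?s x)"
      using s by simp
    show "AE x in lborel. norm (?f x) \<le> norm (sqrt (2 * pi / \<epsilon>) * normal_density 0 ?s x)"
      unfolding nd[symmetric] by (simp add: norm_mult)
  qed measurable
  have "integrable lborel (\<lambda>x. iexp (y / sqrt \<epsilon> * x) * complex_of_real (std_normal_density x))"
  proof (rule Bochner_Integration.integrable_bound[OF integrable_normal_density[of 1 0]])
    show "AE x in lborel. norm (iexp (y / sqrt \<epsilon> * x) * complex_of_real (std_normal_density x)) \<le> norm (std_normal_density x)"
      by (simp add: norm_mult)
  qed simp_all
  have "(\<integral>x. ?f x \<partial>lborel) = \<bar>?s\<bar> *\<^sub>R (\<integral>x. ?f (0 + ?s * x) \<partial>lborel)"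
    using lborel_integral_real_affine[of ?s ?f 0] s by simp
  also have "(\<lambda>x. ?f (0 + ?s * x)) = (\<lambda>x. complex_of_real (sqrt (2 * pi)) * (std_normal_density x *\<^sub>R iexp (y / sqrt \<epsilon> * x)))"
  proof
    fix x :: real
    have 1: "y * (0 + ?s * x) = y / sqrt \<epsilon> * x" by simp
    have 2: "- \<epsilon> * (0 + ?s * x)\<^sup>2 / 2 = - x\<^sup>2 / 2" using e by (simp add: power_divide)
    have 3: "exp (- x\<^sup>2 / 2) = sqrt (2 * pi) * std_normal_density x" by (simp add: std_normal_density_def)
    show "?f (0 + ?s * x) = complex_of_real (sqrt (2 * pi)) * (std_normal_density x *\<^sub>R iexp (y / sqrt \<epsilon> * x))"
      unfolding 1 2 3 scaleR_conv_of_real of_real_mult by (simp only: mult_ac)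
  qed
  also have "(\<integral>x. complex_of_real (sqrt (2 * pi)) * (std_normal_density x *\<^sub>R iexp (y / sqrt \<epsilon> * x)) \<partial>lborel)
      = complex_of_real (sqrt (2 * pi)) * (\<integral>x. std_normal_density x *\<^sub>R iexp (y / sqrt \<epsilon> * x) \<partial>lborel)"
    by (rule integral_mult_right_zero)
  also have "(\<integral>x. std_normal_density x *\<^sub>R iexp (y / sqrt \<epsilon> * x) \<partial>lborel) = char std_normal_distribution (y / sqrt \<epsilon>)"
    unfolding char_def by (subst integral_density) (auto simp: normal_density_nonneg)
  also have "\<dots> = complex_of_real (exp (- y\<^sup>2 / (2 * \<epsilon>)))"
    using e by (simp add: char_std_normal_distribution power_divide mult.commute)
  finally show "(\<integral>x. ?f x \<partial>lborel) = complex_of_real (sqrt (2 * pi / \<epsilon>) * exp (- y\<^sup>2 / (2 * \<epsilon>)))"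
    using e by (simp add: scaleR_conv_of_real real_sqrt_divide)
qed

text \<open>The characteristic function of a product of one-dimensional centred normal laws, read as a Fourier integral
  with the roles of \<open>\<xi>\<close> and \<open>y\<close> exchanged; the imaginary part vanishes.\<close>

lemma heat_kernel_fourier:
  fixes y :: "real^'d"
  assumes e: "0 < \<epsilon>"
  shows "heat_kernel \<epsilon> y = (\<integral>\<xi>. (2 * pi) powr (- real CARD('d)) * exp (- \<epsilon> * (norm \<xi>)\<^sup>2 / 2) * cos (\<xi> \<bullet> y) \<partial>(lborel :: (real^'d) measure))"
proof -
  let ?d = "real CARD('d)"
  let ?f = "\<lambda>b x. iexp ((y \<bullet> b) * x) * complex_of_real (exp (- \<epsilon> * x\<^sup>2 / 2))"
  let ?g = "\<lambda>\<xi> :: real^'d. iexp (\<xi> \<bullet> y) * complex_of_real (exp (- \<epsilon> * (norm \<xi>)\<^sup>2 / 2))"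
  interpret PS: product_sigma_finite "\<lambda>_::real^'d. lborel :: real measure" ..
  have g: "?g \<xi> = (\<Prod>b\<in>Basis. ?f b (\<xi> \<bullet> b))" for \<xi>
  proof -
    have "\<xi> \<bullet> y = (\<Sum>b\<in>Basis. (y \<bullet> b) * (\<xi> \<bullet> b))" by (subst euclidean_inner) (simp add: mult.commute)
    then have 1: "iexp (\<xi> \<bullet> y) = (\<Prod>b\<in>Basis. iexp ((y \<bullet> b) * (\<xi> \<bullet> b)))"
      by (simp add: exp_sum[symmetric] sum_distrib_left)
    have "(norm \<xi>)\<^sup>2 = (\<Sum>b\<in>Basis. (\<xi> \<bullet> b)\<^sup>2)"
      unfolding power2_norm_eq_inner euclidean_inner[of \<xi> \<xi>] by (simp add: power2_eq_square)
    then have 2: "exp (- \<epsilon> * (norm \<xi>)\<^sup>2 / 2) = (\<Prod>b\<in>Basis. exp (- \<epsilon> * (\<xi> \<bullet> b)\<^sup>2 / 2))"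
      by (simp add: exp_sum[symmetric] sum_distrib_left sum_negf sum_divide_distrib)
    show ?thesis unfolding 1 2 by (simp add: prod.distrib)
  qed
  have c: "?g = (\<lambda>\<xi>. \<Prod>b\<in>Basis. ?f b (\<xi> \<bullet> b))" using g by blast
  have gm: "?g \<in> borel_measurable borel" by measurable
  have sb: "(\<Sum>b\<in>Basis. h b *\<^sub>R b) \<bullet> b = h b" if "b \<in> Basis" for h and b :: "real^'d"
    using that by (simp add: inner_sum_left inner_Basis if_distrib sum.delta cong: if_cong)
  have "(\<integral>\<xi>. ?g \<xi> \<partial>lborel) = (\<integral>h. ?g (\<Sum>b\<in>Basis. h b *\<^sub>R b) \<partial>(\<Pi>\<^sub>M b\<in>(Basis :: (real^'d) set). lborel))"
    unfolding lborel_eq[where 'a="real^'d"] by (rule integral_distr) (use gm in measurable)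
  also have "\<dots> = (\<integral>h. (\<Prod>b\<in>Basis. ?f b (h b)) \<partial>(\<Pi>\<^sub>M b\<in>(Basis :: (real^'d) set). lborel))"
    unfolding g by (intro Bochner_Integration.integral_cong refl prod.cong) (simp add: sb)
  also have "\<dots> = (\<Prod>b\<in>(Basis :: (real^'d) set). \<integral>x. ?f b x \<partial>lborel)"
    by (rule PS.product_integral_prod) (use gauss_fourier_real(1)[OF e] in auto)
  also have "\<dots> = (\<Prod>b\<in>(Basis :: (real^'d) set). complex_of_real (sqrt (2 * pi / \<epsilon>) * exp (- (y \<bullet> b)\<^sup>2 / (2 * \<epsilon>))))"
    by (simp only: gauss_fourier_real(2)[OF e])
  also have "\<dots> = complex_of_real (sqrt (2 * pi / \<epsilon>) ^ CARD('d) * exp (- (norm y)\<^sup>2 / (2 * \<epsilon>)))"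
  proof -
    have "(norm y)\<^sup>2 = (\<Sum>b\<in>Basis. (y \<bullet> b)\<^sup>2)"
      unfolding power2_norm_eq_inner euclidean_inner[of y y] by (simp add: power2_eq_square)
    then have "exp (- (norm y)\<^sup>2 / (2 * \<epsilon>)) = (\<Prod>b\<in>Basis. exp (- (y \<bullet> b)\<^sup>2 / (2 * \<epsilon>)))"
      by (simp add: exp_sum[symmetric] sum_negf sum_divide_distrib)
    then show ?thesis by (simp add: prod.distrib)
  qed
  finally have I: "(\<integral>\<xi>. ?g \<xi> \<partial>lborel) = complex_of_real (sqrt (2 * pi / \<epsilon>) ^ CARD('d) * exp (- (norm y)\<^sup>2 / (2 * \<epsilon>)))" .
  have gi: "integrable lborel ?g"
  proof (rule integrableI_bounded)
    have "(\<integral>\<^sup>+x. ennreal (norm (?g x)) \<partial>lborel) = (\<integral>\<^sup>+x. ennreal (exp (- (\<epsilon> / 2) * (norm x)\<^sup>2)) \<partial>(lborel :: (real^'d) measure))"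
      by (simp add: norm_mult)
    also have "\<dots> < \<infinity>" using e by (intro nn_integral_gauss_finite) simp
    finally show "(\<integral>\<^sup>+x. ennreal (norm (?g x)) \<partial>lborel) < \<infinity>" .
  qed (use gm in simp)
  have Reg: "Re (?g \<xi>) = exp (- \<epsilon> * (norm \<xi>)\<^sup>2 / 2) * cos (\<xi> \<bullet> y)" for \<xi>
    by (simp add: Re_exp)
  have "(\<integral>\<xi>. exp (- \<epsilon> * (norm \<xi>)\<^sup>2 / 2) * cos (\<xi> \<bullet> y) \<partial>(lborel :: (real^'d) measure))
     = sqrt (2 * pi / \<epsilon>) ^ CARD('d) * exp (- (norm y)\<^sup>2 / (2 * \<epsilon>))"
    using integral_Re[OF gi] unfolding I Reg Re_complex_of_real .
  then have "(\<integral>\<xi>. (2 * pi) powr (- ?d) * (exp (- \<epsilon> * (norm \<xi>)\<^sup>2 / 2) * cos (\<xi> \<bullet> y)) \<partial>(lborel :: (real^'d) measure))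
     = (2 * pi) powr (- ?d) * (sqrt (2 * pi / \<epsilon>) ^ CARD('d) * exp (- (norm y)\<^sup>2 / (2 * \<epsilon>)))"
    by (simp only: integral_mult_right_zero)
  moreover have "(2 * pi) powr (- ?d) * sqrt (2 * pi / \<epsilon>) ^ CARD('d) = (2 * pi * \<epsilon>) powr (- ?d / 2)"
  proof -
    have "sqrt (2 * pi / \<epsilon>) ^ CARD('d) = (2 * pi / \<epsilon>) powr (?d / 2)" using e by (intro sqrt_power_eq_powr) simp
    also have "\<dots> = (2 * pi) powr (?d / 2) / \<epsilon> powr (?d / 2)" by (rule powr_divide)
    finally have "(2 * pi) powr (- ?d) * sqrt (2 * pi / \<epsilon>) ^ CARD('d) = ((2 * pi) powr (- ?d) * (2 * pi) powr (?d / 2)) * \<epsilon> powr (- (?d / 2))"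
      by (simp only: powr_minus divide_inverse[of "(2 * pi) powr (?d / 2)"] mult.assoc)
    also have "(2 * pi) powr (- ?d) * (2 * pi) powr (?d / 2) = (2 * pi) powr (- (?d / 2))"
      unfolding powr_add[symmetric] by (rule arg_cong[of _ _ "\<lambda>x. (2 * pi) powr x"]) simp
    also have "(2 * pi) powr (- (?d / 2)) * \<epsilon> powr (- (?d / 2)) = (2 * pi * \<epsilon>) powr (- (?d / 2))"
      by (rule powr_mult[symmetric])
    finally show ?thesis by simp
  qed
  ultimately show ?thesis unfolding heat_kernel_def by (simp only: mult.assoc[symmetric])
qed

section \<open>Independent copies of a Gaussian field\<close>

locale gaussian_copies = prob_space M + M0: prob_space M0
  for M0 :: "'u measure" and X0 :: "real^'n \<Rightarrow> 'u \<Rightarrow> real"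
    and M :: "'w measure" and X :: "real^'n \<Rightarrow> 'w \<Rightarrow> real^'d" +
  assumes gaussian: "gaussian_field M0 X0" and centered: "centered_field M0 X0"
    and copies: "independent_copies M0 X0 M X"
begin

definition r0 :: "real^'n \<Rightarrow> real^'n \<Rightarrow> real" where
  "r0 s t = (\<integral>w. X0 s w * X0 t w \<partial>M0)"

abbreviation PI :: "(real^'n \<Rightarrow> real) measure" where
  "PI \<equiv> \<Pi>\<^sub>M t\<in>(unit_cube :: (real^'n) set). borel"

lemma combination_gaussian:
  "finite S \<Longrightarrow> S \<subseteq> unit_cube \<Longrightarrow> gaussian_variable M0 (\<lambda>w. \<Sum>t\<in>S. a t * X0 t w)"
  using gaussian by (simp add: gaussian_field_def)

lemma X0_square_integrable: "t \<in> unit_cube \<Longrightarrow> square_integrable M0 (X0 t)"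
  using M0.gaussian_variable_centered(1)[of "X0 t"] combination_gaussian[of "{t}" "\<lambda>_. 1"] centered
  by (simp add: centered_field_def)

lemma X0_mean: "t \<in> unit_cube \<Longrightarrow> integrable M0 (X0 t)" "t \<in> unit_cube \<Longrightarrow> (\<integral>w. X0 t w \<partial>M0) = 0"
  using M0.square_integrable_imp_integrable[OF X0_square_integrable] centered
  by (auto simp: centered_field_def)

lemma covariance_r0: "s \<in> unit_cube \<Longrightarrow> t \<in> unit_cube \<Longrightarrow> covariance M0 (X0 s) (X0 t) = r0 s t"
  by (simp add: covariance_def X0_mean r0_def)

lemma combination_mean:
  assumes "finite S" "S \<subseteq> unit_cube"
  shows "(\<integral>w. (\<Sum>t\<in>S. a t * X0 t w) \<partial>M0) = 0"
  using assms X0_mean by (subst Bochner_Integration.integral_sum) (auto intro!: sum.neutral)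

lemma combination_mgf:
  assumes "finite S" "S \<subseteq> unit_cube"
  shows "square_integrable M0 (\<lambda>w. \<Sum>t\<in>S. a t * X0 t w)"
    and "(\<integral>\<^sup>+w. ennreal (exp (\<Sum>t\<in>S. a t * X0 t w)) \<partial>M0)
      = ennreal (exp ((\<integral>w. (\<Sum>t\<in>S. a t * X0 t w)\<^sup>2 \<partial>M0) / 2))"
  using M0.gaussian_variable_centered[OF combination_gaussian[OF assms] combination_mean[OF assms]] by auto

lemma r0_sq_combination:
  assumes "s \<in> unit_cube" "t \<in> unit_cube"
  shows "(\<integral>w. (a * X0 s w + b * X0 t w)\<^sup>2 \<partial>M0) = a\<^sup>2 * r0 s s + 2 * (a * b) * r0 s t + b\<^sup>2 * r0 t t"
proof -
  have i: "integrable M0 (\<lambda>w. X0 s w * X0 t w)" if "s \<in> unit_cube" "t \<in> unit_cube" for s t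
    by (rule square_integrable_mult[OF X0_square_integrable[OF that(1)] X0_square_integrable[OF that(2)]])
  have "(\<integral>w. (a * X0 s w + b * X0 t w)\<^sup>2 \<partial>M0)
      = (\<integral>w. a\<^sup>2 * (X0 s w * X0 s w) + 2 * (a * b) * (X0 s w * X0 t w) + b\<^sup>2 * (X0 t w * X0 t w) \<partial>M0)"
    by (rule Bochner_Integration.integral_cong) (auto simp: power2_eq_square algebra_simps)
  also have "\<dots> = a\<^sup>2 * r0 s s + 2 * (a * b) * r0 s t + b\<^sup>2 * r0 t t"
    using i[OF assms] i[OF assms(1,1)] i[OF assms(2,2)] by (simp add: r0_def)
  finally show ?thesis .
qed

lemma path_measurable [measurable]: "coordinate_path X i \<in> M \<rightarrow>\<^sub>M PI"
  using copies unfolding independent_copies_def indep_vars_def by auto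

lemma path0_measurable [measurable]: "(\<lambda>w. \<lambda>t\<in>unit_cube. X0 t w) \<in> M0 \<rightarrow>\<^sub>M PI"
  by (rule measurable_restrict) (use X0_square_integrable in \<open>auto simp: square_integrable_def\<close>)

lemma path_law: "distr M PI (coordinate_path X i) = distr M0 PI (\<lambda>w. \<lambda>t\<in>unit_cube. X0 t w)"
  using copies by (simp add: independent_copies_def)

definition evaluate :: "(real^'n) set \<Rightarrow> (real^'n \<Rightarrow> real) \<Rightarrow> (real^'n \<Rightarrow> real) \<Rightarrow> real" where
  "evaluate S a f = (\<Sum>t\<in>S. a t * f t)"

lemma evaluate_measurable [measurable]: "S \<subseteq> unit_cube \<Longrightarrow> evaluate S a \<in> borel_measurable PI"
  unfolding evaluate_def
  by (intro borel_measurable_sum borel_measurable_times borel_measurable_const measurable_component_singleton) auto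

lemma evaluate_path:
  "S \<subseteq> unit_cube \<Longrightarrow> evaluate S a (coordinate_path X i w) = (\<Sum>t\<in>S. a t * X t w $ i)"
  unfolding evaluate_def coordinate_path_def by (intro sum.cong) auto

lemma evaluate_path0:
  "S \<subseteq> unit_cube \<Longrightarrow> evaluate S a (\<lambda>t\<in>unit_cube. X0 t w) = (\<Sum>t\<in>S. a t * X0 t w)"
  unfolding evaluate_def by (intro sum.cong) auto

text \<open>A coordinate of the field and \<open>X\<^sub>0\<close> have the same law on path space, so functionals of finitely many values
  have the same expectations.\<close>

lemma component_transfer:
  fixes g :: "real \<Rightarrow> real"
  assumes S: "finite S" "S \<subseteq> unit_cube" and [measurable]: "g \<in> borel_measurable borel"
  shows "(\<integral>\<^sup>+w. ennreal (g (\<Sum>t\<in>S. a t * X t w $ i)) \<partial>M) = (\<integral>\<^sup>+w. ennreal (g (\<Sum>t\<in>S. a t * X0 t w)) \<partial>M0)"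
    and "integrable M (\<lambda>w. g (\<Sum>t\<in>S. a t * X t w $ i)) \<longleftrightarrow> integrable M0 (\<lambda>w. g (\<Sum>t\<in>S. a t * X0 t w))"
    and "(\<integral>w. g (\<Sum>t\<in>S. a t * X t w $ i) \<partial>M) = (\<integral>w. g (\<Sum>t\<in>S. a t * X0 t w) \<partial>M0)"
proof -
  have ev [measurable]: "evaluate S a \<in> borel_measurable PI" using S(2) by (rule evaluate_measurable)
  have gm: "(\<lambda>f. g (evaluate S a f)) \<in> borel_measurable PI" by measurable
  note e = evaluate_path[OF S(2), of a i] evaluate_path0[OF S(2), of a]
  have gm': "(\<lambda>f. ennreal (g (evaluate S a f))) \<in> borel_measurable PI" by measurable
  show "(\<integral>\<^sup>+w. ennreal (g (\<Sum>t\<in>S. a t * X t w $ i)) \<partial>M) = (\<integral>\<^sup>+w. ennreal (g (\<Sum>t\<in>S. a t * X0 t w)) \<partial>M0)"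
  proof -
    have "(\<integral>\<^sup>+f. ennreal (g (evaluate S a f)) \<partial>distr M PI (coordinate_path X i))
        = (\<integral>\<^sup>+w. ennreal (g (evaluate S a (coordinate_path X i w))) \<partial>M)"
      by (rule nn_integral_distr[OF path_measurable]) (use gm' in simp)
    moreover have "(\<integral>\<^sup>+f. ennreal (g (evaluate S a f)) \<partial>distr M0 PI (\<lambda>w. \<lambda>t\<in>unit_cube. X0 t w))
        = (\<integral>\<^sup>+w. ennreal (g (evaluate S a (\<lambda>t\<in>unit_cube. X0 t w))) \<partial>M0)"
      by (rule nn_integral_distr[OF path0_measurable]) (use gm' in simp)
    ultimately show ?thesis using path_law[of i] by (simp add: e)
  qed
  show "integrable M (\<lambda>w. g (\<Sum>t\<in>S. a t * X t w $ i)) \<longleftrightarrow> integrable M0 (\<lambda>w. g (\<Sum>t\<in>S. a t * X0 t w))"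
    using integrable_distr_eq[OF path_measurable gm, of i] integrable_distr_eq[OF path0_measurable gm] path_law[of i]
    by (simp add: e)
  show "(\<integral>w. g (\<Sum>t\<in>S. a t * X t w $ i) \<partial>M) = (\<integral>w. g (\<Sum>t\<in>S. a t * X0 t w) \<partial>M0)"
    using integral_distr[OF path_measurable gm, of i] integral_distr[OF path0_measurable gm] path_law[of i]
    by (simp add: e)
qed

lemma part_measurable:
  "S \<subseteq> unit_cube \<Longrightarrow> (\<lambda>w. \<Sum>t\<in>S. a t * X t w $ i) \<in> borel_measurable M"
  using measurable_compose[OF path_measurable[of i] evaluate_measurable[of S a]] by (simp add: evaluate_path)

lemma part_square_integrable:
  assumes "finite S" "S \<subseteq> unit_cube"
  shows "square_integrable M (\<lambda>w. \<Sum>t\<in>S. a t * X t w $ i)"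
  using component_transfer(2)[OF assms, of "\<lambda>x. x\<^sup>2" a i] combination_mgf(1)[OF assms, of a] part_measurable[OF assms(2)]
  by (simp add: square_integrable_def)

lemma part_mean: "finite S \<Longrightarrow> S \<subseteq> unit_cube \<Longrightarrow> (\<integral>w. (\<Sum>t\<in>S. a t * X t w $ i) \<partial>M) = 0"
  using component_transfer(3)[of S "\<lambda>x. x" a i] combination_mean[of S a] by simp

lemma parts_indep:
  assumes "\<And>i. S i \<subseteq> unit_cube"
  shows "indep_vars (\<lambda>_. borel) (\<lambda>i w. \<Sum>t\<in>S i. a i t * X t w $ i) UNIV"
proof -
  have "indep_vars (\<lambda>i. PI) (coordinate_path X) UNIV"
    using copies by (simp add: independent_copies_def)
  then have "indep_vars (\<lambda>_. borel) (\<lambda>i w. evaluate (S i) (a i) (coordinate_path X i w)) UNIV"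
    by (rule indep_vars_compose2) (rule evaluate_measurable[OF assms])
  then show ?thesis by (simp only: evaluate_path[OF assms])
qed

lemma parts_orthogonal:
  assumes S: "finite S" "S \<subseteq> unit_cube" and T: "finite T" "T \<subseteq> unit_cube" and "i \<noteq> j"
  shows "(\<integral>w. (\<Sum>t\<in>S. a t * X t w $ i) * (\<Sum>t\<in>T. c t * X t w $ j) \<partial>M) = 0"
proof -
  define U where "U k = (if k = i then S else T)" for k
  define d where "d k = (if k = i then a else c)" for k
  have U: "finite (U k)" "U k \<subseteq> unit_cube" for k using S T by (auto simp: U_def)
  have "indep_vars (\<lambda>_. borel) (\<lambda>k w. \<Sum>t\<in>U k. d k t * X t w $ k) {i, j}"
    by (rule indep_vars_subset[OF parts_indep[OF U(2)]]) simp
  then have "(\<integral>w. (\<Prod>k\<in>{i, j}. \<Sum>t\<in>U k. d k t * X t w $ k) \<partial>M) = (\<Prod>k\<in>{i, j}. \<integral>w. (\<Sum>t\<in>U k. d k t * X t w $ k) \<partial>M)"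
    using square_integrable_imp_integrable[OF part_square_integrable[OF U]]
    by (intro indep_vars_lebesgue_integral) auto
  then show ?thesis
    using \<open>i \<noteq> j\<close> part_mean[OF S, of a i] by (simp add: U_def d_def)
qed

lemma linear_form_parts: "(\<Sum>t\<in>S. A t \<bullet> X t w) = (\<Sum>i\<in>UNIV. \<Sum>t\<in>S. A t $ i * X t w $ i)"
  unfolding inner_vec_def inner_real_def by (rule sum.swap)

text \<open>A linear form is the sum of one independent Gaussian part per coordinate; variances add up and moment
  generating functions multiply.\<close>

lemma gaussian_space_linear_forms: "gaussian_space M (linear_forms X)"
proof
  show "(\<lambda>w. a * Y w + b * W w) \<in> linear_forms X" if "Y \<in> linear_forms X" "W \<in> linear_forms X" for Y W a b
    by (rule linear_forms_lin[OF that])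
  fix W assume "W \<in> linear_forms X"
  then obtain S A where W: "W = (\<lambda>w. \<Sum>t\<in>S. A t \<bullet> X t w)" and S: "finite S" "S \<subseteq> unit_cube"
    by (auto simp: linear_forms_def)
  define V where "V i w = (\<Sum>t\<in>S. A t $ i * X t w $ i)" for i w
  have WV: "W = (\<lambda>w. \<Sum>i\<in>UNIV. V i w)" unfolding W V_def linear_form_parts ..
  have sV: "square_integrable M (V i)" for i unfolding V_def[abs_def] by (rule part_square_integrable[OF S])
  then show "square_integrable M W" unfolding WV by (intro square_integrable_sum)
  have "(\<integral>w. (W w)\<^sup>2 \<partial>M) = (\<integral>w. (\<Sum>i\<in>UNIV. \<Sum>j\<in>UNIV. V i w * V j w) \<partial>M)"
    unfolding WV by (simp add: power2_eq_square sum_product)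
  also have "\<dots> = (\<Sum>i\<in>UNIV. \<Sum>j\<in>UNIV. \<integral>w. V i w * V j w \<partial>M)"
    using square_integrable_mult[OF sV sV] by simp
  also have "\<dots> = (\<Sum>i\<in>UNIV. \<Sum>j\<in>UNIV. if j = i then \<integral>w. (V i w)\<^sup>2 \<partial>M else 0)"
    using parts_orthogonal[OF S S] by (intro sum.cong refl) (auto simp: V_def power2_eq_square)
  also have "\<dots> = (\<Sum>i\<in>UNIV. \<integral>w. (V i w)\<^sup>2 \<partial>M)" by (simp add: sum.delta)
  finally have v: "(\<integral>w. (W w)\<^sup>2 \<partial>M) = (\<Sum>i\<in>UNIV. \<integral>w. (V i w)\<^sup>2 \<partial>M)" .
  have "indep_vars (\<lambda>_. borel) (\<lambda>i w. ennreal (exp (V i w))) UNIV"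
    using indep_vars_compose2[OF parts_indep[OF S(2), of "\<lambda>i t. A t $ i"], of "\<lambda>_ x. ennreal (exp x)" "\<lambda>_. borel"]
    by (simp add: V_def)
  then have "(\<integral>\<^sup>+w. (\<Prod>i\<in>UNIV. ennreal (exp (V i w))) \<partial>M) = (\<Prod>i\<in>UNIV. \<integral>\<^sup>+w. ennreal (exp (V i w)) \<partial>M)"
    by (intro indep_vars_nn_integral) auto
  moreover have "(\<integral>\<^sup>+w. ennreal (exp (V i w)) \<partial>M) = ennreal (exp ((\<integral>w. (V i w)\<^sup>2 \<partial>M) / 2))" for i
    unfolding V_def using component_transfer(1)[OF S, of exp "\<lambda>t. A t $ i" i] combination_mgf(2)[OF S, of "\<lambda>t. A t $ i"]
      component_transfer(3)[OF S, of "\<lambda>x. x\<^sup>2" "\<lambda>t. A t $ i" i] by simp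
  ultimately have "(\<integral>\<^sup>+w. (\<Prod>i\<in>UNIV. ennreal (exp (V i w))) \<partial>M) = (\<Prod>i\<in>UNIV. ennreal (exp ((\<integral>w. (V i w)\<^sup>2 \<partial>M) / 2)))"
    by simp
  moreover have "(\<Prod>i\<in>UNIV. ennreal (exp (V i w))) = ennreal (exp (W w))" for w
    unfolding WV by (simp add: prod_ennreal exp_sum)
  moreover have "(\<Prod>i\<in>UNIV. ennreal (exp ((\<integral>w. (V i w)\<^sup>2 \<partial>M) / 2))) = ennreal (exp ((\<integral>w. (W w)\<^sup>2 \<partial>M) / 2))"
    unfolding v by (simp add: prod_ennreal exp_sum sum_divide_distrib)
  ultimately show "(\<integral>\<^sup>+w. ennreal (exp (W w)) \<partial>M) = ennreal (exp ((\<integral>w. (W w)\<^sup>2 \<partial>M) / 2))" by simp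
qed

lemma covariance_linear_forms:
  assumes s: "s \<in> unit_cube" and t: "t \<in> unit_cube"
  shows "(\<integral>w. (\<xi> \<bullet> X s w) * (\<eta> \<bullet> X t w) \<partial>M) = r0 s t * (\<xi> \<bullet> \<eta>)"
proof -
  have sq: "square_integrable M (\<lambda>w. X u w $ i)" if "u \<in> unit_cube" for u i
    using part_square_integrable[of "{u}" "\<lambda>_. 1" i] that by simp
  have diag: "(\<integral>w. X s w $ i * X t w $ i \<partial>M) = r0 s t" for i
  proof -
    have m: "(\<lambda>f. f s * f t) \<in> borel_measurable PI"
      by (intro borel_measurable_times measurable_component_singleton s t)
    show ?thesis
      using integral_distr[OF path_measurable m, of i] integral_distr[OF path0_measurable m] path_law[of i] s t
      by (simp add: coordinate_path_def r0_def)
  qed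
  have off: "(\<integral>w. X s w $ i * X t w $ j \<partial>M) = 0" if "i \<noteq> j" for i j
    using parts_orthogonal[of "{s}" "{t}" i j "\<lambda>_. 1" "\<lambda>_. 1"] s t that by simp
  have "(\<integral>w. (\<xi> \<bullet> X s w) * (\<eta> \<bullet> X t w) \<partial>M)
      = (\<integral>w. (\<Sum>i\<in>UNIV. \<Sum>j\<in>UNIV. (\<xi> $ i * \<eta> $ j) * (X s w $ i * X t w $ j)) \<partial>M)"
    unfolding inner_vec_def inner_real_def sum_product
    by (intro Bochner_Integration.integral_cong sum.cong refl) (simp only: mult_ac)
  also have "\<dots> = (\<Sum>i\<in>UNIV. \<Sum>j\<in>UNIV. (\<xi> $ i * \<eta> $ j) * (\<integral>w. X s w $ i * X t w $ j \<partial>M))"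
    using square_integrable_mult[OF sq[OF s] sq[OF t]] by simp
  also have "\<dots> = (\<Sum>i\<in>UNIV. \<Sum>j\<in>UNIV. if j = i then (\<xi> $ i * \<eta> $ i) * r0 s t else 0)"
    using diag off by (intro sum.cong refl) auto
  also have "\<dots> = r0 s t * (\<xi> \<bullet> \<eta>)"
    by (simp add: sum.delta inner_vec_def sum_distrib_left mult_ac)
  finally show ?thesis .
qed

end

section \<open>Local times\<close>

text \<open>On the cube \<open>|k|\<close> and \<open>|\<xi>|\<close> differ by a bounded amount, and half of the Gaussian exponent absorbs any power of
  \<open>1 + |\<xi>|\<close>.\<close>

lemma cube_gauss_decay:
  fixes m :: nat
  assumes e: "0 < \<epsilon>"
  defines "g \<equiv> \<lambda>k :: (real^'n) \<times> (real^'d). indicator unit_cube (fst k) * exp (- \<epsilon> * (norm (snd k))\<^sup>2 / 2)"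
  shows "g \<in> borel_measurable borel" and "integrable lborel (\<lambda>k. \<bar>g k\<bar> * (1 + norm k) ^ m)"
proof -
  have [measurable]: "(fst :: (real^'n) \<times> (real^'d) \<Rightarrow> real^'n) \<in> borel_measurable borel"
    "(snd :: (real^'n) \<times> (real^'d) \<Rightarrow> real^'d) \<in> borel_measurable borel"
    by (auto intro!: borel_measurable_continuous_onI continuous_intros)
  have [measurable]: "(unit_cube :: (real^'n) set) \<in> sets borel" by (simp add: unit_cube_def)
  show g [measurable]: "g \<in> borel_measurable borel"
    unfolding g_def by measurable
  define C where "C = real m * (1 + real CARD('n)) + (real m)\<^sup>2 / \<epsilon>"
  have cube_norm: "norm s \<le> real CARD('n)" if "s \<in> unit_cube" for s :: "real^'n"
  proof -
    have "norm s \<le> (\<Sum>i\<in>UNIV. \<bar>s $ i\<bar>)" by (rule norm_le_l1_cart)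
    also have "\<dots> \<le> (\<Sum>i\<in>(UNIV :: 'n set). 1)"
      using that by (intro sum_mono) (auto simp: unit_cube_def mem_box_cart)
    finally show ?thesis by simp
  qed
  have bound: "\<bar>g k\<bar> * (1 + norm k) ^ m \<le> indicator unit_cube (fst k) * (exp C * exp (- (\<epsilon> / 4) * (norm (snd k))\<^sup>2))" for k
  proof (cases "fst k \<in> unit_cube")
    case True
    let ?x = "norm (snd k)"
    have "norm k \<le> norm (fst k) + ?x" using norm_Pair_le[of "fst k" "snd k"] by simp
    also have "\<dots> \<le> real CARD('n) + ?x" using cube_norm[OF True] by simp
    finally have nk: "norm k \<le> real CARD('n) + ?x" .
    have "(1 + norm k) ^ m \<le> exp (norm k) ^ m"
      by (intro power_mono) (auto simp: add.commute)
    also have "\<dots> = exp (real m * norm k)" by (simp add: exp_of_nat_mult)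
    finally have 1: "(1 + norm k) ^ m \<le> exp (real m * norm k)" .
    \<comment> \<open>Young's inequality for the product of \<open>m\<close> and \<open>?x\<close>, in the form of a complete square.\<close>
    have "0 \<le> (\<epsilon> * ?x - 2 * real m)\<^sup>2 / (4 * \<epsilon>)" using e by simp
    also have "\<dots> = \<epsilon> * ?x\<^sup>2 / 4 - real m * ?x + (real m)\<^sup>2 / \<epsilon>"
      using e by (simp add: field_simps power2_eq_square)
    finally have "real m * ?x \<le> \<epsilon> * ?x\<^sup>2 / 4 + (real m)\<^sup>2 / \<epsilon>" by simp
    moreover have "real m * norm k \<le> real m * (real CARD('n) + ?x)" by (intro mult_left_mono nk) simp
    ultimately have "- \<epsilon> * ?x\<^sup>2 / 2 + real m * norm k \<le> C + - (\<epsilon> / 4) * ?x\<^sup>2"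
      by (simp add: C_def algebra_simps)
    then have "exp (- \<epsilon> * ?x\<^sup>2 / 2) * exp (real m * norm k) \<le> exp C * exp (- (\<epsilon> / 4) * ?x\<^sup>2)"
      by (simp only: exp_le_cancel_iff flip: exp_add)
    moreover have "exp (- \<epsilon> * ?x\<^sup>2 / 2) * (1 + norm k) ^ m \<le> exp (- \<epsilon> * ?x\<^sup>2 / 2) * exp (real m * norm k)"
      by (intro mult_left_mono 1) simp
    ultimately have "exp (- \<epsilon> * ?x\<^sup>2 / 2) * (1 + norm k) ^ m \<le> exp C * exp (- (\<epsilon> / 4) * ?x\<^sup>2)"
      by (rule order_trans[rotated])
    then show ?thesis using True by (simp add: g_def)
  qed (simp add: g_def)
  have cube_emeasure: "(\<integral>\<^sup>+s. indicator unit_cube s \<partial>(lborel :: (real^'n) measure)) < \<infinity>"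
    using emeasure_lborel_cbox_finite[of "0 :: real^'n" 1] by (simp add: unit_cube_def)
  show "integrable lborel (\<lambda>k. \<bar>g k\<bar> * (1 + norm k) ^ m)"
  proof (rule integrableI_bounded)
    have "(\<integral>\<^sup>+k. ennreal (norm (\<bar>g k\<bar> * (1 + norm k) ^ m)) \<partial>lborel)
        \<le> (\<integral>\<^sup>+k. indicator unit_cube (fst k) * (ennreal (exp C) * ennreal (exp (- (\<epsilon> / 4) * (norm (snd k))\<^sup>2)))
          \<partial>(lborel :: ((real^'n) \<times> (real^'d)) measure))"
    proof (rule nn_integral_mono)
      fix k :: "(real^'n) \<times> (real^'d)"
      have "ennreal (norm (\<bar>g k\<bar> * (1 + norm k) ^ m))
          \<le> ennreal (indicator unit_cube (fst k) * (exp C * exp (- (\<epsilon> / 4) * (norm (snd k))\<^sup>2)))"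
        using bound[of k] by (intro ennreal_leI) (simp add: abs_mult)
      also have "\<dots> = indicator unit_cube (fst k) * (ennreal (exp C) * ennreal (exp (- (\<epsilon> / 4) * (norm (snd k))\<^sup>2)))"
        by (simp add: ennreal_mult indicator_def)
      finally show "ennreal (norm (\<bar>g k\<bar> * (1 + norm k) ^ m))
          \<le> indicator unit_cube (fst k) * (ennreal (exp C) * ennreal (exp (- (\<epsilon> / 4) * (norm (snd k))\<^sup>2)))" .
    qed
    also have "\<dots> = (\<integral>\<^sup>+s. \<integral>\<^sup>+\<xi>. indicator unit_cube s * (ennreal (exp C) * ennreal (exp (- (\<epsilon> / 4) * (norm \<xi>)\<^sup>2)))
        \<partial>(lborel :: (real^'d) measure) \<partial>(lborel :: (real^'n) measure))"
      by (subst nn_integral_lborel_pair) simp_all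
    also have "\<dots> = (\<integral>\<^sup>+s. indicator unit_cube s \<partial>(lborel :: (real^'n) measure))
        * (ennreal (exp C) * (\<integral>\<^sup>+\<xi>. ennreal (exp (- (\<epsilon> / 4) * (norm \<xi>)\<^sup>2)) \<partial>(lborel :: (real^'d) measure)))"
      by (simp add: nn_integral_cmult nn_integral_multc)
    also have "\<dots> < \<infinity>"
      using cube_emeasure nn_integral_gauss_finite[of "\<epsilon> / 4", where 'a="real^'d"] e
      by (simp add: ennreal_mult_less_top)
    finally show "(\<integral>\<^sup>+k. ennreal (norm (\<bar>g k\<bar> * (1 + norm k) ^ m)) \<partial>lborel) < \<infinity>" .
  qed measurable
qed

lemma clamp_cube: "clamp 0 1 s \<in> (unit_cube :: (real^'n) set)"
  unfolding unit_cube_def by (rule clamp_in_interval) (auto simp: Basis_vec_def inner_axis)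

lemma clamp_cube_cancel: "s \<in> unit_cube \<Longrightarrow> clamp 0 1 s = s"
  by (simp add: unit_cube_def)

lemma clamp_cube_continuous: "continuous_on S (clamp 0 1 :: real^'n \<Rightarrow> real^'n)"
  using clamp_continuous_on[of 0 1 "\<lambda>x. x" S] by simp

locale local_time_field = gaussian_copies M0 X0 M X
  for M0 :: "'u measure" and X0 :: "real^'n \<Rightarrow> 'u \<Rightarrow> real"
    and M :: "'w measure" and X :: "real^'n \<Rightarrow> 'w \<Rightarrow> real^'d" +
  fixes H :: "real^'n"
  assumes paths: "continuous_paths M X" and cov_cont: "continuous_covariance M0 X0"
    and H: "\<And>j. 0 < H $ j" "\<And>j. H $ j < 1"
    and C1: "condition_C1 M0 X0 H" and C2: "condition_C2 M0 X0 H"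
begin

text \<open>Precomposition with the projection to the cube extends the covariance continuously to the whole space; the
  paths are extended in the same way, so that the parameter \<open>k\<close> can range over a full Euclidean space.\<close>

definition r :: "real^'n \<Rightarrow> real^'n \<Rightarrow> real" where
  "r s t = r0 (clamp 0 1 s) (clamp 0 1 t)"

lemma r_cube: "s \<in> unit_cube \<Longrightarrow> t \<in> unit_cube \<Longrightarrow> r s t = r0 s t"
  by (simp add: r_def clamp_cube_cancel)

lemma r_cont: "continuous_on UNIV (\<lambda>(s, t). r s t)"
proof -
  have "continuous_on (unit_cube \<times> unit_cube) (\<lambda>p. r0 (fst p) (snd p))"
    using cov_cont unfolding continuous_covariance_def case_prod_unfold
    by (rule continuous_on_eq) (auto simp: covariance_r0)
  moreover have "continuous_on UNIV (\<lambda>p :: (real^'n) \<times> (real^'n). (clamp 0 1 (fst p), clamp 0 1 (snd p)))"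
    by (intro continuous_on_Pair continuous_on_compose2[OF clamp_cube_continuous[of UNIV]] continuous_intros) auto
  ultimately have "continuous_on UNIV (\<lambda>p. r0 (fst (clamp 0 1 (fst p), clamp 0 1 (snd p))) (snd (clamp 0 1 (fst p), clamp 0 1 (snd p))))"
    by (rule continuous_on_compose2) (auto intro: clamp_cube)
  then show ?thesis by (simp add: r_def case_prod_unfold)
qed

lemma r_bounded: obtains A where "0 \<le> A" "\<And>t. r t t \<le> A"
proof -
  have "continuous_on unit_cube (\<lambda>t. r t t)"
    using continuous_on_compose2[OF r_cont, of unit_cube "\<lambda>t. (t, t)"] by (simp add: continuous_on_Pair continuous_on_id)
  then have "compact ((\<lambda>t. r t t) ` unit_cube)"
    by (intro compact_continuous_image) (auto simp: unit_cube_def)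
  then have "bounded ((\<lambda>t. r t t) ` unit_cube)" by (rule compact_imp_bounded)
  then obtain B where "\<forall>x\<in>(\<lambda>t. r t t) ` unit_cube. norm x \<le> B" by (auto simp only: bounded_iff)
  then have B: "norm (r t t) \<le> B" if "t \<in> unit_cube" for t using that by simp
  have "r t t = r (clamp 0 1 t) (clamp 0 1 t)" for t
    by (simp add: r_def clamp_cube_cancel[OF clamp_cube])
  moreover have "r (clamp 0 1 t) (clamp 0 1 t) \<le> \<bar>B\<bar>" for t
    using B[OF clamp_cube[of t]] by simp
  ultimately have "r t t \<le> \<bar>B\<bar>" for t by (rule ord_eq_le_trans)
  then show thesis by (rule that[OF abs_ge_zero])
qed

lemma covariance_kernel_r: obtains c1 c2 A where "covariance_kernel r H c1 c2 A"
proof -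
  obtain A where A: "0 \<le> A" "\<And>t. r t t \<le> A" by (rule r_bounded) blast
  obtain c1 where c1: "c1 > 0" "\<forall>s\<in>unit_cube. \<forall>t\<in>unit_cube.
      (\<integral>w. (X0 s w - X0 t w)\<^sup>2 \<partial>M0) \<le> c1 * (\<Sum>j\<in>UNIV. \<bar>s $ j - t $ j\<bar> powr (2 * H $ j))"
    using C1 by (auto simp: condition_C1_def)
  obtain c2 where c2: "c2 > 0" "\<forall>s\<in>unit_cube. \<forall>t\<in>unit_cube. AE w in M0. cond_variance M0 (X0 t) (X0 s) w \<ge>
      c2 * (\<Sum>j\<in>UNIV. min (\<bar>s $ j - t $ j\<bar> powr (2 * H $ j)) (\<bar>t $ j\<bar> powr (2 * H $ j)))"
    using C2 by (auto simp: condition_C2_def)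
  have "covariance_kernel r H c1 c2 A"
  proof
    show "continuous_on UNIV (\<lambda>(s, t). r s t)" by (rule r_cont)
    show "0 < H $ j" "H $ j < 1" for j by (rule H)+
    show "0 < c1" "0 < c2" by (rule c1 c2)+
    show "r t t \<le> A" for t by (rule A)
    fix s t :: "real^'n" assume s: "s \<in> unit_cube" and t: "t \<in> unit_cube"
    note r = r_cube[OF s s] r_cube[OF s t] r_cube[OF t t]
    have "0 \<le> (\<integral>w. (x * X0 s w + y * X0 t w)\<^sup>2 \<partial>M0)" for x y by simp
    then show "0 \<le> x\<^sup>2 * r s s + 2 * (x * y) * r s t + y\<^sup>2 * r t t" for x y
      by (simp only: r0_sq_combination[OF s t] r)
    have "(\<integral>w. (X0 s w - X0 t w)\<^sup>2 \<partial>M0) = r s s - 2 * r s t + r t t"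
      using r0_sq_combination[OF s t, of 1 "-1"] by (simp add: r)
    then show "r s s - 2 * r s t + r t t \<le> c1 * (\<Sum>j\<in>UNIV. \<bar>s $ j - t $ j\<bar> powr (2 * H $ j))"
      using bspec[OF bspec[OF c1(2) s] t] by simp
    fix a
    have "(\<integral>w. (X0 t w - a * X0 s w)\<^sup>2 \<partial>M0) = r t t - 2 * a * r s t + a\<^sup>2 * r s s"
      using r0_sq_combination[OF s t, of "-a" 1] by (simp add: r algebra_simps)
    moreover have "c2 * (\<Sum>j\<in>UNIV. min (\<bar>s $ j - t $ j\<bar> powr (2 * H $ j)) (\<bar>t $ j\<bar> powr (2 * H $ j)))
        \<le> (\<integral>w. (X0 t w - a * X0 s w)\<^sup>2 \<partial>M0)"
      by (rule M0.cond_variance_le_approximation[OF X0_square_integrable[OF t] X0_square_integrable[OF s]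
            bspec[OF bspec[OF c2(2) s] t]])
    ultimately show "c2 * (\<Sum>j\<in>UNIV. min (\<bar>s $ j - t $ j\<bar> powr (2 * H $ j)) (\<bar>t $ j\<bar> powr (2 * H $ j)))
        \<le> r t t - 2 * a * r s t + a\<^sup>2 * r s s" by simp
  qed
  then show thesis by (rule that)
qed

definition Y :: "(real^'n) \<times> (real^'d) \<Rightarrow> 'w \<Rightarrow> real" where
  "Y k w = snd k \<bullet> X (clamp 0 1 (fst k)) w"

definition q :: "(real^'n) \<times> (real^'d) \<Rightarrow> (real^'n) \<times> (real^'d) \<Rightarrow> real" where
  "q k l = r (fst k) (fst l) * (snd k \<bullet> snd l)"

lemma gaussian_family_Y:
  obtains R where "gaussian_family M X Y (\<lambda>k. snd k \<bullet> x) R q"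
proof -
  obtain A where A: "0 \<le> A" "\<And>t. r t t \<le> A" by (rule r_bounded) blast
  interpret G: gaussian_space M "linear_forms X" by (rule gaussian_space_linear_forms)
  obtain c1 c2 B where ck: "covariance_kernel r H c1 c2 B" by (rule covariance_kernel_r)
  have q_def': "q = covariance_kernel.q r" by (intro ext) (simp add: q_def covariance_kernel.q_def[OF ck])
  have "gaussian_family M X Y (\<lambda>k. snd k \<bullet> x) A q"
  proof
    show "Y k \<in> linear_forms X" for k
      unfolding Y_def[abs_def] by (rule linear_forms_single[OF clamp_cube])
    show "continuous_on UNIV (\<lambda>k. Y k w)" if "w \<in> space M" for w
    proof -
      have "continuous_on (cbox 0 1) (\<lambda>t. X t w)"
        using paths that by (simp add: continuous_paths_def unit_cube_def)
      then have "continuous_on UNIV (\<lambda>t. X (clamp 0 1 t) w)" by (rule clamp_continuous_on)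
      then have "continuous_on UNIV (\<lambda>k :: (real^'n) \<times> (real^'d). X (clamp 0 1 (fst k)) w)"
        by (rule continuous_on_compose2) (auto intro!: continuous_intros)
      then show ?thesis unfolding Y_def by (intro continuous_intros)
    qed
    show "q k l = (\<integral>w. Y k w * Y l w \<partial>M)" for k l
      by (simp add: q_def Y_def r_def covariance_linear_forms[OF clamp_cube clamp_cube])
    show "continuous_on UNIV (\<lambda>(k, l). q k l)"
      unfolding q_def' by (rule covariance_kernel.q_cont[OF ck])
    show "q k k \<le> A * (norm k)\<^sup>2" for k
    proof -
      have "q k k \<le> A * (norm (snd k))\<^sup>2"
        unfolding q_def power2_norm_eq_inner by (intro mult_right_mono A) simp
      also have "\<dots> \<le> A * (norm k)\<^sup>2"
        by (intro mult_left_mono power_mono A) (use norm_snd_le[of "snd k" "fst k"] in auto)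
      finally show ?thesis .
    qed
    show "(\<lambda>k. snd k \<bullet> x) \<in> borel_measurable borel"
      by (intro borel_measurable_continuous_onI continuous_intros)
  qed
  then show thesis by (rule that)
qed

text \<open>The constant is the one in the Fourier representation of the heat kernel.\<close>

definition w0 :: "(real^'n) \<times> (real^'d) \<Rightarrow> real" where
  "w0 k = (2 * pi) powr (- real CARD('d)) * indicator unit_cube (fst k)"

definition u :: "real \<Rightarrow> (real^'n) \<times> (real^'d) \<Rightarrow> real" where
  "u \<epsilon> k = w0 k * exp (- \<epsilon> * (norm (snd k))\<^sup>2 / 2)"

lemma u_eq: "u \<epsilon> k = (2 * pi) powr (- real CARD('d)) * (indicator unit_cube (fst k) * exp (- \<epsilon> * (norm (snd k))\<^sup>2 / 2))"
  by (simp add: u_def w0_def)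

lemma u_decay: "0 < \<epsilon> \<Longrightarrow> u \<epsilon> \<in> borel_measurable borel"
   "0 < \<epsilon> \<Longrightarrow> integrable lborel (\<lambda>k. \<bar>u \<epsilon> k\<bar> * (1 + norm k) ^ m)"
proof -
  assume e: "0 < \<epsilon>"
  show "u \<epsilon> \<in> borel_measurable borel"
    unfolding u_eq[abs_def] by (intro borel_measurable_times borel_measurable_const cube_gauss_decay(1)[OF e])
  have "integrable lborel (\<lambda>k. (2 * pi) powr (- real CARD('d))
      * (\<bar>indicator unit_cube (fst k) * exp (- \<epsilon> * (norm (snd k))\<^sup>2 / 2)\<bar> * (1 + norm (k :: (real^'n) \<times> (real^'d))) ^ m))"
    by (intro integrable_mult_right cube_gauss_decay(2)[OF e])
  then show "integrable lborel (\<lambda>k. \<bar>u \<epsilon> k\<bar> * (1 + norm k) ^ m)"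
    by (simp add: u_eq abs_mult mult.assoc)
qed

text \<open>Insert the Fourier representation of the heat kernel and combine the integrals over \<open>s\<close> and \<open>\<xi>\<close>.\<close>

lemma approx_local_time_oscillation:
  assumes e: "0 < \<epsilon>" and w: "w \<in> space M"
    and f: "gaussian_family M X Y (\<lambda>k. snd k \<bullet> x) R q"
  shows "approx_local_time X \<epsilon> x w = gaussian_family.oscillation Y (\<lambda>k. snd k \<bullet> x) (u \<epsilon>) w"
proof -
  interpret gaussian_family M X Y "\<lambda>k. snd k \<bullet> x" R q by (rule f)
  let ?f = "\<lambda>k. u \<epsilon> k * cos (Y k w - snd k \<bullet> x)"
  have [measurable]: "(\<lambda>k. Y k w) \<in> borel_measurable borel" by (rule borel_measurable_continuous_onI[OF Y_cont[OF w]])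
  have [measurable]: "u \<epsilon> \<in> borel_measurable borel" by (rule u_decay(1)[OF e])
  have "integrable lborel ?f"
  proof (rule Bochner_Integration.integrable_bound)
    show "integrable lborel (\<lambda>k. \<bar>u \<epsilon> k\<bar>)" using u_decay(2)[OF e, of 0] by simp
    show "AE k in lborel. norm (?f k) \<le> norm \<bar>u \<epsilon> k\<bar>"
      by (intro AE_I2) (simp add: abs_mult mult_left_le)
    show "?f \<in> borel_measurable lborel" by measurable
  qed
  then have i: "integrable (lborel \<Otimes>\<^sub>M lborel) ?f" by (simp add: lborel_prod)
  have "(\<integral>s. \<integral>\<xi>. ?f (s, \<xi>) \<partial>lborel \<partial>lborel) = (\<integral>k. ?f k \<partial>(lborel \<Otimes>\<^sub>M lborel))"
    by (rule lborel_pair.integral_fst'[OF i])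
  then have "oscillation (u \<epsilon>) w = (\<integral>s. \<integral>\<xi>. ?f (s, \<xi>) \<partial>lborel \<partial>lborel)"
    by (simp add: oscillation_def lborel_prod)
  also have "\<dots> = (\<integral>s. indicator unit_cube s *\<^sub>R heat_kernel \<epsilon> (X s w - x) \<partial>lborel)"
  proof (rule Bochner_Integration.integral_cong[OF refl])
    fix s :: "real^'n"
    show "(\<integral>\<xi>. ?f (s, \<xi>) \<partial>lborel) = indicator unit_cube s *\<^sub>R heat_kernel \<epsilon> (X s w - x)"
      unfolding heat_kernel_fourier[OF e]
      by (cases "s \<in> unit_cube") (simp_all add: u_eq Y_def clamp_cube_cancel inner_diff_right mult.assoc)
  qed
  finally show ?thesis by (simp add: approx_local_time_def set_lebesgue_integral_def)
qed

lemma weights: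
  obtains R where "regularized_weights M X Y (\<lambda>k. snd k \<bullet> x) R q w0 u"
proof -
  obtain R where f: "gaussian_family M X Y (\<lambda>k. snd k \<bullet> x) R q" by (rule gaussian_family_Y)
  interpret gaussian_family M X Y "\<lambda>k. snd k \<bullet> x" R q by (rule f)
  have w0_nonneg: "0 \<le> w0 k" for k by (simp add: w0_def)
  have "regularized_weights M X Y (\<lambda>k. snd k \<bullet> x) R q w0 u"
  proof
    have [measurable]: "(fst :: (real^'n) \<times> (real^'d) \<Rightarrow> real^'n) \<in> borel_measurable borel"
      by (auto intro!: borel_measurable_continuous_onI continuous_intros)
    have [measurable]: "(unit_cube :: (real^'n) set) \<in> sets borel" by (simp add: unit_cube_def)
    show "w0 \<in> borel_measurable borel" unfolding w0_def[abs_def] by measurable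
    show "fast_decay (u \<epsilon>)" if "0 < \<epsilon>" for \<epsilon>
      using u_decay[OF that] by (simp add: fast_decay_def)
    show "0 \<le> u \<epsilon> k" for \<epsilon> k by (simp add: u_def w0_nonneg)
    show "u \<epsilon> k \<le> w0 k" if "0 < \<epsilon>" for \<epsilon> k
      using that unfolding u_def by (intro mult_left_le w0_nonneg) simp
    show "u \<delta> k \<le> u \<epsilon> k" if "0 < \<epsilon>" "\<epsilon> \<le> \<delta>" for \<epsilon> \<delta> k
      using that unfolding u_def by (intro mult_left_mono w0_nonneg) (simp add: mult_right_mono)
    show "((\<lambda>\<epsilon>. u \<epsilon> k) \<longlongrightarrow> w0 k) (at_right 0)" for k
    proof -
      have "((\<lambda>\<epsilon>. w0 k * exp (- \<epsilon> * (norm (snd k))\<^sup>2 / 2)) \<longlongrightarrow> w0 k * exp (- 0 * (norm (snd k))\<^sup>2 / 2)) (at_right 0)"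
        by (intro tendsto_intros) simp
      then show ?thesis by (simp add: u_def)
    qed
  qed
  then show thesis by (rule that)
qed

lemma approx_limit_iff:
  assumes f: "gaussian_family M X Y (\<lambda>k. snd k \<bullet> x) R q"
  shows "((\<lambda>\<epsilon>. L2_dist_sq M (approx_local_time X \<epsilon> x) L) \<longlongrightarrow> 0) (at_right 0)
    \<longleftrightarrow> ((\<lambda>\<epsilon>. L2_dist_sq M (gaussian_family.oscillation Y (\<lambda>k. snd k \<bullet> x) (u \<epsilon>)) L) \<longlongrightarrow> 0) (at_right 0)"
proof (rule tendsto_cong)
  have "L2_dist_sq M (approx_local_time X \<epsilon> x) L
      = L2_dist_sq M (gaussian_family.oscillation Y (\<lambda>k. snd k \<bullet> x) (u \<epsilon>)) L" if "0 < \<epsilon>" for \<epsilon>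
    unfolding L2_dist_sq_def
    by (intro nn_integral_cong) (simp add: approx_local_time_oscillation[OF that _ f])
  then show "\<forall>\<^sub>F \<epsilon> in at_right 0. L2_dist_sq M (approx_local_time X \<epsilon> x) L
      = L2_dist_sq M (gaussian_family.oscillation Y (\<lambda>k. snd k \<bullet> x) (u \<epsilon>)) L"
    by (intro eventually_at_rightI[of 0 1]) auto
qed

lemma w0_product:
  assumes "0 \<le> z"
  shows "ennreal (w0 k * w0 l * z) = ennreal (((2 * pi) powr (- real CARD('d)))\<^sup>2)
    * (indicator unit_cube (fst k) * indicator unit_cube (fst l) * ennreal z)"
  using assms by (auto simp: w0_def indicator_def power2_eq_square ennreal_mult)

text \<open>The criterion with absolute values is insensitive to the phases \<open>\<xi> \<bullet> x\<close>, hence holds for all levels \<open>x\<close>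
  at once.\<close>

lemma index_sum_imp_local_time_in_D1:
  assumes Q: "real CARD('d) + 2 < (\<Sum>j\<in>UNIV. 1 / H $ j)"
  shows "local_time_in_D1 M X x"
proof -
  obtain R where "regularized_weights M X Y (\<lambda>k. snd k \<bullet> x) R q w0 u" by (rule weights)
  then interpret W: regularized_weights M X Y "\<lambda>k. snd k \<bullet> x" R q w0 u .
  obtain c1 c2 A where "covariance_kernel r H c1 c2 A" by (rule covariance_kernel_r)
  then interpret K: covariance_kernel r H c1 c2 A .
  let ?c = "((2 * pi) powr (- real CARD('d)))\<^sup>2"
  let ?E = "\<lambda>(k :: (real^'n) \<times> (real^'d), l :: (real^'n) \<times> (real^'d)). indicator unit_cube (fst k) * indicator unit_cube (fst l)
       * ennreal (K.energy_density (fst k) (snd k) (fst l) (snd l))"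
  have [measurable]: "(fst :: (real^'n) \<times> (real^'d) \<Rightarrow> real^'n) \<in> borel_measurable borel"
    "(snd :: (real^'n) \<times> (real^'d) \<Rightarrow> real^'d) \<in> borel_measurable borel"
    by (auto intro!: borel_measurable_continuous_onI continuous_intros)
  have [measurable]: "?E \<in> borel_measurable (lborel \<Otimes>\<^sub>M (lborel :: ((real^'n) \<times> (real^'d)) measure))"
    unfolding case_prod_unfold K.energy_density_def by measurable
  have "(\<integral>\<^sup>+(k, l). ennreal (w0 k * w0 l * (W.gauss_weight k l * ((1 + \<bar>q k l\<bar>) * exp \<bar>q k l\<bar>))) \<partial>(lborel \<Otimes>\<^sub>M lborel))
      = (\<integral>\<^sup>+p. ennreal ?c * ?E p \<partial>(lborel \<Otimes>\<^sub>M lborel))"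
  proof (rule nn_integral_cong, clarify)
    fix k l :: "(real^'n) \<times> (real^'d)"
    have e: "W.gauss_weight k l * ((1 + \<bar>q k l\<bar>) * exp \<bar>q k l\<bar>) = K.energy_density (fst k) (snd k) (fst l) (snd l)"
      by (simp add: W.gauss_weight_def K.energy_density_def q_def power2_norm_eq_inner)
    have "0 \<le> W.gauss_weight k l * ((1 + \<bar>q k l\<bar>) * exp \<bar>q k l\<bar>)"
      by (simp add: W.gauss_weight_def)
    from w0_product[OF this] show "ennreal (w0 k * w0 l * (W.gauss_weight k l * ((1 + \<bar>q k l\<bar>) * exp \<bar>q k l\<bar>)))
      = ennreal ?c * (indicator unit_cube (fst k) * indicator unit_cube (fst l)
       * ennreal (K.energy_density (fst k) (snd k) (fst l) (snd l)))"
      by (simp only: e)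
  qed
  also have "\<dots> = ennreal ?c * (\<integral>\<^sup>+p. ?E p \<partial>(lborel \<Otimes>\<^sub>M lborel))"
    by (rule nn_integral_cmult) measurable
  also have "\<dots> < \<infinity>"
    unfolding K.energy_reorder using K.energy_finite[where 'd='d] Q
    by (simp add: K.Q_def ennreal_mult_less_top)
  finally obtain L where L: "square_integrable M L" "L \<in> D1 M X"
    "((\<lambda>\<epsilon>. L2_dist_sq M (W.oscillation (u \<epsilon>)) L) \<longlongrightarrow> 0) (at_right 0)"
    by (rule W.limit_in_D1)
  then have "is_local_time M X x L"
    by (simp add: is_local_time_def approx_limit_iff[OF W.gaussian_family_axioms])
  then show ?thesis unfolding local_time_in_D1_def using L(2) by (intro exI conjI)
qed

text \<open>Only at level \<open>0\<close> do all phases vanish, which excludes cancellation in the second moments.\<close>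

lemma local_time_in_D1_imp_index_sum:
  assumes D: "local_time_in_D1 M X 0"
  shows "real CARD('d) + 2 < (\<Sum>j\<in>UNIV. 1 / H $ j)"
proof (rule ccontr)
  assume Q: "\<not> ?thesis"
  obtain R where "regularized_weights M X Y (\<lambda>k. snd k \<bullet> 0) R q w0 u" by (rule weights)
  then interpret W: regularized_weights M X Y "\<lambda>k. snd k \<bullet> 0" R q w0 u .
  obtain c1 c2 A where "covariance_kernel r H c1 c2 A" by (rule covariance_kernel_r)
  then interpret K: covariance_kernel r H c1 c2 A .
  obtain L where loc: "is_local_time M X 0 L" and D1: "L \<in> D1 M X"
    using D unfolding local_time_in_D1_def by (elim exE conjE)
  have L: "square_integrable M L" "((\<lambda>\<epsilon>. L2_dist_sq M (W.oscillation (u \<epsilon>)) L) \<longlongrightarrow> 0) (at_right 0)"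
    using loc approx_limit_iff[OF W.gaussian_family_axioms, of L] by (simp_all add: is_local_time_def)
  let ?c = "((2 * pi) powr (- real CARD('d)))\<^sup>2"
  let ?E = "\<lambda>(k :: (real^'n) \<times> (real^'d), l :: (real^'n) \<times> (real^'d)). indicator unit_cube (fst k) * indicator unit_cube (fst l)
       * ennreal (exp (- (r (fst k) (fst k) * (norm (snd k))\<^sup>2 + r (fst l) (fst l) * (norm (snd l))\<^sup>2) / 2)
          * (r (fst k) (fst l) * (snd k \<bullet> snd l) * sinh (r (fst k) (fst l) * (snd k \<bullet> snd l))))"
  have [measurable]: "(fst :: (real^'n) \<times> (real^'d) \<Rightarrow> real^'n) \<in> borel_measurable borel"
    "(snd :: (real^'n) \<times> (real^'d) \<Rightarrow> real^'d) \<in> borel_measurable borel"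
    by (auto intro!: borel_measurable_continuous_onI continuous_intros)
  have [measurable]: "(sinh :: real \<Rightarrow> real) \<in> borel_measurable borel"
    by (intro borel_measurable_continuous_onI continuous_intros)
  have [measurable]: "?E \<in> borel_measurable (lborel \<Otimes>\<^sub>M (lborel :: ((real^'n) \<times> (real^'d)) measure))"
    unfolding case_prod_unfold by measurable
  have "ennreal ?c * (\<integral>\<^sup>+p. ?E p \<partial>(lborel \<Otimes>\<^sub>M lborel)) = (\<integral>\<^sup>+p. ennreal ?c * ?E p \<partial>(lborel \<Otimes>\<^sub>M lborel))"
    by (rule nn_integral_cmult[symmetric]) measurable
  also have "\<dots> = (\<integral>\<^sup>+(k, l). ennreal (w0 k * w0 l * (W.gauss_weight k l * (q k l * sinh (q k l)))) \<partial>(lborel \<Otimes>\<^sub>M lborel))"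
  proof (rule nn_integral_cong, clarify)
    fix k l :: "(real^'n) \<times> (real^'d)"
    have e: "W.gauss_weight k l * (q k l * sinh (q k l))
      = exp (- (r (fst k) (fst k) * (norm (snd k))\<^sup>2 + r (fst l) (fst l) * (norm (snd l))\<^sup>2) / 2)
          * (r (fst k) (fst l) * (snd k \<bullet> snd l) * sinh (r (fst k) (fst l) * (snd k \<bullet> snd l)))"
      by (simp add: W.gauss_weight_def q_def power2_norm_eq_inner)
    have "0 \<le> z * sinh z" for z :: real
      by (cases "0 \<le> z") (auto simp: mult_nonpos_nonpos)
    then have "0 \<le> W.gauss_weight k l * (q k l * sinh (q k l))"
      by (rule mult_nonneg_nonneg[OF less_imp_le[OF W.gauss_weight_pos]])
    from w0_product[OF this] show "ennreal ?c * (indicator unit_cube (fst k) * indicator unit_cube (fst l)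
       * ennreal (exp (- (r (fst k) (fst k) * (norm (snd k))\<^sup>2 + r (fst l) (fst l) * (norm (snd l))\<^sup>2) / 2)
          * (r (fst k) (fst l) * (snd k \<bullet> snd l) * sinh (r (fst k) (fst l) * (snd k \<bullet> snd l)))))
      = ennreal (w0 k * w0 l * (W.gauss_weight k l * (q k l * sinh (q k l))))"
      by (simp only: e)
  qed
  also have "\<dots> < \<infinity>"
    by (rule W.limit_in_D1_imp_finite[OF _ L(1) D1 L(2)]) simp
  finally have "ennreal ?c * (\<integral>\<^sup>+p. ?E p \<partial>(lborel \<Otimes>\<^sub>M lborel)) < \<infinity>" .
  moreover have "(\<integral>\<^sup>+p. ?E p \<partial>(lborel \<Otimes>\<^sub>M lborel)) = \<infinity>"
    using K.energy_divergent[where 'd='d] Q by (simp add: K.Q_def)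
  ultimately show False by (simp add: ennreal_mult_eq_top_iff)
qed

end

theorem theorem2p10:
  fixes M0 :: "'u measure" and X0 :: "real^'n \<Rightarrow> 'u \<Rightarrow> real"
    and M :: "'w measure" and X :: "real^'n \<Rightarrow> 'w \<Rightarrow> real^'d"
    and H :: "real^'n"
  assumes "prob_space M0" and "prob_space M"
    and "gaussian_field M0 X0" and "centered_field M0 X0"
    and "continuous_covariance M0 X0"
    and "independent_copies M0 X0 M X" and "continuous_paths M X"
    and "\<forall>j. 0 < H $ j \<and> H $ j < 1"
    and "condition_C1 M0 X0 H" and "condition_C2 M0 X0 H"
  shows "(local_time_in_D1 M X 0 \<longleftrightarrow> (\<Sum>j\<in>UNIV. 1 / H $ j) > real CARD('d) + 2) \<and>
         ((\<Sum>j\<in>UNIV. 1 / H $ j) > real CARD('d) + 2 \<longrightarrow>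
            (\<forall>x. x \<noteq> 0 \<longrightarrow> local_time_in_D1 M X x))"
proof -
  interpret local_time_field M0 X0 M X H
    by (intro local_time_field.intro gaussian_copies.intro gaussian_copies_axioms.intro
        local_time_field_axioms.intro) (simp_all only: assms)
  show ?thesis
    by (intro conjI iffI impI allI) (erule local_time_in_D1_imp_index_sum index_sum_imp_local_time_in_D1)+
qed

end
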